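(* Let $N\ge1$, $\alpha>-1$, $A>0$ and $\eta\in(0,1)$. There exists a constant $\delta>0$, depending only on the universal data $N,\alpha,A,\eta$, such that for every $a\in(0,A]$ with $|a-A|<\delta$ and for $\mathcal{M}_{a,A}$ equal to either one of the Pucci operators $\mathcal{M}^+_{a,A}$, $\mathcal{M}^-_{a,A}$, the following holds: if $\Omega\subset\mathbb{R}^N$ is a bounded $\mathcal{C}^{2,\eta}$ domain for which there exist a constant $c\in\mathbb{R}$ and an eigenfunction $\psi$ of constant sign of the operator $|\nabla\psi|^\alpha\mathcal{M}_{a,A}(D^2\psi)$ in $\Omega$ satisfying $$\partial_{\vec n}\psi=c\quad\text{on }\partial\Omega,$$ where $\vec n$ is the unit outer normal to $\partial\Omega$, then $\Omega$ is a ball.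
   Context: For a symmetric matrix $X$ with positive and negative parts $X^+,X^-$ (so $X=X^+-X^-$, $X^\pm\ge0$, $X^+X^-=0$), the Pucci operators with $0<a\le A$ are $$\mathcal{M}^+_{a,A}(X)=A\,\mathrm{tr}(X^+)-a\,\mathrm{tr}(X^-),\qquad \mathcal{M}^-_{a,A}(X)=a\,\mathrm{tr}(X^+)-A\,\mathrm{tr}(X^-).$$ Set $F(p,X)=|p|^\alpha\mathcal{M}_{a,A}(X)$. Viscosity solutions. For a continuous function $f$, a function $v\in\mathcal{C}(\Omega)\cap L^\infty(\Omega)$ is a viscosity supersolution of $F(\nabla v,D^2v)+f(v)=0$ in $\Omega$ (written $F(\nabla v,D^2v)+f(v)\le0$) if for every $x_0\in\Omega$: either there is an open ball $B(x_0,\rho)\subset\Omega$, $\rho>0$, on which $v$ is equal to a constant $\kappa$ and $f(\kappa)\le0$; or for every $\varphi\in\mathcal{C}^2(\Omega)$ such that $v-\varphi$ has a local minimum at $x_0$ and $\nabla\varphi(x_0)\ne0$, one has $F(\nabla\varphi(x_0),D^2\varphi(x_0))+f(v(x_0))\le0$. Subsolutions (written with $\ge0$) are defined symmetrically (local maximum, reversed inequalities). A viscosity solution is both a supersolution and a subsolution. Here $f(u)=\lambda|u|^\alpha u$ (equal to $0$ when $u=0$). Principal eigenvalues: $$\lambda^+(\Omega)=\sup\{\lambda:\ \exists\,\phi>0\text{ in }\Omega,\ |\nabla\phi|^\alpha\mathcal{M}_{a,A}(D^2\phi)+\lambda\phi^{1+\alpha}\le0\text{ in }\Omega\},$$ $$\lambda^-(\Omega)=\sup\{\lambda:\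 \exists\,\psi<0\text{ in }\Omega,\ |\nabla\psi|^\alpha\mathcal{M}_{a,A}(D^2\psi)+\lambda|\psi|^{\alpha}\psi\ge0\text{ in }\Omega\},$$ with the inequalities in the viscosity sense. An eigenfunction is a function $\psi\not\equiv0$, of class $\mathcal{C}^1(\overline\Omega)$, which is a viscosity solution of $$|\nabla\psi|^\alpha\mathcal{M}_{a,A}(D^2\psi)+\lambda|\psi|^\alpha\psi=0\ \text{ in }\Omega,\qquad \psi=0\ \text{ on }\partial\Omega,$$ with $\lambda=\lambda^+(\Omega)$ or $\lambda=\lambda^-(\Omega)$. "Constant sign" means $\psi\ge0$ in $\Omega$ or $\psi\le0$ in $\Omega$. A domain is a connected open set. *)

theory Defs
  imports "HOL-Analysis.Analysis"
begin

section \<open>Pucci operators\<close>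

definition psd :: "real^'n^'n \<Rightarrow> bool" where
  "psd X \<longleftrightarrow> transpose X = X \<and> (\<forall>v. 0 \<le> v \<bullet> (X *v v))"

definition is_pos_neg_parts :: "real^'n^'n \<Rightarrow> real^'n^'n \<Rightarrow> real^'n^'n \<Rightarrow> bool" where
  "is_pos_neg_parts X P Q \<longleftrightarrow> psd P \<and> psd Q \<and> X = P - Q \<and> P ** Q = 0"

text \<open>The two parts exist and are unique when X is symmetric; for other X the values below
  are unspecified. They are only evaluated at Hessians of functions of class C2.\<close>

definition pos_part_mat :: "real^'n^'n \<Rightarrow> real^'n^'n" where
  "pos_part_mat X = (THE P. \<exists>Q. is_pos_neg_parts X P Q)"

definition neg_part_mat :: "real^'n^'n \<Rightarrow> real^'n^'n" where
  "neg_part_mat X = (THE Q. \<exists>P. is_pos_neg_parts X P Q)"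

definition pucci_plus :: "real \<Rightarrow> real \<Rightarrow> real^'n^'n \<Rightarrow> real" where
  "pucci_plus a A X = A * trace (pos_part_mat X) - a * trace (neg_part_mat X)"

definition pucci_minus :: "real \<Rightarrow> real \<Rightarrow> real^'n^'n \<Rightarrow> real" where
  "pucci_minus a A X = a * trace (pos_part_mat X) - A * trace (neg_part_mat X)"


section \<open>Differentiability classes\<close>

definition gradient :: "(real^'n \<Rightarrow> real) \<Rightarrow> real^'n \<Rightarrow> real^'n" where
  "gradient f x = (THE D. GDERIV f x :> D)"

definition hessian :: "(real^'n \<Rightarrow> real) \<Rightarrow> real^'n \<Rightarrow> real^'n^'n" where
  "hessian f x = jacobian (gradient f) (at x)"

text \<open>Only used for open S. Continuity of f and of its gradient follows from differentiability.\<close>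

definition C2_on :: "(real^'n) set \<Rightarrow> (real^'n \<Rightarrow> real) \<Rightarrow> bool" where
  "C2_on S f \<longleftrightarrow>
     (\<forall>x\<in>S. f differentiable (at x)) \<and>
     (\<forall>x\<in>S. gradient f differentiable (at x)) \<and>
     continuous_on S (hessian f)"

definition C2_Holder :: "real \<Rightarrow> (real^'n \<Rightarrow> real) \<Rightarrow> bool" where
  "C2_Holder \<eta> f \<longleftrightarrow> C2_on UNIV f \<and>
     (\<exists>L. \<forall>x y. norm (hessian f x - hessian f y) \<le> L * dist x y powr \<eta>)"

definition C1_closure :: "(real^'n) set \<Rightarrow> (real^'n \<Rightarrow> real) \<Rightarrow> bool" where
  "C1_closure \<Omega> f \<longleftrightarrow> continuous_on (closure \<Omega>) f \<and>
     (\<exists>G. continuous_on (closure \<Omega>) G \<and> (\<forall>x\<in>\<Omega>. GDERIV f x :> G x))"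


section \<open>Domains with smooth boundary\<close>

text \<open>Near x, the set \<Omega> is the part above the graph of \<gamma> over the hyperplane orthogonal to
  the unit vector e. The function \<gamma> of N - 1 variables is represented by a function
  on the whole space which does not depend on the e-coordinate.\<close>

definition local_graph ::
  "(real^'n) set \<Rightarrow> real^'n \<Rightarrow> real^'n \<Rightarrow> (real^'n \<Rightarrow> real) \<Rightarrow> bool" where
  "local_graph \<Omega> x e \<gamma> \<longleftrightarrow> norm e = 1 \<and> (\<forall>y t. \<gamma> (y + t *\<^sub>R e) = \<gamma> y) \<and>
     (\<exists>r>0. \<Omega> \<inter> ball x r = {y \<in> ball x r. \<gamma> y < y \<bullet> e})"

definition C2_Holder_domain :: "real \<Rightarrow> (real^'n) set \<Rightarrow> bool" where
  "C2_Holder_domain \<eta> \<Omega> \<longleftrightarrow> open \<Omega> \<and> connected \<Omega> \<and>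
     (\<forall>x\<in>frontier \<Omega>. \<exists>e \<gamma>. local_graph \<Omega> x e \<gamma> \<and> C2_Holder \<eta> \<gamma>)"

text \<open>At a boundary point x, the set \<Omega> is locally where \<gamma> y - y \<bullet> e is negative, so the outer
  normal is the normalised gradient of that function. That gradient is nonzero, as the
  gradient of \<gamma> is orthogonal to e.\<close>

definition unit_outer_normal :: "(real^'n) set \<Rightarrow> real^'n \<Rightarrow> real^'n \<Rightarrow> bool" where
  "unit_outer_normal \<Omega> x n \<longleftrightarrow> x \<in> frontier \<Omega> \<and>
     (\<exists>e \<gamma>. local_graph \<Omega> x e \<gamma> \<and> C2_on UNIV \<gamma> \<and> n = sgn (gradient \<gamma> x - e))"

text \<open>The function is only known on the closure of the domain, so the derivative in the
  direction n is taken from inside.\<close>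

definition has_outer_derivative :: "(real^'n \<Rightarrow> real) \<Rightarrow> real^'n \<Rightarrow> real^'n \<Rightarrow> real \<Rightarrow> bool" where
  "has_outer_derivative f x n c \<longleftrightarrow>
     ((\<lambda>t. (f x - f (x - t *\<^sub>R n)) / t) \<longlongrightarrow> c) (at_right 0)"


section \<open>Viscosity solutions\<close>

definition op_F ::
  "real \<Rightarrow> (real^'n^'n \<Rightarrow> real) \<Rightarrow> real^'n \<Rightarrow> real^'n^'n \<Rightarrow> real" where
  "op_F \<alpha> M p X = norm p powr \<alpha> * M X"

definition locally_constant_at :: "(real^'n) set \<Rightarrow> (real^'n \<Rightarrow> real) \<Rightarrow> real^'n \<Rightarrow> real \<Rightarrow> bool" where
  "locally_constant_at \<Omega> v x \<kappa> \<longleftrightarrow>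
     (\<exists>\<rho>>0. ball x \<rho> \<subseteq> \<Omega> \<and> (\<forall>y\<in>ball x \<rho>. v y = \<kappa>))"

definition local_min_at :: "(real^'n \<Rightarrow> real) \<Rightarrow> real^'n \<Rightarrow> bool" where
  "local_min_at g x \<longleftrightarrow> eventually (\<lambda>y. g x \<le> g y) (nhds x)"

definition local_max_at :: "(real^'n \<Rightarrow> real) \<Rightarrow> real^'n \<Rightarrow> bool" where
  "local_max_at g x \<longleftrightarrow> eventually (\<lambda>y. g y \<le> g x) (nhds x)"

text \<open>The two alternatives are exclusive: test functions are used only at points near which v
  is not constant. Where v is locally constant there is no test function with nonvanishing
  gradient, so with an inclusive disjunction the sign condition on f \<kappa> would be void, every
  constant would be a supersolution, and the principal eigenvalues would be infinite.\<close>

definition viscosity_supersolution ::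
  "(real^'n \<Rightarrow> real^'n^'n \<Rightarrow> real) \<Rightarrow> (real \<Rightarrow> real) \<Rightarrow> (real^'n) set \<Rightarrow> (real^'n \<Rightarrow> real) \<Rightarrow> bool"
where
  "viscosity_supersolution F f \<Omega> v \<longleftrightarrow>
     continuous_on \<Omega> v \<and> bounded (v ` \<Omega>) \<and>
     (\<forall>x\<in>\<Omega>.
        (\<exists>\<kappa>. locally_constant_at \<Omega> v x \<kappa> \<and> f \<kappa> \<le> 0) \<or>
        (\<not> (\<exists>\<kappa>. locally_constant_at \<Omega> v x \<kappa>) \<and>
         (\<forall>\<phi>. C2_on \<Omega> \<phi> \<and> local_min_at (\<lambda>y. v y - \<phi> y) x \<and> gradient \<phi> x \<noteq> 0 \<longrightarrow>
              F (gradient \<phi> x) (hessian \<phi> x) + f (v x) \<le> 0)))"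

definition viscosity_subsolution ::
  "(real^'n \<Rightarrow> real^'n^'n \<Rightarrow> real) \<Rightarrow> (real \<Rightarrow> real) \<Rightarrow> (real^'n) set \<Rightarrow> (real^'n \<Rightarrow> real) \<Rightarrow> bool"
where
  "viscosity_subsolution F f \<Omega> v \<longleftrightarrow>
     continuous_on \<Omega> v \<and> bounded (v ` \<Omega>) \<and>
     (\<forall>x\<in>\<Omega>.
        (\<exists>\<kappa>. locally_constant_at \<Omega> v x \<kappa> \<and> f \<kappa> \<ge> 0) \<or>
        (\<not> (\<exists>\<kappa>. locally_constant_at \<Omega> v x \<kappa>) \<and>
         (\<forall>\<phi>. C2_on \<Omega> \<phi> \<and> local_max_at (\<lambda>y. v y - \<phi> y) x \<and> gradient \<phi> x \<noteq> 0 \<longrightarrow>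
              F (gradient \<phi> x) (hessian \<phi> x) + f (v x) \<ge> 0)))"

definition viscosity_solution ::
  "(real^'n \<Rightarrow> real^'n^'n \<Rightarrow> real) \<Rightarrow> (real \<Rightarrow> real) \<Rightarrow> (real^'n) set \<Rightarrow> (real^'n \<Rightarrow> real) \<Rightarrow> bool"
where
  "viscosity_solution F f \<Omega> v \<longleftrightarrow>
     viscosity_supersolution F f \<Omega> v \<and> viscosity_subsolution F f \<Omega> v"


section \<open>Principal eigenvalues and eigenfunctions\<close>

text \<open>The product vanishes at u = 0, also for negative \<alpha>, and for positive u it is
  lam * u powr (1 + \<alpha>).\<close>

definition eigen_term :: "real \<Rightarrow> real \<Rightarrow> real \<Rightarrow> real" where
  "eigen_term \<alpha> lam u = lam * \<bar>u\<bar> powr \<alpha> * u"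

definition principal_eigenvalue_plus ::
  "real \<Rightarrow> (real^'n^'n \<Rightarrow> real) \<Rightarrow> (real^'n) set \<Rightarrow> ereal" where
  "principal_eigenvalue_plus \<alpha> M \<Omega> =
     Sup (ereal ` {lam. \<exists>\<phi>. (\<forall>x\<in>\<Omega>. \<phi> x > 0) \<and>
            viscosity_supersolution (op_F \<alpha> M) (eigen_term \<alpha> lam) \<Omega> \<phi>})"

definition principal_eigenvalue_minus ::
  "real \<Rightarrow> (real^'n^'n \<Rightarrow> real) \<Rightarrow> (real^'n) set \<Rightarrow> ereal" where
  "principal_eigenvalue_minus \<alpha> M \<Omega> =
     Sup (ereal ` {lam. \<exists>\<psi>. (\<forall>x\<in>\<Omega>. \<psi> x < 0) \<and>
            viscosity_subsolution (op_F \<alpha> M) (eigen_term \<alpha> lam) \<Omega> \<psi>})"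

definition eigenfunction ::
  "real \<Rightarrow> (real^'n^'n \<Rightarrow> real) \<Rightarrow> (real^'n) set \<Rightarrow> (real^'n \<Rightarrow> real) \<Rightarrow> bool" where
  "eigenfunction \<alpha> M \<Omega> \<psi> \<longleftrightarrow>
     (\<exists>x\<in>\<Omega>. \<psi> x \<noteq> 0) \<and> C1_closure \<Omega> \<psi> \<and> (\<forall>x\<in>frontier \<Omega>. \<psi> x = 0) \<and>
     (\<exists>lam. (ereal lam = principal_eigenvalue_plus \<alpha> M \<Omega> \<or>
             ereal lam = principal_eigenvalue_minus \<alpha> M \<Omega>) \<and>
            viscosity_solution (op_F \<alpha> M) (eigen_term \<alpha> lam) \<Omega> \<psi>)"

definition constant_sign :: "(real^'n) set \<Rightarrow> (real^'n \<Rightarrow> real) \<Rightarrow> bool" where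
  "constant_sign \<Omega> \<psi> \<longleftrightarrow> (\<forall>x\<in>\<Omega>. \<psi> x \<ge> 0) \<or> (\<forall>x\<in>\<Omega>. \<psi> x \<le> 0)"

end

theory Submission
  imports Defs "HOL-Library.Landau_Symbols" "HOL-Probability.Distributions"
begin

notation scaleR (infixr "*." 75)

text \<open>The method of moving planes for a positive solution \<open>u\<close> that is only continuously differentiable.
 If \<open>u\<close> is a subsolution and \<open>v\<close> a supersolution, then \<open>u - v\<close> is a subsolution for the maximal operator:
 this operator is a supremum of linear ones, so a supersolution can be mollified and used as a test function.
 In a cap, \<open>u\<close> lies below its reflection \<open>v\<close>, since a maximum of \<open>u / v\<close> above 1 would force a critical
 local minimum of \<open>v\<close>. Near the boundary the gradient does not vanish, so \<open>v - u\<close> satisfies Hopf's lemma, and as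
 the normal derivative is constant, the part of the boundary whose reflection is again in the boundary is open.

 The remaining case is a boundary point \<open>Q\<close> at which the plane is orthogonal to the boundary. There \<open>v - u\<close>
 is at least a multiple of \<open>(h k) powr q\<close>, where \<open>h\<close> and \<open>k\<close> vanish on two orthogonal spheres through \<open>Q\<close>; this is
 a barrier for some \<open>q > 1\<close> close to 1 provided that \<open>a\<close> is close to \<open>A\<close>. On the other hand the gradient of \<open>u\<close> at
 \<open>x\<close> differs from its value at \<open>Q\<close> in the normal direction by at most \<open>C (\<bar>x - Q\<bar>^2 + d powr \<beta>)\<close> for every
 \<open>\<beta> < 1\<close>, \<open>d\<close> being the distance to the boundary, by a barrier for the difference quotients of \<open>u\<close>. Since the
 boundary is of class \<open>C\<close> with exponent \<open>2 + \<eta>\<close>, this makes \<open>v - u\<close> too small for the lower bound.\<close>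

text \<open>Test functions have nonzero gradient, so a contact at a critical point of
  \<open>u\<close> yields no inequality; and \<open>u\<close> need not have second derivatives, so
  Serrin's argument at a corner, which compares Taylor coefficients of order two, is replaced by two
  estimates with explicit powers along a curve. For \<open>q = 1\<close> the barrier
  \<open>h k\<close> fails: its Hessian at \<open>Q\<close> is symmetric of trace 0 with eigenvalues
  1 and -1, so the minimal operator gives \<open>- (A - a)\<close>, negative unless
  \<open>a = A\<close>. A power \<open>q > 1\<close> gains a multiple of \<open>(q - 1) a\<close>,
  whence the condition \<open>CARD('n) (A - a) < (q - 1) a\<close>. The room for
  \<open>q > 1\<close> comes from the Hoelder exponent. At tangential distance \<open>t\<close> and
  normal distance \<open>s = t powr (1 + \<eta>/2)\<close> the function \<open>h k\<close> has order
  \<open>t powr (2 + \<eta>/2)\<close>, while the quadratic part of the boundary cancels by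
  reflection and leaves an error of order \<open>t powr (2 + \<eta>)\<close>. For
  \<open>s = t\<close> the error \<open>s powr (1 + \<beta>)\<close> of the gradient estimate would
  exceed the barrier, so the curve has to be tangent to the boundary. The choice
  \<open>q = 1 + \<eta>/8\<close> then fixes the size of \<open>A - a\<close>.\<close>

section \<open>Spectral decomposition of symmetric matrices and the Pucci operators\<close>

definition outer :: "real^'n => real^'n => real^'n^'n" where
 "outer p q = (\<chi> i j. p $ i*q $ j)"

lemma outer_mv: "outer p q *v h = (q \<bullet> h)*.p"
 by (simp add: outer_def matrix_vector_mult_def vec_eq_iff inner_vec_def sum_distrib_left
   sum_distrib_right mult_ac)

lemma transpose_outer: "transpose (outer p q) = outer q p"
 by (simp add: outer_def transpose_def vec_eq_iff mult.commute)

lemma trace_outer: "trace (outer p q) = p \<bullet> q"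
 by (simp add: outer_def trace_def inner_vec_def)

lemma mul_outer: "B ** outer p q = outer (B *v p) q"
 by (simp add: matrix_eq matrix_vector_mul_assoc[symmetric] outer_mv matrix_vector_mult_scaleR)

lemma matrix_sum_mv: "(\<Sum>v\<in>E. f v) *v x = (\<Sum>v\<in>E. (f v :: real^'n^'n) *v x)"
 by (induction E rule: infinite_finite_induct) (auto simp: matrix_vector_mult_add_rdistrib)

lemma trace_sum: "trace (\<Sum>v\<in>E. (f v :: real^'n^'n)) = (\<Sum>v\<in>E. trace (f v))"
 by (induction E rule: infinite_finite_induct) (auto simp: trace_add trace_0[simplified])

lemma trace_scaleR: "trace (c*.(X :: real^'n^'n)) = c*trace X"
 by (simp add: trace_def sum_distrib_left)

lemma trace_uminus: "trace (- (X :: real^'n^'n)) = - trace X"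
 by (simp add: trace_def sum_negf)

lemma sym_dot:
 assumes "transpose X = (X :: real^'n^'n)"
 shows "x \<bullet> (X *v y) = (X *v x) \<bullet> y"
 by (metis assms dot_lmul_matrix transpose_matrix_vector)

lemma mv_add: "(X+Y) *v x = X *v x+(Y :: real^'n^'n) *v x"
 by (rule matrix_vector_mult_add_rdistrib)

lemma mv_diff: "(X-Y) *v x = X *v x-(Y :: real^'n^'n) *v x"
 by (simp add: matrix_vector_mult_diff_rdistrib)

lemma mv_scaleR: "(c*.X) *v x = c*.(X *v (x :: real^'n))"
 by (simp add: scaleR_matrix_vector_assoc)

lemma mv_uminus: "(- X) *v x = - ((X :: real^'n^'n) *v x)"
 using mv_diff[of 0 X x] by simp

text \<open>Induction on the dimension: a maximiser of the Rayleigh quotient on the unit sphere of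
  \<open>S\<close> is an eigenvector, and its orthogonal complement in \<open>S\<close> is again
  invariant.\<close>

lemma eigenbasis_subspace:
 fixes X :: "real^'n^'n"
 assumes sym: "transpose X = X" and "subspace S" and "!!x. x : S ==> X *v x : S"
 shows "\<exists>E. E <= S & pairwise orthogonal E & (\<forall>v\<in>E. norm v = 1) & S <= span E &
      (\<forall>v\<in>E. \<exists>l. X *v v = l *. v)"
 using assms(2,3)
proof (induction "dim S" arbitrary: S rule: less_induct)
 case less
 show ?case
 proof (cases "S <= {0}")
  case True
  thus ?thesis by (intro exI[of _ "{}"]) (auto simp: pairwise_def)
 next
  case False
  then obtain w where w: "w : S" "w ~= 0" by auto
  let ?K = "S Int sphere 0 1"
  have "compact ?K"
   by (intro closed_Int_compact closed_subspace less.prems compact_sphere)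
  moreover have "(1/norm w)*.w : ?K"
   using w less.prems by (auto simp: subspace_scale)
  moreover have "continuous_on ?K (%x. x \<bullet> (X *v x))"
   by (intro continuous_intros matrix_vector_mult_linear_continuous_on)
  ultimately obtain v where v: "v : ?K" and vmax: "!!y. y : ?K ==> y \<bullet> (X *v y) <= v \<bullet> (X *v v)"
   using continuous_attains_sup[of ?K "%x. x \<bullet> (X *v x)"] by (metis empty_iff)
  define l where "l = v \<bullet> (X *v v)"
  have vv: "v \<bullet> v = 1" and vS: "v : S"
   using v by (auto simp: dot_square_norm)
  have ray: "y \<bullet> (X *v y) <= l*(y \<bullet> y)" if "y : S" for y
  proof (cases "y = 0")
   case False
   have "(1/norm y)*.y : ?K" using False that less.prems by (auto simp: subspace_scale)
   from vmax[OF this] have "(y \<bullet> (X *v y))/(norm y*norm y) <= l"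
    by (simp add: matrix_vector_mult_scaleR l_def)
   thus ?thesis using False by (simp add: divide_simps dot_square_norm power2_eq_square)
  qed simp
  have orth: "h \<bullet> (X *v v) = 0" if h: "h : S" "h \<bullet> v = 0" for h
  proof (rule ccontr)
   assume ne: "h \<bullet> (X *v v) ~= 0"
   define b where "b = h \<bullet> (X *v v)"
   define k where "k = l*(h \<bullet> h)-h \<bullet> (X *v h)"
   have ineq: "2*t*b <= t^2 * k" for t
   proof -
    have "v+t*.h : S" using vS h less.prems by (simp add: subspace_add subspace_scale)
    from ray[OF this] have "(v+t*.h) \<bullet> (X *v (v+t*.h)) <= l*((v+t*.h) \<bullet> (v+t*.h))" .
    moreover have "v \<bullet> (X *v h) = b"
     unfolding b_def by (metis inner_commute sym sym_dot)
    ultimately show ?thesis using h vv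
     by (simp add: matrix_vector_right_distrib matrix_vector_mult_scaleR inner_add_left inner_add_right
       l_def[symmetric] b_def[symmetric] k_def power2_eq_square algebra_simps inner_commute)
   qed
   \<comment> \<open>With \<open>t = b / m\<close> the linear term of \<open>ineq\<close> dominates
     the quadratic one unless \<open>b = 0\<close>.\<close>
   define m where "m = \<bar>k\<bar>+1"
   have "m > 0" "k <= m" unfolding m_def by auto
   have "2*(b/m)*b <= (b/m)^2 * k" by (rule ineq)
   also have "\<dots> <= (b/m)^2*m" using \<open>k <= m\<close> by (intro mult_left_mono) auto
   also have "\<dots> = b^2/m" using \<open>m > 0\<close> by (simp add: power2_eq_square)
   finally have "b^2/m <= 0" using \<open>m > 0\<close> by (simp add: power2_eq_square)
   moreover have "b^2/m > 0" using ne \<open>m > 0\<close> by (simp add: b_def)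
   ultimately show False by simp
  qed
  have eig: "X *v v = l *. v"
  proof -
   let ?w = "X *v v-l *. v"
   have "?w : S" using vS less.prems by (simp add: subspace_diff subspace_scale)
   moreover have wv: "?w \<bullet> v = 0" by (simp add: inner_diff_left vv l_def) (simp add: inner_commute)
   ultimately have "?w \<bullet> (X *v v) = 0" by (rule orth)
   with wv have "?w \<bullet> ?w = 0" by (simp add: inner_diff_right)
   thus ?thesis by simp
  qed
  let ?S = "{x : S. x \<bullet> v = 0}"
  have sub: "subspace ?S"
   using less.prems(1) by (auto simp: subspace_def inner_add_left)
  have "v ~: ?S" using vv by simp
  hence "?S ~= S" using vS by blast
  hence "?S \<subset> S" by blast
  moreover have "span ?S = ?S" "span S = S" using sub less.prems(1) by (simp_all only: span_eq_iff)
  ultimately have "span ?S \<subset> span S" by (simp only:)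
  hence "dim ?S < dim S" by (rule dim_psubset)
  moreover have "X *v x : ?S" if "x : ?S" for x
   using that less.prems(2) eig by (auto simp: sym_dot[OF sym, symmetric])
  ultimately obtain E where E: "E <= ?S" "pairwise orthogonal E" "\<forall>v\<in>E. norm v = 1" "?S <= span E"
   "\<forall>v\<in>E. \<exists>l. X *v v = l *. v"
   using less.hyps[OF _ sub] by meson
  have "S <= span (insert v E)"
  proof
   fix x assume "x : S"
   hence "x-(x \<bullet> v) *. v : ?S" using vS less.prems(1) vv
    by (auto simp: subspace_diff subspace_scale inner_diff_left)
   hence "x-(x \<bullet> v) *. v : span (insert v E)"
    using E(4) span_mono[of E "insert v E"] by auto
   moreover have "(x \<bullet> v) *. v : span (insert v E)" by (simp add: span_base span_scale)
   ultimately show "x : span (insert v E)" using span_add by fastforce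
  qed
  moreover have "pairwise orthogonal (insert v E)"
   using E by (auto simp: pairwise_insert orthogonal_def inner_commute)
  moreover have "norm v = 1" using v by simp
  ultimately show ?thesis using E vS eig by (intro exI[of _ "insert v E"]) auto
 qed
qed

text \<open>Completeness is recorded as the expansion of every vector, the form in which traces and
  quadratic forms are computed.\<close>

definition eigenbasis :: "real^'n^'n => (real^'n) set => (real^'n => real) => bool" where
 "eigenbasis X E l \<longleftrightarrow> finite E & (\<forall>v\<in>E. v \<bullet> v = 1) & (\<forall>v\<in>E. \<forall>w\<in>E. v ~= w --> v \<bullet> w = 0) &
   (\<forall>x. (\<Sum>v\<in>E. (v \<bullet> x) *. v) = x) & (\<forall>v\<in>E. X *v v = l v *. v)"

lemma eigenbasis_exists:
 fixes X :: "real^'n^'n"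
 assumes "transpose X = X"
 obtains E l where "eigenbasis X E l"
proof -
 obtain E where E: "pairwise orthogonal E" "\<forall>v\<in>E. norm v = 1" "UNIV <= span E"
      "\<forall>v\<in>E. \<exists>l. X *v v = l *. v"
  using eigenbasis_subspace[OF assms, of UNIV] by auto
 then obtain l where "\<forall>v\<in>E. X *v v = l v *. v" by metis
 moreover have "finite E"
  using E by (metis independent_imp_finite norm_zero pairwise_orthogonal_independent zero_neq_one)
 moreover have "(\<Sum>v\<in>E. (v \<bullet> x) *. v) = x" for x
  using E \<open>finite E\<close> orthonormal_basis_expand[of E x] by (auto simp: inner_commute)
 ultimately have "eigenbasis X E l"
  using E by (auto simp: eigenbasis_def pairwise_def orthogonal_def dot_square_norm)
 thus ?thesis using that by blast
qed

lemma eigenbasisD: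
 assumes "eigenbasis X E l"
 shows "v : E ==> v \<bullet> v = 1" "v : E ==> X *v v = l v *. v" "finite E"
 using assms unfolding eigenbasis_def by blast+

lemma eigenbasis_uminus: "eigenbasis X E l ==> eigenbasis (- X) E (%v. - l v)"
 by (auto simp: eigenbasis_def mv_uminus)

lemma trace_eigenbasis:
 assumes "eigenbasis X E l"
 shows "trace (Y :: real^'n^'n) = (\<Sum>v\<in>E. v \<bullet> (Y *v v))"
proof -
 have "Y *v x = (\<Sum>v\<in>E. outer (Y *v v) v) *v x" for x
 proof -
  have "Y *v x = Y *v (\<Sum>v\<in>E. (v \<bullet> x) *. v)" using assms by (simp add: eigenbasis_def)
  also have "\<dots> = (\<Sum>v\<in>E. (v \<bullet> x)*.(Y *v v))"
   by (simp add: linear_sum[OF matrix_vector_mul_linear] matrix_vector_mult_scaleR)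
  finally show ?thesis by (simp add: matrix_sum_mv outer_mv)
 qed
 hence "Y = (\<Sum>v\<in>E. outer (Y *v v) v)" unfolding matrix_eq by blast
 hence "trace Y = trace (\<Sum>v\<in>E. outer (Y *v v) v)" by (rule arg_cong)
 also have "\<dots> = (\<Sum>v\<in>E. v \<bullet> (Y *v v))" by (simp add: trace_sum trace_outer inner_commute)
 finally show ?thesis .
qed

definition from_eigen :: "(real^'n) set => (real^'n => real) => real^'n^'n" where
 "from_eigen E m = (\<Sum>v\<in>E. m v *. outer v v)"

lemma from_eigen_mv: "from_eigen E m *v x = (\<Sum>v\<in>E. (m v *(v \<bullet> x)) *. v)"
 by (simp add: from_eigen_def matrix_sum_mv outer_mv mv_scaleR mult.commute)

lemma from_eigen_form: "x \<bullet> (from_eigen E m *v y) = (\<Sum>v\<in>E. m v *(v \<bullet> x)*(v \<bullet> y))"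
 by (simp add: from_eigen_mv inner_sum_right mult_ac inner_commute)

lemma transpose_from_eigen: "transpose (from_eigen E m) = from_eigen E m"
 by (simp add: from_eigen_def transpose_def outer_def vec_eq_iff mult.commute)

lemma from_eigen_eig:
 assumes "eigenbasis X E l" "v : E"
 shows "from_eigen E m *v v = m v *. v"
proof -
 have "from_eigen E m *v v = (\<Sum>w\<in>E. if w = v then m v *. v else 0)"
  unfolding from_eigen_mv using assms by (intro sum.cong) (auto simp: eigenbasis_def)
 thus ?thesis using assms by (simp add: eigenbasis_def)
qed

lemma eigenbasis_eqI:
 assumes "eigenbasis X E l" "!!v. v : E ==> Y *v v = Z *v v"
 shows "Y = (Z :: real^'n^'n)"
proof -
 have *: "W *v x = (\<Sum>v\<in>E. (v \<bullet> x)*.(W *v v))" for x and W :: "real^'n^'n"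
 proof -
  have "W *v x = W *v (\<Sum>v\<in>E. (v \<bullet> x) *. v)" using assms(1) by (simp add: eigenbasis_def)
  thus ?thesis
   by (simp add: linear_sum[OF matrix_vector_mul_linear] matrix_vector_mult_scaleR)
 qed
 have "(\<Sum>v\<in>E. (v \<bullet> x)*.(Y *v v)) = (\<Sum>v\<in>E. (v \<bullet> x)*.(Z *v v))" for x
  using assms(2) by (intro sum.cong) auto
 hence "Y *v x = Z *v x" for x using *[of Y x] *[of Z x] by metis
 thus ?thesis by (simp add: matrix_eq)
qed

lemma is_pos_neg_parts_uminus:
 fixes X :: "real^'n^'n"
 shows "is_pos_neg_parts X P Q ==> is_pos_neg_parts (- X) Q P"
proof -
 assume H: "is_pos_neg_parts X P (Q :: real^'n^'n)"
 hence t: "transpose P = P" "transpose Q = Q" and 0: "P ** Q = 0"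
  unfolding is_pos_neg_parts_def psd_def by blast+
 have "transpose (P ** Q) = Q ** P"
  by (simp only: matrix_transpose_mul t)
 moreover have "transpose (0 :: real^'n^'n) = 0" by (simp add: transpose_def vec_eq_iff)
 ultimately have "Q ** P = 0" by (simp only: 0)
 moreover have "- X = Q-P" using H unfolding is_pos_neg_parts_def by (metis minus_diff_eq)
 ultimately show ?thesis using H unfolding is_pos_neg_parts_def by blast
qed

text \<open>This gives uniqueness of the two parts. From \<open>P ** Q = Q ** P = 0\<close>, the
  operator \<open>P\<close> multiplies \<open>P *v v\<close> by \<open>l\<close> and
  \<open>Q\<close> multiplies \<open>Q *v v\<close> by \<open>- l\<close>, so by positivity one of
  the two vectors vanishes, according to the sign of \<open>l\<close>.\<close>

lemma is_pos_neg_parts_eig: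
 assumes parts: "is_pos_neg_parts X P Q" and ev: "X *v v = l *. v"
 shows "P *v v = max l 0 *. v"
proof -
 have P: "transpose P = P" "!!v. 0 <= v \<bullet> (P *v v)" and Q: "!!v. 0 <= v \<bullet> (Q *v v)"
  and X: "X = P-Q" and PQ: "P ** Q = 0"
  using parts by (auto simp: is_pos_neg_parts_def psd_def)
 have QP: "Q ** P = 0"
  using is_pos_neg_parts_uminus[OF parts] by (simp add: is_pos_neg_parts_def)
 have PPv: "P *v (P *v v) = l*.(P *v v)"
 proof -
  have "P *v (X *v v) = P *v (P *v v)-(P ** Q) *v v"
   by (simp add: X mv_diff matrix_vector_mult_diff_distrib matrix_vector_mul_assoc)
  thus ?thesis using PQ ev by (simp add: matrix_vector_mult_scaleR)
 qed
 have QQv: "Q *v (Q *v v) = - (l*.(Q *v v))"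
 proof -
  have "Q *v (X *v v) = (Q ** P) *v v-Q *v (Q *v v)"
   by (simp add: X mv_diff matrix_vector_mult_diff_distrib matrix_vector_mul_assoc)
  thus ?thesis using QP ev by (simp add: matrix_vector_mult_scaleR)
 qed
 consider "l < 0" | "l = 0" | "l > 0" by linarith
 thus ?thesis
 proof cases
  case 1
  have "0 <= (P *v v) \<bullet> (P *v (P *v v))" by (rule P(2))
  hence "0 <= l*((P *v v) \<bullet> (P *v v))" by (simp add: PPv)
  hence "(P *v v) \<bullet> (P *v v) <= 0" using 1 by (simp add: zero_le_mult_iff)
  hence "P *v v = 0" by (metis inner_gt_zero_iff not_less)
  thus ?thesis using 1 by simp
 next
  case 2
  have "(P *v v) \<bullet> (P *v v) = v \<bullet> (P *v (P *v v))" by (simp add: sym_dot[OF P(1)])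
  thus ?thesis using 2 PPv by simp
 next
  case 3
  have "0 <= (Q *v v) \<bullet> (Q *v (Q *v v))" by (rule Q)
  hence "l*((Q *v v) \<bullet> (Q *v v)) <= 0" by (simp add: QQv)
  hence "(Q *v v) \<bullet> (Q *v v) <= 0" using 3 by (simp add: mult_le_0_iff)
  hence "Q *v v = 0" by (metis inner_gt_zero_iff not_less)
  thus ?thesis using 3 ev by (simp add: X mv_diff)
 qed
qed

lemma is_pos_neg_parts_from_eigen:
 assumes E: "eigenbasis X E l"
 shows "is_pos_neg_parts X (from_eigen E (%v. max (l v) 0)) (from_eigen E (%v. max (- l v) 0))"
proof -
 have psd: "psd (from_eigen E (%v. max (f v) 0))" for f
  unfolding psd_def by (auto simp: transpose_from_eigen from_eigen_form mult.assoc intro!: sum_nonneg)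
 have "X = from_eigen E (%v. max (l v) 0)-from_eigen E (%v. max (- l v) 0)"
  by (rule eigenbasis_eqI[OF E])
   (use E in \<open>auto simp: mv_diff from_eigen_eig[OF E] eigenbasis_def max_def\<close>)
 moreover have "from_eigen E (%v. max (l v) 0) ** from_eigen E (%v. max (- l v) 0) = 0"
  by (rule eigenbasis_eqI[OF E])
   (auto simp: matrix_vector_mul_assoc[symmetric] from_eigen_eig[OF E] matrix_vector_mult_scaleR max_def)
 ultimately show ?thesis using psd by (auto simp: is_pos_neg_parts_def)
qed

lemma pos_part_eigen:
 assumes E: "eigenbasis X E l"
 shows "pos_part_mat X = from_eigen E (%v. max (l v) 0)"
 unfolding pos_part_mat_def
proof (rule the_equality)
 show "\<exists>Q. is_pos_neg_parts X (from_eigen E (%v. max (l v) 0)) Q"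
  using is_pos_neg_parts_from_eigen[OF E] by blast
 fix P assume "\<exists>Q. is_pos_neg_parts X P Q"
 then obtain Q where PQ: "is_pos_neg_parts X P Q" by blast
 show "P = from_eigen E (%v. max (l v) 0)"
  by (rule eigenbasis_eqI[OF E]) (use E is_pos_neg_parts_eig[OF PQ] in
    \<open>auto simp: from_eigen_eig[OF E] eigenbasis_def\<close>)
qed

lemma neg_part_mat_eq: "neg_part_mat X = pos_part_mat (- X)"
proof -
 have "(\<exists>P. is_pos_neg_parts X P Q) \<longleftrightarrow> (\<exists>P. is_pos_neg_parts (- X) Q P)" for Q
  using is_pos_neg_parts_uminus[of X _ Q] is_pos_neg_parts_uminus[of "- X" Q] by auto
 thus ?thesis unfolding neg_part_mat_def pos_part_mat_def by (simp only:)
qed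

lemma trace_from_eigen:
 assumes E: "eigenbasis X E l"
 shows "trace (from_eigen E m) = (\<Sum>v\<in>E. m v)"
proof -
 have "v \<bullet> (from_eigen E m *v v) = m v" if "v : E" for v
  by (simp only: from_eigen_eig[OF E that] inner_scaleR_right eigenbasisD(1)[OF E that] mult_1_right)
 thus ?thesis unfolding trace_eigenbasis[OF E] by (intro sum.cong refl)
qed

lemma pucci_plus_eigen:
 assumes E: "eigenbasis X E l"
 shows "pucci_plus a A X = (\<Sum>v\<in>E. A*max (l v) 0-a*max (- l v) 0)"
 unfolding pucci_plus_def neg_part_mat_eq pos_part_eigen[OF E]
  pos_part_eigen[OF eigenbasis_uminus[OF E]] trace_from_eigen[OF E]
 by (simp add: sum_subtractf sum_distrib_left)

lemma pucci_minus_eq: "pucci_minus a A X = - pucci_plus a A (- X)"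
 by (simp add: pucci_minus_def pucci_plus_def neg_part_mat_eq)

text \<open>Coefficient matrices of the linear operators whose maximum is \<open>pucci_plus\<close>;
  the next two lemmas prove this description, through which all properties of the Pucci operators
  are derived.\<close>

definition ellip :: "real => real => real^'n^'n => bool" where
 "ellip a A B \<longleftrightarrow> transpose B = B & (\<forall>v. a*(v \<bullet> v) <= v \<bullet> (B *v v) & v \<bullet> (B *v v) <= A*(v \<bullet> v))"

lemma pucci_plus_ge:
 assumes "transpose X = X" and B: "ellip a A B"
 shows "trace (B ** X) <= pucci_plus a A X"
proof -
 obtain E l where E: "eigenbasis X E l" using eigenbasis_exists[OF assms(1)] .
 have "trace (B ** X) = (\<Sum>v\<in>E. l v *(v \<bullet> (B *v v)))"
  unfolding trace_eigenbasis[OF E]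
  by (intro sum.cong refl) (simp add: eigenbasisD[OF E] matrix_vector_mul_assoc[symmetric] matrix_vector_mult_scaleR)
 also have "\<dots> <= (\<Sum>v\<in>E. A*max (l v) 0-a*max (- l v) 0)"
 proof (rule sum_mono)
  fix v assume "v : E"
  hence "a <= v \<bullet> (B *v v)" "v \<bullet> (B *v v) <= A"
   using B eigenbasisD(1)[OF E] unfolding ellip_def by (metis mult.right_neutral)+
  thus "l v *(v \<bullet> (B *v v)) <= A*max (l v) 0-a*max (- l v) 0"
   by (cases "l v >= 0") (auto simp: max_def mult.commute[of A] mult.commute[of a] mult_left_mono mult_left_mono_neg)
 qed
 finally show ?thesis by (simp add: pucci_plus_eigen[OF E])
qed

text \<open>The maximiser weights each eigenvector of \<open>X\<close> by \<open>A\<close> or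
  \<open>a\<close>, according to the sign of its eigenvalue.\<close>

lemma pucci_plus_attained:
 assumes "transpose X = X" and "a <= A"
 obtains B where "ellip a A B" "trace (B ** X) = pucci_plus a A X"
proof -
 obtain E l where E: "eigenbasis X E l" using eigenbasis_exists[OF assms(1)] .
 define m where "m v = (if l v >= 0 then A else a)" for v
 define B where "B = from_eigen E m"
 have xx: "x \<bullet> x = (\<Sum>v\<in>E. (v \<bullet> x)*(v \<bullet> x))" for x
 proof -
  have "x \<bullet> x = x \<bullet> (\<Sum>v\<in>E. (v \<bullet> x) *. v)" using E by (simp add: eigenbasis_def)
  thus ?thesis by (simp add: inner_sum_right inner_commute)
 qed
 have "ellip a A B"
 proof -
  have "a*(x \<bullet> x) <= x \<bullet> (B *v x) & x \<bullet> (B *v x) <= A*(x \<bullet> x)" for x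
   unfolding B_def from_eigen_form xx[of x] sum_distrib_left
   using assms(2) by (auto simp: m_def mult.assoc intro!: sum_mono mult_right_mono)
  thus ?thesis unfolding ellip_def B_def using transpose_from_eigen by blast
 qed
 moreover have "trace (B ** X) = (\<Sum>v\<in>E. l v *m v)"
  unfolding trace_eigenbasis[OF E]
  by (intro sum.cong refl) (simp add: B_def from_eigen_eig[OF E] eigenbasisD[OF E] matrix_vector_mul_assoc[symmetric] matrix_vector_mult_scaleR)
 moreover have "\<dots> = pucci_plus a A X"
  unfolding pucci_plus_eigen[OF E] m_def by (intro sum.cong) (auto simp: max_def)
 ultimately show ?thesis using that by simp
qed

text \<open>The norm of a matrix is the Euclidean norm of its entries, which dominates the operator
  norm by the Cauchy-Schwarz inequality in each row.\<close>

lemma norm_mv_le: "norm ((X :: real^'n^'n) *v h) <= norm X*norm h"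
proof (rule power2_le_imp_le)
 have "(norm (X *v h))^2 = (\<Sum>i\<in>UNIV. (X $ i \<bullet> h)^2)"
  by (simp add: norm_vec_def L2_set_def sum_nonneg matrix_vector_mult_def inner_vec_def)
 also have "\<dots> <= (\<Sum>i\<in>UNIV. (norm (X $ i))^2*(norm h)^2)"
  by (intro sum_mono) (metis Cauchy_Schwarz_ineq2 power2_abs power_mono abs_ge_zero power_mult_distrib)
 also have "\<dots> = (norm X*norm h)^2"
  by (simp add: norm_vec_def[of X] L2_set_def sum_nonneg power_mult_distrib sum_distrib_right)
 finally show "(norm (X *v h))^2 <= (norm X*norm h)^2" .
qed simp

lemma abs_form_le: "\<bar>h \<bullet> ((X :: real^'n^'n) *v k)\<bar> <= norm X*norm h*norm k"
proof -
 have "\<bar>h \<bullet> (X *v k)\<bar> <= norm h*norm (X *v k)" by (rule Cauchy_Schwarz_ineq2)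
 also have "\<dots> <= norm h*(norm X*norm k)" by (intro mult_left_mono norm_mv_le) simp
 finally show ?thesis by (simp add: mult_ac)
qed

lemma norm_outer: "norm (outer p q) = norm p*norm q"
proof -
 have "(norm (outer p q))^2 = (\<Sum>i\<in>UNIV. \<Sum>j\<in>UNIV. (p $ i)^2*(q $ j)^2)"
  by (simp add: norm_vec_def L2_set_def sum_nonneg outer_def power_mult_distrib)
 also have "\<dots> = (norm p*norm q)^2"
  by (simp add: norm_vec_def L2_set_def sum_nonneg power_mult_distrib sum_product)
 finally have "(norm (outer p q))^2 = (norm p*norm q)^2" .
 thus ?thesis by (simp add: power2_eq_iff_nonneg)
qed

subsection \<open>Second-order jets\<close>

text \<open>Semijets take the place of test functions: they add and transform like Taylor
  polynomials. Symmetry of the matrix is asked only where an operator is applied to it.\<close>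

definition subjet :: "(real^'n => real) => real^'n => real^'n => real^'n^'n => bool" where
 "subjet w x p X \<longleftrightarrow> (\<forall>\<epsilon>>0. \<forall>\<^sub>F y in nhds x.
   w x+p \<bullet> (y-x)+(y-x) \<bullet> (X *v (y-x))/2-\<epsilon>*(norm (y-x))^2 <= w y)"

definition superjet :: "(real^'n => real) => real^'n => real^'n => real^'n^'n => bool" where
 "superjet w x p X \<longleftrightarrow> subjet (%y. - w y) x (- p) (- X)"

text \<open>A two-sided Peano expansion at a single point. Its calculus replaces the computation of
  Hessians of the barriers.\<close>

definition jet2 :: "(real^'n => real) => real^'n => real^'n => real^'n^'n => bool" where
 "jet2 w x p X \<longleftrightarrow>
   (%y. w y-w x-p \<bullet> (y-x)-(y-x) \<bullet> (X *v (y-x))/2) : o[nhds x](%y. (norm (y-x))^2)"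

lemma jet2_sub: assumes "jet2 w x p X" shows "subjet w x p X"
 unfolding subjet_def
proof (intro allI impI)
 fix \<epsilon> :: real assume "\<epsilon> > 0"
 from landau_o.smallD[OF assms[unfolded jet2_def] this]
 show "\<forall>\<^sub>F y in nhds x. w x+p \<bullet> (y-x)+(y-x) \<bullet> (X *v (y-x))/2-\<epsilon>*(norm (y-x))^2 <= w y"
  by eventually_elim (auto simp: abs_le_iff)
qed

lemma jet2_uminus: "jet2 w x p X ==> jet2 (%y. - w y) x (- p) (- X)"
proof -
 assume "jet2 w x p X"
 hence "(%y. - (w y-w x-p \<bullet> (y-x)-(y-x) \<bullet> (X *v (y-x))/2)) : o[nhds x](%y. (norm (y-x))^2)"
  unfolding jet2_def landau_o.small.uminus_in_iff .
 moreover have "- (w y-w x-p \<bullet> (y-x)-(y-x) \<bullet> (X *v (y-x))/2) =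
  - w y - - w x-(- p) \<bullet> (y-x)-(y-x) \<bullet> ((- X) *v (y-x))/2" for y
  by (simp add: mv_uminus)
 ultimately show ?thesis unfolding jet2_def by (simp only:)
qed

lemma jet2_super: "jet2 w x p X ==> superjet w x p X"
 unfolding superjet_def by (intro jet2_sub jet2_uminus)

lemma subjet_add:
 assumes "subjet w x p X" "subjet v x q Y"
 shows "subjet (%y. w y + v y) x (p+q) (X+Y)"
 unfolding subjet_def
proof (intro allI impI)
 fix \<epsilon> :: real assume "\<epsilon> > 0"
 hence "\<epsilon>/2 > 0" by simp
 from assms(1)[unfolded subjet_def, rule_format, OF this] assms(2)[unfolded subjet_def, rule_format, OF this]
 show "\<forall>\<^sub>F y in nhds x. w x + v x+(p+q) \<bullet> (y-x)+(y-x) \<bullet> ((X+Y) *v (y-x))/2-\<epsilon>*(norm (y-x))^2 <= w y + v y"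
  by eventually_elim (simp add: mv_add inner_add_left inner_add_right add_divide_distrib)
qed

lemma superjet_add:
 assumes "superjet w x p X" "superjet v x q Y"
 shows "superjet (%y. w y + v y) x (p+q) (X+Y)"
 using subjet_add[OF assms[unfolded superjet_def]] unfolding superjet_def by simp

lemma subjet_mono:
 assumes "subjet v x p X" "\<forall>\<^sub>F y in nhds x. v y - v x <= w y-w x"
 shows "subjet w x p X"
 unfolding subjet_def
proof (intro allI impI)
 fix \<epsilon> :: real assume "\<epsilon> > 0"
 from assms(1)[unfolded subjet_def, rule_format, OF this] assms(2)
 show "\<forall>\<^sub>F y in nhds x. w x+p \<bullet> (y-x)+(y-x) \<bullet> (X *v (y-x))/2-\<epsilon>*(norm (y-x))^2 <= w y"
  by eventually_elim simp
qed

lemma subjet_cong: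
 assumes "\<forall>\<^sub>F y in nhds x. v y = w y"
 shows "subjet v x p X \<longleftrightarrow> subjet w x p X"
proof -
 have "v x = w x" using assms by (rule eventually_nhds_x_imp_x)
 thus ?thesis
  using subjet_mono[of v x p X w, OF _ eventually_mono[OF assms]]
   subjet_mono[of w x p X v, OF _ eventually_mono[OF assms]] by auto
qed

lemma subjet_cmult:
 assumes "subjet w x p X" "c > 0"
 shows "subjet (%y. c*w y) x (c*.p) (c*.X)"
 unfolding subjet_def
proof (intro allI impI)
 fix \<epsilon> :: real assume "\<epsilon> > 0"
 hence "\<epsilon> / c > 0" using assms by simp
 from assms(1)[unfolded subjet_def, rule_format, OF this]
 show "\<forall>\<^sub>F y in nhds x. c*w x+(c*.p) \<bullet> (y-x)+(y-x) \<bullet> ((c*.X) *v (y-x))/2-\<epsilon>*(norm (y-x))^2 <= c*w y"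
 proof eventually_elim
  case (elim y)
  from mult_left_mono[OF elim, of c] assms(2) show ?case
   by (simp add: mv_scaleR ring_distribs right_diff_distrib)
 qed
qed

lemma subjet_uminus_iff: "subjet (%y. - w y) x p X \<longleftrightarrow> superjet w x (- p) (- X)"
 by (simp add: superjet_def)

lemma superjet_uminus_iff: "superjet (%y. - w y) x p X \<longleftrightarrow> subjet w x (- p) (- X)"
 by (simp add: superjet_def)

lemma jet2_add: "jet2 w x p X ==> jet2 v x q Y ==> jet2 (%y. w y + v y) x (p+q) (X+Y)"
proof -
 assume "jet2 w x p X" "jet2 v x q Y"
 hence "(%y. (w y-w x-p \<bullet> (y-x)-(y-x) \<bullet> (X *v (y-x))/2) +
   (v y - v x-q \<bullet> (y-x)-(y-x) \<bullet> (Y *v (y-x))/2)) : o[nhds x](%y. (norm (y-x))^2)"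
  unfolding jet2_def by (rule sum_in_smallo)
 moreover have "(w y-w x-p \<bullet> (y-x)-(y-x) \<bullet> (X *v (y-x))/2) +
   (v y - v x-q \<bullet> (y-x)-(y-x) \<bullet> (Y *v (y-x))/2) =
   w y + v y-(w x + v x)-(p+q) \<bullet> (y-x)-(y-x) \<bullet> ((X+Y) *v (y-x))/2" for y
  by (simp add: mv_add inner_add_left inner_add_right add_divide_distrib)
 ultimately show ?thesis unfolding jet2_def by simp
qed

lemma jet2_diff: "jet2 w x p X ==> jet2 v x q Y ==> jet2 (%y. w y - v y) x (p-q) (X-Y)"
 using jet2_add[OF _ jet2_uminus, of w x p X v q Y] by simp

lemma jet2_cmult: "jet2 w x p X ==> jet2 (%y. c*w y) x (c*.p) (c*.X)"
 unfolding jet2_def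
proof -
 assume "(%y. w y-w x-p \<bullet> (y-x)-(y-x) \<bullet> (X *v (y-x))/2) : o[nhds x](%y. (norm (y-x))^2)"
 hence "(%y. c*(w y-w x-p \<bullet> (y-x)-(y-x) \<bullet> (X *v (y-x))/2)) : o[nhds x](%y. (norm (y-x))^2)"
  by (cases "c = 0") auto
 thus "(%y. c*w y - c*w x-(c*.p) \<bullet> (y-x)-(y-x) \<bullet> ((c*.X) *v (y-x))/2) : o[nhds x](%y. (norm (y-x))^2)"
  by (simp add: mv_scaleR right_diff_distrib)
qed

lemma jet2_const: "jet2 (%y. c) x 0 0"
 by (simp add: jet2_def)

lemma jet2_form:
 assumes "transpose C = C"
 shows "jet2 (%y. (y-z) \<bullet> (C *v (y-z))) x (2*.(C *v (x-z))) (2*.C)"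
proof -
 have *: "(y-z) \<bullet> (C *v (y-z))-(x-z) \<bullet> (C *v (x-z))-(2*.(C *v (x-z))) \<bullet> (y-x)
   - (y-x) \<bullet> ((2*.C) *v (y-x))/2 = 0" for y
 proof -
  define h k where "h = y-x" and "k = x-z"
  have e: "y-z = h + k" by (simp add: h_def k_def)
  have "h \<bullet> (C *v k) = (C *v k) \<bullet> h" "k \<bullet> (C *v h) = (C *v k) \<bullet> h"
   by (rule inner_commute, rule sym_dot[OF assms])
  thus ?thesis
   unfolding e h_def[symmetric] k_def[symmetric]
   by (simp add: matrix_vector_right_distrib inner_add_left inner_add_right mv_scaleR)
 qed
 show ?thesis unfolding jet2_def * by simp
qed

lemma jet2_inner: "jet2 (%y. q \<bullet> y) x q 0"
 by (simp add: jet2_def inner_diff_right)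

lemma jet2_norm2: "jet2 (%y. (norm (y-z))^2) x (2*.(x-z)) (2*.mat 1)"
 using jet2_form[of "mat 1" z x] by (simp add: power2_norm_eq_inner transpose_mat)

lemma norm_in_smallo: "(%y. norm (y-x)) : o[nhds x](%_. 1 :: real)"
proof (rule smalloI_tendsto)
 have "((%y. norm (y-x)) \<longlongrightarrow> norm (x-x)) (nhds x)"
  by (intro tendsto_intros filterlim_ident)
 thus "((%y. norm (y-x)/1) \<longlongrightarrow> 0) (nhds x)" by simp
qed simp

lemma inner_in_bigo: "(%y. p \<bullet> (y-x)) : O[nhds x](%y. norm (y-x))"
 by (rule bigoI[of _ "norm p"]) (auto simp: Cauchy_Schwarz_ineq2)

lemma form_in_bigo: "(%y. (y-x) \<bullet> ((X :: real^'n^'n) *v (y-x))/2) : O[nhds x](%y. (norm (y-x))^2)"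
 by (rule bigoI[of _ "norm X/2"])
  (use abs_form_le[of _ X] in \<open>auto simp: power2_eq_square mult.assoc\<close>)

lemma norm_square_smallo: "(%y. (norm (y-x))^2) : o[nhds x](%y. norm (y-x))"
proof -
 have "(%y. norm (y-x)*norm (y-x)) : o[nhds x](%y. norm (y-x)*1)"
  by (rule landau_o.big_small_mult[OF landau_o.big_refl norm_in_smallo])
 thus ?thesis by (simp add: power2_eq_square)
qed

lemma norm_cube_smallo: "(%y. norm (y-x)*(norm (y-x))^2) : o[nhds x](%y. (norm (y-x))^2)"
proof -
 have "(%y. norm (y-x)*(norm (y-x))^2) : o[nhds x](%y. 1*(norm (y-x))^2)"
  by (rule landau_o.small_big_mult[OF norm_in_smallo landau_o.big_refl])
 thus ?thesis by simp
qed

lemma jet2_rem1: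
 assumes "jet2 w x p X"
 shows "(%y. w y-w x-p \<bullet> (y-x)) : O[nhds x](%y. (norm (y-x))^2)"
 using sum_in_bigo(1)[OF landau_o.small_imp_big[OF assms[unfolded jet2_def]] form_in_bigo[of x X]]
 by simp

lemma jet2_rem0:
 assumes "jet2 w x p X"
 shows "(%y. w y-w x) : O[nhds x](%y. norm (y-x))"
proof -
 have "(%y. w y-w x-p \<bullet> (y-x)) : O[nhds x](%y. norm (y-x))"
  using jet2_rem1[OF assms] norm_square_smallo[THEN landau_o.small_imp_big] by (rule landau_o.big_trans)
 from sum_in_bigo(1)[OF this inner_in_bigo[of p x]] show ?thesis by simp
qed

lemma jet2_tendsto:
 assumes "jet2 w x p X"
 shows "(w \<longlongrightarrow> w x) (nhds x)"
proof -
 have "(%y. w y-w x) : o[nhds x](%_. 1 :: real)"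
  using jet2_rem0[OF assms] norm_in_smallo by (rule landau_o.big_small_trans)
 hence "((%y. w y-w x) \<longlongrightarrow> 0) (nhds x)" using smalloD_tendsto by fastforce
 thus ?thesis by (simp add: LIM_zero_iff)
qed

text \<open>The remainder splits into products of first-order and second-order remainders;
  \<open>outer p q + outer q p\<close> is the product of the two linear parts.\<close>

lemma jet2_mult:
 assumes w: "jet2 w x p X" and v: "jet2 v x q Y"
 shows "jet2 (%y. w y * v y) x (w x*.q + v x*.p) (w x*.Y + v x*.X + outer p q + outer q p)"
proof -
 let ?n = "%y. norm (y-x)"
 let ?d = "%y. w y-w x" and ?e = "%y. v y - v x"
 note cub = norm_cube_smallo[of x]
 have 1: "(%y. ?d y*(?e y-q \<bullet> (y-x))) : o[nhds x](%y. (?n y)^2)"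
  by (rule landau_o.big_small_trans[OF landau_o.big.mult[OF jet2_rem0[OF w] jet2_rem1[OF v]] cub])
 have 2: "(%y. (q \<bullet> (y-x))*(?d y-p \<bullet> (y-x))) : o[nhds x](%y. (?n y)^2)"
  by (rule landau_o.big_small_trans[OF landau_o.big.mult[OF inner_in_bigo jet2_rem1[OF w]] cub])
 have 3: "(%y. w x*(?e y-q \<bullet> (y-x)-(y-x) \<bullet> (Y *v (y-x))/2)) : o[nhds x](%y. (?n y)^2)"
  using v unfolding jet2_def by (cases "w x = 0") auto
 have 4: "(%y. v x*(?d y-p \<bullet> (y-x)-(y-x) \<bullet> (X *v (y-x))/2)) : o[nhds x](%y. (?n y)^2)"
  using w unfolding jet2_def by (cases "v x = 0") auto
 have eq: "w y * v y-w x * v x-(w x*.q + v x*.p) \<bullet> (y-x)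
   - (y-x) \<bullet> ((w x*.Y + v x*.X + outer p q + outer q p) *v (y-x))/2 =
   ?d y*(?e y-q \<bullet> (y-x))+(q \<bullet> (y-x))*(?d y-p \<bullet> (y-x)) +
   w x*(?e y-q \<bullet> (y-x)-(y-x) \<bullet> (Y *v (y-x))/2) +
   v x*(?d y-p \<bullet> (y-x)-(y-x) \<bullet> (X *v (y-x))/2)" for y
 proof -
  define k where "k = y-x"
  show ?thesis unfolding k_def[symmetric]
   by (simp add: mv_add mv_scaleR outer_mv inner_add_left inner_add_right) (simp add: field_simps inner_commute[of k])
 qed
 show ?thesis
  unfolding jet2_def eq using sum_in_smallo(1)[OF sum_in_smallo(1)[OF sum_in_smallo(1)[OF 1 2] 3] 4] .
qed

lemma jet2_compose:
 assumes w: "jet2 w x p X"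
  and g: "(%s. g s-g (w x)-g1*(s-w x)-g2*(s-w x)^2/2) : o[nhds (w x)](%s. (s-w x)^2)"
 shows "jet2 (%y. g (w y)) x (g1*.p) (g1*.X+g2 *. outer p p)"
proof -
 let ?n = "%y. norm (y-x)"
 let ?d = "%y. w y-w x"
 note cub = norm_cube_smallo[of x]
 have "(%y. g (w y)-g (w x)-g1 * ?d y-g2*(?d y)^2/2) : o[nhds x](%y. (?d y)^2)"
  using landau_o.small.compose[OF g jet2_tendsto[OF w]] by simp
 moreover have d2: "(%y. (?d y)^2) : O[nhds x](%y. (?n y)^2)"
  using landau_o.big.mult[OF jet2_rem0[OF w] jet2_rem0[OF w]] by (simp add: power2_eq_square)
 ultimately have 1: "(%y. g (w y)-g (w x)-g1 * ?d y-g2*(?d y)^2/2) : o[nhds x](%y. (?n y)^2)"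
  by (rule landau_o.small_big_trans)
 have 2: "(%y. g1*(?d y-p \<bullet> (y-x)-(y-x) \<bullet> (X *v (y-x))/2)) : o[nhds x](%y. (?n y)^2)"
  using w unfolding jet2_def by (cases "g1 = 0") auto
 have "(%y. (?d y+p \<bullet> (y-x))*(?d y-p \<bullet> (y-x))) : o[nhds x](%y. (?n y)^2)"
  by (rule landau_o.big_small_trans[OF landau_o.big.mult[OF sum_in_bigo(1)[OF jet2_rem0[OF w] inner_in_bigo] jet2_rem1[OF w]] cub])
 hence 3: "(%y. (g2/2)*((?d y+p \<bullet> (y-x))*(?d y-p \<bullet> (y-x)))) : o[nhds x](%y. (?n y)^2)"
  by (cases "g2 = 0") auto
 have eq: "g (w y)-g (w x)-(g1*.p) \<bullet> (y-x)-(y-x) \<bullet> ((g1*.X+g2 *. outer p p) *v (y-x))/2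
  = (g (w y)-g (w x)-g1 * ?d y-g2*(?d y)^2/2)+g1*(?d y-p \<bullet> (y-x)-(y-x) \<bullet> (X *v (y-x))/2)
   + (g2/2)*((?d y+p \<bullet> (y-x))*(?d y-p \<bullet> (y-x)))" for y
 proof -
  define k where "k = y-x"
  show ?thesis unfolding k_def[symmetric]
   by (simp add: mv_add mv_scaleR outer_mv inner_add_left inner_add_right) (simp add: field_simps inner_commute[of k] power2_eq_square)
 qed
 show ?thesis
  unfolding jet2_def eq using sum_in_smallo(1)[OF sum_in_smallo(1)[OF 1 2] 3] .
qed

text \<open>The remainder is estimated along the segment by the mean value theorem. The derivative
  of the gradient is symmetrised instead of being shown to be symmetric; the quadratic form is the
  same.\<close>

lemma peano_C2:
 fixes Df :: "real^'n => real^'n"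
 assumes f: "\<forall>\<^sub>F y in nhds x. GDERIV f y :> Df y"
  and D: "(Df has_derivative (%h. X *v h)) (at x)"
 shows "jet2 f x (Df x) ((1/2)*.(X+transpose X))"
 unfolding jet2_def
proof (rule landau_o.smallI)
 fix \<epsilon> :: real assume e: "\<epsilon> > 0"
 from f obtain d1 where d1: "d1 > 0" "!!y. dist y x < d1 ==> GDERIV f y :> Df y"
  unfolding eventually_nhds_metric by blast
 from D e obtain d2 where d2: "d2 > 0" "!!y. norm (y-x) < d2 ==> norm (Df y-Df x-X *v (y-x)) <= \<epsilon>*norm (y-x)"
  unfolding has_derivative_at_alt by blast
 have main: "\<bar>f y-f x-Df x \<bullet> (y-x)-(y-x) \<bullet> (X *v (y-x))/2\<bar> <= \<epsilon>*(norm (y-x))^2"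
  if y: "norm (y-x) < min d1 d2" for y
 proof -
  define k where "k = y-x"
  define g where "g s = f (x + s *. k) - s*(Df x \<bullet> k) - s^2/2*(k \<bullet> (X *v k))" for s
  define g' where "g' s = (Df (x + s *. k)-Df x-X *v (s *. k)) \<bullet> k" for s
  have der: "(g has_real_derivative g' s) (at s)" if "0 <= s" "s <= 1" for s
  proof -
   have "norm (s *. k) <= norm k" using that by (simp add: mult_left_le_one_le)
   hence "GDERIV f (x + s *. k) :> Df (x + s *. k)" using y by (intro d1) (simp add: dist_norm k_def)
   hence F: "(f has_derivative (%h. h \<bullet> Df (x + s *. k))) (at (x + s *. k))" by (simp add: gderiv_def)
   have "((%s. x + s *. k) has_derivative (%r. r *. k)) (at s)"
    by (auto intro!: derivative_eq_intros)
   from diff_chain_at[OF this F] have "((%s. f (x + s *. k)) has_derivative (%r. (r *. k) \<bullet> Df (x + s *. k))) (at s)"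
    by (simp add: o_def)
   hence "((%s. f (x + s *. k)) has_real_derivative k \<bullet> Df (x + s *. k)) (at s)"
    by (simp add: has_field_derivative_def mult.commute[of _ "k \<bullet> _"])
   thus ?thesis unfolding g_def g'_def
    by (auto intro!: derivative_eq_intros simp: inner_diff_left inner_diff_right inner_commute matrix_vector_mult_scaleR)
  qed
  have bd: "\<bar>g' s\<bar> <= \<epsilon>*(norm k)^2" if "0 <= s" "s <= 1" for s
  proof -
   have le: "norm (s *. k) <= norm k" using that by (simp add: mult_left_le_one_le)
   have "\<bar>g' s\<bar> <= norm (Df (x + s *. k)-Df x-X *v (s *. k))*norm k"
    unfolding g'_def by (rule Cauchy_Schwarz_ineq2)
   also have "\<dots> <= (\<epsilon>*norm (s *. k))*norm k"
    using d2(2)[of "x + s *. k"] le y by (intro mult_right_mono) (auto simp: k_def)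
   also have "\<dots> <= (\<epsilon>*norm k)*norm k" using le e by (intro mult_right_mono mult_left_mono) auto
   finally show ?thesis by (simp add: power2_eq_square)
  qed
  obtain z where z: "0 < z" "z < 1" "g 1-g 0 = (1-0)*g' z"
   using MVT2[of 0 1 g g'] der by auto
  have "f y-f x-Df x \<bullet> (y-x)-(y-x) \<bullet> (X *v (y-x))/2 = g 1-g 0"
   by (simp add: g_def k_def)
  with z bd[of z] show ?thesis by (simp add: k_def)
 qed
 have tr: "h \<bullet> (transpose X *v h) = h \<bullet> (X *v h)" for h
  by (metis dot_lmul_matrix inner_commute transpose_matrix_vector)
 have "h \<bullet> (((1/2)*.(X+transpose X)) *v h) = h \<bullet> (X *v h)" for h
  using tr[of h] by (simp add: mv_scaleR mv_add inner_add_right)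
 moreover have "\<forall>\<^sub>F y in nhds x. norm (y-x) < min d1 d2"
  using d1(1) d2(1) by (auto simp: eventually_nhds_metric dist_norm intro!: exI[of _ "min d1 d2"])
 ultimately show "\<forall>\<^sub>F y in nhds x. norm (f y-f x-Df x \<bullet> (y-x)-(y-x) \<bullet> (((1/2)*.(X+transpose X)) *v (y-x))/2)
   <= \<epsilon>*norm ((norm (y-x))^2)"
  using main by (auto elim!: eventually_mono)
qed

lemma peano_real:
 assumes f: "\<forall>\<^sub>F y in nhds s. (g has_real_derivative g1 y) (at y)"
  and D: "(g1 has_real_derivative g2) (at s)"
 shows "(%y. g y-g s-g1 s*(y - s)-g2*(y - s)^2/2) : o[nhds s](%y. (y - s)^2)"
proof (rule landau_o.smallI)
 fix \<epsilon> :: real assume e: "\<epsilon> > 0"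
 from f obtain d1 where d1: "d1 > 0" "!!y. dist y s < d1 ==> (g has_real_derivative g1 y) (at y)"
  unfolding eventually_nhds_metric by blast
 from D e obtain d2 where d2: "d2 > 0" "!!y. norm (y - s) < d2 ==> norm (g1 y-g1 s-g2*(y - s)) <= \<epsilon>*norm (y - s)"
  unfolding has_field_derivative_def has_derivative_at_alt by blast
 have main: "\<bar>g y-g s-g1 s*(y - s)-g2*(y - s)^2/2\<bar> <= \<epsilon>*(y - s)^2"
  if y: "\<bar>y - s\<bar> < min d1 d2" for y
 proof -
  define k where "k = y - s"
  define G where "G r = g (s+r * k)-r*(g1 s * k)-r^2/2*(g2 * k^2)" for r
  define G' where "G' r = (g1 (s+r * k)-g1 s-g2*(r * k)) * k" for r
  have le: "\<bar>r * k\<bar> <= \<bar>k\<bar>" if "0 <= r" "r <= 1" for r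
   using that by (simp add: abs_mult mult_left_le_one_le)
  have der: "(G has_real_derivative G' r) (at r)" if "0 <= r" "r <= 1" for r
  proof -
   have "(g has_real_derivative g1 (s+r * k)) (at (s+r * k))"
    using le[OF that] y by (intro d1) (simp add: dist_real_def k_def)
   thus ?thesis unfolding G_def G'_def
    by (auto intro!: derivative_eq_intros DERIV_chain2[where g = "%r. s+r * k"] simp: algebra_simps power2_eq_square)
  qed
  obtain z where z: "0 < z" "z < 1" "G 1-G 0 = (1-0)*G' z"
   using MVT2[of 0 1 G G'] der by auto
  have "\<bar>G' z\<bar> = \<bar>g1 (s+z * k)-g1 s-g2*(z * k)\<bar>*\<bar>k\<bar>" unfolding G'_def by (rule abs_mult)
  also have "\<dots> <= (\<epsilon>*\<bar>z * k\<bar>)*\<bar>k\<bar>"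
   using d2(2)[of "s+z * k"] le[of z] z y by (intro mult_right_mono) (auto simp: k_def)
  also have "\<dots> <= (\<epsilon>*\<bar>k\<bar>)*\<bar>k\<bar>" using le[of z] z e by (intro mult_right_mono mult_left_mono) auto
  finally have "\<bar>G' z\<bar> <= \<epsilon> * k^2" by (simp add: power2_eq_square)
  moreover have "g y-g s-g1 s*(y - s)-g2*(y - s)^2/2 = G 1-G 0"
   by (simp add: G_def k_def)
  ultimately show ?thesis using z by (simp add: k_def)
 qed
 have "\<forall>\<^sub>F y in nhds s. \<bar>y - s\<bar> < min d1 d2"
  using d1(1) d2(1) by (auto simp: eventually_nhds_metric dist_real_def intro!: exI[of _ "min d1 d2"])
 thus "\<forall>\<^sub>F y in nhds s. norm (g y-g s-g1 s*(y - s)-g2*(y - s)^2/2) <= \<epsilon>*norm ((y - s)^2)"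
  using main by (auto elim!: eventually_mono)
qed

text \<open>Along the ray \<open>x - t h\<close> with \<open>h = D - p\<close> the lower bound of
  the jet would force \<open>h \<bullet> h <= 0\<close>.\<close>

lemma subjet_gradient:
 assumes "subjet w x p X" "GDERIV w x :> D"
 shows "D = p"
proof (rule ccontr)
 assume "D ~= p"
 define h where "h = D-p"
 have h: "h \<bullet> h > 0" using \<open>D ~= p\<close> by (simp add: h_def)
 have "((%t. (w (x-t*.h)-w x)/t) \<longlongrightarrow> - (D \<bullet> h)) (at_right 0)"
 proof -
  have F: "(w has_derivative (%h. h \<bullet> D)) (at (x-0*.h))" using assms(2) by (simp add: gderiv_def)
  have "((%t. x-t*.h) has_derivative (%r. - (r*.h))) (at 0)"
   by (auto intro!: derivative_eq_intros)
  moreover have "(%h. h \<bullet> D) \<circ> (%r. - (r*.h)) = (*) (- (D \<bullet> h))"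
   by (auto simp: inner_commute)
  ultimately have "((%t. w (x-t*.h)) has_real_derivative (- (D \<bullet> h))) (at 0)"
   using diff_chain_at[of "%t. x-t*.h" "%r. - (r*.h)" 0 w "%h. h \<bullet> D"] F
   by (simp add: o_def has_field_derivative_def)
  hence "((%t. (w (x-t*.h)-w x)/t) \<longlongrightarrow> - (D \<bullet> h)) (at 0)"
   by (simp add: has_field_derivative_iff)
  thus ?thesis by (rule filterlim_mono[OF _ order_refl at_le]) simp
 qed
 moreover have "\<forall>\<^sub>F t in at_right 0. - (p \<bullet> h)-t*(norm X+1)*(h \<bullet> h) <= (w (x-t*.h)-w x)/t"
 proof -
  have "((%t. x-t*.h) \<longlongrightarrow> x-0*.h) (at_right 0)" by (intro tendsto_intros)
  hence lim: "filterlim (%t. x-t*.h) (nhds x) (at_right 0)" by simp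
  have "\<forall>\<^sub>F y in nhds x. w x+p \<bullet> (y-x)+(y-x) \<bullet> (X *v (y-x))/2-1*(norm (y-x))^2 <= w y"
   using assms(1)[unfolded subjet_def, rule_format, of 1] by simp
  from eventually_compose_filterlim[OF this lim] eventually_at_right_less[of "0 :: real"]
  show ?thesis
  proof eventually_elim
   case (elim t)
   have "- ((t*t)*(norm X*(h \<bullet> h))) <= t*t*(h \<bullet> (X *v h))/2"
   proof -
    have "- (norm X*(h \<bullet> h)) <= (h \<bullet> (X *v h))/2"
     using abs_form_le[of h X h] h mult_nonneg_nonneg[of "norm X" "h \<bullet> h"]
     by (auto simp: dot_square_norm power2_eq_square mult.assoc abs_le_iff)
    from mult_left_mono[OF this, of "t*t"] show ?thesis using elim by simp
   qed
   moreover have "w x-t*(p \<bullet> h)+t*t*(h \<bullet> (X *v h))/2-t*t*(h \<bullet> h) <= w (x-t*.h)"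
    using elim by (simp add: matrix_vector_mult_scaleR power2_norm_eq_inner mv_uminus
      matrix_vector_mult_diff_distrib linear_neg[OF matrix_vector_mul_linear])
     (simp add: power2_eq_square dot_square_norm mult_ac)
   ultimately have "w x-t*(p \<bullet> h)-(t*t)*(norm X*(h \<bullet> h))-t*t*(h \<bullet> h) <= w (x-t*.h)"
    by linarith
   hence "t*(- (p \<bullet> h)-t*(norm X+1)*(h \<bullet> h)) <= w (x-t*.h)-w x"
    by (simp add: algebra_simps)
   thus ?case using elim by (simp add: pos_le_divide_eq mult.commute)
  qed
 qed
 moreover have "((%t. - (p \<bullet> h)-t*(norm X+1)*(h \<bullet> h)) \<longlongrightarrow> - (p \<bullet> h)-0*(norm X+1)*(h \<bullet> h)) (at_right 0)"
  by (intro tendsto_intros)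
 ultimately have "- (p \<bullet> h)-0*(norm X+1)*(h \<bullet> h) <= - (D \<bullet> h)"
  by (intro tendsto_le[OF trivial_limit_at_right_real])
 hence "(D-p) \<bullet> h <= 0" by (simp add: inner_diff_left)
 thus False using h unfolding h_def by linarith
qed

lemma superjet_gradient:
 assumes "superjet w x p X" "GDERIV w x :> D"
 shows "D = p"
 using subjet_gradient[OF assms(1)[unfolded superjet_def] GDERIV_minus[OF assms(2)]] by simp

subsection \<open>Pucci operators\<close>

lemma transpose_add: "transpose (X+Y) = transpose X+transpose (Y :: real^'n^'n)"
 by (simp add: transpose_def vec_eq_iff)

lemma transpose_diff: "transpose (X-Y) = transpose X-transpose (Y :: real^'n^'n)"
 by (simp add: transpose_def vec_eq_iff)

lemma transpose_scaleR: "transpose (c*.X) = c*.transpose (X :: real^'n^'n)"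
 by (simp add: transpose_def vec_eq_iff)

lemma transpose_uminus: "transpose (- X) = - transpose (X :: real^'n^'n)"
 by (simp add: transpose_def vec_eq_iff)

lemma transpose_zero: "transpose (0 :: real^'n^'n) = 0"
 by (simp add: transpose_def vec_eq_iff)

lemmas sym_simps = transpose_add transpose_diff transpose_scaleR transpose_uminus transpose_zero
 transpose_outer transpose_mat

lemma mul_add_r: "B ** (X+Y) = B ** X+B ** (Y :: real^'n^'n)"
 by (rule matrix_add_ldistrib)

lemma mul_scaleR_r: "B ** (c*.X) = c*.(B ** (X :: real^'n^'n))"
 by (simp add: matrix_eq matrix_vector_mul_assoc[symmetric] mv_scaleR matrix_vector_mult_scaleR)

lemma mul_uminus_r: "B ** (- X) = - (B ** (X :: real^'n^'n))"
 using mul_scaleR_r[of B "-1" X] by simp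

lemma ellip_bounds:
 assumes "ellip a A B"
 shows "a*(v \<bullet> v) <= v \<bullet> (B *v v)" "v \<bullet> (B *v v) <= A*(v \<bullet> v)" "transpose B = B"
 using assms by (auto simp: ellip_def)

lemma card_eigenbasis:
 fixes X :: "real^'n^'n"
 assumes "eigenbasis X E l" shows "card E = CARD('n)"
proof -
 have "trace (mat 1 :: real^'n^'n) = (\<Sum>v\<in>E. v \<bullet> (mat 1 *v v))" by (rule trace_eigenbasis[OF assms])
 also have "\<dots> = (\<Sum>v\<in>E. 1)" using eigenbasisD(1)[OF assms] by (intro sum.cong) auto
 finally show ?thesis by (simp add: trace_I)
qed

lemma abs_eigenvalue_le:
 assumes "eigenbasis X E l" "v : E" shows "\<bar>l v\<bar> <= norm X"
proof -
 have "norm v = 1" using eigenbasisD(1)[OF assms] by (simp add: norm_eq_sqrt_inner)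
 hence "\<bar>l v\<bar> = norm (X *v v)" by (simp add: eigenbasisD(2)[OF assms])
 with norm_mv_le[of X v] \<open>norm v = 1\<close> show ?thesis by simp
qed

context
 fixes a A :: real
 assumes aA: "0 < a" "a <= A"
begin

lemma pucci_plus_add:
 assumes "transpose X = X" "transpose Y = Y"
 shows "pucci_plus a A (X+Y) <= pucci_plus a A X+pucci_plus a A Y"
proof -
 obtain B where B: "ellip a A B" "trace (B ** (X+Y)) = pucci_plus a A (X+Y)"
  using pucci_plus_attained[of "X+Y" a A] assms aA by (auto simp: transpose_add)
 thus ?thesis
  using pucci_plus_ge[OF assms(1) B(1)] pucci_plus_ge[OF assms(2) B(1)]
  by (simp add: mul_add_r trace_add)
qed

lemma pucci_plus_le_iff:
 assumes "transpose X = X"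
 shows "pucci_plus a A X <= c \<longleftrightarrow> (\<forall>B. ellip a A B --> trace (B ** X) <= c)"
 using pucci_plus_attained[OF assms aA(2)] pucci_plus_ge[OF assms] by (metis order_trans)

lemma pucci_plus_scaleR:
 assumes "transpose X = X" "c >= 0"
 shows "pucci_plus a A (c*.X) = c*pucci_plus a A X"
proof (rule antisym)
 show "pucci_plus a A (c*.X) <= c*pucci_plus a A X"
  using assms pucci_plus_ge[OF assms(1)]
  by (subst pucci_plus_le_iff) (auto simp: sym_simps mul_scaleR_r trace_scaleR mult_left_mono)
 obtain B where B: "ellip a A B" "trace (B ** X) = pucci_plus a A X"
  using pucci_plus_attained[OF assms(1) aA(2)] .
 thus "c*pucci_plus a A X <= pucci_plus a A (c*.X)"
  using pucci_plus_ge[of "c*.X" a A B] assms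
  by (simp add: sym_simps mul_scaleR_r trace_scaleR)
qed

lemma pucci_plus_zero: "pucci_plus a A 0 = 0"
 using pucci_plus_scaleR[of 0 0] by (simp add: transpose_zero)

text \<open>For \<open>a\<close> close to \<open>A\<close> the operator is \<open>A\<close> times
  the Laplacian up to a small error; the corner barrier uses this for a matrix of small
  trace.\<close>

lemma pucci_plus_laplace:
 fixes X :: "real^'n^'n"
 assumes "transpose X = X"
 shows "pucci_plus a A X <= A*trace X+(A-a)*CARD('n)*norm X"
proof -
 obtain E l where E: "eigenbasis X E l" using eigenbasis_exists[OF assms] .
 have tr: "trace X = (\<Sum>v\<in>E. l v)"
  unfolding trace_eigenbasis[OF E] using eigenbasisD[OF E] by (intro sum.cong) auto
 have "pucci_plus a A X = (\<Sum>v\<in>E. A*l v+(A-a)*max (- l v) 0)"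
  unfolding pucci_plus_eigen[OF E] by (intro sum.cong) (auto simp: max_def algebra_simps)
 also have "\<dots> <= (\<Sum>v\<in>E. A*l v+(A-a)*norm X)"
  using abs_eigenvalue_le[OF E] aA by (intro sum_mono add_left_mono mult_left_mono) (auto simp: max_def abs_le_iff)
 also have "\<dots> = A*trace X+(A-a)*CARD('n)*norm X"
  by (simp add: sum.distrib tr sum_distrib_left card_eigenbasis[OF E])
 finally show ?thesis .
qed

lemma pucci_plus_abs:
 fixes X :: "real^'n^'n"
 assumes "transpose X = X"
 shows "\<bar>pucci_plus a A X\<bar> <= A*CARD('n)*norm X"
proof -
 obtain E l where E: "eigenbasis X E l" using eigenbasis_exists[OF assms] .
 have "\<bar>pucci_plus a A X\<bar> <= (\<Sum>v\<in>E. \<bar>A*max (l v) 0-a*max (- l v) 0\<bar>)"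
  unfolding pucci_plus_eigen[OF E] by (rule sum_abs)
 also have "\<dots> <= (\<Sum>v\<in>E. A*norm X)"
 proof (rule sum_mono)
  fix v assume "v : E"
  have "\<bar>A*max (l v) 0-a*max (- l v) 0\<bar> <= A*\<bar>l v\<bar>"
   using aA by (cases "l v >= 0") (auto simp: max_def abs_mult intro!: mult_right_mono)
  also have "\<dots> <= A*norm X" using abs_eigenvalue_le[OF E \<open>v : E\<close>] aA by (intro mult_left_mono) auto
  finally show "\<bar>A*max (l v) 0-a*max (- l v) 0\<bar> <= A*norm X" .
 qed
 finally show ?thesis by (simp add: card_eigenbasis[OF E] mult_ac)
qed

lemma pucci_plus_neg_outer: "pucci_plus a A (- outer p p) <= - a*(norm p)^2"
 by (subst pucci_plus_le_iff)
  (auto simp: sym_simps mul_uminus_r mul_outer trace_uminus trace_outer inner_commute power2_norm_eq_inner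
   dest: ellip_bounds(1)[of _ _ _ p])

lemma pucci_minus_le_plus:
 assumes "transpose X = X"
 shows "pucci_minus a A X <= pucci_plus a A X"
 using pucci_plus_add[of X "- X"] assms by (simp add: pucci_minus_eq sym_simps pucci_plus_zero)

text \<open>Conjugation by \<open>S\<close> permutes the admissible coefficient matrices, and the
  trace is cyclic. With \<open>S\<close> a reflection matrix, this makes the equation invariant
  under reflections.\<close>

lemma pucci_plus_conj:
 fixes X S :: "real^'n^'n"
 assumes "transpose X = X" and S: "transpose S = S" "S ** S = mat 1"
 shows "pucci_plus a A (S ** X ** S) = pucci_plus a A X"
proof -
 have le: "pucci_plus a A (S ** X ** S) <= pucci_plus a A X" if X: "transpose X = X" for X :: "real^'n^'n"
 proof (subst pucci_plus_le_iff)
  show "transpose (S ** X ** S) = S ** X ** S" by (simp only: matrix_transpose_mul S X matrix_mul_assoc)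
  show "\<forall>B. ellip a A B --> trace (B ** (S ** X ** S)) <= pucci_plus a A X"
  proof (intro allI impI)
   fix B :: "real^'n^'n" assume B: "ellip a A B"
   have "(S *v v) \<bullet> (S *v v) = v \<bullet> v" for v
    by (metis S sym_dot matrix_vector_mul_assoc matrix_vector_mul_lid)
   moreover have "v \<bullet> ((S ** B ** S) *v v) = (S *v v) \<bullet> (B *v (S *v v))" for v
    by (simp add: matrix_vector_mul_assoc[symmetric] sym_dot[OF S(1)])
   moreover have "transpose (S ** B ** S) = S ** B ** S"
    by (simp only: matrix_transpose_mul S ellip_bounds(3)[OF B] matrix_mul_assoc)
   ultimately have "ellip a A (S ** B ** S)"
    using ellip_bounds[OF B] unfolding ellip_def by metis
   from pucci_plus_ge[OF X this] have "trace (S ** B ** S ** X) <= pucci_plus a A X" .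
   moreover have "trace (S ** B ** S ** X) = trace (B ** (S ** X ** S))"
    by (metis trace_mul_sym matrix_mul_assoc)
   ultimately show "trace (B ** (S ** X ** S)) <= pucci_plus a A X" by simp
  qed
 qed
 have sym: "transpose (S ** X ** S) = S ** X ** S" by (simp only: matrix_transpose_mul S assms(1) matrix_mul_assoc)
 have "S ** (S ** X ** S) ** S = X"
  by (metis S(2) matrix_mul_assoc matrix_mul_lid matrix_mul_rid)
 thus ?thesis using le[OF assms(1)] le[OF sym] by simp
qed

end

subsection \<open>Viscosity inequalities in terms of jets\<close>

text \<open>Here the right-hand side depends on the point only. The equation for \<open>u\<close>
  takes this form where its gradient does not vanish: the power of the gradient is divided out and
  absorbed into \<open>f\<close>.\<close>

definition vsup :: "(real^'n^'n => real) => (real^'n => real) => (real^'n) set => (real^'n => real) => bool" where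
 "vsup M f U v \<longleftrightarrow> (\<forall>x\<in>U. \<forall>p X. transpose X = X --> subjet v x p X --> M X <= f x)"

definition vsub :: "(real^'n^'n => real) => (real^'n => real) => (real^'n) set => (real^'n => real) => bool" where
 "vsub M g U u \<longleftrightarrow> (\<forall>x\<in>U. \<forall>p X. transpose X = X --> superjet u x p X --> g x <= M X)"

lemma vsupD: "vsup M f U v ==> x : U ==> transpose X = X ==> subjet v x p X ==> M X <= f x"
 by (auto simp: vsup_def)

lemma vsubD: "vsub M g U u ==> x : U ==> transpose X = X ==> superjet u x p X ==> g x <= M X"
 by (auto simp: vsub_def)

lemma subjet_local_min:
 assumes "jet2 \<phi> x p X" "\<forall>\<^sub>F y in nhds x. w x-\<phi> x <= w y-\<phi> y"
 shows "subjet w x p X"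
 using subjet_mono[OF jet2_sub[OF assms(1)], of w] assms(2) by (simp add: algebra_simps)

lemma superjet_local_max:
 assumes "jet2 \<phi> x p X" "\<forall>\<^sub>F y in nhds x. w y-\<phi> y <= w x-\<phi> x"
 shows "superjet w x p X"
 unfolding superjet_def
 by (rule subjet_local_min[OF jet2_uminus[OF assms(1)]]) (use assms(2) in \<open>simp add: algebra_simps\<close>)

subsection \<open>Convolutions with smooth kernels\<close>

text \<open>\<open>D\<close> and \<open>H\<close> are the gradient and the Hessian. The cubic
  remainder, uniform on bounded sets, is the property that survives integration.\<close>

definition smooth_kernel :: "(real^'n => real) => (real^'n => real^'n) => (real^'n => real^'n^'n) => bool" where
 "smooth_kernel k D H \<longleftrightarrow> continuous_on UNIV k & continuous_on UNIV D & continuous_on UNIV H &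
   (\<forall>R. \<exists>K\<ge>0. \<forall>z h. norm z <= R --> norm h <= 1 -->
    \<bar>k (z+h) - k z-D z \<bullet> h-h \<bullet> (H z *v h)/2\<bar> <= K*norm h ^ 3)"

text \<open>Covers both kernels used below, the Gaussian with \<open>th s = exp (- s)\<close> and
  the bump with a cubed positive part: a cubic remainder for the profile \<open>th\<close> gives one
  for its composition with a quadratic form.\<close>

lemma smooth_kernel_form:
 fixes C :: "real^'n^'n" and th thd thdd :: "real => real"
 assumes C: "transpose C = C"
  and I: "!!z. z \<bullet> (C *v z) : I"
  and cont: "continuous_on I th" "continuous_on I thd" "continuous_on I thdd"
  and M: "!!s. s : I ==> \<bar>thdd s\<bar> <= M"
  and rem: "!!s t. s : I ==> t : I ==>
   \<bar>th t-th s-thd s*(t - s)-thdd s/2*(t - s)^2\<bar> <= \<bar>t - s\<bar> ^ 3"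
 shows "smooth_kernel (%z. th (z \<bullet> (C *v z))) (%z. (2*thd (z \<bullet> (C *v z)))*.(C *v z))
  (%z. (4*thdd (z \<bullet> (C *v z))) *. outer (C *v z) (C *v z)+(2*thd (z \<bullet> (C *v z)))*.C)"
 unfolding smooth_kernel_def
proof (intro conjI allI)
 have q: "continuous_on UNIV (%z. z \<bullet> (C *v z))" and cz: "continuous_on UNIV (%z. C *v z)"
  by (intro continuous_intros matrix_vector_mult_linear_continuous_on)+
 have comp: "continuous_on UNIV (%z. f (z \<bullet> (C *v z)))" if "continuous_on I f" for f :: "real => real"
  using continuous_on_compose2[OF that q] I by auto
 have out: "continuous_on UNIV (%z. outer (C *v z) (C *v z))"
  unfolding outer_def by (intro continuous_intros cz)
 show "continuous_on UNIV (%z. th (z \<bullet> (C *v z)))" by (intro comp cont)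
 show "continuous_on UNIV (%z. (2*thd (z \<bullet> (C *v z)))*.(C *v z))" by (intro continuous_intros comp cont cz)
 show "continuous_on UNIV (%z. (4*thdd (z \<bullet> (C *v z))) *. outer (C *v z) (C *v z)+(2*thd (z \<bullet> (C *v z)))*.C)"
  by (intro continuous_intros comp cont out)
 fix R :: real
 define c r where "c = norm C" and "r = max R 0"
 have "c >= 0" "r >= 0" by (auto simp: c_def r_def)
 have "M >= 0" using M[OF I[of 0]] by linarith
 define K where "K = (2 * c*r + c) ^ 3+M/2*(4*(c*r) * c + c^2)"
 have "K >= 0" unfolding K_def using \<open>c >= 0\<close> \<open>r >= 0\<close> \<open>M >= 0\<close> by (intro add_nonneg_nonneg mult_nonneg_nonneg zero_le_power) auto
 moreover have "\<bar>th ((z+h) \<bullet> (C *v (z+h)))-th (z \<bullet> (C *v z))-((2*thd (z \<bullet> (C *v z)))*.(C *v z)) \<bullet> h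
   - h \<bullet> (((4*thdd (z \<bullet> (C *v z))) *. outer (C *v z) (C *v z)+(2*thd (z \<bullet> (C *v z)))*.C) *v h)/2\<bar> <= K*norm h ^ 3"
  if z: "norm z <= R" and h: "norm h <= 1" for z h
 proof -
  define s t where "s = z \<bullet> (C *v z)" and "t = (z+h) \<bullet> (C *v (z+h))"
  define x y where "x = (C *v z) \<bullet> h" and "y = h \<bullet> (C *v h)"
  have ts: "t - s = 2*x+y"
   using sym_dot[OF C, of z h] by (simp add: t_def s_def x_def y_def matrix_vector_right_distrib
     inner_add_left inner_add_right inner_commute)
  have xb: "\<bar>x\<bar> <= c*r*norm h"
  proof -
   have "\<bar>x\<bar> <= norm C*norm h*norm z" using abs_form_le[of h C z] by (simp add: x_def inner_commute)
   also have "\<dots> <= norm C*norm h*r" using z by (intro mult_left_mono) (auto simp: r_def)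
   finally show ?thesis by (simp add: c_def mult_ac)
  qed
  have yb2: "\<bar>y\<bar> <= c*(norm h)^2" using abs_form_le[of h C h] by (simp add: y_def c_def power2_eq_square mult_ac)
  have h2: "(norm h)^2 <= norm h" using h by (simp add: power2_eq_square mult_left_le_one_le)
  have yb: "\<bar>y\<bar> <= c*norm h"
   using yb2 mult_left_mono[OF h2 \<open>c >= 0\<close>] by linarith
  have "\<bar>t - s\<bar> <= (2 * c*r + c)*norm h" unfolding ts using xb yb by (simp add: algebra_simps abs_le_iff)
  hence e1: "\<bar>t - s\<bar> ^ 3 <= ((2 * c*r + c)*norm h) ^ 3" by (intro power_mono) auto
  have e2: "\<bar>4*(x*y)+y^2\<bar> <= (4*(c*r) * c + c^2)*norm h ^ 3"
  proof -
   have "\<bar>x*y\<bar> <= (c*r*norm h)*(c*(norm h)^2)" unfolding abs_mult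
    using xb yb2 by (intro mult_mono) auto
   moreover have "\<bar>y*y\<bar> <= (c*norm h)*(c*(norm h)^2)" unfolding abs_mult
    using yb yb2 \<open>c >= 0\<close> by (intro mult_mono) auto
   moreover have "\<bar>4*(x*y)+y^2\<bar> <= 4*\<bar>x*y\<bar>+\<bar>y*y\<bar>" unfolding power2_eq_square by linarith
   moreover have "4*((c*r*norm h)*(c*(norm h)^2))+(c*norm h)*(c*(norm h)^2) =
    (4*(c*r) * c + c^2)*norm h ^ 3" by (simp add: power2_eq_square power3_eq_cube algebra_simps)
   ultimately show ?thesis by linarith
  qed
  have "s : I" "t : I" using I by (auto simp: s_def t_def)
  from rem[OF this] e1 have r1: "\<bar>th t-th s-thd s*(t - s)-thdd s/2*(t - s)^2\<bar> <= ((2 * c*r + c)*norm h) ^ 3"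
   by linarith
  have r2: "\<bar>thdd s/2*(4*(x*y)+y^2)\<bar> <= M/2*((4*(c*r) * c + c^2)*norm h ^ 3)"
   unfolding abs_mult using M[OF \<open>s : I\<close>] e2 \<open>M >= 0\<close> by (intro mult_mono) auto
  have "th t-th s-((2*thd s)*.(C *v z)) \<bullet> h
   - h \<bullet> (((4*thdd s) *. outer (C *v z) (C *v z)+(2*thd s)*.C) *v h)/2 =
   (th t-th s-thd s*(t - s)-thdd s/2*(t - s)^2)+thdd s/2*(4*(x*y)+y^2)"
   unfolding ts
   by (simp add: mv_add mv_scaleR outer_mv inner_add_right x_def[symmetric] y_def[symmetric] inner_commute[of h "C *v z"])
    (simp add: field_simps power2_eq_square)
  hence "\<bar>th t-th s-((2*thd s)*.(C *v z)) \<bullet> h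
   - h \<bullet> (((4*thdd s) *. outer (C *v z) (C *v z)+(2*thd s)*.C) *v h)/2\<bar>
   <= ((2 * c*r + c)*norm h) ^ 3+M/2*((4*(c*r) * c + c^2)*norm h ^ 3)"
   using r1 r2 by linarith
  also have "\<dots> = K*norm h ^ 3"
  proof -
   define A0 where "A0 = 2 * c*r + c"
   show ?thesis unfolding K_def A0_def[symmetric] by (simp add: power_mult_distrib algebra_simps)
  qed
  finally show ?thesis by (simp add: s_def t_def)
 qed
 ultimately show "\<exists>K\<ge>0. \<forall>z h. norm z <= R --> norm h <= 1 -->
  \<bar>th ((z+h) \<bullet> (C *v (z+h)))-th (z \<bullet> (C *v z))-((2*thd (z \<bullet> (C *v z)))*.(C *v z)) \<bullet> h
   - h \<bullet> (((4*thdd (z \<bullet> (C *v z))) *. outer (C *v z) (C *v z)+(2*thd (z \<bullet> (C *v z)))*.C) *v h)/2\<bar> <= K*norm h ^ 3"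
  by blast
qed

lemma exp_cubic_remainder:
 fixes s t :: real
 assumes "0 <= s" "0 <= t"
 shows "\<bar>exp (- t)-exp (- s)-(- exp (- s))*(t - s)-exp (- s)/2*(t - s)^2\<bar> <= \<bar>t - s\<bar> ^ 3"
proof (cases "t = s")
 case False
 define diff where "diff m x = (- 1) ^ m*exp (- x)" for m :: nat and x :: real
 have "\<exists>r. (if t < s then t < r & r < s else s < r & r < t) &
  exp (- t) = (\<Sum>m<3. diff m s/fact m*(t - s) ^ m)+diff 3 r/fact 3*(t - s) ^ 3"
  by (rule Taylor[where a = "min s t" and b = "max s t"])
   (use False in \<open>auto simp: diff_def intro!: derivative_eq_intros\<close>)
 then obtain r where r: "if t < s then t < r & r < s else s < r & r < t"
  and e: "exp (- t) = (\<Sum>m<3. diff m s/fact m*(t - s) ^ m)+diff 3 r/fact 3*(t - s) ^ 3" by blast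
 have "r >= 0" using r assms by (auto split: if_splits)
 have "exp (- t)-exp (- s)-(- exp (- s))*(t - s)-exp (- s)/2*(t - s)^2 = diff 3 r/6*(t - s) ^ 3"
  unfolding e by (simp add: diff_def numeral_3_eq_3 eval_nat_numeral fact_numeral)
 moreover have "\<bar>diff 3 r/6\<bar> <= 1" using \<open>r >= 0\<close> by (simp add: diff_def order_trans[of _ 1])
 ultimately show ?thesis
  using mult_right_mono[of "\<bar>diff 3 r/6\<bar>" 1 "\<bar>t - s\<bar> ^ 3"]
  by (simp only: abs_mult power_abs) simp
qed simp

text \<open>The third power of the positive part has a Lipschitz second derivative. If both
  arguments are positive the remainder is the cube of the difference; otherwise it is bounded by it
  through a comparison of cubes.\<close>

lemma cube_remainder:
 fixes r s t :: real
 shows "\<bar>(max (r-t) 0) ^ 3-(max (r - s) 0) ^ 3-(- 3*(max (r - s) 0)^2)*(t - s)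
   - (6*max (r - s) 0)/2*(t - s)^2\<bar> <= \<bar>t - s\<bar> ^ 3"
proof -
 define x y where "x = r - s" and "y = r-t"
 have ts: "t - s = x-y" by (simp add: x_def y_def)
 have "\<bar>(max y 0) ^ 3-(max x 0) ^ 3+3*(max x 0)^2*(x-y)-3*max x 0*(x-y)^2\<bar> <= \<bar>x-y\<bar> ^ 3"
 proof (cases "x >= 0")
  case x: True
  show ?thesis
  proof (cases "y >= 0")
   case True
   have "y ^ 3-x ^ 3+3*x^2*(x-y)-3*x*(x-y)^2 = (y-x) ^ 3"
    by (simp add: power2_eq_square power3_eq_cube algebra_simps)
   thus ?thesis using x True by (simp add: max_def power_abs abs_minus_commute)
  next
   case False
   have e: "0-x ^ 3+3*x^2*(x-y)-3*x*(x-y)^2 = - ((x-y) ^ 3-(- y) ^ 3)"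
    by (simp add: power2_eq_square power3_eq_cube algebra_simps)
   have "(- y) ^ 3 <= (x-y) ^ 3" using x False by (intro power_mono) auto
   moreover have "0 <= (- y) ^ 3" using False by (intro zero_le_power) auto
   ultimately show ?thesis using x False e by (simp add: max_def)
  qed
 next
  case False
  thus ?thesis
  proof (cases "y >= 0")
   case True
   have "y ^ 3 <= (y-x) ^ 3" using True False by (intro power_mono) auto
   thus ?thesis using True False by (simp add: max_def abs_minus_commute)
  qed (simp add: max_def)
 qed
 thus ?thesis unfolding ts by (simp add: x_def y_def algebra_simps)
qed

text \<open>Differentiation under the integral sign: the Taylor remainder of the kernel is cubic
  uniformly in \<open>y\<close>, hence still cubic after integration over the box.\<close>

lemma conv_jet:
 fixes k :: "real^'n => real"
 assumes k: "smooth_kernel k D H" and v: "continuous_on (cbox a b) v"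
 shows "jet2 (%x. integral (cbox a b) (%y. v y * k (x-y))) x
   (integral (cbox a b) (%y. v y*.D (x-y))) (integral (cbox a b) (%y. v y*.H (x-y)))"
  (is "jet2 ?W x ?p ?X")
proof -
 have kc: "continuous_on UNIV k" "continuous_on UNIV D" "continuous_on UNIV H" using k by (auto simp: smooth_kernel_def)
 have cont: "continuous_on (cbox a b) (%y. v y * k (x-y))" "continuous_on (cbox a b) (%y. v y*.D (x-y))"
  "continuous_on (cbox a b) (%y. v y*.H (x-y))" for x
  by (intro continuous_intros v continuous_on_compose2[OF kc(1)] continuous_on_compose2[OF kc(2)] continuous_on_compose2[OF kc(3)]; simp)+
 note int = integrable_continuous[OF cont(1)] integrable_continuous[OF cont(2)] integrable_continuous[OF cont(3)]
 have "bounded (v ` cbox a b)" by (intro compact_imp_bounded compact_continuous_image v compact_cbox)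
 then obtain C where C: "C > 0" "!!y. y : cbox a b ==> \<bar>v y\<bar> <= C"
  unfolding bounded_pos by force
 have "bounded ((%y. x-y) ` cbox a b)"
  by (intro compact_imp_bounded compact_continuous_image continuous_intros compact_cbox)
 then obtain R where R: "!!y. y : cbox a b ==> norm (x-y) <= R"
  unfolding bounded_pos by force
 obtain K where K: "K >= 0" "!!z h. norm z <= R ==> norm h <= 1 ==>
    \<bar>k (z+h) - k z-D z \<bullet> h-h \<bullet> (H z *v h)/2\<bar> <= K*norm h ^ 3"
  using k unfolding smooth_kernel_def by meson
 define m where "m = measure lborel (cbox a b)"
 have est: "\<bar>?W (x+h) - ?W x - ?p \<bullet> h-h \<bullet> (?X *v h)/2\<bar> <= C*K*m*norm h ^ 3" if h: "norm h <= 1" for h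
 proof -
  have i1: "((%y. v y * k (x+h-y)) has_integral ?W (x+h)) (cbox a b)"
   and i2: "((%y. v y * k (x-y)) has_integral ?W x) (cbox a b)"
   using int(1) by (auto simp: integrable_integral)
  have i3: "((%y. (v y*.D (x-y)) \<bullet> h) has_integral ?p \<bullet> h) (cbox a b)"
   using has_integral_linear[OF integrable_integral[OF int(2)[of x]] bounded_linear_inner_left[of h]] by (simp add: o_def)
  have "linear (%X :: real^'n^'n. h \<bullet> (X *v h))"
   by (rule linearI) (auto simp: mv_add mv_scaleR inner_add_right)
  hence bl: "bounded_linear (%X :: real^'n^'n. h \<bullet> (X *v h))" by (simp add: linear_conv_bounded_linear)
  have i4: "((%y. h \<bullet> ((v y*.H (x-y)) *v h)/2) has_integral h \<bullet> (?X *v h)/2) (cbox a b)"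
   using has_integral_divide[OF has_integral_linear[OF integrable_integral[OF int(3)[of x]] bl], of 2] by (simp add: o_def)
  from has_integral_diff[OF has_integral_diff[OF has_integral_diff[OF i1 i2] i3] i4]
  have "norm (?W (x+h) - ?W x - ?p \<bullet> h-h \<bullet> (?X *v h)/2) <= (C*(K*norm h ^ 3))*measure lborel (cbox a b)"
  proof (rule has_integral_bound[rotated])
   fix y assume y: "y : cbox a b"
   have "v y * k (x+h-y) - v y * k (x-y)-(v y*.D (x-y)) \<bullet> h-h \<bullet> ((v y*.H (x-y)) *v h)/2
    = v y*(k ((x-y)+h) - k (x-y)-D (x-y) \<bullet> h-h \<bullet> (H (x-y) *v h)/2)"
    by (simp add: mv_scaleR algebra_simps add_diff_eq)
   thus "norm (v y * k (x+h-y) - v y * k (x-y)-(v y*.D (x-y)) \<bullet> h-h \<bullet> ((v y*.H (x-y)) *v h)/2)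
    <= C*(K*norm h ^ 3)"
    using C(1) C(2)[OF y] K(2)[OF R[OF y] h] by (simp add: abs_mult mult_mono)
  qed (use C K in auto)
  thus ?thesis by (simp add: m_def mult_ac)
 qed
 have "(%y. ?W y - ?W x - ?p \<bullet> (y-x)-(y-x) \<bullet> (?X *v (y-x))/2) : O[nhds x](%y. norm (y-x)*(norm (y-x))^2)"
 proof (rule bigoI[of _ "C*K*m"])
  have "\<forall>\<^sub>F y in nhds x. norm (y-x) < 1"
   by (auto simp: eventually_nhds_metric dist_norm intro!: exI[of _ 1])
  thus "\<forall>\<^sub>F y in nhds x. norm (?W y - ?W x - ?p \<bullet> (y-x)-(y-x) \<bullet> (?X *v (y-x))/2)
   <= C*K*m*norm (norm (y-x)*(norm (y-x))^2)"
  proof eventually_elim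
   case (elim y)
   thus ?case using est[of "y-x"] by (simp add: power2_eq_square power3_eq_cube)
  qed
 qed
 from landau_o.big_small_trans[OF this norm_cube_smallo] show ?thesis unfolding jet2_def .
qed

lemma linear_trace_mul: "linear (%X :: real^'n^'n. trace (B ** X))"
 by (rule linearI) (auto simp: mul_add_r mul_scaleR_r trace_add trace_scaleR)

lemma transpose_integral:
 fixes f :: "real^'n => real^'m^'m"
 assumes "f integrable_on S" "!!y. y : S ==> transpose (f y) = f y"
 shows "transpose (integral S f) = integral S f"
proof -
 have "linear (%X :: real^'m^'m. transpose X)"
  by (rule linearI) (auto simp: transpose_add transpose_scaleR)
 hence "bounded_linear (%X :: real^'m^'m. transpose X)" by (simp add: linear_conv_bounded_linear)
 from integral_linear[OF assms(1) this] have "transpose (integral S f) = integral S (%y. transpose (f y))"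
  by (simp add: o_def)
 also have "\<dots> = integral S f" using assms(2) by (intro integral_cong) auto
 finally show ?thesis .
qed

lemma trace_integral:
 fixes f :: "real^'n => real^'m^'m"
 assumes "f integrable_on S"
 shows "trace (B ** integral S f) = integral S (%y. trace (B ** f y))"
 using integral_linear[OF assms linear_trace_mul[of B, unfolded linear_conv_bounded_linear]]
 by (simp add: o_def)

subsection \<open>The heat semigroup\<close>

lemma integral_lborel_compact_support:
 fixes v :: "real^'n => real"
 assumes "continuous_on UNIV v" "continuous_on UNIV \<phi>" and supp: "!!y. y ~: cbox a b ==> v y = 0"
 shows "integrable lborel (%y. v y*\<phi> y)" "(\<integral>y. v y*\<phi> y \<partial>lborel) = integral (cbox a b) (%y. v y*\<phi> y)"
proof -
 have eq: "(%y. indicator (cbox a b) y*.(v y*\<phi> y)) = (%y. v y*\<phi> y)"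
  using supp by (auto simp: indicator_def fun_eq_iff)
 have "continuous_on (cbox a b) (%y. v y*\<phi> y)"
  using assms(1,2) by (intro continuous_intros) (auto intro: continuous_on_subset)
 from borel_integrable_compact[OF compact_cbox this] show int: "integrable lborel (%y. v y*\<phi> y)"
  unfolding eq .
 have "integral UNIV (%y. v y*\<phi> y) = integral UNIV (%y. if y : cbox a b then v y*\<phi> y else 0)"
  using supp by (intro integral_cong) auto
 thus "(\<integral>y. v y*\<phi> y \<partial>lborel) = integral (cbox a b) (%y. v y*\<phi> y)"
  using integral_lborel[OF int] by (simp add: integral_restrict_UNIV)
qed

lemma lborel_integral_affine:
 fixes f :: "real^'n => real"
 assumes [measurable]: "f : borel_measurable borel" and c: "c ~= 0"
 shows "(\<integral>y. f y \<partial>lborel) = \<bar>c\<bar> ^ CARD('n)*(\<integral>z. f (x + c*.z) \<partial>lborel)"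
proof -
 have "(\<integral>y. f y \<partial>lborel) = (\<integral>y. f y \<partial>(density (distr lborel borel (%z. x + c*.z)) (%_. \<bar>c\<bar> ^ DIM(real^'n))))"
  using lborel_affine[OF c, of x] by simp
 also have "\<dots> = (\<integral>y. \<bar>c\<bar> ^ CARD('n)*f y \<partial>distr lborel borel (%z. x + c*.z))"
  by (subst integral_density) auto
 also have "\<dots> = (\<integral>z. \<bar>c\<bar> ^ CARD('n)*f (x + c*.z) \<partial>lborel)"
  by (subst integral_distr) auto
 finally show ?thesis by simp
qed

lemma integrable_gaussian:
 assumes "c > 0"
 shows "integrable lborel (%z :: real^'n. exp (- (c*(z \<bullet> z))))"
proof -
 define \<sigma> where "\<sigma> = sqrt (1/(2 * c))"
 have \<sigma>: "\<sigma>^2 = 1/(2 * c)" "\<sigma> > 0" using assms by (auto simp: \<sigma>_def)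
 have nd: "normal_density 0 \<sigma> t = 1 / sqrt (2*pi*\<sigma>^2)*exp (- (c*t^2))" for t
  unfolding normal_density_def \<sigma>(1) using assms by simp
 have "integrable lborel (%t. sqrt (2*pi*\<sigma>^2)*normal_density 0 \<sigma> t)"
  using \<sigma>(2) by (intro integrable_mult_right integrable_normal_density)
 hence "integrable lborel (%t. exp (- (c*t^2)))"
  using \<sigma>(2) by (simp add: nd)
 hence fin: "(\<integral>\<^sup>+t. exp (- (c*t^2)) \<partial>lborel) < \<infinity>"
  by (simp add: integrable_iff_bounded)
 have e: "ennreal (exp (- (c*(z \<bullet> z)))) = (\<Prod>b\<in>Basis. ennreal (exp (- (c*(z \<bullet> b)^2))))" for z :: "real^'n"
  by (subst euclidean_inner[of z z])
   (simp add: prod_ennreal exp_sum[symmetric] sum_distrib_left sum_negf power2_eq_square)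
 have "(\<integral>\<^sup>+z. ennreal (exp (- (c*(z \<bullet> z)))) \<partial>(lborel :: (real^'n) measure)) =
  (\<Prod>b\<in>(Basis :: (real^'n) set). \<integral>\<^sup>+t. exp (- (c*t^2)) \<partial>lborel)"
  unfolding e by (rule nn_integral_lborel_prod) auto
 also have "\<dots> < \<infinity>" using fin by (simp add: power_less_top_ennreal)
 finally show ?thesis by (intro integrableI_bounded) auto
qed

lemma mul_diff_r: "B ** (X-Y) = B ** X-B ** (Y :: real^'n^'n)"
 using mul_add_r[of B X "- Y"] by (simp add: mul_uminus_r)

text \<open>Data of the heat kernel of \<open>trace (B ** X)\<close>, whose exponent is the
  quadratic form of the inverse matrix \<open>Bi\<close>.\<close>

locale heat =
 fixes a A :: real and B Bi :: "real^'n^'n"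
 assumes aA: "0 < a" "a <= A" and B: "ellip a A B" and BBi: "B ** Bi = mat 1" and Bi_sym: "transpose Bi = Bi"
begin

abbreviation Q :: "real^'n => real" where "Q z \<equiv> z \<bullet> (Bi *v z)"

lemma B_Bi: "B *v (Bi *v z) = z"
 by (simp add: matrix_vector_mul_assoc BBi)

lemma Q_ge: "a/(norm B+1)^2*(z \<bullet> z) <= Q z"
proof -
 let ?w = "Bi *v z"
 have "norm z <= norm B*norm ?w" using norm_mv_le[of B ?w] by (simp add: B_Bi)
 also have "\<dots> <= (norm B+1)*norm ?w" by (intro mult_right_mono) auto
 finally have "(norm z)^2 <= ((norm B+1)*norm ?w)^2" by (intro power_mono) auto
 hence "a*(z \<bullet> z) <= (norm B+1)^2*(a*(?w \<bullet> ?w))"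
  using aA by (simp add: power2_norm_eq_inner[symmetric] power_mult_distrib)
 also have "\<dots> <= (norm B+1)^2*Q z"
  using ellip_bounds(1)[OF B, of ?w] by (intro mult_left_mono) (auto simp: B_Bi inner_commute)
 finally have "a*(z \<bullet> z) <= (norm B+1)^2*Q z" .
 moreover have "(norm B+1)^2 > 0" by (intro zero_less_power add_nonneg_pos) auto
 ultimately show ?thesis by (simp add: pos_divide_le_eq mult.commute)
qed

lemma Q_nonneg: "0 <= Q z"
 using Q_ge[of z] aA by (meson divide_nonneg_nonneg inner_ge_zero less_imp_le mult_nonneg_nonneg order_trans zero_le_power2)

definition gk :: "real^'n => real" where "gk z = exp (- (Q z/4))"

lemma Q_cont: "continuous_on S Q"
 by (intro continuous_intros matrix_vector_mult_linear_continuous_on)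

lemma gk_cont: "continuous_on S gk"
 unfolding gk_def by (intro continuous_intros Q_cont) auto

lemma gk_pos: "gk z > 0" by (simp add: gk_def)

lemma gk_measurable [measurable]: "gk : borel_measurable borel"
 by (intro borel_measurable_continuous_onI gk_cont)

lemma gk_integrable: "integrable lborel gk"
proof (rule Bochner_Integration.integrable_bound)
 have "a/(norm B+1)^2/4 > 0" using aA by (intro divide_pos_pos zero_less_power) (auto intro: add_nonneg_pos)
 thus "integrable lborel (%z :: real^'n. exp (- (a/(norm B+1)^2/4*(z \<bullet> z))))"
  by (rule integrable_gaussian)
 show "AE z in lborel. norm (gk z) <= norm (exp (- (a/(norm B+1)^2/4*(z \<bullet> z))))"
  using Q_ge by (simp add: gk_def)
qed simp

definition Z :: real where "Z = (\<integral>z. gk z \<partial>lborel)"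

lemma Z_pos: "Z > 0"
proof -
 have "Z >= 0" unfolding Z_def using gk_pos by (intro integral_nonneg_AE) (auto simp: less_imp_le)
 moreover have "Z ~= 0"
 proof
  assume "Z = 0"
  hence "AE z in lborel. gk z = 0"
   unfolding Z_def using gk_pos by (subst (asm) integral_nonneg_eq_0_iff_AE[OF gk_integrable]) (auto simp: less_imp_le)
  hence "AE z :: real^'n in lborel. False" using gk_pos by (auto elim: AE_mp simp: less_le)
  hence "emeasure (lborel :: (real^'n) measure) UNIV = 0" by (simp add: AE_iff_null null_sets_def)
  thus False by simp
 qed
 ultimately show ?thesis by simp
qed

text \<open>The substitution \<open>y = x - sqrt t z\<close> moves the time from the kernel into the
  argument of \<open>v\<close>. The formula thus makes sense at \<open>t = 0\<close>, and joint
  continuity follows by dominated convergence.\<close>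

definition heat :: "(real^'n => real) => real => real^'n => real" where
 "heat v t x = (\<integral>z. gk z * v (x - sqrt t*.z) \<partial>lborel)/Z"

end

locale heat_data = heat a A B Bi for a A and B Bi :: "real^'n^'n" +
 fixes v :: "real^'n => real" and la lb :: "real^'n" and C0 :: real
 assumes v_cont: "continuous_on UNIV v" and supp: "!!y. y ~: cbox la lb ==> v y = 0"
  and bound: "!!y. \<bar>v y\<bar> <= C0"
begin

lemma v_measurable [measurable]: "v : borel_measurable borel"
 by (intro borel_measurable_continuous_onI v_cont)

lemma gv_integrable: "integrable lborel (%z. gk z * v (x - s*.z))"
proof (rule Bochner_Integration.integrable_bound)
 show "integrable lborel (%z. C0*gk z)" using gk_integrable by simp
 show "AE z in lborel. norm (gk z * v (x - s*.z)) <= norm (C0*gk z)"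
 proof (rule AE_I2)
  fix z
  have "\<bar>v (x - s*.z)\<bar>*gk z <= C0*gk z" using bound gk_pos by (intro mult_right_mono) (auto simp: less_imp_le)
  also have "\<dots> <= \<bar>C0*gk z\<bar>" by simp
  finally show "norm (gk z * v (x - s*.z)) <= norm (C0*gk z)" using gk_pos[of z] by (simp add: abs_mult mult.commute)
 qed
qed simp

lemma heat_0: "heat v 0 x = v x"
 using Z_pos by (simp add: heat_def Z_def)

lemma heat_bound: "\<bar>heat v t x\<bar> <= C0"
proof -
 have "\<bar>\<integral>z. gk z * v (x - sqrt t*.z) \<partial>lborel\<bar> <= (\<integral>z. C0*gk z \<partial>lborel)"
 proof (rule integral_abs_bound_integral[OF gv_integrable])
  fix z
  have "\<bar>v (x - sqrt t*.z)\<bar>*gk z <= C0*gk z" using bound gk_pos by (intro mult_right_mono) (auto simp: less_imp_le)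
  thus "\<bar>gk z * v (x - sqrt t*.z)\<bar> <= C0*gk z" using gk_pos[of z] by (simp add: abs_mult mult.commute)
 qed (use gk_integrable in simp)
 also have "\<dots> = C0*Z" by (simp add: Z_def)
 finally show ?thesis using Z_pos by (simp add: heat_def abs_divide divide_simps)
qed

lemma heat_continuous: "continuous_on ({0..} \<times> UNIV) (%(t, x). heat v t x)"
 unfolding continuous_on_sequentially
proof (intro allI ballI impI, clarsimp)
 fix f :: "nat => real \<times> (real^'n)" and t x
 assume f: "\<forall>n. f n : {0..} \<times> UNIV" and lim: "f \<longlonglongrightarrow> (t, x)"
 have t: "(%n. fst (f n)) \<longlonglongrightarrow> t" and x: "(%n. snd (f n)) \<longlonglongrightarrow> x"
  using tendsto_fst[OF lim] tendsto_snd[OF lim] by auto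
 have "(%n. \<integral>z. gk z * v (snd (f n) - sqrt (fst (f n))*.z) \<partial>lborel) \<longlonglongrightarrow> (\<integral>z. gk z * v (x - sqrt t*.z) \<partial>lborel)"
 proof (rule integral_dominated_convergence[where w = "%z. C0*gk z"])
  show "integrable lborel (%z. C0*gk z)" using gk_integrable by simp
  show "AE z in lborel. (%n. gk z * v (snd (f n) - sqrt (fst (f n))*.z)) \<longlonglongrightarrow> gk z * v (x - sqrt t*.z)"
  proof (rule AE_I2)
   fix z
   have "(%n. snd (f n) - sqrt (fst (f n))*.z) \<longlonglongrightarrow> x - sqrt t*.z" by (intro tendsto_intros t x)
   hence "(%n. v (snd (f n) - sqrt (fst (f n))*.z)) \<longlonglongrightarrow> v (x - sqrt t*.z)"
    by (intro continuous_on_tendsto_compose[OF v_cont]) auto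
   thus "(%n. gk z * v (snd (f n) - sqrt (fst (f n))*.z)) \<longlonglongrightarrow> gk z * v (x - sqrt t*.z)"
    by (intro tendsto_intros)
  qed
  show "AE z in lborel. norm (gk z * v (snd (f n) - sqrt (fst (f n))*.z)) <= C0*gk z" for n
  proof (rule AE_I2)
   fix z
   have "\<bar>v (snd (f n) - sqrt (fst (f n))*.z)\<bar>*gk z <= C0*gk z" using bound gk_pos by (intro mult_right_mono) (auto simp: less_imp_le)
   thus "norm (gk z * v (snd (f n) - sqrt (fst (f n))*.z)) <= C0*gk z" using gk_pos[of z] by (simp add: abs_mult mult.commute)
  qed
 qed simp_all
 thus "((%(t, x). heat v t x) \<circ> f) \<longlonglongrightarrow> heat v t x"
  unfolding heat_def o_def case_prod_beta using Z_pos by (intro tendsto_intros) auto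
qed

definition hk :: "real => real^'n => real" where "hk t z = exp (- (z \<bullet> (((1/(4*t))*.Bi) *v z)))"

text \<open>Undoing the substitution gives an integral over the support of \<open>v\<close> against
  a kernel smooth in \<open>t\<close> and \<open>x\<close>, the form that can be
  differentiated.\<close>

lemma heat_eq:
 assumes t: "t > 0"
 shows "heat v t x = t powr (- (CARD('n)/2))/Z*integral (cbox la lb) (%y. v y*hk t (x-y))"
proof -
 have hkc: "continuous_on UNIV (%y. hk t (x-y))"
  unfolding hk_def mv_scaleR inner_scaleR_right
  by (intro continuous_intros continuous_on_compose2[OF Q_cont]) auto
 have hkm [measurable]: "(%y. hk t (x-y)) : borel_measurable borel"
  by (rule borel_measurable_continuous_onI[OF hkc])
 have "integral (cbox la lb) (%y. v y*hk t (x-y)) = (\<integral>y. v y*hk t (x-y) \<partial>lborel)"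
  by (rule integral_lborel_compact_support(2)[OF v_cont hkc supp, symmetric])
 also have "\<dots> = \<bar>- sqrt t\<bar> ^ CARD('n)*(\<integral>z. v (x+(- sqrt t)*.z)*hk t (x-(x+(- sqrt t)*.z)) \<partial>lborel)"
  using t by (intro lborel_integral_affine) auto
 also have "(%z. v (x+(- sqrt t)*.z)*hk t (x-(x+(- sqrt t)*.z))) = (%z. gk z * v (x - sqrt t*.z))"
  using t by (simp add: hk_def gk_def mv_scaleR matrix_vector_mult_scaleR fun_eq_iff mult.commute mult.assoc[symmetric])
 also have "\<bar>- sqrt t\<bar> ^ CARD('n) = t powr (CARD('n)/2)"
  using t by (simp add: powr_half_sqrt[symmetric] powr_realpow[symmetric] powr_powr)
 finally show ?thesis using t Z_pos
  by (simp add: heat_def powr_minus divide_simps)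
qed

lemma hk_cont:
 fixes f :: "'z::topological_space => real"
 assumes "continuous_on S f" "continuous_on S g" "!!w. w : S ==> f w > 0"
 shows "continuous_on S (%w. hk (f w) (g w))"
proof -
 have q: "continuous_on S (%w. Q (g w))"
  by (rule continuous_on_compose2[OF Q_cont[of UNIV] assms(2)]) auto
 have "continuous_on S (%w. exp (- (1/(4*f w)*Q (g w))))"
  by (intro continuous_intros q assms(1)) (use assms(3) in fastforce)
 thus ?thesis by (simp add: hk_def mv_scaleR)
qed

text \<open>The heat equation, with the spatial derivatives given as a jet. The trace of the Hessian
  and the derivative in time both integrate \<open>v\<close> against the kernel with the weight
  \<open>Q / (4 t^2) - N / (2 t)\<close>, \<open>N\<close> being the dimension.\<close>

lemma heat_jet:
 assumes t: "t > 0"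
 obtains p Y d where "jet2 (heat v t) x p Y" "transpose Y = Y"
  "((%s. heat v s x) has_real_derivative trace (B ** Y)) (at t)"
proof -
 define C where "C = (1/(4*t))*.Bi"
 have C: "transpose C = C" by (simp add: C_def Bi_sym transpose_scaleR)
 have qC: "z \<bullet> (C *v z) = Q z/(4*t)" for z by (simp add: C_def mv_scaleR)
 have sk: "smooth_kernel (%z. exp (- (z \<bullet> (C *v z)))) (%z. (2*(- exp (- (z \<bullet> (C *v z)))))*.(C *v z))
  (%z. (4*exp (- (z \<bullet> (C *v z)))) *. outer (C *v z) (C *v z)+(2*(- exp (- (z \<bullet> (C *v z)))))*.C)"
  by (rule smooth_kernel_form[OF C, where I = "{0..}" and M = 1])
   (use t Q_nonneg exp_cubic_remainder in \<open>auto simp: qC intro!: continuous_intros\<close>)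
 define H where "H z = (4*exp (- (z \<bullet> (C *v z)))) *. outer (C *v z) (C *v z)+(2*(- exp (- (z \<bullet> (C *v z)))))*.C" for z
 define Y where "Y = integral (cbox la lb) (%y. v y*.H (x-y))"
 define c where "c s = s powr (- (CARD('n)/2))/Z" for s
 have vc: "continuous_on (cbox la lb) v" using v_cont continuous_on_subset by blast
 obtain p where W: "jet2 (%x. integral (cbox la lb) (%y. v y*hk t (x-y))) x p Y"
  using conv_jet[OF sk vc, of x] by (auto simp: Y_def H_def hk_def C_def)
 have "jet2 (%x. c t*integral (cbox la lb) (%y. v y*hk t (x-y))) x (c t*.p) (c t*.Y)"
  by (rule jet2_cmult[OF W])
 moreover have "heat v t = (%x. c t*integral (cbox la lb) (%y. v y*hk t (x-y)))"
  using heat_eq[OF t] by (simp add: c_def fun_eq_iff)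
 ultimately have J: "jet2 (heat v t) x (c t*.p) (c t*.Y)" by simp
 have Hc: "continuous_on UNIV H" using sk by (simp add: smooth_kernel_def H_def)
 have vH: "(%y. v y*.H (x-y)) integrable_on cbox la lb"
  by (intro integrable_continuous continuous_intros vc continuous_on_compose2[OF Hc]) auto
 have Ysym: "transpose (c t*.Y) = c t*.Y"
  unfolding Y_def transpose_scaleR
  by (subst transpose_integral[OF vH]) (auto simp: H_def sym_simps C)
 have trH: "trace (B ** H z) = hk t z*(Q z/(4*t^2)-CARD('n)/(2*t))" for z
 proof -
  have "B *v (C *v z) = (1/(4*t))*.z" by (simp add: C_def mv_scaleR matrix_vector_mult_scaleR B_Bi)
  moreover have "trace (B ** C) = CARD('n)/(4*t)"
   by (simp add: C_def mul_scaleR_r BBi trace_scaleR trace_I)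
  ultimately show ?thesis
   using t by (simp add: H_def mul_diff_r mul_scaleR_r mul_outer trace_sub trace_scaleR trace_outer qC hk_def
     C_def[symmetric]) (simp add: field_simps power2_eq_square)
 qed
 have trY: "trace (B ** Y) = integral (cbox la lb) (%y. v y*(hk t (x-y)*(Q (x-y)/(4*t^2)-CARD('n)/(2*t))))"
  unfolding Y_def trace_integral[OF vH] by (simp add: mul_scaleR_r trace_scaleR trH)
 have dW: "((%s. integral (cbox la lb) (%y. v y*hk s (x-y))) has_real_derivative
   integral (cbox la lb) (%y. v y*(hk t (x-y)*(Q (x-y)/(4*t^2))))) (at t within {0<..})"
 proof (rule leibniz_rule_field_derivative)
  fix s :: real and y assume "s : {0<..}"
  thus "((%s. v y*hk s (x-y)) has_real_derivative v y*(hk s (x-y)*(Q (x-y)/(4 * s^2)))) (at s within {0<..})"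
   unfolding hk_def mv_scaleR inner_scaleR_right
   by (auto intro!: derivative_eq_intros simp: field_simps power2_eq_square)
 next
  fix s :: real assume "s : {0<..}"
  thus "(%y. v y*hk s (x-y)) integrable_on cbox la lb"
   by (intro integrable_continuous continuous_intros vc hk_cont) auto
 next
  show "continuous_on ({0<..} \<times> cbox la lb) (%(s, y). v y*(hk s (x-y)*(Q (x-y)/(4 * s^2))))"
   unfolding case_prod_beta
   by (intro continuous_intros hk_cont continuous_on_compose2[OF vc] continuous_on_compose2[OF Q_cont]) auto
 qed (use t in auto)
 hence dW: "((%s. integral (cbox la lb) (%y. v y*hk s (x-y))) has_real_derivative
   integral (cbox la lb) (%y. v y*(hk t (x-y)*(Q (x-y)/(4*t^2))))) (at t)"
  using t by (simp add: at_within_open[of t "{0<..}"])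
 have dc: "(c has_real_derivative-(CARD('n)/(2*t)) * c t) (at t)"
 proof -
  define r where "r = - (CARD('n)/2 :: real)"
  have "t powr (r-1) = t powr r/t" using t by (simp add: powr_diff)
  moreover have "c = (%s. s powr r/Z)" by (simp add: c_def r_def fun_eq_iff)
  ultimately have "(c has_real_derivative r*(t powr r/t)/Z) (at t)"
   using DERIV_cdivide[OF has_real_derivative_powr[OF t, of r], of Z] by simp
  moreover have "r*(t powr r/t)/Z = - (CARD('n)/(2*t)) * c t"
   by (simp add: c_def r_def)
  ultimately show ?thesis by simp
 qed
 have I: "(%y. v y*(hk t (x-y)*(Q (x-y)/(4*t^2)))) integrable_on cbox la lb"
  "(%y. v y*hk t (x-y)) integrable_on cbox la lb"
  using t by (intro integrable_continuous continuous_intros vc hk_cont continuous_on_compose2[OF Q_cont]; auto)+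
 have trY2: "trace (B ** Y) = integral (cbox la lb) (%y. v y*(hk t (x-y)*(Q (x-y)/(4*t^2))))
  - CARD('n)/(2*t)*integral (cbox la lb) (%y. v y*hk t (x-y))"
 proof -
  have "trace (B ** Y) = integral (cbox la lb) (%y. v y*(hk t (x-y)*(Q (x-y)/(4*t^2)))
    - CARD('n)/(2*t)*(v y*hk t (x-y)))"
   unfolding trY by (intro integral_cong) (simp add: algebra_simps)
  also have "\<dots> = integral (cbox la lb) (%y. v y*(hk t (x-y)*(Q (x-y)/(4*t^2))))
    - integral (cbox la lb) (%y. CARD('n)/(2*t)*(v y*hk t (x-y)))"
   by (intro Henstock_Kurzweil_Integration.integral_diff I(1) integrable_on_mult_right I(2))
  finally show ?thesis by simp
 qed
 have "((%s. c s*integral (cbox la lb) (%y. v y*hk s (x-y))) has_real_derivative trace (B ** (c t*.Y))) (at t)"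
  by (rule derivative_eq_intros dc dW refl)+ (simp add: trY2 mul_scaleR_r trace_scaleR algebra_simps)
 moreover have "\<forall>\<^sub>F s in nhds t. c s*integral (cbox la lb) (%y. v y*hk s (x-y)) = heat v s x"
  using eventually_nhds_in_open[of "{0<..}" t] t by (auto elim!: eventually_mono simp: heat_eq c_def)
 ultimately have "((%s. heat v s x) has_real_derivative trace (B ** (c t*.Y))) (at t)"
  by (subst (asm) DERIV_cong_ev[OF refl _ refl]) auto
 with J Ysym show ?thesis using that by blast
qed

end

lemma ellip_trace_le:
 fixes B :: "real^'n^'n"
 assumes "ellip a A B"
 shows "trace B <= A*CARD('n)"
proof -
 obtain E l where E: "eigenbasis B E l" using eigenbasis_exists[OF ellip_bounds(3)[OF assms]] .
 have "trace B = (\<Sum>v\<in>E. v \<bullet> (B *v v))" by (rule trace_eigenbasis[OF E])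
 also have "\<dots> <= (\<Sum>v\<in>E. A)"
  using ellip_bounds(2)[OF assms] eigenbasisD(1)[OF E] by (intro sum_mono) (metis mult.right_neutral)
 finally show ?thesis by (simp add: card_eigenbasis[OF E] mult.commute)
qed

lemma pucci_plus_id:
 assumes "0 < a" "a <= A" "c >= 0"
 shows "pucci_plus a A (c*.mat 1 :: real^'n^'n) <= c*(A*CARD('n))"
 unfolding pucci_plus_scaleR[OF assms(1,2) transpose_mat assms(3)] using assms
 by (intro mult_left_mono) (auto simp: pucci_plus_le_iff transpose_mat ellip_trace_le)

lemma trace_mul_psd:
 fixes B :: "real^'n^'n"
 assumes B: "ellip a A B" and "a > 0" and Z: "transpose Z = Z" "!!h. 0 <= h \<bullet> (Z *v h)"
 shows "0 <= trace (B ** Z)"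
proof -
 obtain E l where E: "eigenbasis Z E l" using eigenbasis_exists[OF Z(1)] .
 have "trace (B ** Z) = (\<Sum>v\<in>E. l v *(v \<bullet> (B *v v)))"
  unfolding trace_eigenbasis[OF E]
  by (intro sum.cong refl) (simp add: eigenbasisD[OF E] matrix_vector_mul_assoc[symmetric] matrix_vector_mult_scaleR)
 moreover have "0 <= l v *(v \<bullet> (B *v v))" if "v : E" for v
 proof -
  have "l v = v \<bullet> (Z *v v)" using eigenbasisD[OF E] that by simp
  moreover have "0 <= v \<bullet> (B *v v)"
   using ellip_bounds(1)[OF B, of v] \<open>a > 0\<close> by (meson inner_ge_zero less_imp_le mult_nonneg_nonneg order_trans)
  ultimately show ?thesis using Z(2) by simp
 qed
 ultimately show ?thesis by (simp add: sum_nonneg)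
qed

lemma nonneg_if_quadratic:
 fixes b c :: real
 assumes "!!t. 0 < t ==> t < d ==> t*b <= c*t*t" "d > 0"
 shows "b <= 0"
proof (rule ccontr)
 assume "\<not> b <= 0"
 define t where "t = min (d/2) (b/(2*(\<bar>c\<bar>+1)))"
 have "t <= d/2" by (simp only: t_def min.cobounded1)
 moreover have "0 < b/(2*(\<bar>c\<bar>+1))" using \<open>\<not> b <= 0\<close> by (intro divide_pos_pos) auto
 ultimately have t: "0 < t" "t < d" using assms(2) by (auto simp: t_def)
 have "b <= c*t" using assms(1)[OF t] t by (simp add: mult.commute[of c])
 also have "\<dots> <= (\<bar>c\<bar>+1)*t" using t by (intro mult_right_mono) auto
 also have "\<dots> <= (\<bar>c\<bar>+1)*(b/(2*(\<bar>c\<bar>+1)))" by (intro mult_left_mono) (auto simp: t_def)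
 also have "\<dots> = b/2" by (simp add: field_simps)
 finally show False using \<open>\<not> b <= 0\<close> by simp
qed

lemma superjet_nonneg:
 assumes "superjet (%y. 0) x p X"
 shows "0 <= h \<bullet> (X *v h)"
proof -
 have p: "p = 0" using superjet_gradient[OF assms GDERIV_const] by simp
 have ev: "\<forall>\<^sub>F y in nhds x. (y-x) \<bullet> ((- X) *v (y-x))/2-e*(norm (y-x))^2 <= 0" if "e > 0" for e
  using assms that unfolding superjet_def subjet_def p by simp
 have "h \<bullet> ((- X) *v h)/2 <= e*(norm h)^2" if e: "e > 0" for e
 proof -
  have "((%t. x+t*.h) \<longlongrightarrow> x+0*.h) (at_right 0)" by (intro tendsto_intros)
  hence lim: "filterlim (%t. x+t*.h) (nhds x) (at_right 0)" by simp
  have "\<forall>\<^sub>F t in at_right 0. (t*.h) \<bullet> ((- X) *v (t*.h))/2-e*(norm (t*.h))^2 <= 0"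
   using eventually_compose_filterlim[OF ev[OF e] lim] by (simp only: add_diff_cancel_left')
  from eventually_happens'[OF trivial_limit_at_right_real eventually_conj[OF eventually_at_right_less[of "0 :: real"] this]]
  obtain t where t: "t > 0" "(t*.h) \<bullet> ((- X) *v (t*.h))/2-e*(norm (t*.h))^2 <= 0"
   by blast
  have "t^2*(h \<bullet> ((- X) *v h)/2-e*(norm h)^2) <= 0"
   using t(2) by (simp add: matrix_vector_mult_scaleR power_mult_distrib power2_eq_square algebra_simps)
  thus ?thesis using t(1) by (simp add: mult_le_0_iff)
 qed
 note le = this
 have "h \<bullet> ((- X) *v h)/2 <= 0+e" if "e > 0" for e
 proof -
  define n where "n = (norm h)^2+1"
  have "n > 0" by (simp add: n_def add_nonneg_pos)
  have "h \<bullet> ((- X) *v h)/2 <= e/n*(norm h)^2" using \<open>n > 0\<close> that by (intro le) auto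
  also have "\<dots> <= e/n*n" using that \<open>n > 0\<close> by (intro mult_left_mono) (auto simp: n_def)
  finally show ?thesis using \<open>n > 0\<close> by simp
 qed
 hence "h \<bullet> ((- X) *v h)/2 <= 0" by (rule field_le_epsilon)
 thus ?thesis by (simp add: mv_uminus)
qed

context heat_data
begin

text \<open>Comparison with the heat semigroup of a linear operator turns the viscosity inequality into an
 integral inequality, which survives convolution.\<close>

lemma heat_le:
 assumes r: "r > 0" and v: "vsup (%X. trace (B ** X)) (%_. F) (ball x r) v"
  and t: "0 <= t" "t <= 1"
 shows "heat v t x <= v x+t*F+(2*C0+\<bar>F\<bar>)/r ^ 4*((4*A*CARD('n)+8*A)*A*CARD('n))*t^2"
proof -
 define c1 c2 K where "c1 = 4*A*CARD('n)+8*A" and "c2 = c1*A*CARD('n)"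
  and "K = (2*C0+\<bar>F\<bar>)/r ^ 4"
 have "C0 >= 0" using bound[of 0] by linarith
 hence nn: "c1 >= 0" "c2 >= 0" "K >= 0" using aA r by (auto simp: c1_def c2_def K_def)
 \<comment> \<open>A supersolution of the heat equation: \<open>c1\<close> and \<open>c2\<close>
   make \<open>trace (B ** Yb)\<close>, for the Hessian \<open>Yb\<close> of \<open>b\<close>, at
   most the derivative of \<open>b\<close> in \<open>s\<close>. The factor \<open>K\<close> lets
   \<open>K b\<close> exceed all other terms where \<open>norm (y - x) = r\<close>, and at
   \<open>y = x\<close> only \<open>c2 s^2\<close> remains.\<close>
 define b where "b s y = ((norm (y-x))^2)^2 + c1 * s*(norm (y-x))^2 + c2 * s^2" for s y
 \<comment> \<open>The slack \<open>e\<close> makes the differential inequality at a positive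
   maximum of \<open>\<Psi>\<close> strict.\<close>
 have main: "heat v t x <= v x+t*(F+e)+K * c2*t^2" if e: "e > 0" for e
 proof -
  define \<Psi> where "\<Psi> s y = heat v s y - v y - s*(F+e)-K*b s y" for s y
  have "\<Psi> s y <= 0" if sy: "s : {0..1}" "y : cball x r" for s y
  proof (rule ccontr)
   assume pos: "\<not> \<Psi> s y <= 0"
   let ?S = "{0..1 :: real} \<times> cball x r"
   have "continuous_on ?S (%w. heat v (fst w) (snd w))"
    by (rule continuous_on_subset[OF heat_continuous[unfolded case_prod_beta]]) auto
   moreover have "continuous_on ?S (%w. v (snd w))"
    by (intro continuous_on_compose2[OF v_cont]) (auto intro!: continuous_intros)
   ultimately have "continuous_on ?S (%w. \<Psi> (fst w) (snd w))"
    unfolding \<Psi>_def b_def by (intro continuous_intros)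
   moreover have "compact ?S" by (intro compact_Times compact_Icc compact_cball)
   moreover have "?S ~= {}" using sy by blast
   ultimately obtain w where "w : ?S" "\<forall>z\<in>?S. \<Psi> (fst z) (snd z) <= \<Psi> (fst w) (snd w)"
    using continuous_attains_sup[of ?S "%w. \<Psi> (fst w) (snd w)"] by blast
   then obtain s' y' where w: "s' : {0..1}" "y' : cball x r"
    and max: "!!s y. s : {0..1} ==> y : cball x r ==> \<Psi> s y <= \<Psi> s' y'"
    by (cases w) fastforce
   have pos': "\<Psi> s' y' > 0" using max[OF sy] pos by linarith
   have bnn: "b s' y' >= 0" unfolding b_def using nn w(1) by auto
   have "s' ~= 0"
   proof
    assume "s' = 0"
    hence "\<Psi> s' y' = - K*b s' y'" by (simp add: \<Psi>_def heat_0)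
    thus False using pos' mult_nonneg_nonneg[OF nn(3) bnn] by linarith
   qed
   hence s': "0 < s'" "s' <= 1" using w by auto
   have "y' : ball x r"
   proof (rule ccontr)
    assume "y' ~: ball x r"
    hence nr: "norm (y'-x) = r" using w(2) by (auto simp: dist_norm norm_minus_commute)
    have "(r^2)^2 = r ^ 4" by simp
    hence "b s' y' = r ^ 4+(c1 * s'*r^2 + c2 * s'^2)" unfolding b_def nr by (simp only: add.assoc)
    moreover have "0 <= c1 * s'*r^2 + c2 * s'^2" using nn s' by (intro add_nonneg_nonneg mult_nonneg_nonneg) auto
    ultimately have "b s' y' >= r ^ 4" by linarith
    hence "K*b s' y' >= 2*C0+\<bar>F\<bar>"
     using mult_left_mono[of "r ^ 4" "b s' y'" K] nn r by (simp add: K_def)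
    moreover have "heat v s' y' - v y' <= 2*C0" using heat_bound[of s' y'] bound[of y'] by linarith
    moreover have "- (s'*(F+e)) <= \<bar>F\<bar>"
    proof -
     have "- (s'*F) <= s'*\<bar>F\<bar>" using s' by (metis abs_ge_minus_self less_imp_le mult_left_mono mult_minus_right)
     also have "\<dots> <= 1*\<bar>F\<bar>" using s' by (intro mult_right_mono) auto
     finally show ?thesis using mult_pos_pos[OF s'(1) e] by (simp add: distrib_left)
    qed
    ultimately show False using pos' unfolding \<Psi>_def by linarith
   qed
   obtain p Y where J: "jet2 (heat v s') y' p Y" "transpose Y = Y"
    and D: "((%s. heat v s y') has_real_derivative trace (B ** Y)) (at s')"
    using heat_jet[OF s'(1)] .
   define k where "k = y'-x"
   define Yb where "Yb = (4*(norm k)^2)*.mat 1+8 *. outer k k+(2 * c1 * s')*.(mat 1 :: real^'n^'n)"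
   have J2: "jet2 (%y. (norm (y-x))^2) y' (2 *. k) (2*.mat 1)" unfolding k_def by (rule jet2_norm2)
   have "jet2 (%y. ((norm (y-x))^2)^2) y' ((norm k)^2*.(2 *. k)+(norm k)^2*.(2 *. k))
     ((norm k)^2*.(2*.mat 1)+(norm k)^2*.(2*.mat 1) + outer (2 *. k) (2 *. k) + outer (2 *. k) (2 *. k))"
    using jet2_mult[OF J2 J2] by (simp add: power2_eq_square[of "(norm _)^2"] k_def)
   moreover have "(norm k)^2*.(2*.mat 1)+(norm k)^2*.(2*.mat 1) + outer (2 *. k) (2 *. k) + outer (2 *. k) (2 *. k)
     = (4*(norm k)^2)*.mat 1+8 *. outer k k"
    by (simp add: vec_eq_iff outer_def)
   ultimately obtain q where "jet2 (%y. ((norm (y-x))^2)^2) y' q ((4*(norm k)^2)*.mat 1+8 *. outer k k)" by metis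
   from jet2_add[OF jet2_add[OF this jet2_cmult[OF J2, of "c1 * s'"]] jet2_const[of "c2 * s'^2"]]
   obtain q where Jb: "jet2 (b s') y' q Yb"
    unfolding b_def Yb_def by (auto simp: mult.assoc mult.commute[of _ 2])
   have YbS: "transpose Yb = Yb" by (simp add: Yb_def sym_simps)
   have Jphi: "jet2 (%y. heat v s' y-K*b s' y) y' (p-K*.q) (Y-K*.Yb)"
    by (intro jet2_diff J jet2_cmult Jb)
   have "subjet v y' (p-K*.q) (Y-K*.Yb)"
   proof (rule subjet_local_min[OF Jphi])
    have "\<forall>\<^sub>F y in nhds y'. y : ball x r" using \<open>y' : ball x r\<close> by (intro eventually_nhds_in_open) auto
    thus "\<forall>\<^sub>F y in nhds y'. v y'-(heat v s' y'-K*b s' y') <= v y-(heat v s' y-K*b s' y)"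
    proof eventually_elim
     case (elim y)
     hence "\<Psi> s' y <= \<Psi> s' y'" using w(1) by (intro max) auto
     thus ?case unfolding \<Psi>_def by linarith
    qed
   qed
   hence "trace (B ** (Y-K*.Yb)) <= F"
    using vsupD[OF v \<open>y' : ball x r\<close>] J(2) YbS by (simp add: sym_simps)
   hence t1: "trace (B ** Y) <= F+K*trace (B ** Yb)"
    by (simp add: mul_diff_r mul_scaleR_r trace_sub trace_scaleR)
   have t2: "trace (B ** Yb) <= c1*(norm k)^2+2 * c2 * s'"
   proof -
    have "trace (B ** Yb) = (4*(norm k)^2)*trace B+8*(k \<bullet> (B *v k))+(2 * c1 * s')*trace B"
     by (simp add: Yb_def mul_add_r mul_scaleR_r trace_add trace_scaleR mul_outer trace_outer inner_commute)
    also have "\<dots> <= (4*(norm k)^2)*(A*CARD('n))+8*(A*(norm k)^2)+(2 * c1 * s')*(A*CARD('n))"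
     using ellip_trace_le[OF B] ellip_bounds(2)[OF B, of k] nn s'
     by (intro add_mono mult_left_mono) (auto simp: power2_norm_eq_inner)
    also have "\<dots> = c1*(norm k)^2+2 * c2 * s'" by (simp add: c1_def c2_def algebra_simps)
    finally show ?thesis .
   qed
   define g where "g s = heat v s y' - v y' - s*(F+e)-K*b s y'" for s
   define l where "l = trace (B ** Y)-(F+e)-K*(c1*(norm k)^2+2 * c2 * s')"
   have "(g has_real_derivative l) (at s')"
    unfolding g_def b_def l_def k_def
    by (rule derivative_eq_intros D refl | simp)+
   moreover have "l < 0"
    using t1 mult_left_mono[OF t2 nn(3)] e unfolding l_def by linarith
   \<comment> \<open>The maximum may be attained at the final time, so the derivative in time is
     tested backwards.\<close>
   ultimately obtain d where d: "d > 0" "!!h. 0 < h ==> h < d ==> g s' < g (s'-h)"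
    using DERIV_neg_dec_left by blast
   define h where "h = min (d/2) s'"
   have "g s' < g (s'-h)" by (rule d(2)) (use d(1) s' in \<open>auto simp: h_def min_def\<close>)
   moreover have "g (s'-h) <= g s'"
    using max[of "s'-h" y'] s' d(1) w unfolding g_def \<Psi>_def by (auto simp: h_def min_def)
   ultimately show False by simp
  qed
  from this[of t x] t r have "\<Psi> t x <= 0" by simp
  thus ?thesis by (simp add: \<Psi>_def b_def algebra_simps)
 qed
 have "heat v t x <= (v x+t*F+K * c2*t^2)+e" if "e > 0" for e
 proof -
  have "t*e <= e" using t that by (simp add: mult_left_le_one_le)
  thus ?thesis using main[OF that] by (simp add: distrib_left)
 qed
 hence "heat v t x <= v x+t*F+K * c2*t^2" by (rule field_le_epsilon)
 thus ?thesis by (simp add: K_def c1_def c2_def mult.assoc)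
qed

end

subsection \<open>Mollification and the comparison lemma\<close>

lemma ellip_inverse:
 fixes B :: "real^'n^'n"
 assumes B: "ellip a A B" and a: "a > 0"
 obtains Bi where "B ** Bi = mat 1" "transpose Bi = Bi"
proof -
 have "x = 0" if "B *v x = 0" for x
 proof -
  have "x \<bullet> x <= 0" using ellip_bounds(1)[OF B, of x] that a by (simp add: mult_le_0_iff)
  thus ?thesis by (metis inner_gt_zero_iff not_less)
 qed
 hence "\<forall>x. B *v x = 0 --> x = 0" by blast
 then obtain Bi where L: "Bi ** B = mat 1" using matrix_left_invertible_ker[of B] by blast
 hence R: "B ** Bi = mat 1" by (simp add: matrix_left_right_inverse)
 have "transpose Bi = transpose Bi ** (B ** Bi)" by (simp add: R)
 also have "\<dots> = transpose (B ** Bi) ** Bi"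
  by (simp add: matrix_transpose_mul ellip_bounds(3)[OF B] matrix_mul_assoc)
 also have "\<dots> = Bi" by (simp add: R)
 finally show ?thesis using that R by blast
qed

text \<open>The third power makes the kernel twice continuously differentiable; the redundant
  \<open>mat 1\<close> puts it into the shape of \<open>smooth_kernel_form\<close>.\<close>

definition bump :: "real => real^'n => real" where
 "bump s z = (max (s^2-z \<bullet> (mat 1 *v z)) 0) ^ 3"

lemma bump_nonneg: "bump s z >= 0" by (simp add: bump_def)

lemma bump_eq_0: "norm z >= s ==> s > 0 ==> bump s z = 0"
 by (simp add: bump_def max_def power2_norm_eq_inner[symmetric] power_mono)

lemma bump_kernel: obtains D H where "smooth_kernel (bump s :: real^'n => real) D H" "!!z. transpose (H z) = H z"
proof -
 have "smooth_kernel (%z :: real^'n. (max (s^2-z \<bullet> (mat 1 *v z)) 0) ^ 3)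
  (%z. (2*(- 3*(max (s^2-z \<bullet> (mat 1 *v z)) 0)^2))*.(mat 1 *v z))
  (%z. (4*(6*max (s^2-z \<bullet> (mat 1 *v z)) 0)) *. outer (mat 1 *v z) (mat 1 *v z)+(2*(- 3*(max (s^2-z \<bullet> (mat 1 *v z)) 0)^2))*.mat 1)"
 proof (rule smooth_kernel_form[where th = "%t. (max (s^2-t) 0) ^ 3" and I = "{0..}" and M = "6 * s^2"
    and thd = "%t. - 3*(max (s^2-t) 0)^2" and thdd = "%t. 6*max (s^2-t) 0"])
  show "transpose (mat 1 :: real^'n^'n) = mat 1" by (simp add: transpose_mat)
  show "z \<bullet> (mat 1 *v z) : {0..}" for z :: "real^'n" by simp
  show "\<bar>6*max (s^2-t) 0\<bar> <= 6 * s^2" if "t : {0..}" for t using that by (auto simp: max_def)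
 qed (use cube_remainder in \<open>auto intro!: continuous_intros simp del: max_less_iff_conj\<close>)
 thus ?thesis
  by (intro that[of _ "%z. (4*(6*max (s^2-z \<bullet> (mat 1 *v z)) 0)) *. outer (mat 1 *v z) (mat 1 *v z)+(2*(- 3*(max (s^2-z \<bullet> (mat 1 *v z)) 0)^2))*.mat 1"])
   (auto simp: bump_def[abs_def] sym_simps)
qed

lemma bump_continuous: "continuous_on S (bump s)"
 unfolding bump_def by (intro continuous_intros matrix_vector_mult_linear_continuous_on)

lemma bump_measurable [measurable]: "bump s : borel_measurable borel"
 by (intro borel_measurable_continuous_onI bump_continuous)

lemma bump_integrable:
 assumes "s > 0"
 shows "integrable lborel (bump s :: real^'n => real)" "0 < (\<integral>z. bump s (z :: real^'n) \<partial>lborel)"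
proof -
 have "(%z :: real^'n. indicator (cball 0 s) z*.bump s z) = bump s"
  by (rule ext) (use bump_eq_0[OF less_imp_le assms] in \<open>auto simp: indicator_def not_le\<close>)
 with borel_integrable_compact[OF compact_cball bump_continuous, of "0 :: real^'n" s s]
 show int: "integrable lborel (bump s :: real^'n => real)" by simp
 have "(\<integral>z. bump s (z :: real^'n) \<partial>lborel) >= 0" by (intro integral_nonneg_AE) (auto simp: bump_nonneg)
 moreover have "(\<integral>z. bump s (z :: real^'n) \<partial>lborel) ~= 0"
 proof
  assume "(\<integral>z. bump s (z :: real^'n) \<partial>lborel) = 0"
  hence "AE z :: real^'n in lborel. bump s z = 0"
   by (subst (asm) integral_nonneg_eq_0_iff_AE[OF int]) (auto simp: bump_nonneg)
  hence "AE z :: real^'n in lborel. z ~: ball 0 s"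
  proof eventually_elim
   case (elim z)
   show ?case
   proof
    assume "z : ball 0 s"
    hence "norm z < s" by simp
    hence "(norm z)^2 < s^2" by (intro power_strict_mono) auto
    thus False using elim by (simp add: bump_def power2_norm_eq_inner max_def split: if_splits)
   qed
  qed
  hence "emeasure lborel (ball (0 :: real^'n) s) = 0"
   by (subst (asm) AE_iff_measurable[OF _ refl]) (auto simp: ball_def)
  hence "negligible (ball (0 :: real^'n) s)" by (simp add: negligible_iff_emeasure0)
  thus False using open_not_negligible[of "ball (0 :: real^'n) s"] assms by simp
 qed
 ultimately show "0 < (\<integral>z. bump s (z :: real^'n) \<partial>lborel)" by simp
qed

definition moll :: "real => (real^'n => real) => real^'n => real" where
 "moll s v x = (\<integral>y. bump s y * v (x-y) \<partial>lborel)/(\<integral>y. bump s (y :: real^'n) \<partial>lborel)"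

context
 fixes v :: "real^'n => real" and la lb :: "real^'n" and C0 s :: real
 assumes v_cont: "continuous_on UNIV v" and supp: "!!y. y ~: cbox la lb ==> v y = 0"
  and bound: "!!y. \<bar>v y\<bar> <= C0" and s: "s > 0"
begin

private lemma v_measurable [measurable]: "v : borel_measurable borel"
 by (intro borel_measurable_continuous_onI v_cont)

private lemma bv_integrable: "integrable lborel (%y. bump s y * v (x-y))"
proof (rule Bochner_Integration.integrable_bound)
 show "integrable lborel (%y :: real^'n. C0*bump s y)" using bump_integrable(1)[OF s, where 'n = 'n] by simp
 show "AE y in lborel. norm (bump s y * v (x-y)) <= norm (C0*bump s y)"
 proof (rule AE_I2)
  fix y :: "real^'n"
  have "bump s y*\<bar>v (x-y)\<bar> <= bump s y*C0" using bound bump_nonneg by (intro mult_left_mono) auto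
  also have "\<dots> <= \<bar>bump s y*C0\<bar>" by simp
  finally show "norm (bump s y * v (x-y)) <= norm (C0*bump s y)"
   using bump_nonneg[of s y] by (simp add: abs_mult mult.commute)
 qed
qed simp

lemma moll_eq:
 "moll s v x = integral (cbox la lb) (%y. v y*bump s (x-y))/(\<integral>y. bump s (y :: real^'n) \<partial>lborel)"
proof -
 have c: "continuous_on UNIV (%y. bump s (x-y))"
  by (intro continuous_on_compose2[OF bump_continuous[of UNIV]] continuous_intros) auto
 have "integral (cbox la lb) (%y. v y*bump s (x-y)) = (\<integral>y. v y*bump s (x-y) \<partial>lborel)"
  by (rule integral_lborel_compact_support(2)[OF v_cont c supp, symmetric])
 also have "\<dots> = \<bar>- 1\<bar> ^ CARD('n)*(\<integral>y. v (x+(- 1)*.y)*bump s (x-(x+(- 1)*.y)) \<partial>lborel)"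
  by (rule lborel_integral_affine) auto
 finally show ?thesis by (simp add: moll_def mult.commute)
qed

lemma moll_bound: "\<bar>moll s v x\<bar> <= C0"
proof -
 have "\<bar>\<integral>y. bump s y * v (x-y) \<partial>lborel\<bar> <= (\<integral>y. bump s (y :: real^'n)*C0 \<partial>lborel)"
  using bound bump_integrable(1)[OF s, where 'n = 'n]
  by (intro integral_abs_bound_integral[OF bv_integrable])
   (auto simp: abs_mult bump_nonneg intro!: mult_left_mono)
 thus ?thesis using bump_integrable[OF s, where 'n = 'n]
  by (simp add: moll_def abs_divide divide_simps mult.commute)
qed

lemma moll_near:
 assumes "!!y. norm y < s ==> \<bar>v (x-y) - v x\<bar> <= e"
 shows "\<bar>moll s v x - v x\<bar> <= e"
proof -
 let ?m = "\<integral>y. bump s (y :: real^'n) \<partial>lborel"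
 have m: "?m > 0" and int: "integrable lborel (bump s :: real^'n => real)" using bump_integrable[OF s] by auto
 have "(\<integral>y. bump s y * v (x-y) \<partial>lborel) - ?m * v x = (\<integral>y. bump s y * v (x-y)-bump s y * v x \<partial>lborel)"
  using int by (subst Bochner_Integration.integral_diff[OF bv_integrable]) auto
 also have "\<bar>\<dots>\<bar> <= (\<integral>y. bump s (y :: real^'n)*e \<partial>lborel)"
 proof (rule integral_abs_bound_integral)
  show "integrable lborel (%y. bump s y * v (x-y)-bump s y * v x)" "integrable lborel (%y :: real^'n. bump s y*e)"
   using bv_integrable int by auto
  fix y :: "real^'n"
  show "\<bar>bump s y * v (x-y)-bump s y * v x\<bar> <= bump s y*e"
  proof (cases "norm y < s")
   case True
   thus ?thesis using assms[OF True] bump_nonneg[of s y]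
    by (simp add: right_diff_distrib[symmetric] abs_mult mult_left_mono)
  qed (use bump_eq_0[of s y] s in auto)
 qed
 finally have "\<bar>(\<integral>y. bump s y * v (x-y) \<partial>lborel) - ?m * v x\<bar> <= ?m*e" by simp
 moreover have "(\<integral>y. bump s y * v (x-y) \<partial>lborel) - ?m * v x = ?m*(moll s v x - v x)"
  using m by (simp add: moll_def field_simps)
 ultimately show ?thesis using m by (simp add: abs_mult)
qed

lemma moll_cont: "continuous_on UNIV (moll s v)"
proof -
 have "continuous_on UNIV (%x. integral (cbox la lb) (%y. v y*bump s (x-y)))"
  by (rule integral_continuous_on_param)
   (auto simp: case_prod_beta intro!: continuous_intros continuous_on_compose2[OF v_cont] continuous_on_compose2[OF bump_continuous[of UNIV]])
 thus ?thesis unfolding moll_eq using bump_integrable[OF s, where 'n = 'n] by (intro continuous_intros) auto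
qed

lemma moll_supp:
 assumes "x ~: cbox (la-(\<chi> i. s)) (lb+(\<chi> i. s))"
 shows "moll s v x = 0"
proof -
 have "v y*bump s (x-y) = 0" if y: "y : cbox la lb" for y
 proof -
  obtain i where i: "x $ i < la $ i - s | lb $ i + s < x $ i" using assms by (auto simp: mem_box_cart not_le)
  have "la $ i <= y $ i" "y $ i <= lb $ i" using y by (auto simp: mem_box_cart)
  hence "s <= \<bar>(x-y) $ i\<bar>" using i s by auto
  also have "\<dots> <= norm (x-y)" by (rule component_le_norm_cart)
  finally show ?thesis using bump_eq_0[of s "x-y"] s by simp
 qed
 hence "integral (cbox la lb) (%y. v y*bump s (x-y)) = integral (cbox la lb) (%y. 0)" by (intro integral_cong)
 thus ?thesis by (simp add: moll_eq)
qed

lemma moll_jet: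
 obtains P Y where "!!x. jet2 (moll s v) x (P x) (Y x)" "!!x. transpose (Y x) = Y x" "continuous_on UNIV Y"
proof -
 obtain D H where k: "smooth_kernel (bump s :: real^'n => real) D H" and Hs: "!!z. transpose (H z) = H z"
  using bump_kernel by metis
 define m where "m = (\<integral>y. bump s (y :: real^'n) \<partial>lborel)"
 have vc: "continuous_on (cbox la lb) v" using v_cont continuous_on_subset by blast
 define P where "P x = (1/m)*.integral (cbox la lb) (%y. v y*.D (x-y))" for x
 define Y where "Y x = (1/m)*.integral (cbox la lb) (%y. v y*.H (x-y))" for x
 have Hc: "continuous_on UNIV H" using k by (simp add: smooth_kernel_def)
 have "moll s v = (%x. (1/m)*integral (cbox la lb) (%y. v y*bump s (x-y)))"
  by (simp add: moll_eq m_def fun_eq_iff)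
 hence "jet2 (moll s v) x (P x) (Y x)" for x
  unfolding P_def Y_def using jet2_cmult[OF conv_jet[OF k vc], of "1/m"] by simp
 moreover have "transpose (Y x) = Y x" for x
 proof -
  have "(%y. v y*.H (x-y)) integrable_on cbox la lb"
   by (intro integrable_continuous continuous_intros vc continuous_on_compose2[OF Hc]) auto
  thus ?thesis unfolding Y_def transpose_scaleR
   by (subst transpose_integral) (auto simp: transpose_scaleR Hs)
 qed
 moreover have "continuous_on UNIV Y"
 proof -
  have "continuous_on UNIV (%x. integral (cbox la lb) (%y. v y*.H (x-y)))"
   by (rule integral_continuous_on_param)
    (auto simp: case_prod_beta intro!: continuous_intros continuous_on_compose2[OF v_cont] continuous_on_compose2[OF Hc])
  thus ?thesis unfolding Y_def by (intro continuous_intros)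
 qed
 ultimately show ?thesis using that by blast
qed

text \<open>The semigroup commutes with translations and, by Fubini, with averages of translations.
  A pointwise bound for all translates therefore passes to the mollification, which a viscosity
  inequality does not do directly.\<close>

lemma heat_moll_le:
 assumes h: "heat a A B Bi" and le: "!!y. norm y < s ==> heat.heat Bi v t (x-y) <= v (x-y)+E"
 shows "heat.heat Bi (moll s v) t x <= moll s v x+E"
proof -
 interpret heat a A B Bi by (rule h)
 interpret heat_data a A B Bi v la lb C0 by unfold_locales (use v_cont supp bound in auto)
 let ?m = "\<integral>y. bump s (y :: real^'n) \<partial>lborel"
 have m: "?m > 0" and int: "integrable lborel (bump s :: real^'n => real)" using bump_integrable[OF s] by auto
 let ?f = "%z y. gk z*(bump s y * v (x - sqrt t*.z-y))"
 have fint: "integrable (lborel \<Otimes>\<^sub>M lborel) (%(z, y). ?f z y)"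
 proof (rule lborel_pair.Fubini_integrable)
  show "(%(z, y). ?f z y) : borel_measurable (lborel \<Otimes>\<^sub>M lborel)" by measurable
  show "AE z in lborel. integrable lborel (%y. case (z, y) of (z, y) => ?f z y)"
   using bv_integrable by auto
  show "integrable lborel (%z. \<integral>y. norm (case (z, y) of (z, y) => ?f z y) \<partial>lborel)"
  proof (rule Bochner_Integration.integrable_bound)
   show "integrable lborel (%z. gk z*(C0 * ?m))" using gk_integrable by simp
   show "AE z in lborel. norm (\<integral>y. norm (case (z, y) of (z, y) => ?f z y) \<partial>lborel) <= norm (gk z*(C0 * ?m))"
   proof (rule AE_I2)
    fix z
    have "(\<integral>y. norm (?f z y) \<partial>lborel) <= (\<integral>y. gk z*(C0*bump s (y :: real^'n)) \<partial>lborel)"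
    proof (rule integral_mono)
     show "integrable lborel (%y. norm (?f z y))" using bv_integrable by auto
     show "integrable lborel (%y :: real^'n. gk z*(C0*bump s y))" using int by simp
     fix y :: "real^'n"
     have "norm (?f z y) = gk z*(\<bar>v (x - sqrt t*.z-y)\<bar>*bump s y)"
      using gk_pos[of z] bump_nonneg[of s y] by (simp add: abs_mult)
     also have "\<dots> <= gk z*(C0*bump s y)"
      using gk_pos[of z] bound bump_nonneg by (intro mult_left_mono mult_right_mono) auto
     finally show "norm (?f z y) <= gk z*(C0*bump s y)" .
    qed
    moreover have "0 <= (\<integral>y. norm (?f z y) \<partial>lborel)" by (intro integral_nonneg_AE) auto
    ultimately show "norm (\<integral>y. norm (case (z, y) of (z, y) => ?f z y) \<partial>lborel) <= norm (gk z*(C0 * ?m))"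
     by simp
   qed
  qed measurable
 qed
 have "heat (moll s v) t x = (\<integral>z. (\<integral>y. ?f z y \<partial>lborel) \<partial>lborel) / ?m/Z"
  by (simp add: heat_def moll_def)
 hence heq: "heat (moll s v) t x*(?m*Z) = (\<integral>z. (\<integral>y. ?f z y \<partial>lborel) \<partial>lborel)"
  using m Z_pos by simp
 also have "(\<integral>z. (\<integral>y. ?f z y \<partial>lborel) \<partial>lborel) = (\<integral>y. (\<integral>z. ?f z y \<partial>lborel) \<partial>lborel)"
  by (rule lborel_pair.Fubini_integral[OF fint, symmetric])
 also have "\<dots> = (\<integral>y. bump s y*(heat v t (x-y)*Z) \<partial>lborel)"
 proof (intro Bochner_Integration.integral_cong refl)
  fix y :: "real^'n"
  have "(\<integral>z. ?f z y \<partial>lborel) = (\<integral>z. bump s y*(gk z * v ((x-y) - sqrt t*.z)) \<partial>lborel)"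
   by (simp add: algebra_simps)
  thus "(\<integral>z. ?f z y \<partial>lborel) = bump s y*(heat v t (x-y)*Z)"
   using Z_pos by (simp add: heat_def)
 qed
 also have "\<dots> <= (\<integral>y. bump s y * v (x-y)*Z+bump s y*(E*Z) \<partial>lborel)"
 proof (rule integral_mono)
  have eq: "bump s y*(heat v t (x-y)*Z) = (\<integral>z. ?f z y \<partial>lborel)" for y
  proof -
   have "(\<integral>z. ?f z y \<partial>lborel) = (\<integral>z. bump s y*(gk z * v ((x-y) - sqrt t*.z)) \<partial>lborel)"
    by (simp add: algebra_simps)
   thus ?thesis using Z_pos by (simp add: heat_def)
  qed
  show "integrable lborel (%y. bump s y*(heat v t (x-y)*Z))"
   unfolding eq by (rule lborel_pair.integrable_snd[OF fint])
  show "integrable lborel (%y. bump s y * v (x-y)*Z+bump s y*(E*Z))"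
   using bv_integrable int by auto
  fix y :: "real^'n"
  show "bump s y*(heat v t (x-y)*Z) <= bump s y * v (x-y)*Z+bump s y*(E*Z)"
  proof (cases "norm y < s")
   case True
   have "heat v t (x-y)*Z <= (v (x-y)+E)*Z" using le[OF True] Z_pos by (intro mult_right_mono) auto
   hence "bump s y*(heat v t (x-y)*Z) <= bump s y*((v (x-y)+E)*Z)" using bump_nonneg by (intro mult_left_mono)
   thus ?thesis by (simp add: algebra_simps)
  qed (use bump_eq_0[of s y] s in auto)
 qed
 also have "\<dots> = (moll s v x * ?m+E * ?m)*Z"
  using bv_integrable int m by (simp add: moll_def algebra_simps)
 also have "\<dots> = (moll s v x+E)*(?m*Z)" by (simp add: algebra_simps)
 finally show ?thesis by (rule mult_right_le_imp_le) (use m Z_pos in simp)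
qed

end

text \<open>Each linear operator is treated separately. By \<open>heat_le\<close> for
  \<open>v\<close>, the semigroup raises the mollification at rate at most \<open>F\<close>. If
  \<open>trace (B ** Y x)\<close> exceeded some \<open>G > F\<close>, then \<open>heat_le\<close>
  for the negative of the mollification would give a rate of at least \<open>G\<close>. Both hold up
  to \<open>t^2\<close>, so small \<open>t\<close> gives a contradiction.\<close>

lemma moll_supersolution:
 fixes v :: "real^'n => real"
 assumes aA: "0 < a" "a <= A"
  and v: "continuous_on UNIV v" "!!y. y ~: cbox la lb ==> v y = 0" "!!y. \<bar>v y\<bar> <= C0"
  and sup: "vsup (pucci_plus a A) (%_. F) (ball x0 (3*r)) v" and s: "0 < s" "s <= r"
  and x: "x : ball x0 r" and J: "!!x. jet2 (moll s v) x (P x) (Y x)" "!!x. transpose (Y x) = Y x" "continuous_on UNIV Y"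
 shows "pucci_plus a A (Y x) <= F"
proof (subst pucci_plus_le_iff[OF aA J(2)], intro allI impI)
 fix B :: "real^'n^'n" assume B: "ellip a A B"
 have r: "r > 0" using s by simp
 obtain Bi where Bi: "B ** Bi = mat 1" "transpose Bi = Bi" using ellip_inverse[OF B aA(1)] .
 interpret heat a A B Bi by unfold_locales (use aA B Bi in auto)
 interpret V: heat_data a A B Bi v la lb C0 by unfold_locales (use v in auto)
 have nW: "continuous_on UNIV (%x. - moll s v x)"
  "!!y. y ~: cbox (la-(\<chi> i. s)) (lb+(\<chi> i. s)) ==> - moll s v y = 0" "!!y. \<bar>- moll s v y\<bar> <= C0"
  using moll_cont[OF v s(1)] moll_supp[OF v s(1)] moll_bound[OF v s(1)] by (auto intro!: continuous_intros)
 interpret W: heat_data a A B Bi "%x. - moll s v x" "la-(\<chi> i. s)" "lb+(\<chi> i. s)" C0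
  by unfold_locales (use nW in auto)
 show "trace (B ** Y x) <= F"
 proof (rule ccontr)
  assume "\<not> trace (B ** Y x) <= F"
  define G where "G = (F+trace (B ** Y x))/2"
  have FG: "F < G" "G < trace (B ** Y x)" using \<open>\<not> _\<close> by (auto simp: G_def)
  have "continuous_on UNIV (%x. trace (B ** Y x))"
   using J(3) linear_continuous_on_compose[OF _ linear_trace_mul, of UNIV Y B] by simp
  hence "open ((%x. trace (B ** Y x)) -` {G<..})" by (rule open_vimage[OF open_greaterThan])
  then obtain d where d: "d > 0" "ball x d <= (%x. trace (B ** Y x)) -` {G<..}"
   using FG(2) by (meson open_contains_ball greaterThan_iff vimageI2)
  have supW: "vsup (%X. trace (B ** X)) (%_. - G) (ball x d) (%x. - moll s v x)"
   unfolding vsup_def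
  proof (intro ballI allI impI)
   fix z p X assume z: "z : ball x d" and X: "transpose X = X" and sj: "subjet (%x. - moll s v x) z p X"
   have "superjet (%y. 0) z (- P z-p) (- Y z-X)"
   proof -
    have "superjet (%y. moll s v y) z (- p) (- X)" using sj by (simp add: superjet_def)
    moreover have "superjet (%y. - moll s v y) z (- P z) (- Y z)" by (intro jet2_super jet2_uminus J)
    ultimately have "superjet (%y. - moll s v y+moll s v y) z (- P z + - p) (- Y z + - X)" by (intro superjet_add)
    thus ?thesis by simp
   qed
   from superjet_nonneg[OF this] have "0 <= trace (B ** (- Y z-X))"
    using trace_mul_psd[OF B aA(1)] J(2) X by (simp add: sym_simps)
   hence "trace (B ** X) <= - trace (B ** Y z)" by (simp add: mul_diff_r mul_uminus_r trace_sub trace_uminus)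
   also have "\<dots> <= - G" using d(2) z by auto
   finally show "trace (B ** X) <= - G" .
  qed
  define c where "c = (4*A*CARD('n)+8*A)*A*CARD('n)"
  define K1 K2 where "K1 = (2*C0+\<bar>F\<bar>)/r ^ 4 * c" and "K2 = (2*C0+\<bar>- G\<bar>)/d ^ 4 * c"
  have "t*(G-F) <= (K1+K2)*t*t" if t: "0 < t" "t < 1" for t
  proof -
   have "heat v t (x-y) <= v (x-y)+(t*F+K1*t^2)" if y: "norm y < s" for y
   proof -
    have "ball (x-y) r <= ball x0 (3*r)"
    proof
     fix z assume "z : ball (x-y) r"
     hence "dist x0 z < r+(s+r)"
      using x y dist_triangle[of x0 z x] dist_triangle[of x z "x-y"] by (simp add: dist_norm)
     thus "z : ball x0 (3*r)" using s by simp
    qed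
    hence "vsup (%X. trace (B ** X)) (%_. F) (ball (x-y) r) v"
     using sup pucci_plus_ge[OF _ B] unfolding vsup_def by (meson order_trans subsetD)
    from V.heat_le[OF r this, of t] t show ?thesis by (simp add: K1_def c_def)
   qed
   from heat_moll_le[OF v s(1) heat_axioms this]
   have 1: "heat (moll s v) t x <= moll s v x+(t*F+K1*t^2)" .
   have "heat (%x. - moll s v x) t x <= - moll s v x+t*(- G)+K2*t^2"
    using W.heat_le[OF d(1) supW, of t] t by (simp add: K2_def c_def)
   moreover have "heat (%x. - moll s v x) t x = - heat (moll s v) t x" by (simp add: heat_def)
   ultimately show ?thesis using 1 by (simp add: algebra_simps power2_eq_square)
  qed
  from nonneg_if_quadratic[OF this] FG show False by fastforce
 qed
qed

text \<open>The semigroup acts on functions on the whole space, so a local supersolution is cut off;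
  in the smaller ball it is unchanged and keeps its inequality.\<close>

lemma cutoff_extension:
 fixes v :: "real^'n => real"
 assumes r: "r > 0" and v: "continuous_on (cball x0 (2*r)) v"
 obtains w la lb C0 where "continuous_on UNIV w" "!!y. y ~: cbox la lb ==> w y = 0" "!!y. \<bar>w y\<bar> <= C0"
  "!!y. y : cball x0 r ==> w y = v y"
proof -
 define ct where "ct y = max 0 (min 1 (2-dist x0 y/r))" for y
 define w where "w y = (if y : cball x0 (2*r) then ct y * v y else 0)" for y
 have ct: "continuous_on S ct" for S unfolding ct_def by (intro continuous_intros) (use r in auto)
 have 0: "ct y = 0" if "dist x0 y >= 2*r" for y
  using that r by (simp add: ct_def field_simps max_def)
 have "continuous_on (cball x0 (2*r) Un - ball x0 (2*r)) w"
  unfolding w_def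
 proof (rule continuous_on_cases)
  show "continuous_on (cball x0 (2*r)) (%y. ct y * v y)" by (intro continuous_intros ct v)
  show "\<forall>y. y : cball x0 (2*r) & y ~: cball x0 (2*r) | y : - ball x0 (2*r) & y : cball x0 (2*r) --> ct y * v y = 0"
   using 0 by auto
 qed (auto simp: closed_Compl)
 moreover have "cball x0 (2*r) Un - ball x0 (2*r) = UNIV" by auto
 ultimately have wc: "continuous_on UNIV w" by simp
 obtain la lb where box: "cball x0 (2*r) <= cbox la lb"
  using bounded_subset_cbox_symmetric[OF bounded_cball] by metis
 have "bounded (w ` cball x0 (2*r))"
  by (intro compact_imp_bounded compact_continuous_image continuous_on_subset[OF wc]) auto
 then obtain C where C: "C > 0" "!!y. y : cball x0 (2*r) ==> \<bar>w y\<bar> <= C"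
  unfolding bounded_pos by force
 have "\<bar>w y\<bar> <= C" for y using C by (cases "y : cball x0 (2*r)") (auto simp: w_def)
 moreover have "w y = 0" if "y ~: cbox la lb" for y using that box by (auto simp: w_def)
 moreover have "w y = v y" if "y : cball x0 r" for y
  using that r by (auto simp: w_def ct_def field_simps max_def min_def)
 ultimately show ?thesis using that wc by blast
qed

text \<open>The supersolution is mollified, which is possible because the maximal operator is a supremum of
 linear ones; the resulting smooth function serves as a test function for the subsolution.\<close>

lemma pucci_plus_comparison:
 fixes u v f g :: "real^'n => real"
 assumes aA: "0 < a" "a <= A" and U: "open U" "x0 : U"
  and uc: "continuous_on U u" and vc: "continuous_on U v"
  and fg: "continuous (at x0) f" "continuous (at x0) g"
  and u: "vsub (pucci_plus a A) g U u" and v: "vsup (pucci_plus a A) f U v"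
  and sj: "superjet (%y. u y - v y) x0 p X" and X: "transpose X = X"
 shows "g x0-f x0 <= pucci_plus a A X"
proof (rule ccontr)
 assume neg: "\<not> ?thesis"
 define I1 where "I1 = pucci_plus a A (mat 1 :: real^'n^'n)"
 define \<gamma> where "\<gamma> = g x0-f x0-pucci_plus a A X"
 have \<gamma>: "\<gamma> > 0" using neg by (simp add: \<gamma>_def)
 \<comment> \<open>Small enough that adding \<open>4 e\<close> times the identity to the Hessian
   costs at most \<open>\<gamma>/4\<close>.\<close>
 define e where "e = \<gamma>/(16*(\<bar>I1\<bar>+1))"
 have e: "e > 0" using \<gamma> by (simp add: e_def add_nonneg_pos)
 have eI: "4*e*I1 <= \<gamma>/4"
 proof -
  have "4*e*I1 <= 4*e*(\<bar>I1\<bar>+1)" using e by (intro mult_left_mono) auto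
  also have "\<dots> = \<gamma>/4"
  proof -
   have "\<bar>I1\<bar>+1 ~= 0" by linarith
   thus ?thesis by (simp add: e_def field_simps)
  qed
  finally show ?thesis .
 qed
 define F G where "F = f x0+\<gamma>/4" and "G = g x0-\<gamma>/4"
 have "\<forall>\<^sub>F y in nhds x0. f y < F" "\<forall>\<^sub>F y in nhds x0. g y > G"
  using fg \<gamma> order_tendstoD[of f "f x0" "nhds x0"] order_tendstoD[of g "g x0" "nhds x0"]
  by (auto simp: F_def G_def continuous_at tendsto_at_iff_tendsto_nhds)
 moreover have "\<forall>\<^sub>F y in nhds x0. y : U" using U by (rule eventually_nhds_in_open)
 moreover have "\<forall>\<^sub>F y in nhds x0. u y - v y <= u x0 - v x0+p \<bullet> (y-x0)+(y-x0) \<bullet> (X *v (y-x0))/2+e*(norm (y-x0))^2"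
  using sj[unfolded superjet_def subjet_def, rule_format, OF e]
  by eventually_elim (simp add: mv_uminus)
 ultimately have "\<forall>\<^sub>F y in nhds x0. f y < F & g y > G & y : U &
  u y - v y <= u x0 - v x0+p \<bullet> (y-x0)+(y-x0) \<bullet> (X *v (y-x0))/2+e*(norm (y-x0))^2"
  by (simp add: eventually_conj_iff)
 then obtain R where R: "R > 0" and near: "!!y. dist y x0 < R ==> f y < F & g y > G & y : U &
  u y - v y <= u x0 - v x0+p \<bullet> (y-x0)+(y-x0) \<bullet> (X *v (y-x0))/2+e*(norm (y-x0))^2"
  unfolding eventually_nhds_metric by blast
 define r where "r = R/12"
 have r: "r > 0" using R by (simp add: r_def)
 have near': "f y < F" "g y > G" "y : U"
  "u y - v y <= u x0 - v x0+p \<bullet> (y-x0)+(y-x0) \<bullet> (X *v (y-x0))/2+e*(norm (y-x0))^2"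
  if "y : cball x0 (8*r)" for y
  using near[of y] that R by (auto simp: r_def dist_commute)
 have cv: "continuous_on (cball x0 (2*(4*r))) v" using near'(3) by (intro continuous_on_subset[OF vc]) auto
 obtain w la lb C0 where w: "continuous_on UNIV w" "!!y. y ~: cbox la lb ==> w y = 0" "!!y. \<bar>w y\<bar> <= C0"
  and wv: "!!y. y : cball x0 (4*r) ==> w y = v y"
  using cutoff_extension[OF _ cv] r by (metis mult_pos_pos zero_less_numeral)
 have "vsup (pucci_plus a A) (%_. F) (ball x0 (3*(1*r))) w"
  unfolding vsup_def
 proof (intro ballI allI impI)
  fix z q Y assume z: "z : ball x0 (3*(1*r))" and Y: "transpose Y = Y" "subjet w z q Y"
  have "\<forall>\<^sub>F y in nhds z. y : ball x0 (3*r)" using z by (intro eventually_nhds_in_open) auto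
  hence "\<forall>\<^sub>F y in nhds z. w y = v y" by eventually_elim (use wv r in auto)
  hence "subjet v z q Y" using Y(2) subjet_cong by blast
  hence "pucci_plus a A Y <= f z" using vsupD[OF v _ Y(1)] near'(3)[of z] z r by auto
  also have "\<dots> <= F" using near'(1)[of z] z r by auto
  finally show "pucci_plus a A Y <= F" .
 qed
 hence wsup: "vsup (pucci_plus a A) (%_. F) (ball x0 (3*r)) w" by simp
 define \<rho> where "\<rho> = r/2"
 \<comment> \<open>On the sphere of radius \<open>\<rho>\<close> the quadratic penalty is
   \<open>e \<rho>^2 = 4 e'\<close>, more than the two mollification errors \<open>e'\<close>
   together, so the maximum of \<open>h\<close> is interior.\<close>
 define e' where "e' = e*\<rho>^2/4"
 have e': "e' > 0" using e r by (simp add: e'_def \<rho>_def)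
 have "uniformly_continuous_on (cball x0 (2*r)) w"
  by (intro compact_uniformly_continuous continuous_on_subset[OF w(1)]) auto
 then obtain d where d: "d > 0" "!!y z. y : cball x0 (2*r) ==> z : cball x0 (2*r) ==> dist z y < d ==> dist (w z) (w y) < e'"
  using e' unfolding uniformly_continuous_on_def by meson
 define s where "s = min d r"
 have s: "0 < s" "s <= r" "s <= d" using d r by (auto simp: s_def)
 have close: "\<bar>moll s w x-w x\<bar> <= e'" if "x : cball x0 r" for x
 proof (rule moll_near[OF w s(1)])
  fix y :: "real^'n" assume y: "norm y < s"
  have "dist x0 (x-y) <= dist x0 x+norm y" using dist_triangle[of x0 "x-y" x] by (simp add: dist_norm)
  hence "x-y : cball x0 (2*r)" "x : cball x0 (2*r)" using y s that r by auto
  thus "\<bar>w (x-y)-w x\<bar> <= e'" using d(2)[of x "x-y"] y s by (auto simp: dist_norm)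
 qed
 obtain P Y where J: "!!x. jet2 (moll s w) x (P x) (Y x)" "!!x. transpose (Y x) = Y x" "continuous_on UNIV Y"
  using moll_jet[OF w s(1)] by metis
 have PY: "pucci_plus a A (Y x) <= F" if "x : ball x0 r" for x
  by (rule moll_supersolution[OF aA w wsup s(1,2) that J])
 define \<phi> where "\<phi> y = p \<bullet> y+(y-x0) \<bullet> (((1/2)*.X) *v (y-x0))+2*e*(norm (y-x0))^2" for y
 define h where "h y = u y-(moll s w y+\<phi> y)" for y
 have hc: "continuous_on (cball x0 \<rho>) h"
  unfolding h_def \<phi>_def using near'(3) r
  by (intro continuous_intros matrix_vector_mult_linear_continuous_on continuous_on_subset[OF uc]
    continuous_on_subset[OF moll_cont[OF w s(1)]] continuous_on_compose2[OF matrix_vector_mult_linear_continuous_on[of UNIV]])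
   (auto simp: \<rho>_def)
 have "cball x0 \<rho> ~= {}" using r by (simp add: \<rho>_def)
 with hc obtain x1 where x1: "x1 : cball x0 \<rho>" "!!y. y : cball x0 \<rho> ==> h y <= h x1"
  using continuous_attains_sup[OF compact_cball, of x0 \<rho> h] by metis
 have sub: "cball x0 \<rho> <= cball x0 r" using r by (auto simp: \<rho>_def)
 have hb: "h y <= u x0 - v x0-p \<bullet> x0-e*(norm (y-x0))^2+e'" if "y : cball x0 \<rho>" for y
 proof -
  have "y : cball x0 r" using that sub by auto
  hence "w y <= moll s w y+e'" "w y = v y" using close[of y] wv[of y] r by auto
  moreover have "y : cball x0 (8*r)" using \<open>y : cball x0 r\<close> r by auto
  note near'(4)[OF this]
  ultimately show ?thesis unfolding h_def \<phi>_def by (simp add: mv_scaleR inner_diff_right)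
 qed
 have h0: "h x0 >= u x0 - v x0-p \<bullet> x0-e'"
  using close[of x0] wv[of x0] r unfolding h_def \<phi>_def by (auto simp: abs_le_iff)
 have "x1 : ball x0 \<rho>"
 proof (rule ccontr)
  assume "x1 ~: ball x0 \<rho>"
  hence "norm (x1-x0) = \<rho>" using x1(1) by (auto simp: dist_norm norm_minus_commute)
  hence "h x1 <= u x0 - v x0-p \<bullet> x0-4*e'+e'" using hb[OF x1(1)] by (simp add: e'_def)
  moreover have "h x0 <= h x1" using x1(2)[of x0] r by (simp add: \<rho>_def)
  ultimately show False using h0 e' by linarith
 qed
 have half: "transpose ((1/2)*.X) = (1/2)*.X" by (simp add: transpose_scaleR X)
 define Xt where "Xt = Y x1+(X+(4*e)*.mat 1)"
 have XtS: "transpose Xt = Xt" by (simp add: Xt_def sym_simps J(2) X)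
 obtain q where q: "jet2 (%y. moll s w y+\<phi> y) x1 q Xt"
 proof -
  have "jet2 (%y. moll s w y+\<phi> y) x1 (P x1+(p+2*.(((1/2)*.X) *v (x1-x0))+(2*e)*.(2*.(x1-x0))))
   (Y x1+(0+2*.((1/2)*.X)+(2*e)*.(2*.mat 1)))"
   unfolding \<phi>_def by (intro jet2_add J jet2_inner jet2_form half jet2_cmult jet2_norm2)
  thus ?thesis using that by (simp add: Xt_def mult.commute)
 qed
 have "superjet u x1 q Xt"
 proof (rule superjet_local_max[OF q])
  have "\<forall>\<^sub>F y in nhds x1. y : ball x0 \<rho>" using \<open>x1 : ball x0 \<rho>\<close> by (intro eventually_nhds_in_open) auto
  thus "\<forall>\<^sub>F y in nhds x1. u y-(moll s w y+\<phi> y) <= u x1-(moll s w x1+\<phi> x1)"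
   by eventually_elim (use x1(2) in \<open>auto simp: h_def\<close>)
 qed
 moreover have x1r: "x1 : ball x0 r" "x1 : cball x0 (8*r)" using \<open>x1 : ball x0 \<rho>\<close> r by (auto simp: \<rho>_def)
 ultimately have "g x1 <= pucci_plus a A Xt" using vsubD[OF u near'(3) XtS] by blast
 also have "\<dots> <= pucci_plus a A (Y x1)+(pucci_plus a A X+pucci_plus a A ((4*e)*.mat 1 :: real^'n^'n))"
  unfolding Xt_def using J(2) X
  by (intro order_trans[OF pucci_plus_add[OF aA]] add_left_mono pucci_plus_add[OF aA]) (auto simp: sym_simps)
 also have "pucci_plus a A ((4*e)*.mat 1 :: real^'n^'n) = 4*e*I1"
  unfolding I1_def using e by (intro pucci_plus_scaleR[OF aA]) (auto simp: transpose_mat)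
 finally have "g x1 <= F+(pucci_plus a A X+\<gamma>/4)" using PY[OF x1r(1)] eI by linarith
 thus False using near'(2)[OF x1r(2)] \<gamma> by (simp add: F_def G_def \<gamma>_def field_simps)
qed

text \<open>For the minimal operator the pair \<open>- v\<close>, \<open>- u\<close> satisfies the
  inequalities of the maximal one and has the same difference. The conclusion concerns
  \<open>pucci_plus\<close> in both cases.\<close>

lemma pucci_comparison:
 fixes u v f g :: "real^'n => real"
 assumes aA: "0 < a" "a <= A" and M: "M : {pucci_plus a A, pucci_minus a A}" and U: "open U" "x0 : U"
  and uc: "continuous_on U u" and vc: "continuous_on U v"
  and fg: "continuous (at x0) f" "continuous (at x0) g"
  and u: "vsub M g U u" and v: "vsup M f U v"
  and sj: "superjet (%y. u y - v y) x0 p X" and X: "transpose X = X"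
 shows "g x0-f x0 <= pucci_plus a A X"
proof (cases "M = pucci_plus a A")
 case True
 thus ?thesis using pucci_plus_comparison[OF aA U uc vc fg _ _ sj X] u v by simp
next
 case False
 hence M: "M = pucci_minus a A" using M by simp
 have "vsub (pucci_plus a A) (%x. - f x) U (%x. - v x)"
  unfolding vsub_def
 proof (intro ballI allI impI)
  fix x p X assume "x : U" "transpose X = X" "superjet (%x. - v x) x p X"
  hence "M (- X) <= f x" by (intro vsupD[OF v, of x _ "- p"]) (auto simp: superjet_uminus_iff sym_simps)
  thus "- f x <= pucci_plus a A X" by (simp add: M pucci_minus_eq)
 qed
 moreover have "vsup (pucci_plus a A) (%x. - g x) U (%x. - u x)"
  unfolding vsup_def
 proof (intro ballI allI impI)
  fix x p X assume "x : U" "transpose X = X" "subjet (%x. - u x) x p X"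
  hence "g x <= M (- X)" by (intro vsubD[OF u, of x _ "- p"]) (auto simp: subjet_uminus_iff sym_simps)
  thus "pucci_plus a A X <= - g x" by (simp add: M pucci_minus_eq)
 qed
 ultimately have "- f x0 - - g x0 <= pucci_plus a A X"
  using uc vc fg sj
  by (intro pucci_plus_comparison[OF aA U, where u = "%x. - v x" and v = "%x. - u x" and p = p])
   (auto intro!: continuous_intros simp: X)
 thus ?thesis by simp
qed

subsection \<open>Hopf lemma and strong maximum principle\<close>

text \<open>Only jets with \<open>p ~= 0\<close> are constrained, as that is all the equation
  provides for \<open>u\<close> itself. Hopf's barrier has no critical point in the annulus where it
  is used.\<close>

definition hopfable :: "real => real => real => (real^'n) set => (real^'n => real) => bool" where
 "hopfable a A C U w \<longleftrightarrow> (\<forall>x\<in>U. \<forall>p X. transpose X = X --> p ~= 0 --> subjet w x p X -->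
   pucci_minus a A X <= C*norm p)"

lemma hopfableD: "hopfable a A C U w ==> x : U ==> transpose X = X ==> p ~= 0 ==> subjet w x p X ==>
   pucci_minus a A X <= C*norm p"
 unfolding hopfable_def by blast

lemma hopfable_subset: "hopfable a A C U w ==> V <= U ==> hopfable a A C V w"
 unfolding hopfable_def by blast

text \<open>Comparison on an annulus with \<open>b = e (s + k s^2)\<close>, where \<open>s\<close>
  is \<open>R^2\<close> minus the squared distance from the centre. For large \<open>k\<close> the
  square makes the Hessian so convex in the radial direction that this beats the other directions
  and the gradient term, while \<open>b\<close> vanishes only linearly at the outer sphere.\<close>

lemma hopf_lemma:
 fixes w :: "real^'n => real"
 assumes aA: "0 < a" "a <= A" and C: "C >= 0" and R: "R > 0"
  and wc: "continuous_on (cball y0 R) w" and nn: "!!x. x : cball y0 R ==> w x >= 0"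
  and pos: "!!x. x : ball y0 R ==> w x > 0" and hop: "hopfable a A C (ball y0 R) w"
 shows "\<exists>\<epsilon>>0. \<forall>x\<in>cball y0 R. \<epsilon>*(R-norm (x-y0)) <= w x"
proof -
 \<comment> \<open>The first bound gives \<open>\<rho>^2 >= R^2/2\<close>, which keeps the gradient
   of the barrier away from 0; the second is the strict differential inequality that contradicts
   \<open>hop\<close>.\<close>
 define k where "k = max (2/R^2) ((6*A*CARD('n)+6*C*R+1)/(4*a*R^2))"
 have k1: "2/R^2 <= k" and k2: "(6*A*CARD('n)+6*C*R+1)/(4*a*R^2) <= k" by (auto simp: k_def)
 have "2/R^2 > 0" using R by simp
 hence k: "k > 0" using k1 by linarith
 have kR: "1 / k <= R^2/2" using k1 k R by (simp add: field_simps)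
 have kR2: "6*A*CARD('n)+6*C*R < 4 * k*a*R^2"
  using k2 R aA by (simp add: pos_divide_le_eq algebra_simps)
 define \<rho> where "\<rho> = sqrt (R^2-1 / k)"
 have \<rho>2: "\<rho>^2 = R^2-1 / k"
 proof -
  have "0 <= R^2-1 / k" using kR zero_le_power2[of R] by linarith
  thus ?thesis by (simp add: \<rho>_def)
 qed
 have \<rho>: "0 < \<rho>" "\<rho> < R"
 proof -
  have "R^2 > 0" using R by simp
  hence "R^2-1 / k > 0" using kR by linarith
  thus "0 < \<rho>" by (simp add: \<rho>_def)
  have "\<rho>^2 < R^2" using \<rho>2 k by simp
  thus "\<rho> < R" using R by (simp add: power_less_imp_less_base)
 qed
 have "compact (cball y0 \<rho>)" "cball y0 \<rho> ~= {}" using \<rho> by auto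
 moreover have "continuous_on (cball y0 \<rho>) w" using \<rho> by (intro continuous_on_subset[OF wc]) auto
 ultimately obtain z where z: "z : cball y0 \<rho>" "!!y. y : cball y0 \<rho> ==> w z <= w y"
  using continuous_attains_inf[of "cball y0 \<rho>" w] by metis
 define m where "m = w z"
 have m: "m > 0" "!!y. y : cball y0 \<rho> ==> m <= w y" using pos[of z] z \<rho> by (auto simp: m_def)
 \<comment> \<open>On the inner sphere \<open>s = 1 / k\<close>, so this value of \<open>e\<close>
   makes \<open>b\<close> equal to the minimum \<open>m\<close> there.\<close>
 define e where "e = m * k/2"
 have e: "e > 0" using m k by (simp add: e_def)
 define s where "s x = R^2-(norm (x-y0))^2" for x
 define b where "b x = e*(s x + k*(s x)^2)" for x
 have main: "b x <= w x" if x: "x : cball y0 R" "norm (x-y0) >= \<rho>" for x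
 proof (rule ccontr)
  assume less: "\<not> b x <= w x"
  let ?S = "cball y0 R-ball y0 \<rho>"
  have S: "compact ?S" by (intro compact_diff compact_cball) auto
  have "x : ?S" using x by (auto simp: dist_norm norm_minus_commute)
  have cont: "continuous_on ?S (%x. w x-b x)"
   unfolding b_def s_def by (intro continuous_intros continuous_on_subset[OF wc]) auto
  obtain x1 where x1: "x1 : ?S" "!!y. y : ?S ==> w x1-b x1 <= w y-b y"
   using continuous_attains_inf[OF S _ cont] \<open>x : ?S\<close> by (metis empty_iff)
  have neg: "w x1 < b x1" using x1(2)[OF \<open>x : ?S\<close>] less by linarith
  have n1: "\<rho> <= norm (x1-y0)" "norm (x1-y0) <= R" using x1(1) by (auto simp: dist_norm norm_minus_commute)
  have ne1: "norm (x1-y0) ~= R"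
  proof
   assume "norm (x1-y0) = R"
   hence "b x1 = 0" by (simp add: b_def s_def)
   thus False using neg nn[of x1] x1(1) by auto
  qed
  have ne2: "norm (x1-y0) ~= \<rho>"
  proof
   assume eq: "norm (x1-y0) = \<rho>"
   hence "s x1 = 1 / k" using \<rho>2 by (simp add: s_def)
   hence "b x1 = m" using k by (simp add: b_def e_def power2_eq_square)
   moreover have "x1 : cball y0 \<rho>" using eq by (auto simp: dist_norm norm_minus_commute)
   ultimately show False using neg m(2)[of x1] by simp
  qed
  have in1: "\<rho> < norm (x1-y0)" "norm (x1-y0) < R" using n1 ne1 ne2 by auto
  have s1: "0 < s x1" "k * s x1 <= 1"
  proof -
   have "(norm (x1-y0))^2 < R^2" using in1 by (intro power_strict_mono) auto
   thus "0 < s x1" by (simp add: s_def)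
   have "\<rho>^2 <= (norm (x1-y0))^2" using in1 \<rho> by (intro power_mono) auto
   hence "s x1 <= 1 / k" unfolding s_def \<rho>2 by linarith
   thus "k * s x1 <= 1" using k by (simp add: pos_le_divide_eq mult.commute)
  qed
  define h where "h = x1-y0"
  define g1 where "g1 = e*(1+2 * k * s x1)"
  have g1: "0 < g1" "g1 <= 3*e"
  proof -
   have "0 < k * s x1" using s1 k by simp
   thus "0 < g1" unfolding g1_def using e by simp
   show "g1 <= 3*e" using mult_left_mono[OF s1(2), of e] e by (simp add: g1_def algebra_simps)
  qed
  define X where "X = (- (2*g1))*.mat 1+(8*e * k) *. outer h h"
  have XS: "transpose X = X" by (simp add: X_def sym_simps)
  have Js: "jet2 s x1 (0-2*.h) (0-2*.mat 1)"
   unfolding s_def h_def by (intro jet2_diff jet2_const jet2_norm2)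
  have "jet2 b x1 (g1*.(0-2*.h)) (g1*.(0-2*.mat 1)+(2*e * k) *. outer (0-2*.h) (0-2*.h))"
   unfolding b_def
  proof (rule jet2_compose[OF Js, of "%s. e*(s + k * s^2)"])
   have eq: "e*(r + k*r^2)-e*(s x1 + k*(s x1)^2)-g1*(r - s x1)-2*e * k*(r - s x1)^2/2 = 0" for r
    by (simp add: g1_def power2_eq_square field_simps)
   show "(%r. e*(r + k*r^2)-e*(s x1 + k*(s x1)^2)-g1*(r - s x1)-2*e * k*(r - s x1)^2/2)
    : o[nhds (s x1)](%r. (r - s x1)^2)" unfolding eq by simp
  qed
  moreover have "g1*.(0-2*.mat 1)+(2*e * k) *. outer (0-2*.h) (0-2*.h) = X"
   by (simp add: X_def vec_eq_iff outer_def)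
  ultimately have Jb: "jet2 b x1 (- (2*g1)*.h) X" by (simp add: mult.commute[of 2])
  have "subjet w x1 (- (2*g1)*.h) X"
  proof (rule subjet_local_min[OF Jb])
   have "\<forall>\<^sub>F y in nhds x1. y : ball y0 R - cball y0 \<rho>"
    using in1 by (intro eventually_nhds_in_open) (auto simp: dist_norm norm_minus_commute)
   thus "\<forall>\<^sub>F y in nhds x1. w x1-b x1 <= w y-b y"
    by eventually_elim (auto intro!: x1(2))
  qed
  moreover have "x1 : ball y0 R" using in1 by (simp add: dist_norm norm_minus_commute)
  moreover have hn: "norm h > \<rho>" "norm h < R" using in1 by (auto simp: h_def)
  moreover have "- (2*g1)*.h ~= 0" using hn \<rho> g1 by auto
  ultimately have "pucci_minus a A X <= C*norm (- (2*g1)*.h)"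
   using hopfableD[OF hop _ XS] by blast
  also have "\<dots> <= C*(6*e*R)"
  proof -
   have "2*g1*norm h <= 2*(3*e)*R" using g1 hn e by (intro mult_mono) auto
   thus ?thesis using g1 C by (intro mult_left_mono) auto
  qed
  finally have up: "pucci_minus a A X <= e*(6*C*R)" by (simp add: mult_ac)
  have "pucci_plus a A (- X) <= 2*g1*(A*CARD('n))+8*e * k*(- a*(norm h)^2)"
  proof -
   have "- X = (2*g1)*.mat 1+(8*e * k)*.(- outer h h)" by (simp add: X_def)
   hence "pucci_plus a A (- X) <= pucci_plus a A ((2*g1)*.(mat 1 :: real^'n^'n))+pucci_plus a A ((8*e * k)*.(- outer h h))"
    using pucci_plus_add[OF aA, of "(2*g1)*.mat 1" "(8*e * k)*.(- outer h h)"] by (simp add: sym_simps)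
   also have "\<dots> = 2*g1*pucci_plus a A (mat 1 :: real^'n^'n)+8*e * k*pucci_plus a A (- outer h h)"
    using pucci_plus_scaleR[OF aA, of "mat 1 :: real^'n^'n" "2*g1"] pucci_plus_scaleR[OF aA, of "- outer h h" "8*e * k"] g1 e k
    by (simp add: sym_simps)
   also have "\<dots> <= 2*g1*(A*CARD('n))+8*e * k*(- a*(norm h)^2)"
   proof (intro add_mono mult_left_mono)
    show "pucci_plus a A (mat 1 :: real^'n^'n) <= A*CARD('n)" using pucci_plus_id[OF aA, of 1] by simp
   qed (use g1 e k pucci_plus_neg_outer[OF aA, of h] in auto)
   finally show ?thesis .
  qed
  also have "\<dots> <= 6*e*(A*CARD('n))-4*e * k*a*R^2"
  proof -
   have "2*g1*(A*CARD('n)) <= 6*e*(A*CARD('n))" using g1 aA by (intro mult_right_mono) auto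
   moreover have "8*e * k*a*(R^2/2) <= 8*e * k*a*(norm h)^2"
   proof (intro mult_left_mono)
    have "\<rho>^2 <= (norm h)^2" using hn \<rho> by (intro power_mono) auto
    thus "R^2/2 <= (norm h)^2" using \<rho>2 kR by linarith
   qed (use e k aA in auto)
   ultimately show ?thesis by (simp add: mult_ac)
  qed
  finally have "e*(4 * k*a*R^2-6*A*CARD('n)) <= pucci_minus a A X"
   by (simp add: pucci_minus_eq algebra_simps)
  hence "e*(4 * k*a*R^2-6*A*CARD('n)) <= e*(6*C*R)" using up by linarith
  hence "4 * k*a*R^2-6*A*CARD('n) <= 6*C*R" using e by simp
  thus False using kR2 by linarith
 qed
 define E where "E = min (e*R) (m/R)"
 have "E > 0" using e m R by (simp add: E_def)
 moreover have "E*(R-norm (x-y0)) <= w x" if x: "x : cball y0 R" for x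
 proof -
  have nx: "norm (x-y0) <= R" using x by (simp add: dist_norm norm_minus_commute)
  show ?thesis
  proof (cases "norm (x-y0) >= \<rho>")
   case True
   have "E*(R-norm (x-y0)) <= e*R*(R-norm (x-y0))" using nx by (intro mult_right_mono) (auto simp: E_def)
   also have "\<dots> <= e * s x"
   proof -
    have "R*(R-norm (x-y0)) <= (R+norm (x-y0))*(R-norm (x-y0))" using nx by (intro mult_right_mono) auto
    also have "\<dots> = s x" by (simp add: s_def power2_eq_square algebra_simps)
    finally show ?thesis using e by (simp add: mult.assoc)
   qed
   also have "\<dots> <= b x" using e k by (simp add: b_def)
   finally show ?thesis using main[OF x True] by linarith
  next
   case False
   have "E*(R-norm (x-y0)) <= m/R*R" using nx R m by (intro mult_mono) (auto simp: E_def)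
   also have "\<dots> <= w x" using m(2)[of x] False R by (simp add: dist_norm norm_minus_commute)
   finally show ?thesis .
  qed
 qed
 ultimately show ?thesis by blast
qed

text \<open>Otherwise a ball of positive values touches the zero set at an interior point
  \<open>z'\<close>. There \<open>w\<close> has a minimum and, being differentiable, gradient 0,
  against the linear growth given by Hopf's lemma.\<close>

lemma strong_maximum_principle:
 fixes w :: "real^'n => real"
 assumes aA: "0 < a" "a <= A" and C: "C >= 0" and U: "open U" "connected U"
  and wc: "continuous_on U w" and nn: "!!x. x : U ==> w x >= 0" and hop: "hopfable a A C U w"
  and diff: "!!x. x : U ==> \<exists>D. GDERIV w x :> D" and x1: "x1 : U" "w x1 = 0" and x: "x : U"
 shows "w x = 0"
proof (rule ccontr)
 assume "w x ~= 0"
 define Z where "Z = {x : U. w x = 0}"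
 have "closedin (top_of_set U) Z"
 proof -
  have "Z = U Int w -` {0}" by (auto simp: Z_def)
  thus ?thesis using continuous_closedin_preimage[OF wc closed_singleton, of 0] by simp
 qed
 moreover have "Z ~= {}" "Z ~= U" using x1 x \<open>w x ~= 0\<close> by (auto simp: Z_def)
 ultimately have "\<not> openin (top_of_set U) Z" using U(2) by (metis connected_clopen)
 hence "\<not> open Z" using openin_open_eq[OF U(1), of Z] by (auto simp: Z_def)
 then obtain z where z: "z : Z" "!!e. e > 0 ==> \<not> ball z e <= Z" unfolding open_contains_ball by blast
 obtain d where d: "d > 0" "ball z d <= U" using U(1) z(1) by (auto simp: open_contains_ball Z_def)
 obtain y0 where y0: "y0 : ball z (d/4)" "y0 ~: Z" using z(2)[of "d/4"] d by (meson divide_pos_pos subsetI zero_less_numeral)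
 define K where "K = Z Int cball z (d/2)"
 have "K = cball z (d/2) Int w -` {0}" using d by (auto simp: K_def Z_def subset_eq)
 moreover have c: "continuous_on (cball z (d/2)) w" using d by (intro continuous_on_subset[OF wc]) (auto simp: subset_eq)
 ultimately have "closed K" using continuous_closed_preimage[OF c closed_cball closed_singleton, of 0] by simp
 moreover have "bounded K" unfolding K_def by (rule bounded_subset[OF bounded_cball]) auto
 ultimately have "compact K" by (simp add: compact_eq_bounded_closed)
 moreover have "z : K" using z(1) d by (simp add: K_def)
 ultimately obtain z' where z': "z' : K" "!!y. y : K ==> dist y0 z' <= dist y0 y"
  using distance_attains_inf[OF compact_imp_closed, of K y0] by blast
 define R where "R = dist y0 z'"
 have R: "R <= dist y0 z" using z'(2)[OF \<open>z : K\<close>] by (simp add: R_def)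
 have Rd: "R < d/4" using R y0(1) by (simp add: dist_commute)
 have "R > 0" using z'(1) y0(2) by (auto simp: R_def K_def)
 have sub: "cball y0 R <= ball z (d/2)"
 proof
  fix y assume "y : cball y0 R"
  thus "y : ball z (d/2)" using y0(1) Rd dist_triangle[of z y y0] by simp
 qed
 have subU: "cball y0 R <= U" using sub d by (auto simp: subset_eq)
 have pos: "w y > 0" if "y : ball y0 R" for y
 proof -
  have "y ~: K" using z'(2)[of y] that by (auto simp: R_def)
  moreover have "y : cball y0 R" using that by simp
  hence "y : ball z (d/2)" "y : U" using sub subU by blast+
  ultimately have "y ~: Z" by (auto simp: K_def)
  thus ?thesis using nn[of y] \<open>y : U\<close> by (auto simp: Z_def)
 qed
 have "hopfable a A C (ball y0 R) w" using subU by (intro hopfable_subset[OF hop]) (auto simp: subset_eq)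
 then obtain e where e: "e > 0" "!!x. x : cball y0 R ==> e*(R-norm (x-y0)) <= w x"
  using hopf_lemma[OF aA C \<open>R > 0\<close> continuous_on_subset[OF wc subU]] nn subU pos by (meson subsetD)
 have z'U: "z' : U" "w z' = 0" using z'(1) by (auto simp: K_def Z_def)
 obtain D where D: "GDERIV w z' :> D" using diff[OF z'U(1)] by blast
 have "subjet w z' 0 0"
 proof (rule subjet_local_min[OF jet2_const[of 0]])
  have "\<forall>\<^sub>F y in nhds z'. y : U" using z'U U by (intro eventually_nhds_in_open) auto
  thus "\<forall>\<^sub>F y in nhds z'. w z'-0 <= w y-0" by eventually_elim (use nn z'U in auto)
 qed
 from subjet_gradient[OF this D] have "(w has_derivative (%h. 0)) (at z')" using D by (simp add: gderiv_def)
 then obtain \<delta> where \<delta>: "\<delta> > 0" "!!y. norm (y-z') < \<delta> ==> norm (w y-w z'-0) <= e/2*norm (y-z')"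
  using e(1) unfolding has_derivative_at_alt by (meson half_gt_zero)
 define t where "t = min (\<delta>/2) R/R"
 have t: "0 < t" "t <= 1" "t*R < \<delta>" using \<delta> \<open>R > 0\<close> by (auto simp: t_def)
 define y where "y = z'+t*.(y0-z')"
 have n1: "norm (y-z') = t*R" using t by (simp add: y_def R_def dist_norm)
 have "y-y0 = (1-t)*.(z'-y0)" by (simp add: y_def algebra_simps)
 hence n2: "norm (y-y0) = (1-t)*R" using t by (simp add: R_def dist_norm norm_minus_commute)
 have "(1-t)*R <= R" using t \<open>R > 0\<close> by (simp add: mult_left_le_one_le)
 hence "y : cball y0 R" using n2 by (simp add: dist_norm norm_minus_commute)
 from e(2)[OF this] have "e*(t*R) <= w y" by (simp add: n2 algebra_simps)
 also have "\<dots> <= e/2*(t*R)" using \<delta>(2)[of y] n1 t z'U by simp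
 finally show False using e(1) t \<open>R > 0\<close> by (simp add: field_simps)
qed

subsection \<open>Local defining functions\<close>

lemma GDERIV_gradient:
 fixes f :: "real^'n => real"
 assumes "f differentiable (at x)"
 shows "GDERIV f x :> gradient f x"
proof -
 obtain f' where f': "(f has_derivative f') (at x)" using assms by (auto simp: differentiable_def)
 hence lin: "linear f'" using has_derivative_linear by blast
 define d where "d = adjoint f' 1"
 have fd: "f' = (%h. h \<bullet> d)"
  unfolding d_def using adjoint_works[OF lin, of _ 1] by (intro ext) (simp add: inner_commute)
 have ex: "GDERIV f x :> d" using f' unfolding gderiv_def fd .
 have uniq: "D = d" if "GDERIV f x :> D" for D
 proof -
  have "(%h. h \<bullet> D) = (%h. h \<bullet> d)"
   using that ex unfolding gderiv_def by (rule has_derivative_unique)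
  hence "\<forall>h. h \<bullet> D = h \<bullet> d" by (rule fun_cong[THEN allI])
  thus ?thesis by (simp only: vector_eq_ldot)
 qed
 have "gradient f x = d" unfolding gradient_def by (rule the_equality) (fact ex, fact uniq)
 thus ?thesis using ex by (simp only:)
qed

lemma GDERIV_unique: "GDERIV f x :> D ==> GDERIV f x :> E ==> D = (E :: 'a::real_inner)"
 unfolding gderiv_def by (drule (1) has_derivative_unique) (metis vector_eq_ldot inner_commute)

lemma gradient_eq: "GDERIV f x :> D ==> gradient f x = (D :: real^'n)"
 unfolding gradient_def by (rule the_equality) (auto intro: GDERIV_unique)

lemma GDERIV_line:
 fixes f :: "'a::real_inner => real"
 assumes "GDERIV f (y + s*.h) :> D"
 shows "((%s. f (y + s*.h)) has_real_derivative D \<bullet> h) (at s)"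
proof -
 have "((%s. y + s*.h) has_derivative (%r. r*.h)) (at s)" by (auto intro!: derivative_eq_intros)
 from diff_chain_at[OF this assms[unfolded gderiv_def]] show ?thesis
  by (simp add: o_def has_field_derivative_def inner_commute mult.commute[of _ "D \<bullet> h"] cong: if_cong)
qed

lemma GDERIV_mvt:
 fixes f :: "'a::real_inner => real"
 assumes cont: "continuous_on {0..1} (%s. f (y + s*.h))"
  and der: "!!s. 0 < s ==> s < 1 ==> GDERIV f (y + s*.h) :> D (y + s*.h)"
 obtains s where "0 < s" "s < 1" "f (y+h)-f y = D (y + s*.h) \<bullet> h"
proof -
 have "\<exists>\<xi>. 0 < \<xi> & \<xi> < 1 & f (y+1*.h)-f (y+0*.h) = (%r. r*(D (y+\<xi>*.h) \<bullet> h)) (1-0)"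
  using mvt[of 0 1 "%s. f (y + s*.h)" "%s r. r*(D (y + s*.h) \<bullet> h)"] cont GDERIV_line[OF der]
  by (auto simp: has_field_derivative_def mult.commute[of _ "_ \<bullet> h"])
 thus ?thesis using that by auto
qed

text \<open>Near the boundary point \<open>x\<close>, \<open>\<rho>\<close> is a defining function with gradient \<open>D\<close> and symmetrised Hessian \<open>H\<close>.
 The last clause replaces the Hoelder continuity of the Hessian.\<close>

definition brep :: "real => (real^'n) set => real^'n => (real^'n => real) => (real^'n => real^'n) =>
  (real^'n => real^'n^'n) => real => real => bool" where
 "brep \<eta> Om x \<rho> D H r L \<longleftrightarrow> 0 < r & 0 < L & \<rho> x = 0 & Om Int ball x r = {y : ball x r. 0 < \<rho> y} &
   (\<forall>y. GDERIV \<rho> y :> D y) & (\<forall>y. jet2 \<rho> y (D y) (H y)) & (\<forall>y. transpose (H y) = H y) &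
   (\<forall>y. 1 <= norm (D y)) & (\<forall>y\<in>ball x r. norm (H y) <= L) &
   (\<forall>y\<in>ball x r. \<forall>z\<in>ball x r. norm (D y-D z) <= L*norm (y-z)) &
   (\<forall>y\<in>ball x r. \<forall>z\<in>ball x r. \<bar>\<rho> z-\<rho> y-D y \<bullet> (z-y)\<bar> <= L*(norm (z-y))^2) &
   (\<forall>y z. \<bar>\<rho> z-\<rho> y-D y \<bullet> (z-y)-(z-y) \<bullet> (H y *v (z-y))/2\<bar> <= L*norm (z-y) powr (2+\<eta>))"

lemma brep_shift:
 assumes b: "brep \<eta> Om x \<rho> D H r L" and y: "y : ball x r" "\<rho> y = 0"
 shows "brep \<eta> Om y \<rho> D H (r-dist x y) L"
proof -
 have sub: "ball y (r-dist x y) <= ball x r"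
 proof
  fix z assume "z : ball y (r-dist x y)"
  thus "z : ball x r" using dist_triangle[of x z y] by simp
 qed
 have "Om Int ball x r = {y : ball x r. 0 < \<rho> y}" using b unfolding brep_def by blast
 hence "Om Int ball y (r-dist x y) = {z : ball y (r-dist x y). 0 < \<rho> z}" using sub by blast
 moreover have "0 < r-dist x y" using y by simp
 ultimately show ?thesis using b y(2) subsetD[OF sub] unfolding brep_def by simp
qed

lemma local_graph_value:
 assumes lg: "local_graph Om x e \<gamma>" and "x : frontier Om" "open Om" and c: "continuous_on UNIV \<gamma>"
 shows "\<gamma> x = x \<bullet> e"
proof (rule ccontr)
 assume ne: "\<gamma> x ~= x \<bullet> e"
 obtain r where r: "r > 0" "Om Int ball x r = {y : ball x r. \<gamma> y < y \<bullet> e}" using lg by (auto simp: local_graph_def)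
 have x: "x ~: Om" "x : closure Om" using assms(2,3) by (auto simp: frontier_def interior_open)
 have "\<not> \<gamma> x < x \<bullet> e"
 proof
  assume "\<gamma> x < x \<bullet> e"
  hence "x : {y : ball x r. \<gamma> y < y \<bullet> e}" using r(1) by simp
  thus False using x(1) unfolding r(2)[symmetric] by blast
 qed
 hence "x \<bullet> e < \<gamma> x" using ne by simp
 moreover have "open {y. y \<bullet> e < \<gamma> y}" by (intro open_Collect_less continuous_intros c)
 ultimately have "open ({y. y \<bullet> e < \<gamma> y} Int ball x r)" "x : {y. y \<bullet> e < \<gamma> y} Int ball x r" using r(1) by auto
 hence "Om Int ({y. y \<bullet> e < \<gamma> y} Int ball x r) ~= {}"
  using x(2) by (metis closure_iff_nhds_not_empty inf_commute order_refl)
 then obtain y where "y : Om" "y \<bullet> e < \<gamma> y" "y : ball x r" by auto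
 hence "y : {y : ball x r. \<gamma> y < y \<bullet> e}" using r(2) by blast
 thus False using \<open>y \<bullet> e < \<gamma> y\<close> by simp
qed

text \<open>\<open>\<gamma>\<close> is constant along \<open>e\<close>, so its gradient is
  orthogonal to \<open>e\<close> and cannot shorten the gradient of
  \<open>y \<bullet> e - \<gamma> y\<close> below 1.\<close>

lemma local_graph_gradient:
 fixes \<gamma> :: "real^'n => real"
 assumes lg: "local_graph Om x e \<gamma>" and d: "!!y. \<gamma> differentiable (at y)"
 shows "GDERIV (%y. y \<bullet> e-\<gamma> y) y :> e-gradient \<gamma> y" "1 <= norm (e-gradient \<gamma> y)"
proof -
 have g: "GDERIV \<gamma> y :> gradient \<gamma> y" by (rule GDERIV_gradient[OF d])
 have "GDERIV (%y. y \<bullet> e) y :> e" unfolding gderiv_def by (auto intro!: derivative_eq_intros)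
 thus "GDERIV (%y. y \<bullet> e-\<gamma> y) y :> e-gradient \<gamma> y" by (intro GDERIV_diff g)
 have e: "norm e = 1" "!!y t. \<gamma> (y+t*.e) = \<gamma> y" using lg by (auto simp: local_graph_def)
 have "GDERIV \<gamma> (y+0*.e) :> gradient \<gamma> y" using g by simp
 from GDERIV_line[OF this] have "((%s. \<gamma> y) has_real_derivative gradient \<gamma> y \<bullet> e) (at 0)" by (simp add: e(2))
 hence orth: "gradient \<gamma> y \<bullet> e = 0" by (metis DERIV_const DERIV_unique)
 have "(norm (e-gradient \<gamma> y))^2 = 1+(norm (gradient \<gamma> y))^2"
  using e(1) orth by (simp add: power2_norm_eq_inner inner_diff_left inner_diff_right inner_commute norm_eq_1)
 thus "1 <= norm (e-gradient \<gamma> y)" by (metis le_add_same_cancel1 one_power2 power2_le_imp_le norm_ge_zero zero_le_power2)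
qed

text \<open>The defining function is \<open>y \<bullet> e - \<gamma> y\<close>. The Hoelder bound on
  the Hessian becomes a remainder of order \<open>2 + \<eta>\<close> by a mean value inequality for
  the gradient and a second one along the segment.\<close>

lemma brep_exists:
 fixes Om :: "(real^'n) set"
 assumes lg: "local_graph Om x e \<gamma>" and x: "x : frontier Om" "open Om" and C2: "C2_Holder \<eta> \<gamma>" and \<eta>: "\<eta> > 0"
 obtains \<rho> D H r L where "brep \<eta> Om x \<rho> D H r L"
proof -
 define g h where "g = gradient \<gamma>" and "h = hessian \<gamma>"
 have d: "!!y. \<gamma> differentiable (at y)" and d2: "!!y. g differentiable (at y)" and hc: "continuous_on UNIV h"
  using C2 by (auto simp: C2_Holder_def C2_on_def g_def h_def)
 obtain L0 where L0: "!!x y. norm (h x-h y) <= L0*dist x y powr \<eta>" using C2 by (auto simp: C2_Holder_def h_def)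
 have gd: "GDERIV \<gamma> y :> g y" for y unfolding g_def by (rule GDERIV_gradient[OF d])
 have hd: "(g has_derivative (%k. h y *v k)) (at y)" for y
  using d2[of y] jacobian_works[of g "at y"] by (simp add: h_def hessian_def g_def)
 have gc: "continuous_on S \<gamma>" for S using d by (meson continuous_at_imp_continuous_on differentiable_imp_continuous_within)
 obtain r where r: "r > 0" "Om Int ball x r = {y : ball x r. \<gamma> y < y \<bullet> e}" using lg by (auto simp: local_graph_def)
 have "bounded (h ` cball x r)" by (intro compact_imp_bounded compact_continuous_image continuous_on_subset[OF hc]) auto
 then obtain L1 where L1: "L1 > 0" "!!y. y : cball x r ==> norm (h y) <= L1" unfolding bounded_pos by force
 define L where "L = L1+\<bar>L0\<bar>"
 define \<rho> where "\<rho> y = y \<bullet> e-\<gamma> y" for y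
 define D where "D y = e-g y" for y
 define H where "H y = - ((1/2)*.(h y+transpose (h y)))" for y
 have GD: "GDERIV \<rho> y :> D y" for y
  unfolding \<rho>_def D_def g_def by (rule local_graph_gradient[OF lg d])
 have form: "k \<bullet> (H y *v k) = - (k \<bullet> (h y *v k))" for k y
 proof -
  have "k \<bullet> (transpose (h y) *v k) = k \<bullet> (h y *v k)"
   by (metis dot_lmul_matrix inner_commute transpose_matrix_vector)
  thus ?thesis by (simp add: H_def mv_uminus mv_scaleR mv_add inner_add_right)
 qed
 have Hn: "norm (H y) <= norm (h y)" for y
 proof -
  have "norm (transpose (h y)) = norm (h y)"
  proof -
   have "(norm (transpose (h y)))^2 = (norm (h y))^2"
    by (simp add: norm_vec_def L2_set_def sum_nonneg transpose_def) (rule sum.swap)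
   thus ?thesis by (simp add: power2_eq_iff_nonneg)
  qed
  hence "norm (h y+transpose (h y)) <= 2*norm (h y)" using norm_triangle_ineq[of "h y" "transpose (h y)"] by simp
  thus ?thesis by (simp add: H_def)
 qed
 have Lip: "norm (D y-D z) <= L*norm (y-z)" if "y : ball x r" "z : ball x r" for y z
 proof -
  have "norm (g y-g z) <= L1*norm (y-z)"
  proof (rule differentiable_bound[of "ball x r"])
   fix w assume "w : ball x r"
   show "(g has_derivative (%k. h w *v k)) (at w within ball x r)" using hd has_derivative_at_withinI by blast
   show "onorm (%k. h w *v k) <= L1"
   proof (rule onorm_bound)
    fix k
    have "norm (h w *v k) <= norm (h w)*norm k" by (rule norm_mv_le)
    also have "\<dots> <= L1*norm k" using L1(2)[of w] \<open>w : ball x r\<close> by (intro mult_right_mono) auto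
    finally show "norm (h w *v k) <= L1*norm k" .
   qed (use L1 in simp)
  qed (use that in auto)
  also have "\<dots> <= L*norm (y-z)" by (intro mult_right_mono) (auto simp: L_def)
  finally show ?thesis by (simp add: D_def norm_minus_commute)
 qed
 have \<rho>c: "continuous_on S \<rho>" for S unfolding \<rho>_def by (intro continuous_intros gc)
 have quad: "\<bar>\<rho> z-\<rho> y-D y \<bullet> (z-y)\<bar> <= L*(norm (z-y))^2" if yz: "y : ball x r" "z : ball x r" for y z
 proof -
  obtain s where s: "0 < s" "s < 1" "\<rho> (y+(z-y))-\<rho> y = D (y + s*.(z-y)) \<bullet> (z-y)"
   by (rule GDERIV_mvt[of \<rho> y "z-y" D]) (auto intro!: GD continuous_on_compose2[OF \<rho>c[of UNIV]] continuous_intros)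
  have "y + s*.(z-y) = (1 - s)*.y + s*.z" by (simp add: algebra_simps)
  hence "y + s*.(z-y) : ball x r" using convexD[OF convex_ball yz, of "1 - s" s] s by simp
  from Lip[OF this yz(1)] have "norm (D (y + s*.(z-y))-D y) <= L*(s*norm (z-y))" using s by simp
  also have "\<dots> <= L*norm (z-y)" using s L1 by (intro mult_left_mono) (auto simp: L_def mult_left_le_one_le)
  finally have "norm (D (y + s*.(z-y))-D y) <= L*norm (z-y)" .
  have "\<bar>\<rho> z-\<rho> y-D y \<bullet> (z-y)\<bar> = \<bar>(D (y + s*.(z-y))-D y) \<bullet> (z-y)\<bar>"
   using s(3) by (simp add: inner_diff_left)
  also have "\<dots> <= norm (D (y + s*.(z-y))-D y)*norm (z-y)" by (rule Cauchy_Schwarz_ineq2)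
  also have "\<dots> <= L*norm (z-y)*norm (z-y)" by (intro mult_right_mono) (fact, simp)
  finally show ?thesis by (simp add: power2_eq_square)
 qed
 have hoelder: "\<bar>\<rho> z-\<rho> x-D x \<bullet> (z-x)-(z-x) \<bullet> (H x *v (z-x))/2\<bar> <= L*norm (z-x) powr (2+\<eta>)" for x z
 proof (cases "z = x")
  case True
  thus ?thesis by simp
 next
  case False
  define k where "k = z-x"
  have k: "norm k > 0" using False by (simp add: k_def)
  define m where "m = \<bar>L0\<bar>*norm k powr \<eta>"
  have "m >= 0" by (simp add: m_def)
  have gest: "norm ((g (x + s *. k)-h x *v (x + s *. k))-(g x-h x *v x)) <= m*norm k" if s: "0 <= s" "s <= 1" for s
  proof -
   have "norm ((%v. g v-h x *v v) (x + s *. k)-(%v. g v-h x *v v) x) <= m*norm ((x + s *. k)-x)"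
   proof (rule differentiable_bound[of "cball x (norm k)"])
    fix w assume w: "w : cball x (norm k)"
    show "((%v. g v-h x *v v) has_derivative (%k. (h w-h x) *v k)) (at w within cball x (norm k))"
     unfolding mv_diff
     by (intro has_derivative_diff has_derivative_at_withinI[OF hd] linear_imp_has_derivative) simp
    show "onorm (%k. (h w-h x) *v k) <= m"
    proof (rule onorm_bound)
     fix j
     have "norm (h w-h x) <= L0*dist w x powr \<eta>" by (rule L0)
     also have "\<dots> <= m" unfolding m_def using w \<eta> by (intro mult_mono powr_mono2) (auto simp: dist_commute)
     finally show "norm ((h w-h x) *v j) <= m*norm j"
      using norm_mv_le[of "h w-h x" j] by (meson mult_right_mono norm_ge_zero order_trans)
    qed fact
   qed (use s in \<open>auto simp: dist_norm mult_left_le_one_le\<close>)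
   also have "\<dots> <= m*norm k" using s \<open>m >= 0\<close> by (intro mult_left_mono) (auto simp: mult_left_le_one_le)
   finally show ?thesis .
  qed
  define f where "f s = \<rho> (x + s *. k) - s*(D x \<bullet> k) - s^2/2*(k \<bullet> (H x *v k))" for s
  define f' where "f' s = - (((g (x + s *. k)-h x *v (x + s *. k))-(g x-h x *v x)) \<bullet> k)" for s
  have der: "(f has_real_derivative f' s) (at s)" for s
   unfolding f_def f'_def
   by (rule derivative_eq_intros GDERIV_line[OF GD] refl | simp)+
    (simp add: D_def form inner_diff_left matrix_vector_right_distrib matrix_vector_mult_scaleR inner_add_left inner_commute algebra_simps)
  obtain s where s: "0 < s" "s < 1" "f 1-f 0 = (1-0)*f' s" using MVT2[of 0 1 f f'] der by auto
  have "\<bar>f' s\<bar> <= (m*norm k)*norm k"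
   unfolding f'_def abs_minus_cancel
   by (rule order_trans[OF Cauchy_Schwarz_ineq2]) (use gest[of s] s in \<open>intro mult_right_mono; simp\<close>)
  also have "\<dots> = \<bar>L0\<bar>*norm k powr (2+\<eta>)" using k by (simp add: m_def powr_add powr_numeral power2_eq_square)
  also have "\<dots> <= L*norm k powr (2+\<eta>)" using L1 by (intro mult_right_mono) (auto simp: L_def)
  finally have "\<bar>f' s\<bar> <= L*norm k powr (2+\<eta>)" .
  moreover have "\<rho> z-\<rho> x-D x \<bullet> (z-x)-(z-x) \<bullet> (H x *v (z-x))/2 = f 1-f 0"
   by (simp add: f_def k_def)
  ultimately show ?thesis using s by (simp add: k_def)
 qed
 have "brep \<eta> Om x \<rho> D H r L"
  unfolding brep_def
 proof (intro conjI allI ballI)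
  show "\<rho> x = 0" using local_graph_value[OF lg x gc] by (simp add: \<rho>_def)
  show "Om Int ball x r = {y : ball x r. 0 < \<rho> y}" unfolding r(2) by (auto simp: \<rho>_def)
  fix y
  show "transpose (H y) = H y" by (simp add: H_def sym_simps transpose_transpose add.commute)
  have "jet2 \<gamma> y (g y) ((1/2)*.(h y+transpose (h y)))"
   by (rule peano_C2) (use gd hd in auto)
  hence "jet2 (%y. e \<bullet> y-\<gamma> y) y (e-g y) (0-(1/2)*.(h y+transpose (h y)))"
   by (intro jet2_diff jet2_inner)
  thus "jet2 \<rho> y (D y) (H y)" by (simp add: \<rho>_def[abs_def] D_def H_def inner_commute)
  show "1 <= norm (D y)" unfolding D_def g_def by (rule local_graph_gradient(2)[OF lg d])
  assume "y : ball x r"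
  hence "norm (h y) <= L1" using L1(2)[of y] by simp
  thus "norm (H y) <= L" using Hn[of y] by (simp add: L_def)
 qed (use r L1 GD Lip quad hoelder in \<open>auto simp: L_def\<close>)
 thus ?thesis using that by blast
qed

lemma norm_diff_square: "(norm (p-q))^2 = (norm p)^2-2*(p \<bullet> q)+(norm (q :: 'a::real_inner))^2"
 by (simp add: power2_norm_eq_inner inner_diff_left inner_diff_right inner_commute)

lemma brep_D:
 assumes "brep \<eta> Om x \<rho> D H r L"
 shows "norm (D x) > 0" "norm (sgn (D x)) = 1" "D x = norm (D x) *. sgn (D x)"
proof -
 have "1 <= norm (D x)" using assms unfolding brep_def by blast
 thus "norm (D x) > 0" by linarith
 thus "norm (sgn (D x)) = 1" "D x = norm (D x) *. sgn (D x)" by (auto simp: norm_sgn sgn_div_norm)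
qed

lemma brep_directions:
 assumes b: "brep \<eta> Om x \<rho> D H r L"
 shows "h \<bullet> D x > 0 ==> \<forall>\<^sub>F t in at_right 0. x+t*.h : Om"
  and "h \<bullet> D x < 0 ==> \<forall>\<^sub>F t in at_right 0. x+t*.h ~: closure Om"
proof -
 have r: "r > 0" and \<rho>x: "\<rho> x = 0" and om: "Om Int ball x r = {y : ball x r. 0 < \<rho> y}" and gd: "GDERIV \<rho> y :> D y" for y
  using b unfolding brep_def by blast+
 have "GDERIV \<rho> (x+0*.h) :> D x" using gd by simp
 from GDERIV_line[OF this] have d: "((%t. \<rho> (x+t*.h)) has_real_derivative D x \<bullet> h) (at 0)" .
 have "((%t. x+t*.h) \<longlongrightarrow> x+0*.h) (at_right 0)" by (intro tendsto_intros)
 hence "\<forall>\<^sub>F t in at_right 0. x+t*.h : ball x r" using r by (intro topological_tendstoD) auto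
 note near = this
 show "\<forall>\<^sub>F t in at_right 0. x+t*.h : Om" if h: "h \<bullet> D x > 0"
 proof -
  obtain d where "d > 0" "!!t. 0 < t ==> t < d ==> \<rho> (x+0*.h) < \<rho> (x+(0+t)*.h)"
   using DERIV_pos_inc_right[OF d] h by (auto simp: inner_commute)
  hence "\<forall>\<^sub>F t in at_right 0. \<rho> (x+t*.h) > 0"
   unfolding eventually_at_right_field using \<rho>x by auto
  with near show ?thesis by eventually_elim (use om in blast)
 qed
 show "\<forall>\<^sub>F t in at_right 0. x+t*.h ~: closure Om" if h: "h \<bullet> D x < 0"
 proof -
  obtain d where "d > 0" "!!t. 0 < t ==> t < d ==> \<rho> (x+0*.h) > \<rho> (x+(0+t)*.h)"
   using DERIV_neg_dec_right[OF d] h by (auto simp: inner_commute)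
  hence "\<forall>\<^sub>F t in at_right 0. \<rho> (x+t*.h) < 0"
   unfolding eventually_at_right_field using \<rho>x by auto
  with near show ?thesis
  proof eventually_elim
   case (elim t)
   have "open {y. \<rho> y < 0}"
   proof (rule open_Collect_less)
    show "continuous_on UNIV \<rho>"
     using gd unfolding gderiv_def by (meson continuous_at_imp_continuous_on has_derivative_continuous)
   qed simp
   hence "open ({y. \<rho> y < 0} Int ball x r)" by auto
   moreover have "Om Int ({y. \<rho> y < 0} Int ball x r) = {}"
   proof -
    have "\<not> \<rho> y < 0" if "y : Om" "y : ball x r" for y
     using that om by (metis (no_types, lifting) IntI mem_Collect_eq order.asym)
    thus ?thesis by auto
   qed
   ultimately have "closure Om Int ({y. \<rho> y < 0} Int ball x r) = {}"
    by (metis Int_commute open_Int_closure_eq_empty)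
   thus ?case using elim by auto
  qed
 qed
qed

subsection \<open>Positive solutions with constant normal derivative\<close>

text \<open>The situation after normalisation of the sign: \<open>\<kappa>\<close> is the derivative
  in the direction of the inner normal, and the power of the gradient has been divided out. The
  assumption \<open>nconst\<close> is what the alternative for locally constant points leaves when
  \<open>lam > 0\<close> and \<open>u > 0\<close>.\<close>

locale overdet =
 fixes \<alpha> a A lam \<kappa> \<eta> :: real and M :: "real^'n^'n => real" and Om :: "(real^'n) set"
  and u :: "real^'n => real" and G :: "real^'n => real^'n"
 assumes alpha: "\<alpha> > -1" and aA: "0 < a" "a <= A" and lam: "lam > 0" and eta: "0 < \<eta>" "\<eta> < 1"
  and M: "M : {pucci_plus a A, pucci_minus a A}"
  and dom: "open Om" "connected Om" "bounded Om" "Om ~= {}"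
  and uc: "continuous_on (closure Om) u" and Gc: "continuous_on (closure Om) G"
  and GD: "!!x. x : Om ==> GDERIV u x :> G x"
  and u0: "!!x. x : frontier Om ==> u x = 0" and upos: "!!x. x : Om ==> u x > 0"
  and sup: "!!x p X. x : Om ==> transpose X = X ==> p ~= 0 ==> subjet u x p X ==>
    M X <= - (lam*u x powr (1+\<alpha>)*norm p powr (- \<alpha>))"
  and sub: "!!x p X. x : Om ==> transpose X = X ==> p ~= 0 ==> superjet u x p X ==>
    - (lam*u x powr (1+\<alpha>)*norm p powr (- \<alpha>)) <= M X"
  and nconst: "!!x r. x : Om ==> r > 0 ==> ball x r <= Om ==> \<exists>y\<in>ball x r. u y ~= u x"
  and bd: "!!x. x : frontier Om ==> \<exists>\<rho> D H r L. brep \<eta> Om x \<rho> D H r L &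
    ((%t. u (x+t *. sgn (D x))/t) \<longlongrightarrow> \<kappa>) (at_right 0)"
begin

lemma pucci_minus_le_M:
 assumes "transpose X = X" shows "pucci_minus a A X <= M X" "M X <= pucci_plus a A X"
 using M pucci_minus_le_plus[OF aA assms] by auto

lemma frontier_facts:
 assumes "x : frontier Om" shows "x ~: Om" "x : closure Om"
 using assms dom(1) by (auto simp: frontier_def interior_open)

lemma frontierI: "x : closure Om ==> x ~: Om ==> x : frontier Om"
 using dom(1) by (auto simp: frontier_def interior_open)

lemma u_nonneg: "x : closure Om ==> u x >= 0"
 using upos[of x] u0[of x] frontierI[of x] by fastforce

lemma compact_frontier: "compact (frontier Om)"
 using dom(3) by (rule compact_frontier_bounded)

lemma compact_closure: "compact (closure Om)"
 using dom(3) by (simp add: compact_closure)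

lemma frontier_nonempty: "frontier Om ~= {}"
 using dom frontier_eq_empty not_bounded_UNIV by metis

lemma hopfable_u: "hopfable a A 0 Om u"
 unfolding hopfable_def
proof (intro ballI allI impI)
 fix x p X assume x: "x : Om" and X: "transpose X = X" and p: "p ~= 0" and sj: "subjet u x p X"
 have "0 <= lam*u x powr (1+\<alpha>)*norm p powr (- \<alpha>)" using lam by simp
 thus "pucci_minus a A X <= 0*norm p"
  using sup[OF x X p sj] pucci_minus_le_M(1)[OF X] by linarith
qed

lemma segment_mvt:
 assumes "y : closure Om" "y+h : closure Om" "!!s. 0 < s ==> s < 1 ==> y + s*.h : Om"
 obtains s where "0 < s" "s < 1" "u (y+h)-u y = G (y + s*.h) \<bullet> h"
proof (rule GDERIV_mvt[of u y h G])
 have "y + s*.h : closure Om" if "s : {0..1}" for s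
 proof -
  have "s = 0 | s = 1 | (0 < s & s < 1)" using that by auto
  thus ?thesis using assms closure_subset[of Om] by auto
 qed
 thus "continuous_on {0..1} (%s. u (y + s*.h))"
  by (intro continuous_on_compose2[OF uc]) (auto intro!: continuous_intros)
qed (use assms GD that in auto)

lemma segment_mvt':
 assumes y: "y : closure Om" and seg: "!!s. 0 < s ==> s <= 1 ==> y + s*.h : Om"
 obtains s where "0 < s" "s < 1" "u (y+h)-u y = G (y + s*.h) \<bullet> h"
proof (rule segment_mvt[OF y])
 show "y+h : closure Om" using seg[of 1] closure_subset[of Om] by auto
qed (use seg that in auto)

text \<open>In the ball, \<open>k = y - x\<close> and the unit gradient \<open>n\<close> of
  \<open>\<rho>\<close> at \<open>x\<close> satisfy
  \<open>(norm k)^2 <= 2 R (k \<bullet> n)\<close>. For \<open>4 L R <= 1\<close> the quadratic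
  error is thus at most half of the linear term of \<open>\<rho>\<close>.\<close>

lemma brep_interior_ball:
 assumes b: "brep \<eta> Om x \<rho> D H r L"
 obtains R0 where "R0 > 0" "!!R. 0 < R ==> R <= R0 ==> cball (x+R *. sgn (D x)) R - {x} <= Om"
proof -
 have r: "r > 0" "L > 0" and \<rho>x: "\<rho> x = 0" and om: "Om Int ball x r = {y : ball x r. 0 < \<rho> y}" and D1: "1 <= norm (D x)"
  and q: "!!y z. y : ball x r ==> z : ball x r ==> \<bar>\<rho> z-\<rho> y-D y \<bullet> (z-y)\<bar> <= L*(norm (z-y))^2"
  using b unfolding brep_def by blast+
 define R0 where "R0 = min (r/3) (1/(4*L))"
 have "R0 > 0" using r by (simp add: R0_def)
 moreover have "cball (x+R *. sgn (D x)) R - {x} <= Om" if R: "0 < R" "R <= R0" for R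
 proof
  fix y assume y: "y : cball (x+R *. sgn (D x)) R - {x}"
  define k where "k = y-x"
  have kn: "k ~= 0" using y by (simp add: k_def)
  note ns = brep_D(2)[OF b]
  have "norm (k-R *. sgn (D x)) <= R" using y by (simp add: k_def dist_norm norm_minus_commute algebra_simps)
  hence "(norm (k-R *. sgn (D x)))^2 <= R^2" by (intro power_mono) auto
  moreover have "(norm (k-R *. sgn (D x)))^2 = (norm k)^2-2*R*(k \<bullet> sgn (D x))+R^2"
   using ns R by (simp add: norm_diff_square)
  ultimately have le: "(norm k)^2 <= 2*R*(k \<bullet> sgn (D x))" by linarith
  have "norm k <= norm (k-R *. sgn (D x))+norm (R *. sgn (D x))" by (metis diff_add_cancel norm_triangle_ineq)
  hence "norm k <= 2*R" using \<open>norm (k - R *\<^sub>R sgn (D x)) <= R\<close> ns R by simp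
  hence yb: "y : ball x r" using R r by (simp add: k_def dist_norm norm_minus_commute R0_def)
  have "k \<bullet> sgn (D x) > 0"
  proof -
   have "0 < (norm k)^2" using kn by simp
   hence "0 < 2*R*(k \<bullet> sgn (D x))" using le by linarith
   thus ?thesis using R by (simp add: zero_less_mult_iff)
  qed
  have "\<rho> y >= D x \<bullet> k-L*(norm k)^2" using q[of x y] yb r \<rho>x by (simp add: k_def)
  moreover have "D x \<bullet> k >= k \<bullet> sgn (D x)"
  proof -
   have "D x \<bullet> k = norm (D x)*(k \<bullet> sgn (D x))" by (subst brep_D(3)[OF b]) (simp add: inner_commute)
   thus ?thesis using D1 \<open>k \<bullet> sgn (D x) > 0\<close> by simp
  qed
  moreover have "L*(norm k)^2 <= (k \<bullet> sgn (D x))/2"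
  proof -
   have "L*(norm k)^2 <= L*(2*R*(k \<bullet> sgn (D x)))" using le r by (intro mult_left_mono) auto
   also have "\<dots> = (L*R)*2*(k \<bullet> sgn (D x))" by simp
   also have "\<dots> <= (1/4)*2*(k \<bullet> sgn (D x))"
   proof (intro mult_right_mono)
    have "L*R <= L*(1/(4*L))" using R r by (intro mult_left_mono) (auto simp: R0_def)
    thus "L*R <= 1/4" using r by simp
   qed (use \<open>k \<bullet> sgn (D x) > 0\<close> in auto)
   finally show ?thesis by simp
  qed
  ultimately have "\<rho> y > 0" using \<open>k \<bullet> sgn (D x) > 0\<close> by linarith
  thus "y : Om" using om yb by blast
 qed
 ultimately show ?thesis using that by blast
qed

lemma kappa_pos: "\<kappa> > 0"
proof -
 obtain x where x: "x : frontier Om" using frontier_nonempty by blast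
 obtain \<rho> D H r L where b: "brep \<eta> Om x \<rho> D H r L" and lim: "((%t. u (x+t *. sgn (D x))/t) \<longlongrightarrow> \<kappa>) (at_right 0)"
  using bd[OF x] by blast
 obtain R where R: "R > 0" "cball (x+R *. sgn (D x)) R - {x} <= Om" using brep_interior_ball[OF b] by (metis order_refl)
 note ns = brep_D(2)[OF b]
 let ?y = "x+R *. sgn (D x)"
 have cb: "cball ?y R <= closure Om" using R(2) frontier_facts(2)[OF x] closure_subset[of Om] by blast
 have bb: "ball ?y R <= Om"
 proof
  fix z assume z: "z : ball ?y R"
  have "x ~: ball ?y R" using ns R(1) by (simp add: dist_norm)
  hence "z ~= x" using z by blast
  moreover have "z : cball ?y R" using z by simp
  ultimately show "z : Om" using R(2) by blast
 qed
 obtain e where e: "e > 0" "!!z. z : cball ?y R ==> e*(R-norm (z - ?y)) <= u z"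
  using hopf_lemma[OF aA order_refl R(1) continuous_on_subset[OF uc cb] _ _ hopfable_subset[OF hopfable_u bb]]
   u_nonneg cb upos bb by (meson subsetD)
 have "\<forall>\<^sub>F t in at_right 0. e <= u (x+t *. sgn (D x))/t"
  unfolding eventually_at_right_field
 proof (intro exI[of _ R] conjI allI impI R(1))
  fix t assume t: "0 < t" "t < R"
  have eq: "x+t *. sgn (D x) - ?y = - ((R-t) *. sgn (D x))" by (simp add: algebra_simps)
  hence n: "norm (x+t *. sgn (D x) - ?y) = R-t" using t ns by simp
  hence "x+t *. sgn (D x) : cball ?y R" using t by (simp add: dist_norm norm_minus_commute)
  from e(2)[OF this] have "e*t <= u (x+t *. sgn (D x))" unfolding n by simp
  thus "e <= u (x+t *. sgn (D x))/t" using t by (simp add: pos_le_divide_eq)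
 qed
 hence "e <= \<kappa>" by (rule tendsto_lowerbound[OF lim]) simp
 thus ?thesis using e by simp
qed

text \<open>Mean value theorem on short segments from \<open>x\<close> into the domain, and
  continuity of \<open>G\<close> up to the boundary. In this way \<open>G\<close> on the boundary is
  linked to the one-sided derivatives of \<open>u\<close>.\<close>

lemma directional_limit:
 assumes x: "x : frontier Om" and ev: "\<forall>\<^sub>F t in at_right 0. x+t*.h : Om"
 shows "((%t. u (x+t*.h)/t) \<longlongrightarrow> G x \<bullet> h) (at_right 0)"
proof (rule tendstoI)
 fix e :: real assume e: "e > 0"
 obtain d where d: "d > 0" "!!t. 0 < t ==> t < d ==> x+t*.h : Om"
  using ev unfolding eventually_at_right_field by auto
 define e' where "e' = e/(norm h+1)"
 have "norm h+1 > 0" by (simp add: add_nonneg_pos)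
 hence e': "e' > 0" using e by (simp add: e'_def)
 obtain d2 where d2: "d2 > 0" "!!y. y : closure Om ==> dist y x < d2 ==> dist (G y) (G x) < e'"
  using Gc[unfolded continuous_on_iff, rule_format, OF frontier_facts(2)[OF x] e'] by blast
 show "\<forall>\<^sub>F t in at_right 0. dist (u (x+t*.h)/t) (G x \<bullet> h) < e"
  unfolding eventually_at_right_field
 proof (intro exI[of _ "min d (d2/(norm h+1))"] conjI allI impI)
  show "0 < min d (d2/(norm h+1))" using d d2 \<open>norm h + 1 > 0\<close> by simp
  fix t assume t: "0 < t" "t < min d (d2/(norm h+1))"
  have in_Om: "x + s*.(t*.h) : Om" if "0 < s" "s <= 1" for s
  proof -
   have "s*t <= t" using that t by (simp add: mult_left_le_one_le)
   hence "s*t < d" using t by linarith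
   moreover have "0 < s*t" using that t by simp
   ultimately show ?thesis using d(2)[of "s*t"] by simp
  qed
  obtain s where s: "0 < s" "s < 1" "u (x+t*.h)-u x = G (x + s*.(t*.h)) \<bullet> (t*.h)"
   by (rule segment_mvt'[OF frontier_facts(2)[OF x] in_Om])
  define z where "z = x + s*.(t*.h)"
  have "dist z x = s*t*norm h" using s t by (simp add: z_def dist_norm)
  also have "\<dots> <= t*norm h" using s t by (intro mult_right_mono) (auto simp: mult_left_le_one_le)
  also have "\<dots> <= t*(norm h+1)" using t by simp
  also have "\<dots> < d2" using t \<open>norm h + 1 > 0\<close> by (simp add: pos_less_divide_eq)
  finally have "dist (G z) (G x) < e'" using in_Om[of s] s closure_subset[of Om] by (intro d2) (auto simp: z_def)
  have "u (x+t*.h)/t = G z \<bullet> h" using s(3) u0[OF x] t by (simp add: z_def)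
  hence "dist (u (x+t*.h)/t) (G x \<bullet> h) = \<bar>(G z-G x) \<bullet> h\<bar>" by (simp add: dist_real_def inner_diff_left)
  also have "\<dots> <= norm (G z-G x)*norm h" by (rule Cauchy_Schwarz_ineq2)
  also have "\<dots> <= e'*norm h" using \<open>dist (G z) (G x) < e'\<close> by (intro mult_right_mono) (auto simp: dist_norm)
  also have "\<dots> < e'*(norm h+1)" using e' by simp
  also have "\<dots> = e" using \<open>norm h + 1 > 0\<close> by (simp add: e'_def)
  finally show "dist (u (x+t*.h)/t) (G x \<bullet> h) < e" .
 qed
qed

text \<open>Positivity of \<open>u\<close> gives \<open>G x \<bullet> h >= 0\<close> for every
  inward direction \<open>h\<close>. Inward directions close to minus the tangential part
  \<open>g\<close> of \<open>G x\<close> show that \<open>g = 0\<close>.\<close>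

lemma G_parallel:
 assumes x: "x : frontier Om" and b: "brep \<eta> Om x \<rho> D H r L"
 shows "G x = (G x \<bullet> sgn (D x)) *. sgn (D x)" "0 <= G x \<bullet> sgn (D x)"
proof -
 define n where "n = sgn (D x)"
 have D: "D x = norm (D x)*.n" "norm (D x) > 0" and nn: "n \<bullet> n = 1"
  using brep_D[OF b] by (auto simp: n_def dot_square_norm)
 have dir: "h \<bullet> D x > 0 \<longleftrightarrow> h \<bullet> n > 0" for h
  by (subst D(1)) (use D(2) in \<open>simp add: zero_less_mult_iff\<close>)
 have pos: "G x \<bullet> h >= 0" if "h \<bullet> n > 0" for h
 proof -
  have ev: "\<forall>\<^sub>F t in at_right 0. x+t*.h : Om" using brep_directions(1)[OF b] that dir by blast
  have "\<forall>\<^sub>F t in at_right 0. 0 <= u (x+t*.h)/t"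
   using ev eventually_at_right_less[of "0::real"] by eventually_elim (use upos in \<open>auto simp: less_imp_le\<close>)
  thus ?thesis by (rule tendsto_lowerbound[OF directional_limit[OF x ev]]) simp
 qed
 define g where "g = G x-(G x \<bullet> n)*.n"
 have gn: "g \<bullet> n = 0" by (simp add: g_def inner_diff_left nn)
 have "g \<bullet> g <= 0+e" if e: "e > 0" for e
 proof -
  define d where "d = e/(\<bar>G x \<bullet> n\<bar>+1)"
  have d: "d > 0" using e by (simp add: d_def add_nonneg_pos)
  have "(d*.n-g) \<bullet> n = d" by (simp add: inner_diff_left nn gn)
  hence "0 <= G x \<bullet> (d*.n-g)" using pos d by simp
  moreover have "G x \<bullet> g = g \<bullet> g" using gn by (simp add: g_def inner_diff_left inner_diff_right nn inner_commute)
  ultimately have "g \<bullet> g <= d*(G x \<bullet> n)" by (simp add: inner_diff_right)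
  also have "\<dots> <= d*(\<bar>G x \<bullet> n\<bar>+1)" using d by (intro mult_left_mono) auto
  also have "\<dots> = e" by (simp add: d_def)
  finally show ?thesis by simp
 qed
 hence "g \<bullet> g <= 0" by (rule field_le_epsilon)
 hence "g = 0" by (metis inner_gt_zero_iff not_less)
 thus "G x = (G x \<bullet> sgn (D x)) *. sgn (D x)" by (simp add: g_def n_def)
 show "0 <= G x \<bullet> sgn (D x)" using pos[of n] nn unfolding n_def by linarith
qed

lemma norm_G_frontier:
 assumes x: "x : frontier Om" shows "norm (G x) = \<kappa>"
proof -
 obtain \<rho> D H r L where b: "brep \<eta> Om x \<rho> D H r L" and lim: "((%t. u (x+t *. sgn (D x))/t) \<longlongrightarrow> \<kappa>) (at_right 0)"
  using bd[OF x] by blast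
 define n where "n = sgn (D x)"
 have n: "norm n = 1" "n \<bullet> D x > 0" using brep_D[OF b] by (auto simp: n_def sgn_div_norm dot_square_norm divide_pos_pos)
 have "\<forall>\<^sub>F t in at_right 0. x+t*.n : Om" using brep_directions(1)[OF b n(2)] .
 from directional_limit[OF x this] have "((%t. u (x+t*.n)/t) \<longlongrightarrow> G x \<bullet> n) (at_right 0)" .
 hence "G x \<bullet> n = \<kappa>" using lim unfolding n_def by (rule tendsto_unique[OF trivial_limit_at_right_real])
 hence "G x = \<kappa>*.n" using G_parallel(1)[OF x b] by (simp add: n_def)
 thus ?thesis using kappa_pos n(1) by simp
qed

lemma boundary_rep_G:
 assumes x: "x : frontier Om" and b: "brep \<eta> Om x \<rho> D H r L"
 shows "G x = \<kappa> *. sgn (D x)"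
proof -
 have "norm (G x) = \<bar>G x \<bullet> sgn (D x)\<bar>*norm (sgn (D x))" by (subst G_parallel(1)[OF x b]) simp
 hence "G x \<bullet> sgn (D x) = \<kappa>" using norm_G_frontier[OF x] brep_D(2)[OF b] G_parallel(2)[OF x b] by simp
 thus ?thesis using G_parallel(1)[OF x b] by simp
qed

text \<open>On the boundary this is the inner unit normal; it is read off from the gradient, so that
  it does not depend on a choice of defining function.\<close>

definition nu :: "real^'n => real^'n" where "nu x = (1/\<kappa>)*.G x"

lemma G_nu: "G x = \<kappa>*.nu x" using kappa_pos by (simp add: nu_def)

lemma norm_nu: "x : frontier Om ==> norm (nu x) = 1"
 using norm_G_frontier kappa_pos by (simp add: nu_def)

lemma boundary_rep_nu:
 assumes x: "x : frontier Om"
 obtains \<rho> D H r L where "brep \<eta> Om x \<rho> D H r L" "sgn (D x) = nu x" "D x = norm (D x)*.nu x"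
proof -
 obtain \<rho> D H r L where b: "brep \<eta> Om x \<rho> D H r L" using bd[OF x] by blast
 hence "sgn (D x) = nu x" using boundary_rep_G[OF x b] kappa_pos by (simp add: nu_def)
 with brep_D(3)[OF b] show ?thesis using that b by metis
qed

lemma frontier_brep:
 assumes b: "brep \<eta> Om x \<rho> D H r L" and y: "y : frontier Om" "y : ball x r"
 shows "\<rho> y = 0" "nu y = sgn (D y)"
proof -
 have om: "Om Int ball x r = {y : ball x r. 0 < \<rho> y}" and gd: "GDERIV \<rho> y :> D y" for y using b unfolding brep_def by blast+
 have c: "continuous_on UNIV \<rho>"
  using gd unfolding gderiv_def by (meson continuous_at_imp_continuous_on has_derivative_continuous)
 have "\<not> \<rho> y > 0" using om y frontier_facts(1)[OF y(1)] by blast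
 moreover have "\<not> \<rho> y < 0"
 proof
  assume neg: "\<rho> y < 0"
  have "open ({y. \<rho> y < 0} Int ball x r)" by (intro open_Int open_Collect_less c) auto
  moreover have "Om Int ({y. \<rho> y < 0} Int ball x r) = {}" using om by (auto simp: set_eq_iff) (metis order.asym)
  ultimately have "closure Om Int ({y. \<rho> y < 0} Int ball x r) = {}"
   by (metis Int_commute open_Int_closure_eq_empty)
  thus False using frontier_facts(2)[OF y(1)] neg y(2) by auto
 qed
 ultimately show 0: "\<rho> y = 0" by simp
 show "nu y = sgn (D y)" using boundary_rep_G[OF y(1) brep_shift[OF b y(2) 0]] kappa_pos by (simp add: nu_def)
qed

lemma directions:
 assumes x: "x : frontier Om"
 shows "h \<bullet> nu x > 0 ==> \<forall>\<^sub>F t in at_right 0. x+t*.h : Om"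
  and "h \<bullet> nu x < 0 ==> \<forall>\<^sub>F t in at_right 0. x+t*.h ~: closure Om"
proof -
 obtain \<rho> D H r L where b: "brep \<eta> Om x \<rho> D H r L" "D x = norm (D x)*.nu x" using boundary_rep_nu[OF x] .
 note n = brep_D(1)[OF b(1)]
 have "h \<bullet> D x = norm (D x)*(h \<bullet> nu x)" using b(2) by (metis inner_scaleR_right)
 thus "h \<bullet> nu x > 0 ==> \<forall>\<^sub>F t in at_right 0. x+t*.h : Om"
  "h \<bullet> nu x < 0 ==> \<forall>\<^sub>F t in at_right 0. x+t*.h ~: closure Om"
  using brep_directions[OF b(1)] n by (auto simp: mult_pos_neg)
qed

lemma interior_ball:
 assumes x: "x : frontier Om"
 obtains R0 where "R0 > 0" "!!R. 0 < R ==> R <= R0 ==> cball (x+R*.nu x) R - {x} <= Om"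
proof -
 obtain \<rho> D H r L where b: "brep \<eta> Om x \<rho> D H r L" "sgn (D x) = nu x" using boundary_rep_nu[OF x] .
 show ?thesis by (rule brep_interior_ball[OF b(1)]) (rule that, assumption, simp only: b(2))
qed

text \<open>If the direction \<open>m\<close> of the centre differed from the normal, then
  \<open>h = m - nu y\<close> would point into the ball and out of the domain.\<close>

lemma touching_ball:
 assumes "ball p R <= Om" and y: "y : frontier Om" and R: "norm (p-y) = R" "R > 0"
 shows "p-y = R*.nu y"
proof (rule ccontr)
 assume ne: "p-y ~= R*.nu y"
 define m where "m = (1/R)*.(p-y)"
 define h where "h = m-nu y"
 have m: "norm m = 1" "p-y = R*.m" using R by (auto simp: m_def)
 have "h ~= 0" using ne m by (auto simp: h_def)
 hence hh: "h \<bullet> h > 0" by simp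
 have mm: "m \<bullet> m = 1" "nu y \<bullet> nu y = 1" using m norm_nu[OF y] by (auto simp: dot_square_norm)
 have "h \<bullet> h = 2*(h \<bullet> m)" using mm by (simp add: h_def inner_diff_left inner_diff_right inner_commute)
 hence hm: "h \<bullet> m > 0" using hh by simp
 have "h \<bullet> nu y = - (h \<bullet> m)" using mm by (simp add: h_def inner_diff_left inner_diff_right inner_commute)
 hence "\<forall>\<^sub>F t in at_right 0. y+t*.h ~: closure Om" using directions(2)[OF y] hm by simp
 moreover have "\<forall>\<^sub>F t in at_right 0. y+t*.h : ball p R"
  unfolding eventually_at_right_field
 proof (intro exI[of _ R] conjI allI impI R(2))
  fix t assume t: "0 < t" "t < R"
  have eq: "p-(y+t*.h) = R*.m-t*.h" using m(2) by (simp add: algebra_simps)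
  have "(norm (p-(y+t*.h)))^2 = R^2-2*R*t*(h \<bullet> m)+t^2*(h \<bullet> h)"
   unfolding eq norm_diff_square using m(1) by (simp add: power_mult_distrib inner_commute power2_norm_eq_inner[of h])
  also have "\<dots> = R^2-2*(h \<bullet> m)*t*(R-t)"
   using \<open>h \<bullet> h = 2 * (h \<bullet> m)\<close> by (simp add: power2_eq_square algebra_simps)
  also have "\<dots> < R^2" using t hm by simp
  finally show "y+t*.h : ball p R" using R(2) by (simp add: dist_norm power_less_imp_less_base)
 qed
 ultimately have "\<forall>\<^sub>F t :: real in at_right 0. False"
  by eventually_elim (use assms(1) closure_subset[of Om] in blast)
 thus False by (simp add: trivial_limit_at_right_real)
qed

lemma ball_in_domain:
 assumes "x : Om"
 shows "ball x (infdist x (frontier Om)) <= Om" "infdist x (frontier Om) > 0"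
  "\<exists>y\<in>frontier Om. dist x y = infdist x (frontier Om)"
proof -
 obtain y where y: "y : frontier Om" "infdist x (frontier Om) = dist x y"
  using infdist_attains_inf[OF frontier_closed frontier_nonempty] by metis
 thus "\<exists>y\<in>frontier Om. dist x y = infdist x (frontier Om)" by auto
 have "x ~= y" using y(1) frontier_facts(1) assms by blast
 thus "infdist x (frontier Om) > 0" using y by simp
 show "ball x (infdist x (frontier Om)) <= Om"
 proof (rule ccontr)
  assume "\<not> ?thesis"
  hence "ball x (infdist x (frontier Om))-Om ~= {}" by blast
  moreover have "ball x (infdist x (frontier Om)) Int Om ~= {}" using assms \<open>infdist x (frontier Om) > 0\<close> by (metis IntI centre_in_ball empty_iff)
  ultimately have "ball x (infdist x (frontier Om)) Int frontier Om ~= {}"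
   using connected_Int_frontier[OF connected_ball] by blast
  then obtain z where "z : frontier Om" "dist x z < infdist x (frontier Om)" by auto
  thus False using infdist_le[of z "frontier Om" x] by simp
 qed
qed

text \<open>Mean value theorem along the normal segment from the nearest boundary point, where
  \<open>G\<close> is \<open>\<kappa>\<close> times the normal; uniform continuity of
  \<open>G\<close> makes the error uniform.\<close>

lemma near_boundary:
 assumes "e > 0"
 obtains d where "d > 0" "!!x. x : Om ==> infdist x (frontier Om) < d ==>
  \<bar>u x-\<kappa>*infdist x (frontier Om)\<bar> <= e*infdist x (frontier Om)"
proof -
 have "uniformly_continuous_on (closure Om) G" by (intro compact_uniformly_continuous Gc compact_closure)
 then obtain d where d: "d > 0" "!!x y. x : closure Om ==> y : closure Om ==> dist x y < d ==> dist (G x) (G y) < e"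
  using assms unfolding uniformly_continuous_on_def by (metis dist_commute)
 have "\<bar>u x-\<kappa>*infdist x (frontier Om)\<bar> <= e*infdist x (frontier Om)"
  if x: "x : Om" and lt: "infdist x (frontier Om) < d" for x
 proof -
  define R where "R = infdist x (frontier Om)"
  obtain y where y: "y : frontier Om" "dist x y = R" using ball_in_domain(3)[OF x] by (auto simp: R_def)
  have R: "R > 0" "ball x R <= Om" using ball_in_domain[OF x] by (auto simp: R_def)
  have tb: "x-y = R*.nu y" using touching_ball[OF R(2) y(1)] y(2) R(1) by (simp add: dist_norm)
  have seg: "y + s*.(R*.nu y) : Om" if s: "0 < s" "s <= 1" for s
  proof -
   have "x-(y + s*.(R*.nu y)) = (1 - s)*.(R*.nu y)" using tb by (simp add: algebra_simps)
   hence "dist x (y + s*.(R*.nu y)) = (1 - s)*R" using s R norm_nu[OF y(1)] by (simp add: dist_norm)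
   also have "\<dots> < R" using s R by (simp add: algebra_simps)
   finally show ?thesis using R(2) by auto
  qed
  obtain s where s: "0 < s" "s < 1" "u (y+R*.nu y)-u y = G (y + s*.(R*.nu y)) \<bullet> (R*.nu y)"
   by (rule segment_mvt'[OF frontier_facts(2)[OF y(1)] seg])
  define z where "z = y + s*.(R*.nu y)"
  have ux: "u x = R*(G z \<bullet> nu y)" using s(3) u0[OF y(1)] tb by (simp add: z_def algebra_simps)
  have "dist z y = s*R" using s R norm_nu[OF y(1)] by (simp add: z_def dist_norm)
  also have "\<dots> <= 1*R" using s R by (intro mult_right_mono) auto
  finally have "dist (G z) (G y) < e"
   using lt seg[of s] s closure_subset[of Om] frontier_facts(2)[OF y(1)] by (intro d) (auto simp: z_def R_def)
  have "\<bar>(G z-G y) \<bullet> nu y\<bar> <= norm (G z-G y)*norm (nu y)" by (rule Cauchy_Schwarz_ineq2)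
  hence "\<bar>(G z-G y) \<bullet> nu y\<bar> <= e" using \<open>dist (G z) (G y) < e\<close> norm_nu[OF y(1)] by (simp add: dist_norm)
  moreover have "G y \<bullet> nu y = \<kappa>" using norm_nu[OF y(1)] by (simp add: G_nu dot_square_norm)
  ultimately have "\<bar>G z \<bullet> nu y-\<kappa>\<bar> <= e" by (simp add: inner_diff_left)
  hence "R*\<bar>G z \<bullet> nu y-\<kappa>\<bar> <= R*e" using R by (intro mult_left_mono) auto
  moreover have "u x-\<kappa>*R = R*(G z \<bullet> nu y-\<kappa>)" by (simp add: ux algebra_simps)
  ultimately show ?thesis using R(1) unfolding R_def[symmetric] by (simp add: abs_mult mult.commute)
 qed
 thus ?thesis using that d(1) by blast
qed

text \<open>The domain lies on one side of its boundary: at a boundary point the outward direction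
  leaves the closure. Hence inclusions of open sets can be obtained by passing to limits.\<close>

lemma interior_closure: "interior (closure Om) = Om"
proof
 show "Om <= interior (closure Om)" by (rule interior_maximal[OF closure_subset dom(1)])
 show "interior (closure Om) <= Om"
 proof (rule ccontr)
  assume "\<not> ?thesis"
  then obtain x where x: "x : interior (closure Om)" "x ~: Om" by blast
  hence fx: "x : frontier Om" using interior_subset by (intro frontierI) auto
  have "(- nu x) \<bullet> nu x < 0" using norm_nu[OF fx] by (simp add: dot_square_norm)
  from directions(2)[OF fx this] have "\<forall>\<^sub>F t in at_right 0. x+t*.(- nu x) ~: closure Om" .
  moreover have "((%t. x+t*.(- nu x)) \<longlongrightarrow> x+0*.(- nu x)) (at_right 0)" by (intro tendsto_intros)
  hence "\<forall>\<^sub>F t in at_right 0. x+t*.(- nu x) : interior (closure Om)"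
   using x(1) by (intro topological_tendstoD) auto
  ultimately have "\<forall>\<^sub>F t :: real in at_right 0. False"
   by eventually_elim (use interior_subset in blast)
  thus False by (simp add: trivial_limit_at_right_real)
 qed
qed

end

subsection \<open>Reflections\<close>

definition refl_mat :: "real^'n => real^'n^'n" where
 "refl_mat e = mat 1-2 *. outer e e"

definition reflect :: "real^'n => real => real^'n => real^'n" where
 "reflect e \<mu> x = x+(2*(\<mu>-x \<bullet> e))*.e"

lemma refl_mat_mv: "refl_mat e *v x = x-(2*(e \<bullet> x))*.e"
 by (simp add: refl_mat_def mv_diff mv_scaleR outer_mv)

lemma transpose_refl_mat: "transpose (refl_mat e) = refl_mat e"
 by (simp add: refl_mat_def sym_simps)

lemma reflect_eq: "reflect e \<mu> x = refl_mat e *v x+(2*\<mu>)*.e"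
 by (simp add: reflect_def refl_mat_mv inner_commute algebra_simps)

context
 fixes e :: "real^'n"
 assumes e: "norm e = 1"
begin

lemma ee: "e \<bullet> e = 1" using e by (simp add: norm_eq_1)

lemma refl_mat_mv2: "refl_mat e *v (refl_mat e *v x) = x"
 by (simp add: refl_mat_mv inner_diff_right ee)

lemma refl_mat_sq: "refl_mat e ** refl_mat e = mat 1"
 by (simp add: matrix_eq matrix_vector_mul_assoc[symmetric] refl_mat_mv2)

lemma refl_mat_inner: "(refl_mat e *v x) \<bullet> (refl_mat e *v y) = x \<bullet> y"
 by (simp add: refl_mat_mv inner_diff_right inner_diff_left ee inner_commute)

lemma norm_refl_mat: "norm (refl_mat e *v x) = norm x"
 by (simp add: norm_eq_sqrt_inner refl_mat_inner)

lemma reflect_reflect: "reflect e \<mu> (reflect e \<mu> x) = x"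
 by (simp add: reflect_def inner_add_left ee flip: scaleR_left_distrib)

lemma reflect_inner: "reflect e \<mu> x \<bullet> e = 2*\<mu>-x \<bullet> e"
 by (simp add: reflect_def inner_add_left ee)

lemma reflect_diff: "reflect e \<mu> x-reflect e \<mu> y = refl_mat e *v (x-y)"
 by (simp add: reflect_eq matrix_vector_mult_diff_distrib)

lemma dist_reflect: "dist (reflect e \<mu> x) (reflect e \<mu> y) = dist x y"
 by (simp add: dist_norm reflect_diff norm_refl_mat)

lemma reflect_add: "reflect e \<mu> (x+h) = reflect e \<mu> x+refl_mat e *v h"
 by (simp add: reflect_eq matrix_vector_right_distrib)

lemma reflect_same: "x \<bullet> e = \<mu> ==> reflect e \<mu> x = x"
 by (simp add: reflect_def)

lemma reflect_continuous: "continuous_on S (reflect e \<mu>)"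
 unfolding reflect_def by (intro continuous_intros)

lemma dist_reflect_ge:
 assumes "x \<bullet> e >= \<mu>" "z \<bullet> e >= \<mu>"
 shows "dist x z <= dist x (reflect e \<mu> z)"
proof -
 define b where "b = z \<bullet> e-\<mu>"
 define k where "k = x-z"
 have k: "k \<bullet> e = x \<bullet> e-\<mu>-b" by (simp add: k_def b_def inner_diff_left)
 have "x-reflect e \<mu> z = k+(2*b)*.e" by (simp add: reflect_def b_def k_def algebra_simps)
 hence "(norm (x-reflect e \<mu> z))^2 = (norm k)^2+4*b*(k \<bullet> e)+4*b*b"
  by (simp add: power2_norm_eq_inner inner_add_left inner_add_right ee inner_commute)
 hence "(norm (x-reflect e \<mu> z))^2 = (norm k)^2+4*b*(x \<bullet> e-\<mu>)"
  unfolding k by (simp add: right_diff_distrib)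
 moreover have "4*b*(x \<bullet> e-\<mu>) >= 0" using assms by (simp add: b_def)
 ultimately have "(norm (x-z))^2 <= (norm (x-reflect e \<mu> z))^2" unfolding k_def by linarith
 thus ?thesis unfolding dist_norm by (rule power2_le_imp_le) simp
qed

lemma reflect_form: "(refl_mat e *v x) \<bullet> (X *v (refl_mat e *v x)) = x \<bullet> ((refl_mat e ** X ** refl_mat e) *v x)"
 by (simp add: matrix_vector_mul_assoc[symmetric] sym_dot[OF transpose_refl_mat])

lemma inner_refl_mat: "p \<bullet> (refl_mat e *v x) = (refl_mat e *v p) \<bullet> x"
 by (rule sym_dot[OF transpose_refl_mat])

lemma subjet_reflect:
 assumes "subjet (%y. w (reflect e \<mu> y)) x p X"
 shows "subjet w (reflect e \<mu> x) (refl_mat e *v p) (refl_mat e ** X ** refl_mat e)"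
 unfolding subjet_def
proof (intro allI impI)
 fix \<epsilon> :: real assume "\<epsilon> > 0"
 note ev = assms[unfolded subjet_def, rule_format, OF this]
 have "continuous_on UNIV (reflect e \<mu>)" by (rule reflect_continuous)
 hence "(reflect e \<mu> \<longlongrightarrow> reflect e \<mu> (reflect e \<mu> x)) (nhds (reflect e \<mu> x))"
  by (simp add: continuous_on_eq_continuous_at continuous_at tendsto_at_iff_tendsto_nhds)
 hence "filterlim (reflect e \<mu>) (nhds x) (nhds (reflect e \<mu> x))" by (simp add: reflect_reflect)
 from eventually_compose_filterlim[OF ev this]
 show "\<forall>\<^sub>F y in nhds (reflect e \<mu> x). w (reflect e \<mu> x)+(refl_mat e *v p) \<bullet> (y-reflect e \<mu> x) +
  (y-reflect e \<mu> x) \<bullet> ((refl_mat e ** X ** refl_mat e) *v (y-reflect e \<mu> x))/2-\<epsilon>*(norm (y-reflect e \<mu> x))^2 <= w y"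
 proof eventually_elim
  case (elim y)
  have "reflect e \<mu> y-x = refl_mat e *v (y-reflect e \<mu> x)"
   using reflect_diff[of \<mu> y "reflect e \<mu> x"] by (simp add: reflect_reflect)
  thus ?case using elim
   by (simp only: reflect_reflect reflect_form inner_refl_mat norm_refl_mat)
 qed
qed

lemma GDERIV_reflect:
 assumes "GDERIV w (reflect e \<mu> x) :> D"
 shows "GDERIV (%y. w (reflect e \<mu> y)) x :> refl_mat e *v D"
proof -
 have "(reflect e \<mu> has_derivative (%h. refl_mat e *v h)) (at x)"
  unfolding reflect_eq[abs_def] by (auto intro!: derivative_eq_intros linear_imp_has_derivative)
 from diff_chain_at[OF this assms[unfolded gderiv_def]]
 have "((%y. w (reflect e \<mu> y)) has_derivative (%h. (refl_mat e *v h) \<bullet> D)) (at x)"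
  by (simp add: o_def)
 moreover have "(%h. (refl_mat e *v h) \<bullet> D) = (%h. h \<bullet> (refl_mat e *v D))"
  by (rule ext) (rule inner_refl_mat[symmetric])
 ultimately show ?thesis unfolding gderiv_def by (simp only:)
qed

end

lemma subjet_translate:
 assumes "subjet (%y. w (y-z) + c) x p X"
 shows "subjet w (x-z) p X"
 unfolding subjet_def
proof (intro allI impI)
 fix \<epsilon> :: real assume "\<epsilon> > 0"
 note ev = assms[unfolded subjet_def, rule_format, OF this]
 have "((%y. y+z) \<longlongrightarrow> (x-z)+z) (nhds (x-z))" by (intro tendsto_intros filterlim_ident)
 hence "filterlim (%y. y+z) (nhds x) (nhds (x-z))" by simp
 from eventually_compose_filterlim[OF ev this]
 show "\<forall>\<^sub>F y in nhds (x-z). w (x-z)+p \<bullet> (y-(x-z))+(y-(x-z)) \<bullet> (X *v (y-(x-z)))/2-\<epsilon>*(norm (y-(x-z)))^2 <= w y"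
 proof eventually_elim
  case (elim y)
  have eq: "y+z-x = y-(x-z)" by simp
  show ?case using elim unfolding eq by simp
 qed
qed

lemma superjet_translate:
 assumes "superjet (%y. w (y-z) + c) x p X"
 shows "superjet w (x-z) p X"
 unfolding superjet_def
 by (rule subjet_translate[of _ _ "- c"]) (use assms in \<open>simp add: superjet_def\<close>)

context overdet
begin

lemma M_conj:
 assumes "norm e = 1" "transpose X = X"
 shows "M (refl_mat e ** X ** refl_mat e) = M X" "transpose (refl_mat e ** X ** refl_mat e) = refl_mat e ** X ** refl_mat e"
proof -
 note c = pucci_plus_conj[OF aA _ transpose_refl_mat refl_mat_sq[OF assms(1)]]
 have n: "- (refl_mat e ** X ** refl_mat e) = refl_mat e ** (- X) ** refl_mat e"
  by (simp add: matrix_eq matrix_vector_mul_assoc[symmetric] mv_uminus linear_neg[OF matrix_vector_mul_linear])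
 show "M (refl_mat e ** X ** refl_mat e) = M X"
  using M c[OF assms(2)] c[of "- X"] assms(2) by (auto simp: pucci_minus_eq n sym_simps)
 show "transpose (refl_mat e ** X ** refl_mat e) = refl_mat e ** X ** refl_mat e"
  by (simp only: matrix_transpose_mul transpose_refl_mat assms(2) matrix_mul_assoc)
qed

definition supersol :: "(real^'n) set => (real^'n => real) => bool" where
 "supersol V w \<longleftrightarrow> (\<forall>x\<in>V. \<forall>p X. transpose X = X --> p ~= 0 --> subjet w x p X -->
   M X <= - (lam*w x powr (1+\<alpha>)*norm p powr (- \<alpha>)))"

definition subsol :: "(real^'n) set => (real^'n => real) => bool" where
 "subsol V w \<longleftrightarrow> (\<forall>x\<in>V. \<forall>p X. transpose X = X --> p ~= 0 --> superjet w x p X -->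
   - (lam*w x powr (1+\<alpha>)*norm p powr (- \<alpha>)) <= M X)"

lemma supersol_u: "supersol Om u" and subsol_u: "subsol Om u"
 unfolding supersol_def subsol_def using sup sub by blast+

lemma supersol_subset: "supersol V w ==> W <= V ==> supersol W w"
 and subsol_subset: "subsol V w ==> W <= V ==> subsol W w"
 unfolding supersol_def subsol_def by blast+

lemma refl_nonzero: "norm e = 1 ==> p ~= 0 ==> refl_mat e *v p ~= 0"
 using norm_refl_mat[of e p] by auto

lemma supersol_reflect:
 assumes e: "norm e = 1"
 shows "supersol {x. reflect e \<mu> x : Om} (%x. u (reflect e \<mu> x))"
 unfolding supersol_def
proof (intro ballI allI impI)
 fix x p X assume x: "x : {x. reflect e \<mu> x : Om}" and X: "transpose X = X" and p: "p ~= (0 :: real^'n)" and sj: "subjet (%x. u (reflect e \<mu> x)) x p X"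
 show "M X <= - (lam*u (reflect e \<mu> x) powr (1+\<alpha>)*norm p powr (- \<alpha>))"
  using sup[OF _ M_conj(2)[OF e X] refl_nonzero[OF e p] subjet_reflect[OF e sj]] x M_conj(1)[OF e X] norm_refl_mat[OF e] by simp
qed

lemma M_scaleR: "transpose X = X ==> c >= 0 ==> M (c*.X) = c*M X"
 using M pucci_plus_scaleR[OF aA, of X c] pucci_plus_scaleR[OF aA, of "- X" c]
 by (auto simp: pucci_minus_eq sym_simps)

text \<open>Both terms of the equation are homogeneous of degree \<open>1 + \<alpha>\<close>. This
  is why functions are compared through their ratio and not through their difference.\<close>

lemma supersol_scale:
 assumes w: "supersol V w" and c: "c > 0" and pos: "!!x. x : V ==> w x >= 0"
 shows "supersol V (%x. c*w x)"
 unfolding supersol_def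
proof (intro ballI allI impI)
 fix x p X assume x: "x : V" and X: "transpose X = X" and p: "p ~= 0" and sj: "subjet (%x. c*w x) x p X"
 have "subjet (%y. (1 / c)*(c*w y)) x ((1 / c)*.p) ((1 / c)*.X)" using c by (intro subjet_cmult[OF sj]) simp
 hence "subjet w x ((1 / c)*.p) ((1 / c)*.X)" using c by simp
 hence "M ((1 / c)*.X) <= - (lam*w x powr (1+\<alpha>)*norm ((1 / c)*.p) powr (- \<alpha>))"
  using w[unfolded supersol_def, rule_format, OF x, of "(1 / c)*.X" "(1 / c)*.p"] X p c
  by (simp add: sym_simps)
 hence "(1 / c)*M X <= - (lam*w x powr (1+\<alpha>)*(norm p / c) powr (- \<alpha>))"
  using c X by (simp add: M_scaleR)
 hence "M X <= - (lam*(c*(w x powr (1+\<alpha>)*(norm p / c) powr (- \<alpha>))))"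
  using c by (simp add: field_simps)
 also have "c*(w x powr (1+\<alpha>)*(norm p / c) powr (- \<alpha>)) = (c*w x) powr (1+\<alpha>)*norm p powr (- \<alpha>)"
  using c pos[OF x] by (simp add: powr_divide powr_mult powr_add powr_minus field_simps)
 finally show "M X <= - (lam*(c*w x) powr (1+\<alpha>)*norm p powr (- \<alpha>))" by (simp add: mult_ac)
qed

definition rhs :: "(real^'n => real) => (real^'n => real^'n) => real^'n => real" where
 "rhs w D x = - (lam*w x powr (1+\<alpha>)*norm (D x) powr (- \<alpha>))"

lemma supersol_vsup:
 assumes "supersol V w" "!!x. x : V ==> GDERIV w x :> D x" "!!x. x : V ==> D x ~= 0"
 shows "vsup M (rhs w D) V w"
 unfolding vsup_def
proof (intro ballI allI impI)
 fix x p X assume x: "x : V" and X: "transpose X = X" and sj: "subjet w x p X"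
 have "D x = p" by (rule subjet_gradient[OF sj assms(2)[OF x]])
 thus "M X <= rhs w D x" using assms(1,3) x X sj unfolding supersol_def rhs_def by metis
qed

lemma subsol_vsub:
 assumes "subsol V w" "!!x. x : V ==> GDERIV w x :> D x" "!!x. x : V ==> D x ~= 0"
 shows "vsub M (rhs w D) V w"
 unfolding vsub_def
proof (intro ballI allI impI)
 fix x p X assume x: "x : V" and X: "transpose X = X" and sj: "superjet w x p X"
 have "D x = p" by (rule superjet_gradient[OF sj assms(2)[OF x]])
 thus "rhs w D x <= M X" using assms(1,3) x X sj unfolding subsol_def rhs_def by metis
qed

lemma rhs_continuous:
 assumes "continuous (at x) w" "continuous (at x) D" "w x > 0" "D x ~= 0"
 shows "continuous (at x) (rhs w D)"
 unfolding rhs_def[abs_def] using assms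
 by (intro continuous_intros) auto

text \<open>At a local minimum the strong maximum principle for \<open>u - u x\<close> would make
  \<open>u\<close> locally constant, against \<open>nconst\<close>. This disposes of critical
  contact points, where no test function is available.\<close>

lemma no_local_min:
 assumes x: "x : Om" shows "\<not> (\<forall>\<^sub>F y in nhds x. u x <= u y)"
proof
 assume "\<forall>\<^sub>F y in nhds x. u x <= u y"
 then obtain r where r: "r > 0" "!!y. dist y x < r ==> u x <= u y" unfolding eventually_nhds_metric by blast
 obtain r2 where r2: "r2 > 0" "ball x r2 <= Om" using dom(1) x by (auto simp: open_contains_ball)
 define B where "B = ball x (min r r2)"
 have B: "B <= Om" using r2 by (auto simp: B_def)
 have "hopfable a A 0 B (%y. u y-u x)"
  unfolding hopfable_def
 proof (intro ballI allI impI)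
  fix y p X assume y: "y : B" and X: "transpose X = X" "p ~= 0" "subjet (%y. u y-u x) y p X"
  have "subjet u y p X" by (rule subjet_mono[OF X(3)]) simp
  thus "pucci_minus a A X <= 0*norm p" using hopfableD[OF hopfable_u _ X(1,2)] y B by blast
 qed
 moreover have "continuous_on B (%y. u y-u x)"
  using B closure_subset[of Om] by (intro continuous_intros continuous_on_subset[OF uc]) blast
 moreover have "\<exists>D. GDERIV (%y. u y-u x) y :> D" if "y : B" for y
  using GDERIV_diff[OF GD GDERIV_const] that B by blast
 ultimately have "u y-u x = 0" if "y : B" for y
  using strong_maximum_principle[OF aA order_refl, of B "%y. u y-u x" x y] r r2 that
  by (auto simp: B_def dist_commute)
 hence "\<forall>y\<in>ball x (min r r2). u y = u x" by (auto simp: B_def)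
 moreover have "min r r2 > 0" using r r2 by simp
 ultimately show False using nconst[OF x, of "min r r2"] B unfolding B_def by blast
qed

lemma G_continuous_at: "x : Om ==> continuous (at x) G"
 using Gc closure_subset[of Om] dom(1) by (meson continuous_on_eq_continuous_at continuous_on_subset)

lemma u_continuous_at: "x : Om ==> continuous (at x) u"
 using uc closure_subset[of Om] dom(1) by (meson continuous_on_eq_continuous_at continuous_on_subset)

text \<open>Let \<open>z\<close> be the boundary point nearest to the reflection of
  \<open>x\<close>. Were it too near, its mirror image would lie in the ball in \<open>Om\<close>
  around \<open>x\<close>. Either that image is in the cap, and then \<open>z\<close> is in
  \<open>Om\<close>, or \<open>z\<close> is on the side of \<open>x\<close> and no farther from
  \<open>x\<close> than its image.\<close>

lemma infdist_reflect:
 assumes e: "norm e = 1" and cap: "!!x. x : Om ==> x \<bullet> e > \<mu> ==> reflect e \<mu> x : Om"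
  and x: "x : Om" "x \<bullet> e > \<mu>"
 shows "infdist x (frontier Om) <= infdist (reflect e \<mu> x) (frontier Om)"
proof -
 obtain z where z: "z : frontier Om" "infdist (reflect e \<mu> x) (frontier Om) = dist (reflect e \<mu> x) z"
  using infdist_attains_inf[OF frontier_closed frontier_nonempty] by metis
 show ?thesis
 proof (rule ccontr)
  assume "\<not> ?thesis"
  hence lt: "dist (reflect e \<mu> x) z < infdist x (frontier Om)" using z by simp
  have "dist x (reflect e \<mu> z) < infdist x (frontier Om)"
   using lt dist_reflect[OF e, of \<mu> "reflect e \<mu> x" z] by (simp add: reflect_reflect[OF e])
  hence in1: "reflect e \<mu> z : Om" using ball_in_domain(1)[OF x(1)] by auto
  show False
  proof (cases "reflect e \<mu> z \<bullet> e > \<mu>")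
   case True
   from cap[OF in1 this] show False using frontier_facts(1)[OF z(1)] by (simp add: reflect_reflect[OF e])
  next
   case False
   hence "z \<bullet> e >= \<mu>" by (simp add: reflect_inner[OF e])
   hence "dist x z <= dist x (reflect e \<mu> z)" using dist_reflect_ge[OF e, of \<mu> x z] x by simp
   hence "z : ball x (infdist x (frontier Om))" using \<open>dist x (reflect e \<mu> z) < _\<close> by simp
   thus False using ball_in_domain(1)[OF x(1)] frontier_facts(1)[OF z(1)] by blast
  qed
 qed
qed

end

subsection \<open>Comparison in caps\<close>

context overdet
begin

text \<open>If the gradient at the contact point were not 0, it would be common to both functions,
  and the comparison lemma would give
  \<open>(s v) powr (1 + \<alpha>) <= u powr (1 + \<alpha>)\<close>. But
  \<open>s v = u + \<epsilon>\<close> there; the shift by \<open>\<epsilon>\<close> makes the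
  contradiction strict.\<close>

lemma strict_touching:
 assumes x: "x-z : Om" "x : V" and V: "open V" "!!y. y : V ==> v y > 0" and vs: "supersol V v"
  and vd: "!!y. y : V ==> GDERIV v y :> Dv y" and Dvc: "continuous_on V Dv"
  and s: "s > 0" and \<epsilon>: "\<epsilon> > 0" and eq: "u (x-z)+\<epsilon> = s * v x"
  and le: "\<forall>\<^sub>F y in nhds x. u (y-z)+\<epsilon> <= s * v y"
 shows "G (x-z) = 0"
proof (rule ccontr)
 assume ne: "G (x-z) ~= 0"
 have vc: "continuous_on V v"
  using vd unfolding gderiv_def by (meson continuous_at_imp_continuous_on has_derivative_continuous)
 define U1 where "U1 y = u (y-z)+\<epsilon>" for y
 define V1 where "V1 y = s * v y" for y
 have dU: "GDERIV U1 y :> G (y-z)" if "y-z : Om" for y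
 proof -
  have "((%y. y-z) has_derivative (%h. h)) (at y)" by (auto intro!: derivative_eq_intros)
  from diff_chain_at[OF this GD[OF that, unfolded gderiv_def]]
  have "((%y. u (y-z)) has_derivative (%h. h \<bullet> G (y-z))) (at y)" by (simp add: o_def)
  thus ?thesis unfolding U1_def gderiv_def by (auto intro!: derivative_eq_intros)
 qed
 have dV: "GDERIV V1 y :> s*.Dv y" if "y : V" for y
  using vd[OF that] unfolding V1_def gderiv_def by (auto intro!: derivative_eq_intros)
 have sj: "superjet (%y. U1 y-V1 y) x 0 0"
  by (rule superjet_local_max[OF jet2_const[of 0]])
   (use le eq in \<open>auto simp: U1_def V1_def elim!: eventually_mono\<close>)
 have grad: "G (x-z) = s*.Dv x"
  using superjet_gradient[OF sj GDERIV_diff[OF dU[OF x(1)] dV[OF x(2)]]] by simp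
 define T where "T y = y-z" for y :: "real^'n"
 have Tc: "continuous_on UNIV T" unfolding T_def by (intro continuous_intros)
 have oT: "open (T -` Om)" using dom(1) Tc by (simp add: open_vimage)
 have Gc': "continuous_on (T -` Om) (%y. G (T y))"
  using closure_subset[of Om] by (intro continuous_on_compose2[OF Gc] continuous_on_subset[OF Tc]) auto
 have uc': "continuous_on (T -` Om) (%y. u (T y))"
  using closure_subset[of Om] by (intro continuous_on_compose2[OF uc] continuous_on_subset[OF Tc]) auto
 define W where "W = {y : T -` Om. G (T y) ~= 0} Int {y : V. Dv y ~= 0}"
 have oW: "open W"
 proof -
  have "W = (T -` Om Int (%y. G (T y)) -` (- {0})) Int (V Int Dv -` (- {0}))" by (auto simp: W_def)
  thus ?thesis
   using continuous_open_preimage[OF Gc' oT, of "- {0}"] continuous_open_preimage[OF Dvc V(1), of "- {0}"] by auto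
 qed
 have xW: "x : W" using x ne grad s by (auto simp: W_def T_def)
 have contW: "continuous_on W (%y. G (T y))" "continuous_on W (%y. u (T y))" "continuous_on W Dv" "continuous_on W v"
  using Gc' uc' Dvc vc by (auto intro: continuous_on_subset simp: W_def)
 define g where "g y = rhs (%y. u (T y)) (%y. G (T y)) y" for y
 have "vsub M g W U1"
  unfolding vsub_def
 proof (intro ballI allI impI)
  fix y p X assume y: "y : W" and X: "transpose X = X" "superjet U1 y p X"
  have "superjet u (y-z) p X" using X(2) unfolding U1_def[abs_def] by (rule superjet_translate)
  moreover have "G (y-z) = p" using y by (intro superjet_gradient[OF X(2) dU]) (auto simp: W_def T_def)
  ultimately show "g y <= M X" using sub[of "y-z" X p] X(1) y by (auto simp: g_def rhs_def W_def T_def)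
 qed
 moreover have "vsup M (rhs V1 (%y. s*.Dv y)) W V1"
 proof (rule supersol_vsup)
  show "supersol W V1"
   unfolding V1_def by (rule supersol_subset[OF supersol_scale[OF vs s]]) (use V(2) in \<open>auto simp: W_def less_imp_le\<close>)
 qed (use dV s in \<open>auto simp: W_def\<close>)
 moreover have "continuous (at x) g"
  unfolding g_def using x(1) ne contW oW xW upos
  by (intro rhs_continuous) (auto simp: T_def continuous_on_eq_continuous_at)
 moreover have "continuous (at x) (rhs V1 (%y. s*.Dv y))"
  using contW oW xW V(2)[OF x(2)] s grad ne
  by (intro rhs_continuous) (auto simp: V1_def[abs_def] continuous_on_eq_continuous_at intro!: continuous_intros)
 moreover have "continuous_on W U1" "continuous_on W V1"
  using contW unfolding U1_def V1_def T_def by (auto intro!: continuous_intros)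
 ultimately have "g x-rhs V1 (%y. s*.Dv y) x <= pucci_plus a A (0 :: real^'n^'n)"
  using pucci_comparison[OF aA M oW xW _ _ _ _ _ _ sj] by (simp add: transpose_zero)
 hence "lam*(V1 x powr (1+\<alpha>)-u (x-z) powr (1+\<alpha>))*norm (G (x-z)) powr (- \<alpha>) <= 0"
  by (simp add: g_def rhs_def T_def grad[symmetric] pucci_plus_zero[OF aA] algebra_simps)
 moreover have "norm (G (x-z)) powr (- \<alpha>) > 0" using ne by simp
 moreover have "u (x-z) powr (1+\<alpha>) < V1 x powr (1+\<alpha>)"
  using upos[OF x(1)] eq \<epsilon> alpha by (intro powr_less_mono2) (auto simp: V1_def)
 ultimately show False using lam by (auto simp: mult_le_0_iff zero_less_mult_iff not_le[symmetric])
qed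

text \<open>The comparison function \<open>v\<close> is compared with translates of \<open>u + \<epsilon>\<close>, which are strict subsolutions.
 All contact points must be critical, so the optimal constant does not depend on the translation and
 \<open>v\<close> has a local minimum.\<close>

lemma ratio_argument:
 assumes Sig: "open \<Sigma>" "\<Sigma> <= Om" and vpos: "!!y. y : \<Sigma> ==> v y > 0" and vs: "supersol \<Sigma> v"
  and vd: "!!y. y : \<Sigma> ==> GDERIV v y :> Dv y" and Dvc: "continuous_on \<Sigma> Dv"
  and nomin: "!!y. y : \<Sigma> ==> \<not> (\<forall>\<^sub>F w in nhds y. v y <= v w)"
  and comp: "!!s. s > 1 ==> compact {x : \<Sigma>. u x >= s * v x}"
  and x: "x : \<Sigma>"
 shows "u x <= v x"
proof (rule ccontr)
 assume "\<not> u x <= v x"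
 define q where "q = u x / v x"
 have q: "q > 1" using \<open>\<not> u x <= v x\<close> vpos[OF x] by (simp add: q_def)
 define s1 where "s1 = (1+q)/2"
 have s1: "1 < s1" "s1 < q" using q by (auto simp: s1_def)
 define C where "C = {x : \<Sigma>. u x >= s1 * v x}"
 have C: "compact C" "C <= \<Sigma>" using comp[OF s1(1)] by (auto simp: C_def)
 have "q * v x = u x" using vpos[OF x] by (simp add: q_def)
 hence xC: "x : C" using s1 vpos[OF x] x mult_right_mono[of s1 q "v x"] by (simp add: C_def)
 have vc: "continuous_on \<Sigma> v"
  using vd unfolding gderiv_def by (meson continuous_at_imp_continuous_on has_derivative_continuous)
 have ucS: "continuous_on Om u" using closure_subset by (rule continuous_on_subset[OF uc])
 obtain d0 where d0: "d0 > 0" "(\<Union>x\<in>C. ball x d0) <= \<Sigma>"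
  using compact_subset_open_imp_ball_epsilon_subset[OF C(1) Sig(1) C(2)] by blast
 define d where "d = d0/4"
 have d: "d > 0" using d0 by (simp add: d_def)
 have near\<Sigma>: "y : \<Sigma>" if "infdist y C <= 3*d" for y
 proof -
  obtain w where w: "w : C" "infdist y C = dist y w"
   using infdist_attains_inf[OF compact_imp_closed[OF C(1)]] xC by (metis empty_iff)
  hence "y : ball w d0" using that d d0 by (simp add: d_def dist_commute)
  thus ?thesis using d0(2) w(1) by blast
 qed
 define E where "E = {y. infdist y C <= d}"
 define E2 where "E2 = {y. infdist y C <= 2*d}"
 have bE: "compact {y. infdist y C <= r}" for r
 proof -
  have "closed {y. infdist y C <= r}" by (intro closed_Collect_le continuous_intros)
  moreover have "bounded {y. infdist y C <= r}"
  proof -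
   obtain b where b: "!!w. w : C ==> norm w <= b" using compact_imp_bounded[OF C(1)] by (auto simp: bounded_iff)
   have "norm y <= b+r" if "infdist y C <= r" for y
   proof -
    obtain w where w: "w : C" "infdist y C = dist y w"
     using infdist_attains_inf[OF compact_imp_closed[OF C(1)]] xC by (metis empty_iff)
    have "norm y <= norm w+dist y w" by (metis add.commute dist_norm norm_triangle_sub)
    thus ?thesis using b[OF w(1)] w(2) that by simp
   qed
   thus ?thesis by (auto simp: bounded_iff)
  qed
  ultimately show ?thesis by (simp add: compact_eq_bounded_closed)
 qed
 have E: "compact E" "E <= \<Sigma>" "C <= E" and E2: "compact E2" "E2 <= \<Sigma>" "E2 <= Om"
  using bE near\<Sigma> d Sig(2) by (auto simp: E_def E2_def)
 have tr: "infdist (y-z) C <= 2*d" if "infdist y C <= d" "norm z < d" for y z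
  using infdist_triangle[of "y-z" C y] that by (simp add: dist_norm)
 have "E ~= {}" using xC E(3) by blast
 then obtain ym where ym: "ym : E" "!!y. y : E ==> v ym <= v y"
  using continuous_attains_inf[OF E(1) _ continuous_on_subset[OF vc E(2)]] by blast
 define vm where "vm = v ym"
 have vm: "vm > 0" "!!y. y : E ==> vm <= v y" using ym vpos E(2) by (auto simp: vm_def)
 \<comment> \<open>Outside \<open>C\<close> the ratio \<open>u / v\<close> is below
   \<open>s1\<close>. With this \<open>\<epsilon>\<close>, the shift and the translation together
   cannot raise it to \<open>q\<close>, so all maximisers stay in the interior of
   \<open>E\<close>.\<close>
 define \<epsilon> where "\<epsilon> = (q - s1) * vm/4"
 have \<epsilon>: "\<epsilon> > 0" using vm s1 by (simp add: \<epsilon>_def)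
 have "uniformly_continuous_on E2 u" by (intro compact_uniformly_continuous continuous_on_subset[OF ucS] E2)
 then obtain d1 where d1: "d1 > 0" "!!y w. y : E2 ==> w : E2 ==> dist w y < d1 ==> dist (u w) (u y) < \<epsilon>"
  using \<epsilon> unfolding uniformly_continuous_on_def by meson
 define z0 where "z0 = min d d1"
 have z0: "z0 > 0" "z0 <= d" "z0 <= d1" using d d1 by (auto simp: z0_def)
 have osc: "\<bar>u (y-z)-u y\<bar> <= \<epsilon>" if "y : E" "norm z < z0" for y z
 proof -
  have "y-z : E2" "y : E2" using tr[of y z] that z0 d by (auto simp: E_def E2_def)
  thus ?thesis using d1(2)[of y "y-z"] that z0 by (auto simp: dist_norm)
 qed
 define Q where "Q z y = (u (y-z)+\<epsilon>) / v y" for z y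
 have Qc: "continuous_on E (Q z)" if "norm z < z0" for z
  unfolding Q_def
 proof (intro continuous_intros continuous_on_compose2[OF ucS])
  show "(%y. y-z) ` E <= Om" using tr that z0 E2(3) by (auto simp: E_def E2_def)
  show "continuous_on E v" by (rule continuous_on_subset[OF vc E(2)])
  show "\<forall>y\<in>E. v y ~= 0" using vpos E(2) by force
 qed
 have "\<exists>y\<in>E. \<forall>w\<in>E. Q z w <= Q z y" if "norm z < z0" for z
  using continuous_attains_sup[OF E(1) \<open>E ~= {}\<close> Qc[OF that]] by blast
 then obtain P where P: "!!z. norm z < z0 ==> P z : E" "!!z w. norm z < z0 ==> w : E ==> Q z w <= Q z (P z)"
  by metis
 define S where "S z = Q z (P z)" for z
 have Sle: "u (w-z)+\<epsilon> <= S z * v w" if "norm z < z0" "w : E" for z w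
  using P(2)[OF that] vpos[of w] E(2) that by (auto simp: S_def Q_def pos_divide_le_eq[of "v w"])
 have Seq: "u (P z-z)+\<epsilon> = S z * v (P z)" if "norm z < z0" for z
  using vpos[of "P z"] E(2) P(1)[OF that] by (auto simp: S_def Q_def dest!: subsetD)
 have S_pos: "S z > 0" if "norm z < z0" for z
 proof -
  have "P z-z : Om" using tr[of "P z" z] P(1)[OF that] that z0 E2(3) by (auto simp: E_def E2_def)
  hence "S z * v (P z) > 0" using Seq[OF that] upos[of "P z-z"] \<epsilon> by simp
  thus ?thesis using vpos[of "P z"] E(2) P(1)[OF that] by (auto simp: zero_less_mult_iff dest!: subsetD)
 qed
 have inner: "infdist (P z) C < d" if z: "norm z < z0" for z
 proof (rule ccontr)
  assume "\<not> ?thesis"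
  hence "infdist (P z) C = d" using P(1)[OF z] by (auto simp: E_def)
  hence "P z ~: C" using d by auto
  hence less: "u (P z) < s1 * v (P z)" using P(1)[OF z] E(2) by (auto simp: C_def)
  have PE: "P z : E" by (rule P(1)[OF z])
  have "S z * v (P z) < s1 * v (P z)+2*\<epsilon>" using Seq[OF z] osc[OF PE z] less by linarith
  also have "2*\<epsilon> <= (q - s1)/2 * v (P z)"
   using mult_left_mono[OF vm(2)[OF PE], of "(q - s1)/2"] s1 by (simp add: \<epsilon>_def)
  finally have "S z * v (P z) < (s1+(q - s1)/2) * v (P z)" by (simp add: algebra_simps)
  hence "S z < s1+(q - s1)/2" using vpos[of "P z"] E(2) PE by (auto dest!: subsetD)
  moreover have "S z >= q"
  proof -
   have xE: "x : E" using xC E(3) by blast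
   have "S z * v x >= u x" using Sle[OF z xE] osc[OF xE z] by linarith
   thus ?thesis using vpos[OF x] by (simp add: q_def pos_divide_le_eq)
  qed
  ultimately show False using s1 by (simp add: field_simps)
 qed
 have intE: "\<forall>\<^sub>F y in nhds (P z). y : E" if "norm z < z0" for z
 proof -
  have "open {y. infdist y C < d}" by (intro open_Collect_less continuous_intros)
  from eventually_nhds_in_open[OF this, of "P z"] show ?thesis
   using inner[OF that] by (auto simp: E_def elim: eventually_mono)
 qed
 have crit: "G (P z-z) = 0" if z: "norm z < z0" for z
 proof (rule strict_touching[where V = \<Sigma> and v = v and Dv = Dv and s = "S z" and \<epsilon> = \<epsilon>])
  show "P z-z : Om" using tr[of "P z" z] P(1)[OF z] z z0 E2(3) by (auto simp: E_def E2_def)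
  show "P z : \<Sigma>" using P(1)[OF z] E(2) by blast
  show "\<forall>\<^sub>F y in nhds (P z). u (y-z)+\<epsilon> <= S z * v y"
   using intE[OF z] by eventually_elim (rule Sle[OF z])
 qed (use Sig vpos vs vd Dvc S_pos[OF z] \<epsilon> Seq[OF z] in auto)
 have "uniformly_continuous_on (closure Om) G" by (intro compact_uniformly_continuous Gc compact_closure)
 note uG = this
 \<comment> \<open>An envelope argument: the gradient of \<open>u\<close> vanishes at the maximiser
   for \<open>z\<close>, so passing to \<open>z'\<close> changes the value there by little compared
   with \<open>norm (z - z')\<close>. By symmetry \<open>S\<close> has derivative 0.\<close>
 have Smono: "\<exists>\<delta>>0. \<forall>z z'. norm z < z0 --> norm z' < z0 --> norm (z-z') < \<delta> --> S z-S z' <= r*norm (z-z')" if r: "r > 0" for r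
 proof -
  have "r * vm > 0" using r vm by simp
  then obtain \<delta> where \<delta>: "\<delta> > 0" "!!y w. y : closure Om ==> w : closure Om ==> dist w y < \<delta> ==> dist (G w) (G y) < r * vm"
   using uG unfolding uniformly_continuous_on_def by meson
  have "S z-S z' <= r*norm (z-z')" if z: "norm z < z0" and z': "norm z' < z0" and dz: "norm (z-z') < \<delta>" for z z'
  proof -
   define y h where "y = P z-z" and "h = z-z'"
   have PE: "P z : E" by (rule P(1)[OF z])
   have seg: "y+t*.h : Om" if t: "0 <= t" "t <= 1" for t
   proof -
    have "y+t*.h = P z-((1-t)*.z+t*.z')" by (simp add: y_def h_def algebra_simps)
    moreover have "norm ((1-t)*.z+t*.z') < z0"
     using convexD[OF convex_ball, of z 0 z0 z' "1-t" t] z z' t by simp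
    ultimately show ?thesis using tr[of "P z"] PE z0 E2(3) by (auto simp: E_def E2_def)
   qed
   obtain t where t: "0 < t" "t < 1" "u (y+h)-u y = G (y+t*.h) \<bullet> h"
    by (rule segment_mvt'[of y h]) (use seg seg[of 0] closure_subset[of Om] in auto)
   have "dist (y+t*.h) y = t*norm h" using t by (simp add: dist_norm)
   also have "\<dots> <= 1*norm h" using t by (intro mult_right_mono) auto
   finally have "dist (G (y+t*.h)) (G y) < r * vm"
    using seg[of t] seg[of 0] t dz closure_subset[of Om] by (intro \<delta>(2)) (auto simp: h_def)
   hence "norm (G (y+t*.h)) < r * vm" using crit[OF z] by (simp add: y_def)
   moreover have "\<bar>G (y+t*.h) \<bullet> h\<bar> <= norm (G (y+t*.h))*norm h" by (rule Cauchy_Schwarz_ineq2)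
   ultimately have "\<bar>G (y+t*.h) \<bullet> h\<bar> <= r * vm*norm h" by (meson less_imp_le mult_right_mono norm_ge_zero order_trans)
   moreover have yh: "y+h = P z-z'" by (simp add: y_def h_def)
   ultimately have "u y <= u (P z-z')+r * vm*norm h" using t(3) unfolding yh by linarith
   hence "u (P z-z) <= u (P z-z')+r * vm*norm h" unfolding y_def .
   hence "S z * v (P z) <= S z' * v (P z)+r*norm h * vm"
    using Sle[OF z' PE] Seq[OF z] by (simp add: mult_ac)
   also have "r*norm h * vm <= r*norm h * v (P z)" using vm(2)[OF PE] r by (intro mult_left_mono) auto
   finally have "S z * v (P z) <= (S z'+r*norm h) * v (P z)" by (simp add: algebra_simps)
   hence "S z <= S z'+r*norm h" using vpos[of "P z"] E(2) PE by (auto dest!: subsetD)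
   thus ?thesis by (simp add: h_def)
  qed
  thus ?thesis using \<delta>(1) by blast
 qed
 have "(S has_derivative (%h. 0)) (at z within ball 0 z0)" if z: "z : ball 0 z0" for z
  unfolding has_derivative_within_alt
 proof (intro conjI allI impI)
  show "bounded_linear (%h :: real^'n. 0 :: real)" by simp
  fix r :: real assume "r > 0"
  then obtain \<delta> where \<delta>: "\<delta> > 0" "!!z z'. norm z < z0 ==> norm z' < z0 ==> norm (z-z') < \<delta> ==> S z-S z' <= r*norm (z-z')"
   using Smono by blast
  show "\<exists>d>0. \<forall>y\<in>ball 0 z0. norm (y-z) < d --> norm (S y-S z-0) <= r*norm (y-z)"
  proof (intro exI[of _ \<delta>] conjI ballI impI \<delta>(1))
   fix y assume y: "y : ball 0 z0" "norm (y-z) < \<delta>"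
   have "S y-S z <= r*norm (y-z)" "S z-S y <= r*norm (z-y)"
    using \<delta>(2)[of y z] \<delta>(2)[of z y] y z by (auto simp: norm_minus_commute)
   thus "norm (S y-S z-0) <= r*norm (y-z)" by (simp add: norm_minus_commute abs_le_iff)
  qed
 qed
 then obtain c where "!!z. z : ball 0 z0 ==> S z = c"
  using has_derivative_zero_constant[OF convex_ball, of 0 z0 S] by blast
 hence Sc: "S z = S 0" if "norm z < z0" for z using that z0 by simp
 define x0 where "x0 = P 0"
 have x0: "x0 : E" "infdist x0 C < d" using P(1)[of 0] inner[of 0] z0 by (auto simp: x0_def)
 \<comment> \<open>For \<open>z = w - x0\<close> the value of \<open>u\<close> compared with
   \<open>v w\<close> is \<open>u (w - z) = u x0\<close>, whatever \<open>w\<close> is; as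
   \<open>S z = S 0\<close>, this gives \<open>v x0 <= v w\<close>.\<close>
 have "\<forall>\<^sub>F w in nhds x0. v x0 <= v w"
 proof -
  have "open {y. infdist y C < d}" by (intro open_Collect_less continuous_intros)
  from eventually_nhds_in_open[OF this, of x0] have "\<forall>\<^sub>F w in nhds x0. infdist w C < d" using x0 by simp
  moreover have "\<forall>\<^sub>F w in nhds x0. w : ball x0 z0" using z0 by (intro eventually_nhds_in_open) auto
  ultimately show ?thesis
  proof eventually_elim
   case (elim w)
   have nz: "norm (w-x0) < z0" using elim by (simp add: dist_norm norm_minus_commute)
   have "w : E" using elim by (simp add: E_def)
   from Sle[OF nz this] have "u x0+\<epsilon> <= S 0 * v w" using Sc[OF nz] by simp
   moreover have "u x0+\<epsilon> = S 0 * v x0" using Seq[of 0] z0 by (simp add: x0_def)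
   ultimately show ?case using S_pos[of 0] z0 by simp
  qed
 qed
 thus False using nomin[of x0] x0 E(2) by blast
qed

text \<open>The ratio argument with the reflected solution as \<open>v\<close>. What has to be shown
  is compactness of the set where \<open>u >= s v\<close> for \<open>s > 1\<close>. It cannot
  accumulate on the plane inside \<open>Om\<close>, where \<open>u = v > 0\<close>; nor on the
  boundary, since there \<open>u\<close> and \<open>v\<close> are close to \<open>\<kappa>\<close>
  times the distances of \<open>x\<close> and of its reflection, and the second distance is the
  larger one.\<close>

lemma weak_comparison:
 assumes e: "norm e = 1" and cap: "!!x. x : Om ==> x \<bullet> e > \<mu> ==> reflect e \<mu> x : Om"
  and x: "x : Om" "x \<bullet> e > \<mu>"
 shows "u x <= u (reflect e \<mu> x)"
proof -
 define \<Sigma> where "\<Sigma> = Om Int {x. x \<bullet> e > \<mu>}"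
 define v where "v x = u (reflect e \<mu> x)" for x
 have rS: "reflect e \<mu> y : Om" if "y : \<Sigma>" for y using that cap by (auto simp: \<Sigma>_def)
 have "u x <= v x"
 proof (rule ratio_argument[where \<Sigma> = \<Sigma> and Dv = "%x. refl_mat e *v G (reflect e \<mu> x)"])
  show "open \<Sigma>" unfolding \<Sigma>_def by (intro open_Int dom open_Collect_less continuous_intros)
  show "supersol \<Sigma> v" unfolding v_def by (rule supersol_subset[OF supersol_reflect[OF e]]) (use rS in auto)
  show "GDERIV v y :> refl_mat e *v G (reflect e \<mu> y)" if "y : \<Sigma>" for y
   unfolding v_def by (rule GDERIV_reflect[OF e GD[OF rS[OF that]]])
  show "continuous_on \<Sigma> (%x. refl_mat e *v G (reflect e \<mu> x))"
   using rS closure_subset[of Om]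
   by (intro continuous_on_compose2[OF matrix_vector_mult_linear_continuous_on[of UNIV]] continuous_on_compose2[OF Gc]
     reflect_continuous[OF e]) auto
  show "\<not> (\<forall>\<^sub>F w in nhds y. v y <= v w)" if y: "y : \<Sigma>" for y
  proof
   assume ev: "\<forall>\<^sub>F w in nhds y. v y <= v w"
   have "(reflect e \<mu> \<longlongrightarrow> reflect e \<mu> (reflect e \<mu> y)) (nhds (reflect e \<mu> y))"
    using reflect_continuous[OF e, of UNIV \<mu>]
    by (simp add: continuous_on_eq_continuous_at continuous_at tendsto_at_iff_tendsto_nhds)
   hence "filterlim (reflect e \<mu>) (nhds y) (nhds (reflect e \<mu> y))" by (simp add: reflect_reflect[OF e])
   from eventually_compose_filterlim[OF ev this] have "\<forall>\<^sub>F w in nhds (reflect e \<mu> y). u (reflect e \<mu> y) <= u w"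
    by (simp add: v_def reflect_reflect[OF e])
   thus False using no_local_min[OF rS[OF y]] by blast
  qed
  show "compact {x : \<Sigma>. s * v x <= u x}" if s: "s > 1" for s
  proof -
   let ?K = "{x : \<Sigma>. s * v x <= u x}"
   let ?W = "closure Om Int reflect e \<mu> -` closure Om"
   have cW: "closed ?W"
    by (intro closed_Int closed_closure closed_vimage reflect_continuous[OF e])
   have KW: "?K <= ?W" using rS closure_subset[of Om] by (auto simp: \<Sigma>_def)
   have hc: "continuous_on ?W (%x. u x - s * v x)"
    unfolding v_def by (intro continuous_intros continuous_on_subset[OF uc] continuous_on_compose2[OF uc] reflect_continuous[OF e]) auto
   have "closed (?W Int (%x. u x - s * v x) -` {0..})" by (rule continuous_closed_preimage[OF hc cW closed_atLeast])
   moreover have "?K <= ?W Int (%x. u x - s * v x) -` {0..}" using KW by auto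
   ultimately have clK: "closure ?K <= ?W Int (%x. u x - s * v x) -` {0..}" by (rule closure_minimal[rotated])
   have "closure ?K <= ?K"
   proof
    fix y assume y: "y : closure ?K"
    hence yW: "y : closure Om" "reflect e \<mu> y : closure Om" "s * v y <= u y" using clK by auto
    have ye: "y \<bullet> e >= \<mu>"
    proof -
     have "closed {x. \<mu> <= x \<bullet> e}" by (intro closed_Collect_le continuous_intros)
     moreover have "?K <= {x. \<mu> <= x \<bullet> e}" by (auto simp: \<Sigma>_def)
     ultimately show ?thesis using y closure_minimal by blast
    qed
    show "y : ?K"
    proof (cases "y : Om")
     case True
     have "y \<bullet> e ~= \<mu>"
     proof
      assume "y \<bullet> e = \<mu>"
      hence "s*u y <= u y" using yW(3) by (simp add: v_def reflect_same[OF e])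
      thus False using upos[OF True] s by (simp add: field_simps)
     qed
     thus ?thesis using True ye yW(3) by (simp add: \<Sigma>_def)
    next
     case False
     hence fy: "y : frontier Om" using yW(1) by (rule frontierI[rotated])
     have "v y >= 0" unfolding v_def by (rule u_nonneg[OF yW(2)])
     moreover have "s * v y <= 0" using yW(3) u0[OF fy] by simp
     ultimately have "u (reflect e \<mu> y) = 0" using s by (simp add: v_def mult_le_0_iff)
     hence fr: "reflect e \<mu> y : frontier Om" using upos[of "reflect e \<mu> y"] frontierI[OF yW(2)] by force
     \<comment> \<open>A relative error for which \<open>\<kappa> + r < s (\<kappa> - r)\<close>,
       that is, small against the gap between \<open>s\<close> and 1.\<close>
     define r where "r = \<kappa>*(s-1)/(2*(s+1))"
     have r: "r > 0" using kappa_pos s by (simp add: r_def)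
     have "r*(s+1) = \<kappa>*(s-1)/2" using s by (simp add: r_def field_simps)
     moreover have "\<kappa>*(s-1) > 0" using kappa_pos s by simp
     ultimately have "r*(s+1) < \<kappa>*(s-1)" by linarith
     hence rr: "\<kappa>+r < s*(\<kappa>-r)" by (simp add: algebra_simps)
     have rk: "r < \<kappa>"
     proof -
      have "0 < s*(\<kappa>-r)" using rr kappa_pos r by linarith
      thus ?thesis using s by (simp add: zero_less_mult_iff)
     qed
     obtain d where d: "d > 0" "!!x. x : Om ==> infdist x (frontier Om) < d ==>
      \<bar>u x-\<kappa>*infdist x (frontier Om)\<bar> <= r*infdist x (frontier Om)" using near_boundary[OF r] by metis
     obtain w where w: "w : ?K" "dist w y < d" using y d(1) unfolding closure_approachable by blast
     define D1 D2 where "D1 = infdist w (frontier Om)" and "D2 = infdist (reflect e \<mu> w) (frontier Om)"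
     have wOm: "w : Om" "w \<bullet> e > \<mu>" "w : \<Sigma>" using w(1) by (auto simp: \<Sigma>_def)
     have "D1 <= dist w y" unfolding D1_def by (rule infdist_le[OF fy])
     moreover have "D2 <= dist (reflect e \<mu> w) (reflect e \<mu> y)" unfolding D2_def by (rule infdist_le[OF fr])
     ultimately have D: "D1 < d" "D2 < d" using w(2) by (auto simp: dist_reflect[OF e])
     have D12: "D1 <= D2" unfolding D1_def D2_def by (rule infdist_reflect[OF e cap wOm(1,2)])
     have D1p: "D1 > 0" unfolding D1_def by (rule ball_in_domain(2)[OF wOm(1)])
     have "u w <= (\<kappa>+r)*D1" using d(2)[OF wOm(1)] D by (simp add: D1_def abs_le_iff algebra_simps)
     moreover have "v w >= (\<kappa>-r)*D2" using d(2)[OF rS[OF wOm(3)]] D by (simp add: D2_def v_def abs_le_iff algebra_simps)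
     hence "s * v w >= s*((\<kappa>-r)*D2)" using s by (intro mult_left_mono) auto
     moreover have "s*((\<kappa>-r)*D2) >= s*((\<kappa>-r)*D1)" using s rk D12 by (intro mult_left_mono) auto
     moreover have "s * v w <= u w" using w(1) by simp
     ultimately have "s*((\<kappa>-r)*D1) <= (\<kappa>+r)*D1" by linarith
     hence "s*(\<kappa>-r) <= \<kappa>+r" using D1p by (simp add: mult.assoc[symmetric])
     thus ?thesis using rr by simp
    qed
   qed
   hence "closed ?K" using closure_subset_eq by blast
   moreover have "bounded ?K" using dom(3) by (rule bounded_subset) (auto simp: \<Sigma>_def)
   ultimately show ?thesis by (simp add: compact_eq_bounded_closed)
  qed
 qed (use rS upos x in \<open>auto simp: \<Sigma>_def v_def\<close>)
 thus ?thesis by (simp add: v_def)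
qed

end

subsection \<open>The difference of the solution and its reflection near the boundary\<close>

lemma powr_lipschitz:
 fixes b :: real
 assumes "0 < c0"
 shows "\<exists>K\<ge>0. \<forall>s\<in>{c0..C0}. \<forall>t\<in>{c0..C0}. \<bar>s powr b-t powr b\<bar> <= K*\<bar>s-t\<bar>"
proof -
 have "continuous_on {c0..C0} (%s. b * s powr (b-1))"
  using assms by (intro continuous_intros) auto
 hence "bounded ((%s. b * s powr (b-1)) ` {c0..C0})"
  by (intro compact_imp_bounded compact_continuous_image) auto
 then obtain K where K: "K > 0" "!!s. s : {c0..C0} ==> \<bar>b * s powr (b-1)\<bar> <= K"
  unfolding bounded_pos by force
 have "\<bar>s powr b-t powr b\<bar> <= K*\<bar>s-t\<bar>" if st: "s : {c0..C0}" "t : {c0..C0}" for s t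
 proof -
  have "norm (s powr b-t powr b) <= K*norm (s-t)"
  proof (rule field_differentiable_bound[of "{c0..C0}" "%s. s powr b" "%s. b * s powr (b-1)"])
   fix z assume z: "z : {c0..C0}"
   hence "z > 0" using assms by simp
   thus "((%s. s powr b) has_field_derivative b*z powr (b-1)) (at z within {c0..C0})"
    by (rule has_field_derivative_at_within[OF has_real_derivative_powr])
   show "norm (b*z powr (b-1)) <= K" using K(2)[OF z] by simp
  qed (use st in auto)
  thus ?thesis by simp
 qed
 thus ?thesis using K(1) less_imp_le by blast
qed

lemma brep_continuous: "brep \<eta> Om x \<rho> D H r L ==> continuous_on S \<rho>"
 unfolding brep_def gderiv_def by (meson continuous_at_imp_continuous_on has_derivative_continuous)

context overdet
begin

lemma monotone_direction:
 assumes x: "x : frontier Om" and h: "norm h = 1" "h \<bullet> nu x > 0"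
 obtains \<rho> D H r L r1 where "brep \<eta> Om x \<rho> D H r L" "D x = norm (D x)*.nu x" "0 < r1" "r1 <= r"
  "!!y s. y : ball x r1 ==> s >= 0 ==> y + s*.h : ball x r1 ==> \<rho> y + s*(h \<bullet> nu x)/2 <= \<rho> (y + s*.h)"
proof -
 obtain \<rho> D H r L where b: "brep \<eta> Om x \<rho> D H r L" and Dx: "D x = norm (D x)*.nu x" using boundary_rep_nu[OF x] .
 have r: "0 < r" "0 < L" and gd: "!!y. GDERIV \<rho> y :> D y" and D1: "1 <= norm (D x)"
  and Lip: "!!y z. y : ball x r ==> z : ball x r ==> norm (D y-D z) <= L*norm (y-z)"
  using b unfolding brep_def by blast+
 define c where "c = h \<bullet> nu x/2"
 have c: "c > 0" "2 * c <= D x \<bullet> h"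
 proof -
  show "c > 0" using h by (simp add: c_def)
  have "D x \<bullet> h = norm (D x)*(h \<bullet> nu x)" by (subst Dx) (simp add: inner_commute)
  thus "2 * c <= D x \<bullet> h" using D1 h by (simp add: c_def)
 qed
 define r1 where "r1 = min r (c/L)"
 have r1: "0 < r1" "r1 <= r" using r c by (auto simp: r1_def)
 have half: "c <= D y \<bullet> h" if y: "y : ball x r1" for y
 proof -
  have "\<bar>(D y-D x) \<bullet> h\<bar> <= norm (D y-D x)" using Cauchy_Schwarz_ineq2[of "D y-D x" h] h by simp
  also have "\<dots> <= L*norm (y-x)" using y r1 r by (intro Lip) auto
  also have "\<dots> <= L*(c/L)" using y r by (intro mult_left_mono) (auto simp: dist_norm norm_minus_commute r1_def)
  finally show ?thesis using c r by (simp add: inner_diff_left)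
 qed
 have "\<rho> y + s*(h \<bullet> nu x)/2 <= \<rho> (y + s*.h)" if y: "y : ball x r1" "s >= 0" "y + s*.h : ball x r1" for y s
 proof -
  have "continuous_on {0..1} (%t. \<rho> (y+t*.(s*.h)))"
   by (rule continuous_on_compose2[OF brep_continuous[OF b, of UNIV]]) (auto intro!: continuous_intros)
  then obtain t where t: "0 < t" "t < 1" "\<rho> (y + s*.h)-\<rho> y = D (y+t*.(s*.h)) \<bullet> (s*.h)"
   by (rule GDERIV_mvt[of \<rho> y "s*.h" D]) (rule gd)
  have "y+t*.(s*.h) = (1-t)*.y+t*.(y + s*.h)" by (simp add: algebra_simps)
  also have "\<dots> : ball x r1" using t by (intro convexD[OF convex_ball] y) auto
  finally have "s * c <= s*(D (y+t*.(s*.h)) \<bullet> h)" using y(2) by (intro mult_left_mono half)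
  thus ?thesis using t(3) by (simp add: c_def)
 qed
 thus ?thesis using that[OF b Dx r1] by blast
qed

text \<open>The strong maximum principle needs a connected set. Every point of the domain near
  \<open>x\<close> and in \<open>P\<close> is joined by a segment in the direction of the normal to
  one convex piece \<open>C\<close> deeper inside; the assumption on \<open>P\<close> keeps these
  segments in \<open>P\<close>.\<close>

lemma local_nbhd:
 assumes x: "x : frontier Om" and r: "r > 0" and P: "open P" "convex P" "!!y s. y : P ==> s >= 0 ==> y + s*.nu x : P"
 obtains U r2 where "open U" "connected U" "U <= Om Int ball x r Int P" "0 < r2" "Om Int ball x r2 Int P <= U"
proof -
 obtain \<rho> D H r0 L r1 where b: "brep \<eta> Om x \<rho> D H r0 L" and r1: "0 < r1" "r1 <= r0"
  and mono: "!!y s. y : ball x r1 ==> s >= 0 ==> y + s*.nu x : ball x r1 ==> \<rho> y + s/2 <= \<rho> (y + s*.nu x)"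
  using monotone_direction[OF x norm_nu[OF x]] norm_nu[OF x] unfolding dot_square_norm by (metis mult.right_neutral one_power2 zero_less_one)
 have \<rho>x: "\<rho> x = 0" and om: "Om Int ball x r0 = {y : ball x r0. 0 < \<rho> y}" using b unfolding brep_def by blast+
 define r3 s0 where "r3 = min r1 r" and "s0 = r3/2"
 have r3: "r3 > 0" "r3 <= r1" "r3 <= r" "s0 > 0" using r1 r by (auto simp: r3_def s0_def)
 have "isCont \<rho> x" using brep_continuous[OF b, of UNIV] by (simp add: continuous_on_eq_continuous_at)
 then obtain d where d: "d > 0" "!!y. dist y x < d ==> dist (\<rho> y) (\<rho> x) < s0/2"
  using r3 unfolding continuous_at_eps_delta by (metis half_gt_zero)
 define r2 where "r2 = min d (r3/4)"
 have r2: "r2 > 0" "r2 <= d" "r2 <= r3/4" using d r3 by (auto simp: r2_def)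
 have bnd: "y + s*.nu x : ball x r3" if "y : ball x r2" "0 <= s" "s <= s0" for y s
 proof -
  have "norm (y + s*.nu x-x) <= norm (y-x)+norm (s*.nu x)"
   using norm_triangle_ineq[of "y-x" "s*.nu x"] by (simp add: algebra_simps)
  also have "\<dots> < r2 + s0" using that norm_nu[OF x] by (simp add: dist_norm norm_minus_commute)
  finally show ?thesis using r2 r3 by (simp add: dist_norm norm_minus_commute s0_def)
 qed
 have rr: "ball x r3 <= ball x r1" "ball x r3 <= ball x r0" "ball x r3 <= ball x r" using r3 r1 by auto
 have up: "\<rho> y + s/2 <= \<rho> (y + s*.nu x)" if "y : ball x r2" "0 <= s" "s <= s0" for y s
  using bnd[OF that] bnd[OF that(1), of 0] that r3 rr by (intro mono) auto
 define B where "B = Om Int ball x r2 Int P"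
 define C where "C = ball (x + s0*.nu x) r2 Int P"
 have Csub: "C <= Om Int ball x r Int P"
 proof
  fix z assume z: "z : C"
  define y where "y = z - s0*.nu x"
  have y: "y : ball x r2" using z by (simp add: C_def y_def dist_norm algebra_simps)
  have zy: "z = y + s0*.nu x" by (simp add: y_def)
  have "\<bar>\<rho> y\<bar> < s0/2" using d(2)[of y] y r2 \<rho>x by (simp add: dist_commute)
  hence "\<rho> z > 0" using up[OF y, of s0] r3 zy by simp
  moreover have "z : ball x r3" unfolding zy using bnd[OF y] r3 by simp
  ultimately have "z : {y : ball x r0. 0 < \<rho> y}" "z : ball x r" using rr by blast+
  thus "z : Om Int ball x r Int P" using om z unfolding C_def by blast
 qed
 define F where "F y = (%s. y + s*.nu x) ` {0..s0} Un C" for y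
 define U where "U = (\<Union>y\<in>B. F y)"
 have Fsub: "F y <= Om Int ball x r Int P" if y: "y : B" for y
 proof -
  have "y + s*.nu x : Om Int ball x r Int P" if s: "s : {0..s0}" for s
  proof -
   have yb: "y : ball x r2" "y : Om" "y : P" using y by (auto simp: B_def)
   have "y : ball x r0" using bnd[OF yb(1), of 0] r3 rr by auto
   hence "\<rho> y > 0" using om yb(2) by blast
   hence "\<rho> (y + s*.nu x) > 0" using up[OF yb(1), of s] s by simp
   moreover have "y + s*.nu x : ball x r3" using bnd[OF yb(1)] s by simp
   ultimately have "y + s*.nu x : Om" "y + s*.nu x : ball x r" using om rr by blast+
   thus ?thesis using P(3)[OF yb(3)] s by simp
  qed
  thus ?thesis using Csub by (auto simp: F_def)
 qed
 have endC: "y + s0*.nu x : C" if "y : B" for y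
  using that P(3)[of y s0] r3 by (auto simp: C_def B_def dist_norm)
 have "connected (F y)" if y: "y : B" for y
 proof -
  have "connected ((%s. y + s*.nu x) ` {0..s0})" by (intro connected_continuous_image continuous_intros) auto
  moreover have "connected C" unfolding C_def by (intro convex_connected convex_Int convex_ball P)
  moreover have "(%s. y + s*.nu x) ` {0..s0} Int C ~= {}"
   using endC[OF y] r3 unfolding ex_in_conv[symmetric]
   by (intro exI[of _ "y + s0*.nu x"] IntI image_eqI[of _ _ s0]) auto
  ultimately show ?thesis unfolding F_def by (rule connected_Un)
 qed
 moreover have "\<Inter> (F ` B) ~= {}" if "B ~= {}"
 proof -
  obtain y where "y : B" using \<open>B ~= {}\<close> by blast
  hence "y + s0*.nu x : \<Inter> (F ` B)" using endC by (auto simp: F_def)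
  thus ?thesis by blast
 qed
 ultimately have "connected U" unfolding U_def by (cases "B = {}") (auto intro!: connected_Union)
 moreover have "open U"
 proof -
  have oB: "open B" unfolding B_def by (intro open_Int dom P) auto
  have oC: "open C" unfolding C_def by (intro open_Int P) auto
  have "U = (\<Union>s\<in>{0..s0}. (%y. s*.nu x+y) ` B) Un (if B = {} then {} else C)"
   by (auto simp: U_def F_def add.commute)
  thus ?thesis using oC by (simp add: open_UN open_translation[OF oB] open_Un)
 qed
 moreover have "U <= Om Int ball x r Int P" using Fsub by (auto simp: U_def)
 moreover have "Om Int ball x r2 Int P <= U"
 proof
  fix y assume "y : Om Int ball x r2 Int P"
  hence "y : B" by (simp add: B_def)
  moreover have "y : F y" using r3 by (force simp: F_def)
  ultimately show "y : U" by (auto simp: U_def)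
 qed
 ultimately show ?thesis using that r2(1) by blast
qed

lemma gradient_near_frontier:
 assumes x: "x : frontier Om"
 obtains r where "r > 0" "!!y. y : closure Om ==> y : ball x r ==> \<kappa>/2 <= norm (G y) & norm (G y) <= 2*\<kappa>"
proof -
 have k2: "\<kappa>/2 > 0" using kappa_pos by simp
 obtain r where r: "r > 0" "!!y. y : closure Om ==> dist y x < r ==> dist (G y) (G x) < \<kappa>/2"
  using Gc[unfolded continuous_on_iff, rule_format, OF frontier_facts(2)[OF x] k2] by blast
 have "\<kappa>/2 <= norm (G y) & norm (G y) <= 2*\<kappa>" if "y : closure Om" "y : ball x r" for y
 proof -
  have "norm (G y-G x) < \<kappa>/2" using r(2)[of y] that by (simp add: dist_commute) (simp add: dist_norm norm_minus_commute)
  thus ?thesis using norm_G_frontier[OF x] norm_triangle_ineq3[of "G y" "G x"] kappa_pos by (auto simp: abs_le_iff)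
 qed
 thus ?thesis using that r(1) by blast
qed

lemma u_bounded: obtains C1 where "C1 > 0" "!!x. x : closure Om ==> u x <= C1"
proof -
 have "bounded (u ` closure Om)" by (intro compact_imp_bounded compact_continuous_image uc compact_closure)
 then obtain C1 where C1: "C1 > 0" "\<forall>x\<in>closure Om. \<bar>u x\<bar> <= C1" unfolding bounded_pos by auto
 show ?thesis by (rule that[OF C1(1)]) (use C1(2) in \<open>auto simp: abs_le_iff\<close>)
qed

lemma vsub_u: "W <= Om ==> (!!x. x : W ==> G x ~= 0) ==> vsub M (rhs u G) W u"
 by (rule subsol_vsub[OF subsol_subset[OF subsol_u]]) (use GD in auto)

lemma vsup_u: "W <= Om ==> (!!x. x : W ==> G x ~= 0) ==> vsup M (rhs u G) W u"
 by (rule supersol_vsup[OF supersol_subset[OF supersol_u]]) (use GD in auto)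

text \<open>The comparison lemma bounds \<open>pucci_minus\<close> by a difference of right-hand
  sides. Their dependence on the values has the favourable sign because \<open>u\<close> lies below
  its reflection, and their dependence on the gradient is Lipschitz because both gradients have
  length between \<open>\<kappa>/2\<close> and \<open>2 \<kappa>\<close>.\<close>

lemma diff_hopfable:
 assumes e: "norm e = 1" and W: "open W" "W <= Om" "!!x. x : W ==> reflect e \<mu> x : Om"
  and le: "!!x. x : W ==> u x <= u (reflect e \<mu> x)"
  and gb: "!!x. x : W ==> \<kappa>/2 <= norm (G x) & norm (G x) <= 2*\<kappa>"
   "!!x. x : W ==> \<kappa>/2 <= norm (G (reflect e \<mu> x)) & norm (G (reflect e \<mu> x)) <= 2*\<kappa>"
 shows "\<exists>C\<ge>0. hopfable a A C W (%x. u (reflect e \<mu> x)-u x)"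
proof -
 obtain C1 where C1: "C1 > 0" "!!x. x : closure Om ==> u x <= C1" using u_bounded by blast
 obtain K where K: "K >= 0" "!!s t. s : {\<kappa>/2..2*\<kappa>} ==> t : {\<kappa>/2..2*\<kappa>} ==>
   \<bar>s powr (- \<alpha>)-t powr (- \<alpha>)\<bar> <= K*\<bar>s-t\<bar>"
  using powr_lipschitz[of "\<kappa>/2" "2*\<kappa>" "- \<alpha>"] kappa_pos by auto
 define C where "C = lam*C1 powr (1+\<alpha>)*K"
 have "C >= 0" using lam K by (simp add: C_def)
 define v where "v x = u (reflect e \<mu> x)" for x
 define Dv where "Dv x = refl_mat e *v G (reflect e \<mu> x)" for x
 have dv: "GDERIV v x :> Dv x" if "x : W" for x
  unfolding v_def Dv_def by (rule GDERIV_reflect[OF e GD[OF W(3)[OF that]]])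
 have nDv: "norm (Dv x) = norm (G (reflect e \<mu> x))" for x by (simp add: Dv_def norm_refl_mat[OF e])
 have Dne: "Dv x ~= 0" "G x ~= 0" if "x : W" for x using gb[OF that] kappa_pos nDv[of x] by auto
 have rc: "continuous_on W (reflect e \<mu>)" by (rule reflect_continuous[OF e])
 have clo: "W <= closure Om" "reflect e \<mu> ` W <= closure Om" using W closure_subset[of Om] by auto
 have vc: "continuous_on W v" unfolding v_def by (rule continuous_on_compose2[OF uc rc clo(2)])
 have Dvc: "continuous_on W Dv" unfolding Dv_def
  by (intro continuous_on_compose2[OF matrix_vector_mult_linear_continuous_on[of UNIV]] continuous_on_compose2[OF Gc rc clo(2)]) auto
 have ucW: "continuous_on W u" and GcW: "continuous_on W G" using continuous_on_subset[OF uc clo(1)] continuous_on_subset[OF Gc clo(1)] by auto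
 have "hopfable a A C W (%x. v x-u x)"
  unfolding hopfable_def
 proof (intro ballI allI impI)
  fix x p X assume x: "x : W" and X: "transpose X = X" and sj: "subjet (%x. v x-u x) x p X"
  have p: "Dv x-G x = p"
   by (rule subjet_gradient[OF sj GDERIV_diff[OF dv[OF x] GD]]) (use x W in auto)
  have xOm: "x : Om" "x : closure Om" "reflect e \<mu> x : Om" using x W clo by auto
  have "superjet (%x. u x - v x) x (- p) (- X)" using sj by (simp add: superjet_def)
  moreover have "vsub M (rhs u G) W u" using W(2) Dne by (intro vsub_u) auto
  moreover have "vsup M (rhs v Dv) W v"
  proof (rule supersol_vsup)
   show "supersol W v" using supersol_subset[OF supersol_reflect[OF e, of \<mu>], of W] W(3) unfolding v_def by blast
  qed (rule dv Dne, assumption)+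
  moreover have "continuous (at x) (rhs v Dv)" "continuous (at x) (rhs u G)"
   using vc Dvc ucW GcW W(1) x Dne[OF x] upos[OF xOm(1)] upos[OF xOm(3)]
   by (auto intro!: rhs_continuous simp: continuous_on_eq_continuous_at[OF W(1)]) (simp add: v_def)
  ultimately have "rhs u G x-rhs v Dv x <= pucci_plus a A (- X)"
   using X by (intro pucci_comparison[OF aA M W(1) x ucW vc]) (auto simp: sym_simps)
  hence "pucci_minus a A X <= rhs v Dv x-rhs u G x" by (simp add: pucci_minus_eq)
  also have "\<dots> = lam*(u x powr (1+\<alpha>)*norm (G x) powr (- \<alpha>) - v x powr (1+\<alpha>)*norm (Dv x) powr (- \<alpha>))"
   by (simp add: rhs_def algebra_simps)
  also have "\<dots> <= lam*(u x powr (1+\<alpha>)*norm (G x) powr (- \<alpha>)-u x powr (1+\<alpha>)*norm (Dv x) powr (- \<alpha>))"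
   using lam le[OF x] upos[OF xOm(1)] alpha
   by (intro mult_left_mono diff_left_mono mult_right_mono powr_mono2) (auto simp: v_def)
  also have "\<dots> = lam*(u x powr (1+\<alpha>)*(norm (G x) powr (- \<alpha>)-norm (Dv x) powr (- \<alpha>)))" by (simp add: algebra_simps)
  also have "\<dots> <= lam*(C1 powr (1+\<alpha>)*(K*norm p))"
  proof (intro mult_left_mono order_trans[OF mult_left_mono mult_right_mono])
   show "u x powr (1+\<alpha>) <= C1 powr (1+\<alpha>)"
    using C1(2)[OF xOm(2)] upos[OF xOm(1)] alpha by (intro powr_mono2) auto
   have "norm (G x) powr (- \<alpha>)-norm (Dv x) powr (- \<alpha>) <= K*\<bar>norm (G x)-norm (Dv x)\<bar>"
    using K(2)[of "norm (G x)" "norm (Dv x)"] gb[OF x] by (simp add: nDv)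
   also have "\<dots> <= K*norm p"
    using K(1) norm_triangle_ineq3[of "G x" "Dv x"] p by (intro mult_left_mono) (auto simp: norm_minus_commute)
   finally show "norm (G x) powr (- \<alpha>)-norm (Dv x) powr (- \<alpha>) <= K*norm p" .
  qed (use lam K(1) in auto)
  finally show "pucci_minus a A X <= C*norm p" by (simp add: C_def mult_ac)
 qed
 thus ?thesis using \<open>C >= 0\<close> by (auto simp: v_def)
qed

section \<open>Contact of the reflected cap with the boundary\<close>

definition cap_ok :: "real^'n => real => bool" where
 "cap_ok e \<mu> \<longleftrightarrow> (\<forall>x\<in>Om. x \<bullet> e > \<mu> --> reflect e \<mu> x : Om)"

definition Sset :: "real^'n => real => (real^'n) set" where
 "Sset e \<mu> = {x : frontier Om. x \<bullet> e > \<mu> & reflect e \<mu> x : frontier Om}"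

text \<open>By the strong maximum principle the difference vanishes identically near
  \<open>x\<close> or is positive. If it vanishes, reflected boundary points have
  \<open>u = 0\<close> and thus lie on the boundary. The set \<open>P\<close> is the whole space for
  a contact off the plane, and the open side of the plane at a corner.\<close>

lemma local_dichotomy:
 assumes e: "norm e = 1" and cap: "cap_ok e \<mu>" and x: "x : frontier Om" and rx: "reflect e \<mu> x : frontier Om" and r: "r > 0"
  and P: "open P" "convex P" "!!y s. y : P ==> s >= 0 ==> y + s*.nu x : P" "!!y. y : P ==> y : ball x r ==> y \<bullet> e > \<mu>"
 obtains r2 C where "r2 > 0" "C >= 0" "r2 <= r" "hopfable a A C (Om Int ball x r2 Int P) (%x. u (reflect e \<mu> x)-u x)"
  "(\<forall>y\<in>frontier Om Int ball x r2 Int P. y : Sset e \<mu>) | (\<forall>y\<in>Om Int ball x r2 Int P. u y < u (reflect e \<mu> y))"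
proof -
 obtain r3 where r3: "r3 > 0" "!!y. y : closure Om ==> y : ball x r3 ==> \<kappa>/2 <= norm (G y) & norm (G y) <= 2*\<kappa>"
  using gradient_near_frontier[OF x] by metis
 obtain r4 where r4: "r4 > 0" "!!y. y : closure Om ==> y : ball (reflect e \<mu> x) r4 ==> \<kappa>/2 <= norm (G y) & norm (G y) <= 2*\<kappa>"
  using gradient_near_frontier[OF rx] by metis
 define r5 where "r5 = Min {r, r3, r4}"
 have r5: "r5 > 0" "r5 <= r" "r5 <= r3" "r5 <= r4" using r r3 r4 by (auto simp: r5_def)
 obtain U r2 where U: "open U" "connected U" "U <= Om Int ball x r5 Int P" and r2: "0 < r2" "Om Int ball x r2 Int P <= U"
  using local_nbhd[OF x r5(1) P(1-3)] by metis
 define w where "w y = u (reflect e \<mu> y)-u y" for y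
 have UOm: "y : Om" "y \<bullet> e > \<mu>" "reflect e \<mu> y : Om" "y : ball x r3" "reflect e \<mu> y : ball (reflect e \<mu> x) r4" if "y : U" for y
 proof -
  have y: "y : Om" "y : ball x r5" "y : P" using U(3) that by auto
  hence "y \<bullet> e > \<mu>" using P(4) r5 by auto
  thus "y : Om" "y \<bullet> e > \<mu>" "reflect e \<mu> y : Om" "y : ball x r3" "reflect e \<mu> y : ball (reflect e \<mu> x) r4"
   using y cap r5 by (auto simp: cap_ok_def dist_reflect[OF e])
 qed
 have wnn: "w y >= 0" if "y : U" for y
  using weak_comparison[OF e _ UOm(1,2)[OF that]] cap unfolding w_def cap_ok_def by auto
 have "\<exists>C\<ge>0. hopfable a A C U (%x. u (reflect e \<mu> x)-u x)"
 proof (rule diff_hopfable[OF e U(1)])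
  show "U <= Om" using UOm(1) by blast
  fix y assume y: "y : U"
  show "reflect e \<mu> y : Om" using UOm(3)[OF y] .
  show "u y <= u (reflect e \<mu> y)" using wnn[OF y] by (simp add: w_def)
  show "\<kappa>/2 <= norm (G y) & norm (G y) <= 2*\<kappa>"
   by (rule r3(2)[OF subsetD[OF closure_subset] UOm(4)]) (rule UOm(1)[OF y], rule y)
  show "\<kappa>/2 <= norm (G (reflect e \<mu> y)) & norm (G (reflect e \<mu> y)) <= 2*\<kappa>"
   by (rule r4(2)[OF subsetD[OF closure_subset] UOm(5)]) (rule UOm(3)[OF y], rule y)
 qed
 then obtain C where C: "C >= 0" "hopfable a A C U w" unfolding w_def by blast
 have clU: "U <= closure Om" "reflect e \<mu> ` U <= closure Om" using UOm(1,3) closure_subset[of Om] by blast+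
 have wc: "continuous_on U w"
  unfolding w_def by (intro continuous_intros continuous_on_subset[OF uc clU(1)] continuous_on_compose2[OF uc reflect_continuous[OF e] clU(2)])
 have wd: "\<exists>D. GDERIV w y :> D" if "y : U" for y
  unfolding w_def using GDERIV_diff[OF GDERIV_reflect[OF e GD] GD] UOm(1,3)[OF that] by blast
 define r6 where "r6 = min r2 r"
 have r6: "r6 > 0" "r6 <= r" "Om Int ball x r6 Int P <= U" using r2 r by (auto simp: r6_def)
 have "(\<forall>y\<in>frontier Om Int ball x r6 Int P. y : Sset e \<mu>) | (\<forall>y\<in>Om Int ball x r6 Int P. u y < u (reflect e \<mu> y))"
 proof (cases "\<exists>y\<in>U. w y = 0")
  case True
  hence w0: "w y = 0" if "y : U" for y
   using strong_maximum_principle[OF aA C(1) U(1,2) wc wnn C(2) wd] that by blast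
  have "y : Sset e \<mu>" if y: "y : frontier Om Int ball x r6 Int P" for y
  proof -
   let ?V = "Om Int ball x r6 Int P"
   have "open (ball x r6 Int P)" using P(1) by auto
   hence ycl: "y : closure ?V"
    using y frontier_facts(2)[of y] open_Int_closure_subset[of "ball x r6 Int P" Om] by (auto simp: Int_ac)
   let ?W = "closure Om Int reflect e \<mu> -` closure Om"
   have hc: "continuous_on ?W w"
    unfolding w_def by (intro continuous_intros continuous_on_subset[OF uc] continuous_on_compose2[OF uc] reflect_continuous[OF e]) auto
   have cW: "closed ?W" by (intro closed_Int closed_closure closed_vimage reflect_continuous[OF e])
   have "closed (?W Int w -` {0})" by (rule continuous_closed_preimage[OF hc cW closed_singleton])
   moreover have "?V <= ?W Int w -` {0}" using r6(3) clU w0 by (intro subsetI IntI vimageI2 singletonI) blast+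
   ultimately have "closure ?V <= ?W Int w -` {0}" by (rule closure_minimal[rotated])
   hence "reflect e \<mu> y : closure Om" "w y = 0" using ycl by auto
   moreover have "u y = 0" using y u0 by auto
   ultimately have "reflect e \<mu> y : frontier Om" using upos[of "reflect e \<mu> y"] by (intro frontierI) (auto simp: w_def)
   moreover have "y \<bullet> e > \<mu>" using P(4)[of y] y r6(2) by auto
   ultimately show ?thesis using y by (simp add: Sset_def)
  qed
  thus ?thesis by blast
 next
  case False
  hence "w y > 0" if "y : U" for y using wnn[OF that] that by (metis less_eq_real_def)
  thus ?thesis using r6(3) by (auto simp: w_def)
 qed
 thus ?thesis using that[OF r6(1) C(1) r6(2)] hopfable_subset[OF C(2) r6(3)] unfolding w_def by blast
qed

text \<open>If the difference were positive, Hopf's lemma would make the normal derivative of the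
  reflected solution at \<open>x\<close> larger than \<open>\<kappa>\<close>. But its gradient there
  has length \<open>\<kappa>\<close>, since the reflected point is a boundary point too.\<close>

lemma Sset_open:
 assumes e: "norm e = 1" and cap: "cap_ok e \<mu>" and x: "x : Sset e \<mu>"
 shows "\<exists>r>0. frontier Om Int ball x r <= Sset e \<mu>"
proof -
 have fx: "x : frontier Om" "x \<bullet> e > \<mu>" "reflect e \<mu> x : frontier Om" using x by (auto simp: Sset_def)
 have "open {y. y \<bullet> e > \<mu>}" by (intro open_Collect_less continuous_intros)
 then obtain r where r: "r > 0" "ball x r <= {y. y \<bullet> e > \<mu>}" using fx(2) by (auto simp: open_contains_ball)
 obtain r2 C where r2: "r2 > 0" "C >= 0" "r2 <= r" and hop: "hopfable a A C (Om Int ball x r2 Int UNIV) (%x. u (reflect e \<mu> x)-u x)"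
  and alt: "(\<forall>y\<in>frontier Om Int ball x r2 Int UNIV. y : Sset e \<mu>) | (\<forall>y\<in>Om Int ball x r2 Int UNIV. u y < u (reflect e \<mu> y))"
  by (rule local_dichotomy[OF e cap fx(1,3) r(1), of UNIV]) (use r(2) in auto)
 have "\<not> (\<forall>y\<in>Om Int ball x r2 Int UNIV. u y < u (reflect e \<mu> y))"
 proof
  assume pos: "\<forall>y\<in>Om Int ball x r2 Int UNIV. u y < u (reflect e \<mu> y)"
  obtain R0 where R0: "R0 > 0" "!!R. 0 < R ==> R <= R0 ==> cball (x+R*.nu x) R - {x} <= Om" using interior_ball[OF fx(1)] by metis
  define R where "R = min R0 (r2/3)"
  have R: "R > 0" "R <= R0" "R <= r2/3" using R0 r2 by (auto simp: R_def)
  define y0 where "y0 = x+R*.nu x"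
  note nn = norm_nu[OF fx(1)]
  have cb: "cball y0 R - {x} <= Om" unfolding y0_def by (rule R0(2)[OF R(1,2)])
  have near: "cball y0 R <= ball x r2"
  proof
   fix y assume "y : cball y0 R"
   moreover have "dist x y0 = R" using nn R by (simp add: y0_def dist_norm)
   ultimately show "y : ball x r2" using dist_triangle[of x y y0] R by simp
  qed
  have "x ~: ball y0 R" using nn R by (simp add: y0_def dist_norm)
  hence bb: "ball y0 R <= Om Int ball x r2 Int UNIV" using cb near by (auto simp: subset_eq)
  define w where "w y = u (reflect e \<mu> y)-u y" for y
  have inW: "y : closure Om & reflect e \<mu> y : closure Om & w y >= 0" if y: "y : cball y0 R" for y
  proof (cases "y = x")
   case True
   thus ?thesis using frontier_facts(2) fx u0 by (simp add: w_def)
  next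
   case False
   hence "y : Om" "y : ball x r2" using cb near y by auto
   hence "y : ball x r" using r2(3) by auto
   hence "y \<bullet> e > \<mu>" using r(2) by blast
   thus ?thesis using \<open>y : Om\<close> \<open>y : ball x r2\<close> cap pos closure_subset[of Om] by (auto simp: cap_ok_def w_def less_imp_le)
  qed
  have wc: "continuous_on (cball y0 R) w"
   unfolding w_def using inW
   by (intro continuous_intros continuous_on_subset[OF uc] continuous_on_compose2[OF uc] reflect_continuous[OF e]) auto
  have "\<exists>\<epsilon>>0. \<forall>y\<in>cball y0 R. \<epsilon>*(R-norm (y-y0)) <= w y"
  proof (rule hopf_lemma[OF aA r2(2) R(1) wc])
   show "hopfable a A C (ball y0 R) w" unfolding w_def by (rule hopfable_subset[OF hop bb])
   show "0 < w y" if "y : ball y0 R" for y using pos bb that by (auto simp: w_def subset_eq)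
  qed (use inW in auto)
  then obtain \<epsilon> where \<epsilon>: "\<epsilon> > 0" "!!y. y : cball y0 R ==> \<epsilon>*(R-norm (y-y0)) <= w y" by blast
  have evx: "\<forall>\<^sub>F t in at_right 0. x+t*.nu x : Om" using directions(1)[OF fx(1)] nn by (simp add: dot_square_norm)
  have lim1: "((%t. u (x+t*.nu x)/t) \<longlongrightarrow> \<kappa>) (at_right 0)"
   using directional_limit[OF fx(1) evx] nn by (simp add: G_nu dot_square_norm)
  have "((%t. x+t*.nu x) \<longlongrightarrow> x+0*.nu x) (at_right 0)" by (intro tendsto_intros)
  hence "\<forall>\<^sub>F t in at_right 0. x+t*.nu x : {y. y \<bullet> e > \<mu>}"
   using fx(2) \<open>open {y. y \<bullet> e > \<mu>}\<close> by (intro topological_tendstoD) auto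
  with evx have evr: "\<forall>\<^sub>F t in at_right 0. reflect e \<mu> x+t*.(refl_mat e *v nu x) : Om"
  proof eventually_elim
   case (elim t)
   hence "reflect e \<mu> (x+t*.nu x) : Om" using cap by (simp add: cap_ok_def)
   thus ?case by (simp add: reflect_add[OF e] matrix_vector_mult_scaleR)
  qed
  have lim2: "((%t. u (reflect e \<mu> x+t*.(refl_mat e *v nu x))/t) \<longlongrightarrow> G (reflect e \<mu> x) \<bullet> (refl_mat e *v nu x)) (at_right 0)"
   by (rule directional_limit[OF fx(3) evr])
  have "G (reflect e \<mu> x) \<bullet> (refl_mat e *v nu x) <= norm (G (reflect e \<mu> x))*norm (refl_mat e *v nu x)"
   by (rule norm_cauchy_schwarz)
  also have "\<dots> = \<kappa>" using norm_G_frontier[OF fx(3)] nn by (simp add: norm_refl_mat[OF e])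
  finally have g\<kappa>: "G (reflect e \<mu> x) \<bullet> (refl_mat e *v nu x) <= \<kappa>" .
  have "\<forall>\<^sub>F t in at_right 0. \<epsilon> <= u (reflect e \<mu> x+t*.(refl_mat e *v nu x))/t-u (x+t*.nu x)/t"
   unfolding eventually_at_right_field
  proof (intro exI[of _ R] conjI allI impI R(1))
   fix t assume t: "0 < t" "t < R"
   have eq: "x+t*.nu x-y0 = - ((R-t)*.nu x)" by (simp add: y0_def algebra_simps)
   hence n: "norm (x+t*.nu x-y0) = R-t" using t nn by simp
   hence "x+t*.nu x : cball y0 R" using t by (simp add: dist_norm norm_minus_commute)
   from \<epsilon>(2)[OF this] have "\<epsilon>*t <= u (reflect e \<mu> x+t*.(refl_mat e *v nu x))-u (x+t*.nu x)"
    unfolding n by (simp add: w_def reflect_add[OF e] matrix_vector_mult_scaleR)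
   thus "\<epsilon> <= u (reflect e \<mu> x+t*.(refl_mat e *v nu x))/t-u (x+t*.nu x)/t"
    using t by (simp add: diff_divide_distrib[symmetric] pos_le_divide_eq)
  qed
  hence "\<epsilon> <= G (reflect e \<mu> x) \<bullet> (refl_mat e *v nu x)-\<kappa>"
   by (rule tendsto_lowerbound[OF tendsto_diff[OF lim2 lim1]]) simp
  thus False using g\<kappa> \<epsilon>(1) by simp
 qed
 hence "frontier Om Int ball x r2 <= Sset e \<mu>" using alt by auto
 thus ?thesis using r2(1) by blast
qed

end

subsection \<open>A barrier at a corner between two orthogonal balls\<close>

lemma jet2_powr:
 assumes w: "jet2 w x p X" and s: "w x > 0"
 shows "jet2 (%y. w y powr q) x ((q*w x powr (q-1))*.p)
  ((q*w x powr (q-1))*.X+(q*(q-1)*w x powr (q-2)) *. outer p p)"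
proof (rule jet2_compose[OF w], rule peano_real[where ?g1.0 = "%s. q * s powr (q-1)"])
 have "\<forall>\<^sub>F y in nhds (w x). y > 0" using s eventually_nhds_in_open[of "{0<..}" "w x"] by simp
 thus "\<forall>\<^sub>F y in nhds (w x). ((%s. s powr q) has_real_derivative q*y powr (q-1)) (at y)"
  by eventually_elim (rule has_real_derivative_powr)
 have "((%s. q * s powr (q-1)) has_real_derivative q*((q-1)*w x powr (q-1-1))) (at (w x))"
  by (intro DERIV_cmult has_real_derivative_powr s)
 thus "((%s. q * s powr (q-1)) has_real_derivative q*(q-1)*w x powr (q-2)) (at (w x))"
  by (simp add: mult.assoc)
qed

text \<open>\<open>2 R\<close> times this function is \<open>R^2\<close> minus the squared distance
  from \<open>Q + R n\<close>. It vanishes on the sphere through \<open>Q\<close> with that centre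
  and has gradient \<open>n\<close> at \<open>Q\<close>.\<close>

definition capfun :: "real => real^'n => real^'n => real^'n => real" where
 "capfun R Q n y = n \<bullet> (y-Q)-(norm (y-Q))^2/(2*R)"

lemma capfun_ball: "R > 0 ==> norm n = 1 ==> 0 <= capfun R Q n y \<longleftrightarrow> y : cball (Q+R*.n) R"
proof -
 assume R: "R > 0" and n: "norm n = 1"
 have "(norm (z-R*.n))^2 = R^2-2*R*(n \<bullet> z-(norm z)^2/(2*R))" for z
  using R n unfolding norm_diff_square by (simp add: field_simps power2_eq_square inner_commute)
 hence "(norm (y-Q-R*.n))^2 = R^2-2*R * capfun R Q n y" by (simp add: capfun_def)
 hence "norm (y-Q-R*.n) <= R \<longleftrightarrow> 0 <= R * capfun R Q n y"
  using R abs_le_square_iff[of "norm (y-Q-R*.n)" R] by simp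
 thus ?thesis using R by (simp add: dist_norm norm_minus_commute[of "Q+R*.n"] diff_diff_eq zero_le_mult_iff)
qed

lemma capfun_le: "R > 0 ==> norm n = 1 ==> capfun R Q n y <= norm (y-Q)"
 using norm_cauchy_schwarz[of n "y-Q"] by (simp add: capfun_def) (smt (verit) divide_nonneg_pos zero_le_power2)

lemma jet2_capfun:
 "jet2 (capfun R Q n) x (n-(1/R)*.(x-Q)) (- ((1/R)*.mat 1))"
proof -
 have "jet2 (%y. (n \<bullet> y-n \<bullet> Q)-(1/(2*R))*(norm (y-Q))^2) x
   ((n-0)-(1/(2*R))*.(2*.(x-Q))) ((0-0)-(1/(2*R))*.(2*.mat 1))"
  by (intro jet2_diff jet2_inner jet2_const jet2_cmult jet2_norm2)
 moreover have "(%y. (n \<bullet> y-n \<bullet> Q)-(1/(2*R))*(norm (y-Q))^2) = capfun R Q n"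
  by (auto simp: capfun_def inner_diff_right)
 ultimately show ?thesis by simp
qed

text \<open>For \<open>n \<bullet> n' = 0\<close> the two gradients are orthogonal wherever both
  functions vanish, and their product is small nearby; this keeps the trace of the Hessian of the
  product small.\<close>

lemma capfun_gradients:
 shows "(n-(1/R)*.(x-Q)) \<bullet> (n'-(1/R)*.(x-Q)) = n \<bullet> n'-(capfun R Q n x + capfun R Q n' x)/R"
proof -
 have "(n - c*.z) \<bullet> (n' - c*.z) = n \<bullet> n'-(n \<bullet> z-(norm z)^2 * c/2+(n' \<bullet> z-(norm z)^2 * c/2)) * c" for c z
  by (simp add: inner_diff_left inner_diff_right inner_commute power2_norm_eq_inner algebra_simps)
 from this[of "1/R" "x-Q"] show ?thesis by (simp add: capfun_def)
qed

text \<open>With \<open>s = h k\<close>, its gradient \<open>g\<close> and \<open>t = h + k\<close>: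
  the indefinite part of the Hessian of \<open>s\<close> costs at most \<open>2 N (A - a)\<close>,
  while the power gains \<open>(q - 1) a \<bar>g\<bar>^2 / s\<close>. This is at least
  \<open>2 (q - 1) a\<close> up to terms of order \<open>t\<close>, because
  \<open>h^2 + k^2 >= 2 h k\<close>. Everything of order \<open>t\<close>, including the gradient
  term, is absorbed by a small radius.\<close>

lemma corner_barrier:
 fixes w :: "real^'n => real" and a A C R q :: real
 assumes aA: "0 < a" "a <= A" and C: "C >= 0" and R: "R > 0" and n: "norm n = 1" "norm n' = 1" "n \<bullet> n' = 0"
  and q: "CARD('n)*(A-a) < (q-1)*a"
  and wc: "continuous_on {y. 0 <= capfun R Q n y & 0 <= capfun R Q n' y} w"
  and wn: "!!y. 0 <= capfun R Q n y ==> 0 <= capfun R Q n' y ==> y ~= Q ==> w y > 0" and wQ: "w Q >= 0"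
  and hop: "hopfable a A C {y. 0 < capfun R Q n y & 0 < capfun R Q n' y} w"
 shows "\<exists>c>0. \<exists>r>0. \<forall>y\<in>cball Q r. 0 <= capfun R Q n y --> 0 <= capfun R Q n' y -->
  c*(capfun R Q n y * capfun R Q n' y) powr q <= w y"
proof -
 define h k where "h = capfun R Q n" and "k = capfun R Q n'"
 have q1: "q > 1"
 proof -
  have "0 <= CARD('n)*(A-a)" using aA by simp
  hence "0 < (q-1)*a" using q by linarith
  thus ?thesis using aA by (simp add: zero_less_mult_iff)
 qed
 \<comment> \<open>\<open>2 \<Theta>\<close> is the net gain at the corner, and
   \<open>\<Lambda>\<close> collects the coefficients of all errors proportional to
   \<open>t = h + k\<close>.\<close>
 define \<Theta> :: real where "\<Theta> = (q-1)*a-CARD('n)*(A-a)"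
 have \<Theta>: "\<Theta> > 0" using q by (simp add: \<Theta>_def)
 define \<Lambda> where "\<Lambda> = (A*(CARD('n)+2)+4*(q-1)*a)/R+C"
 have \<Lambda>: "\<Lambda> >= 0" using aA R C q1 by (simp add: \<Lambda>_def)
 define r where "r = min (R/8) (\<Theta>/(2*(\<Lambda>+1)))"
 have r: "r > 0" "r <= R/8" "2*r*\<Lambda> < 2*\<Theta>"
 proof -
  show "r > 0" using R \<Theta> \<Lambda> by (simp add: r_def)
  show "r <= R/8" unfolding r_def by (rule min.cobounded1)
  have "2*r*\<Lambda> <= 2*(\<Theta>/(2*(\<Lambda>+1)))*\<Lambda>" using \<Lambda> by (intro mult_right_mono) (auto simp: r_def)
  also have "\<dots> < 2*\<Theta>" using \<Theta> \<Lambda> by (simp add: field_simps add_pos_nonneg)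
  finally show "2*r*\<Lambda> < 2*\<Theta>" .
 qed
 let ?S = "{y. 0 <= h y & 0 <= k y} Int cball Q r"
 have hc: "continuous_on UNIV h" "continuous_on UNIV k" unfolding h_def k_def capfun_def by (intro continuous_intros; use R in simp)+
 have cS: "compact ?S"
  by (rule closed_Int_compact) (auto intro!: closed_Collect_conj closed_Collect_le hc continuous_intros)
 have wcS: "continuous_on ?S w" using wc by (rule continuous_on_subset) (auto simp: h_def k_def)
 have "\<exists>m>0. \<forall>y\<in>?S. norm (y-Q) = r --> m <= w y"
 proof (cases "?S Int sphere Q r = {}")
  case True
  thus ?thesis by (intro exI[of _ 1]) (auto simp: dist_norm norm_minus_commute)
 next
  case False
  have "continuous_on (?S Int sphere Q r) w" by (rule continuous_on_subset[OF wcS]) blast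
  from continuous_attains_inf[OF compact_Int_closed[OF cS closed_sphere] False this]
  obtain z where z: "z : ?S Int sphere Q r" "!!y. y : ?S Int sphere Q r ==> w z <= w y" by blast
  have "w z > 0" using z(1) r by (intro wn) (auto simp: h_def k_def)
  thus ?thesis using z(2) by (intro exI[of _ "w z"]) (auto simp: dist_norm norm_minus_commute)
 qed
 then obtain m where m: "m > 0" "!!y. y : ?S ==> norm (y-Q) = r ==> m <= w y" by blast
 \<comment> \<open>Both \<open>h\<close> and \<open>k\<close> are at most \<open>r\<close> on the
   sphere of radius \<open>r\<close>, so the barrier is at most \<open>m\<close> there.\<close>
 define c where "c = m/(r*r) powr q"
 have c: "c > 0" using m r by (simp add: c_def)
 define \<phi> where "\<phi> y = (h y * k y) powr q" for y
 have hr: "h y <= norm (y-Q)" "k y <= norm (y-Q)" for y unfolding h_def k_def by (rule capfun_le[OF R] n)+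
 have "c*\<phi> y <= w y" if y: "y : ?S" for y
 proof (rule ccontr)
  assume less: "\<not> c*\<phi> y <= w y"
  have "continuous_on ?S (%y. w y - c*\<phi> y)" unfolding \<phi>_def
   by (intro continuous_intros wcS continuous_on_powr' continuous_on_subset[OF hc(1)] continuous_on_subset[OF hc(2)]) (use q1 in auto)
  from continuous_attains_inf[OF cS _ this] y
  obtain x where x: "x : ?S" "!!y. y : ?S ==> w x - c*\<phi> x <= w y - c*\<phi> y" by blast
  have neg: "w x < c*\<phi> x" using x(2)[OF y] less by linarith
  have w0: "w x >= 0" using x(1) wn[of x] wQ by (cases "x = Q") (auto simp: h_def k_def less_imp_le)
  have hk: "h x > 0" "k x > 0"
   using x(1) neg w0 c by (auto simp: \<phi>_def less_le)
  have xr: "norm (x-Q) < r"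
  proof (rule ccontr)
   assume "\<not> norm (x-Q) < r"
   hence e: "norm (x-Q) = r" using x(1) by (auto simp: dist_norm norm_minus_commute)
   have "\<phi> x <= (r*r) powr q" unfolding \<phi>_def using hk hr[of x] e q1 r by (intro powr_mono2 mult_mono) auto
   hence "c*\<phi> x <= m" using m r by (simp add: c_def field_simps)
   thus False using m(2)[OF x(1) e] neg by linarith
  qed
  define s d d' g where "s = h x * k x" and "d = n-(1/R)*.(x-Q)" and "d' = n'-(1/R)*.(x-Q)" and "g = h x*.d' + k x*.d"
  define t where "t = h x + k x"
  have s: "s > 0" using hk by (simp add: s_def)
  have t: "0 < t" "t <= 2*r" using hk hr[of x] xr by (auto simp: t_def)
  have dd: "d \<bullet> d = 1-2*h x/R" "d' \<bullet> d' = 1-2 * k x/R" "d \<bullet> d' = - t/R"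
   unfolding d_def d'_def capfun_gradients
   using n by (auto simp: h_def k_def t_def dot_square_norm diff_divide_distrib add_divide_distrib)
  have nd: "norm d <= 1" "norm d' <= 1" using dd hk R by (auto simp: norm_le_square)
  have gg: "g \<bullet> g >= 2 * s*(1-2*t/R)"
  proof -
   have "g \<bullet> g = (h x)^2*(d' \<bullet> d')+(k x)^2*(d \<bullet> d)+2 * s*(d \<bullet> d')"
    by (simp add: g_def inner_add_left inner_add_right inner_commute power2_eq_square s_def algebra_simps)
   also have "\<dots> = (h x)^2+(k x)^2-4 * s*t/R" unfolding dd using R by (simp add: s_def t_def power2_eq_square field_simps)
   finally show ?thesis using sum_squares_bound[of "h x" "k x"] by (simp add: s_def algebra_simps)
  qed
  have tR: "2*t/R <= 1/2" using t r R by (simp add: field_simps)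
  have g0: "g ~= 0"
  proof
   assume "g = 0"
   hence "2 * s*(1-2*t/R) <= 0" using gg by simp
   thus False using s tR by (simp add: mult_le_0_iff)
  qed
  have gn: "norm g <= t"
  proof -
   have "norm g <= h x*norm d' + k x*norm d" unfolding g_def using norm_triangle_ineq[of "h x*.d'" "k x*.d"] hk by simp
   also have "\<dots> <= h x*1 + k x*1" using nd hk by (intro add_mono mult_left_mono) auto
   finally show ?thesis by (simp add: t_def)
  qed
  define Z where "Z = - ((t/R)*.mat 1)+(outer d d' + outer d' d)"
  have ZS: "transpose Z = Z" by (simp add: Z_def sym_simps add.commute)
  have Js: "jet2 (%y. h y * k y) x g Z"
  proof -
   have "jet2 (%y. h y * k y) x (h x*.d' + k x*.d)
    (h x*.(- ((1/R)*.mat 1)) + k x*.(- ((1/R)*.mat 1)) + outer d d' + outer d' d)"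
    unfolding h_def k_def d_def d'_def by (intro jet2_mult jet2_capfun)
   moreover have "h x*.(- ((1/R)*.mat 1)) + k x*.(- ((1/R)*.mat 1)) + outer d d' + outer d' d = Z"
    by (simp add: Z_def t_def add_divide_distrib scaleR_add_left)
   ultimately show ?thesis by (simp add: g_def)
  qed
  define c1 c2 where "c1 = q * s powr (q-1)" and "c2 = q*(q-1) * s powr (q-2)"
  have c12: "c1 > 0" "c2 > 0" "c2 * s = (q-1) * c1" using s q1 by (auto simp: c1_def c2_def powr_mult_base[symmetric] powr_diff power2_eq_square)
  define X where "X = c*.(c1*.Z + c2 *. outer g g)"
  have XS: "transpose X = X" using ZS by (simp add: X_def sym_simps)
  have "jet2 (%y. c*\<phi> y) x (c*.(c1*.g)) X"
   unfolding \<phi>_def X_def c1_def c2_def s_def by (intro jet2_cmult jet2_powr Js) (use s in \<open>simp add: s_def\<close>)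
  hence "subjet w x (c*.(c1*.g)) X"
  proof (rule subjet_local_min)
   have "\<forall>\<^sub>F y in nhds x. y : {y. 0 < h y} Int {y. 0 < k y} Int ball Q r"
    using hk xr by (intro eventually_nhds_in_open open_Int open_Collect_less hc continuous_intros) (auto simp: dist_norm norm_minus_commute)
   thus "\<forall>\<^sub>F y in nhds x. w x - c*\<phi> x <= w y - c*\<phi> y"
    by eventually_elim (rule x(2), auto)
  qed
  hence "pucci_minus a A X <= C*norm (c*.(c1*.g))"
   by (rule hopfableD[OF hop _ XS, rotated 2]) (use hk g0 c c12 in \<open>auto simp: h_def k_def\<close>)
  also have "\<dots> <= C*(c*(c1*t))" using gn c c12 C by (simp add: mult_left_mono)
  finally have up: "- pucci_plus a A (- X) <= C*(c*(c1*t))" by (simp add: pucci_minus_eq)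
  have Z': "pucci_plus a A (- Z) <= t/R*(A*(CARD('n)+2))+2*CARD('n)*(A-a)"
  proof -
   have "- Z = (t/R)*.mat 1+(- (outer d d' + outer d' d))" by (simp add: Z_def)
   hence "pucci_plus a A (- Z) <= pucci_plus a A ((t/R)*.(mat 1 :: real^'n^'n))+pucci_plus a A (- (outer d d' + outer d' d))"
    using pucci_plus_add[OF aA, of "(t/R)*.mat 1" "- (outer d d' + outer d' d)"] by (simp add: sym_simps add.commute)
   also have "pucci_plus a A ((t/R)*.(mat 1 :: real^'n^'n)) <= t/R*(A*CARD('n))"
    using t R by (intro pucci_plus_id[OF aA]) auto
   also have "pucci_plus a A (- (outer d d' + outer d' d)) <= A*(2*t/R)+(A-a)*CARD('n)*2"
   proof -
    have "norm (- (outer d d' + outer d' d)) <= norm d*norm d'+norm d'*norm d"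
     using norm_triangle_ineq[of "outer d d'" "outer d' d"] unfolding norm_minus_cancel norm_outer .
    also have "\<dots> <= 1*1+1*1" using nd by (intro add_mono mult_mono) auto
    finally have "(A-a)*CARD('n)*norm (- (outer d d' + outer d' d)) <= (A-a)*CARD('n)*2"
     using aA by (intro mult_left_mono) auto
    moreover have "trace (- (outer d d' + outer d' d)) = 2*t/R"
     using dd(3) by (simp add: trace_uminus trace_sub trace_outer inner_commute)
    ultimately show ?thesis using pucci_plus_laplace[OF aA, of "- (outer d d' + outer d' d)"] by (simp add: sym_simps add.commute)
   qed
   finally show ?thesis by (simp add: algebra_simps)
  qed
  have "- X = c*.(c1*.(- Z) + c2*.(- outer g g))" by (simp add: X_def scaleR_add_right scaleR_diff_right)
  hence "pucci_plus a A (- X) = c*pucci_plus a A (c1*.(- Z) + c2*.(- outer g g))"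
   using pucci_plus_scaleR[OF aA, of "c1*.(- Z) + c2*.(- outer g g)" c] ZS c by (simp add: sym_simps)
  also have "\<dots> <= c*(c1*pucci_plus a A (- Z) + c2*pucci_plus a A (- outer g g))"
   using pucci_plus_add[OF aA, of "c1*.(- Z)" "c2*.(- outer g g)"] ZS c c12
    pucci_plus_scaleR[OF aA, of "- Z" c1] pucci_plus_scaleR[OF aA, of "- outer g g" c2] by (simp add: sym_simps mult_left_mono)
  also have "\<dots> <= c*(c1*(t/R*(A*(CARD('n)+2))+2*CARD('n)*(A-a)) - c2*(a*(2 * s*(1-2*t/R))))"
  proof -
   have "pucci_plus a A (- outer g g) <= - (a*(2 * s*(1-2*t/R)))"
   proof -
    have "a*(2 * s*(1-2*t/R)) <= a*(norm g)^2" using gg aA by (intro mult_left_mono) (auto simp: power2_norm_eq_inner)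
    thus ?thesis using pucci_plus_neg_outer[OF aA, of g] by simp
   qed
   hence "c2*pucci_plus a A (- outer g g) <= c2 * - (a*(2 * s*(1-2*t/R)))" using c12 by (intro mult_left_mono) auto
   moreover have "c1*pucci_plus a A (- Z) <= c1*(t/R*(A*(CARD('n)+2))+2*CARD('n)*(A-a))"
    using Z' c12 by (intro mult_left_mono) auto
   ultimately show ?thesis using c by (intro mult_left_mono) auto
  qed
  also have "c2*(a*(2 * s*(1-2*t/R))) = c1*((q-1)*(a*(2*(1-2*t/R))))"
  proof -
   have "c2*(a*(2 * s*(1-2*t/R))) = (c2 * s)*(a*(2*(1-2*t/R)))" by (simp only: mult_ac)
   thus ?thesis unfolding c12(3) by (simp only: mult_ac)
  qed
  finally have "pucci_plus a A (- X) <= c * c1*((t/R*(A*(CARD('n)+2))+2*CARD('n)*(A-a))-(q-1)*(a*(2*(1-2*t/R))))"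
   by (simp add: algebra_simps)
  hence "0 <= c * c1*(t*\<Lambda>-2*\<Theta>)" using up by (simp add: \<Lambda>_def \<Theta>_def algebra_simps add_divide_distrib diff_divide_distrib)
  hence "0 <= t*\<Lambda>-2*\<Theta>" using mult_pos_pos[OF c c12(1)] by (simp only: zero_le_mult_iff) linarith
  moreover have "t*\<Lambda> <= 2*r*\<Lambda>" using t \<Lambda> by (intro mult_right_mono) auto
  ultimately show False using r by linarith
 qed
 hence "\<forall>y\<in>cball Q r. 0 <= h y --> 0 <= k y --> c*(h y * k y) powr q <= w y" by (auto simp: \<phi>_def)
 thus ?thesis using c r unfolding h_def k_def by blast
qed

subsection \<open>Expansion of the gradient at a boundary point\<close>

text \<open>A boundary point with a ball in which \<open>\<rho>\<close> and \<open>u\<close>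
  increase at a definite rate along the fixed direction \<open>nu Q\<close>; the estimates that
  follow are made along this direction.\<close>

locale bpoint = overdet \<alpha> a A lam \<kappa> \<eta> M Om u G
 for \<alpha> a A lam \<kappa> \<eta> :: real and M :: "real^'n^'n => real" and Om u G +
 fixes Q :: "real^'n" and \<rho> D H and rb L0 r0 :: real
 assumes Q: "Q : frontier Om" and b: "brep \<eta> Om Q \<rho> D H rb L0" and DQ: "D Q = norm (D Q)*.nu Q"
  and r0: "0 < r0" "r0 <= rb"
  and mono: "!!y s. y : ball Q r0 ==> s >= 0 ==> y + s*.nu Q : ball Q r0 ==> \<rho> y + s/2 <= \<rho> (y + s*.nu Q)"
  and gb: "!!y. y : closure Om ==> y : ball Q r0 ==> \<kappa>/2 <= norm (G y) & norm (G y) <= 2*\<kappa>"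
  and gnu: "!!y. y : closure Om ==> y : ball Q r0 ==> \<kappa>/2 <= G y \<bullet> nu Q"

lemma (in overdet) bpoint_exists:
 assumes Q: "Q : frontier Om"
 shows "\<exists>\<rho> D H rb L0 r0. bpoint \<alpha> a A lam \<kappa> \<eta> M Om u G Q \<rho> D H rb L0 r0"
proof -
 obtain \<rho> D H rb L0 r1 where b: "brep \<eta> Om Q \<rho> D H rb L0" "D Q = norm (D Q)*.nu Q" and r1: "0 < r1" "r1 <= rb"
  and mono: "!!y s. y : ball Q r1 ==> s >= 0 ==> y + s*.nu Q : ball Q r1 ==> \<rho> y + s/2 <= \<rho> (y + s*.nu Q)"
  using monotone_direction[OF Q norm_nu[OF Q]] norm_nu[OF Q] unfolding dot_square_norm by (metis mult.right_neutral one_power2 zero_less_one)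
 obtain r2 where r2: "r2 > 0" "!!y. y : closure Om ==> y : ball Q r2 ==> \<kappa>/2 <= norm (G y) & norm (G y) <= 2*\<kappa>"
  using gradient_near_frontier[OF Q] by metis
 have "continuous_on (closure Om) (%y. G y \<bullet> nu Q)" by (intro continuous_intros Gc)
 moreover have GQ: "G Q \<bullet> nu Q = \<kappa>" using norm_nu[OF Q] by (simp add: G_nu dot_square_norm)
 ultimately obtain r3 where r3: "r3 > 0" "!!y. y : closure Om ==> dist y Q < r3 ==> dist (G y \<bullet> nu Q) \<kappa> < \<kappa>/2"
  using frontier_facts(2)[OF Q] kappa_pos unfolding continuous_on_iff by (metis half_gt_zero)
 have "bpoint \<alpha> a A lam \<kappa> \<eta> M Om u G Q \<rho> D H rb L0 (Min {r1, r2, r3})"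
 proof unfold_locales
  fix y assume y: "y : closure Om" "y : ball Q (Min {r1, r2, r3})"
  show "\<kappa>/2 <= norm (G y) & norm (G y) <= 2*\<kappa>" using y by (intro r2(2)) auto
  have "dist (G y \<bullet> nu Q) \<kappa> < \<kappa>/2" using y by (intro r3(2)) (auto simp: dist_commute)
  thus "\<kappa>/2 <= G y \<bullet> nu Q" by (simp only: dist_real_def abs_less_iff) linarith
 qed (use Q b r1 r2(1) r3(1) mono in auto)
 thus ?thesis by blast
qed

context bpoint
begin

lemma nuQ: "norm (nu Q) = 1" by (rule norm_nu[OF Q])

lemma bfacts: "0 < L0" "\<rho> Q = 0" "!!y. GDERIV \<rho> y :> D y" "!!y. jet2 \<rho> y (D y) (H y)" "!!y. transpose (H y) = H y" "!!y. 1 <= norm (D y)"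
  "!!y. y : ball Q r0 ==> norm (H y) <= L0"
 and lipD: "!!y z. y : ball Q r0 ==> z : ball Q r0 ==> norm (D y-D z) <= L0*norm (y-z)"
 and quad: "!!y z. y : ball Q r0 ==> z : ball Q r0 ==> \<bar>\<rho> z-\<rho> y-D y \<bullet> (z-y)\<bar> <= L0*(norm (z-y))^2"
 and hoelder: "!!z. \<bar>\<rho> z-D Q \<bullet> (z-Q)-(z-Q) \<bullet> (H Q *v (z-Q))/2\<bar> <= L0*norm (z-Q) powr (2+\<eta>)"
proof -
 have sub: "y : ball Q rb" if "y : ball Q r0" for y using that r0 by auto
 show "0 < L0" "\<rho> Q = 0" "!!y. GDERIV \<rho> y :> D y" "!!y. jet2 \<rho> y (D y) (H y)" "!!y. transpose (H y) = H y" "!!y. 1 <= norm (D y)"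
  using b unfolding brep_def by blast+
 hence \<rho>Q: "\<rho> Q = 0" by simp
 show "norm (H y) <= L0" if "y : ball Q r0" for y using b sub[OF that] unfolding brep_def by blast
 show "norm (D y-D z) <= L0*norm (y-z)" "\<bar>\<rho> z-\<rho> y-D y \<bullet> (z-y)\<bar> <= L0*(norm (z-y))^2"
  if "y : ball Q r0" "z : ball Q r0" for y z using b sub that unfolding brep_def by blast+
 have "\<bar>\<rho> z-\<rho> Q-D Q \<bullet> (z-Q)-(z-Q) \<bullet> (H Q *v (z-Q))/2\<bar> <= L0*norm (z-Q) powr (2+\<eta>)" for z
  using b unfolding brep_def by blast
 thus "\<bar>\<rho> z-D Q \<bullet> (z-Q)-(z-Q) \<bullet> (H Q *v (z-Q))/2\<bar> <= L0*norm (z-Q) powr (2+\<eta>)" for z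
  unfolding \<rho>Q by simp
qed

lemma rho_pos_iff: "y : ball Q r0 ==> y : Om \<longleftrightarrow> \<rho> y > 0"
proof -
 assume "y : ball Q r0"
 hence "y : ball Q rb" using r0 by auto
 moreover have "Om Int ball Q rb = {y : ball Q rb. 0 < \<rho> y}" using b unfolding brep_def by blast
 ultimately show ?thesis by blast
qed

lemma frontier_rho: "y : ball Q r0 ==> y : frontier Om ==> \<rho> y = 0 & nu y = sgn (D y)"
 using frontier_brep[OF b] r0 by auto

lemma rho_nonneg: "y : ball Q r0 ==> y : closure Om ==> \<rho> y >= 0"
 using frontier_rho[of y] rho_pos_iff[of y] frontierI[of y] by force

lemma shift_in:
 assumes "y : closure Om" "y : ball Q r0" "s > 0" "y + s*.nu Q : ball Q r0"
 shows "y + s*.nu Q : Om"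
 using mono[OF assms(2) _ assms(4)] rho_nonneg[OF assms(2,1)] assms(3,4) rho_pos_iff by fastforce

text \<open>A Lipschitz constant of \<open>\<rho>\<close> on the ball of radius \<open>r0\<close>:
  one \<open>L0 r0\<close> for the variation of the gradient, and two for the quadratic error over a
  diameter.\<close>

definition "Lam = norm (D Q)+3*L0*r0"

lemma Lam1: "Lam >= 1" using bfacts(6)[of Q] bfacts(1) r0 by (simp add: Lam_def add_increasing2)

lemma norm_D: "y : ball Q r0 ==> norm (D y) <= norm (D Q)+L0*r0"
proof -
 assume y: "y : ball Q r0"
 have "norm (D y) <= norm (D Q)+norm (D y-D Q)" by (rule norm_triangle_sub)
 moreover have "norm (D y-D Q) <= L0*norm (y-Q)" using y r0 by (intro lipD) auto
 moreover have "L0*norm (y-Q) <= L0*r0" using y bfacts(1) by (intro mult_left_mono) (auto simp: dist_norm norm_minus_commute)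
 ultimately show ?thesis by linarith
qed

lemma rho_lip:
 assumes "y : ball Q r0" "z : ball Q r0" shows "\<bar>\<rho> z-\<rho> y\<bar> <= Lam*norm (z-y)"
proof -
 have "norm (z-y) <= 2*r0" using assms dist_triangle[of z y Q] by (simp add: dist_norm norm_minus_commute)
 hence "L0*norm (z-y)*norm (z-y) <= L0*(2*r0)*norm (z-y)" using bfacts(1) r0 by (intro mult_mono) auto
 moreover have "\<bar>D y \<bullet> (z-y)\<bar> <= (norm (D Q)+L0*r0)*norm (z-y)"
  using norm_D[OF assms(1)] by (rule order_trans[OF Cauchy_Schwarz_ineq2 mult_right_mono]) simp
 moreover note quad[OF assms]
 ultimately show ?thesis by (simp add: Lam_def power2_eq_square algebra_simps abs_le_iff)
qed

text \<open>From a point \<open>y\<close> of this smaller ball one can move by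
  \<open>2 \<rho> y\<close>, which is at most \<open>2 Lam\<close> times its distance from
  \<open>Q\<close>, without leaving the ball of radius \<open>r0\<close>.\<close>

definition "r1 = r0/(1+2*Lam)"

lemma r1: "0 < r1" "r1 <= r0"
 using r0 Lam1 by (auto simp: r1_def field_simps)

text \<open>Intermediate value theorem, as \<open>\<rho>\<close> decreases at rate at least 1/2
  along \<open>- nu Q\<close>. The foot in a fixed direction replaces the nearest boundary point
  because the gradient is controlled in the direction \<open>nu Q\<close>.\<close>

lemma foot:
 assumes y: "y : Om" "y : ball Q r1"
 obtains s where "0 < s" "s <= 2*\<rho> y" "\<rho> y <= Lam * s" "y - s*.nu Q : frontier Om"
  "!!\<sigma>. 0 <= \<sigma> ==> \<sigma> <= s ==> y-\<sigma>*.nu Q : ball Q r0" "!!\<sigma>. 0 <= \<sigma> ==> \<sigma> < s ==> y-\<sigma>*.nu Q : Om"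
proof -
 have y0: "y : ball Q r0" "\<rho> y > 0" using y r1 rho_pos_iff[of y] by auto
 have ball: "y-\<sigma>*.nu Q : ball Q r0" if "0 <= \<sigma>" "\<sigma> <= 2*\<rho> y" for \<sigma>
 proof -
  have "\<rho> y <= Lam*norm (y-Q)" using rho_lip[of Q y] y0 r0 bfacts(2) by simp
  hence "norm (y-Q)+\<sigma> <= norm (y-Q)*(1+2*Lam)" using that by (simp add: algebra_simps)
  also have "\<dots> < r1*(1+2*Lam)" using y(2) Lam1 by (intro mult_strict_right_mono) (auto simp: dist_norm norm_minus_commute)
  finally have "norm (y-Q)+\<sigma> < r0" using Lam1 by (simp add: r1_def)
  moreover have "norm (y-\<sigma>*.nu Q-Q) <= norm (y-Q)+\<sigma>"
   using norm_triangle_ineq4[of "y-Q" "\<sigma>*.nu Q"] that nuQ by (simp add: algebra_simps)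
  ultimately show ?thesis by (simp add: dist_norm norm_minus_commute)
 qed
 define f where "f \<sigma> = \<rho> (y-\<sigma>*.nu Q)" for \<sigma>
 have fdec: "f \<tau>+(\<tau>-\<sigma>)/2 <= f \<sigma>" if "0 <= \<sigma>" "\<sigma> <= \<tau>" "\<tau> <= 2*\<rho> y" for \<sigma> \<tau>
  using mono[OF ball[of \<tau>], of "\<tau>-\<sigma>"] ball[of \<sigma>] that by (simp add: f_def algebra_simps)
 have "continuous_on {0..2*\<rho> y} f" unfolding f_def
  by (intro continuous_on_compose2[OF brep_continuous[OF b, of UNIV]] continuous_intros) auto
 moreover have "f (2*\<rho> y) <= 0" "0 <= f 0" using fdec[of 0 "2*\<rho> y"] y0 by (auto simp: f_def)
 ultimately obtain s where s: "0 <= s" "s <= 2*\<rho> y" "f s = 0" using IVT2'[of f "2*\<rho> y" 0 0] y0 by auto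
 have s0: "s > 0" using s y0(2) by (cases "s = 0") (auto simp: f_def)
 have inn: "y-\<sigma>*.nu Q : Om" if "0 <= \<sigma>" "\<sigma> < s" for \<sigma>
  using fdec[of \<sigma> s] s that ball[of \<sigma>] rho_pos_iff[of "y-\<sigma>*.nu Q"] by (simp add: f_def)
 have "y - s*.nu Q : frontier Om"
 proof (rule frontierI)
  show "y - s*.nu Q ~: Om" using s ball[OF s(1,2)] rho_pos_iff by (simp add: f_def)
  have "((%\<sigma>. y-\<sigma>*.nu Q) \<longlongrightarrow> y - s*.nu Q) (at_left s)" by (intro tendsto_intros)
  moreover have "\<forall>\<^sub>F \<sigma> in at_left s. y-\<sigma>*.nu Q : Om"
   unfolding eventually_at_left_field using inn s0 by (intro exI[of _ 0]) auto
  ultimately show "y - s*.nu Q : closure Om"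
   using closure_subset[of Om] by (intro Lim_in_closed_set[OF closed_closure]) (auto elim: eventually_mono)
 qed
 moreover have "\<rho> y <= Lam * s" using rho_lip[OF ball[OF s(1,2)] y0(1)] s nuQ by (simp add: f_def)
 ultimately show ?thesis using that[of s] s0 s ball inn by (meson order_trans)
qed

lemma growth:
 assumes y: "y : Om" "y : ball Q r1"
 shows "\<kappa>/(2*Lam)*\<rho> y <= u y"
proof -
 obtain s where s: "0 < s" "\<rho> y <= Lam * s" "y - s*.nu Q : frontier Om"
  and bl: "!!\<sigma>. 0 <= \<sigma> ==> \<sigma> <= s ==> y-\<sigma>*.nu Q : ball Q r0" and inn: "!!\<sigma>. 0 <= \<sigma> ==> \<sigma> < s ==> y-\<sigma>*.nu Q : Om"
  using foot[OF y] by metis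
 define z where "z = y - s*.nu Q"
 have eq: "z+t*.(s*.nu Q) = y-((1-t) * s)*.nu Q" for t by (simp add: z_def algebra_simps)
 have t2: "0 <= (1-t) * s" "(1-t) * s < s" if "0 < t" "t <= 1" for t using that s by auto
 have seg: "z+t*.(s*.nu Q) : Om" if "0 < t" "t <= 1" for t unfolding eq by (rule inn[OF t2[OF that]])
 obtain t where t: "0 < t" "t < 1" "u (z + s*.nu Q)-u z = G (z+t*.(s*.nu Q)) \<bullet> (s*.nu Q)"
  using segment_mvt'[OF _ seg] frontier_facts(2)[OF s(3)] unfolding z_def by metis
 have "z+t*.(s*.nu Q) : closure Om Int ball Q r0"
  unfolding eq using t2[of t] t inn bl closure_subset[of Om] by auto
 hence "s*(\<kappa>/2) <= s*(G (z+t*.(s*.nu Q)) \<bullet> nu Q)" using gnu s by (intro mult_left_mono) auto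
 hence "s*(\<kappa>/2) <= u y" using t(3) u0 s by (simp add: z_def)
 moreover have "\<kappa>/(2*Lam)*\<rho> y <= \<kappa>/(2*Lam)*(Lam * s)" using s kappa_pos Lam1 by (intro mult_left_mono) auto
 ultimately show ?thesis using Lam1 by (simp add: mult.commute)
qed

lemma shift_mvt:
 assumes y: "y : closure Om" "y : ball Q r0" and \<tau>: "\<tau> > 0" "y+\<tau>*.nu Q : ball Q r0"
 obtains s where "0 < s" "s < \<tau>" "y + s*.nu Q : Om" "y + s*.nu Q : ball Q r0" "u (y+\<tau>*.nu Q)-u y = \<tau>*(G (y + s*.nu Q) \<bullet> nu Q)"
proof -
 have bl: "y + s*.nu Q : ball Q r0" if "0 <= s" "s <= \<tau>" for s
 proof -
  have "(1 - s/\<tau>)*.y+(s/\<tau>)*.(y+\<tau>*.nu Q) : ball Q r0" using that \<tau> y by (intro convexD[OF convex_ball]) auto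
  also have "(1 - s/\<tau>)*.y+(s/\<tau>)*.(y+\<tau>*.nu Q) = y + s*.nu Q" using \<tau>(1) by (simp add: algebra_simps)
  finally show ?thesis .
 qed
 have "y + s*.(\<tau>*.nu Q) : Om" if "0 < s" "s <= 1" for s
  using shift_in[OF y, of "s*\<tau>"] bl[of "s*\<tau>"] that \<tau> by (simp add: mult_left_le_one_le)
 from segment_mvt'[OF y(1) this] obtain s where s: "0 < s" "s < 1"
  "u (y+\<tau>*.nu Q)-u y = G (y + s*.(\<tau>*.nu Q)) \<bullet> (\<tau>*.nu Q)" by metis
 have "0 < s*\<tau>" "s*\<tau> < \<tau>" using s \<tau> by auto
 thus ?thesis using that[of "s*\<tau>"] s \<tau> bl[of "s*\<tau>"] shift_in[OF y, of "s*\<tau>"] by simp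
qed

text \<open>For negative \<open>\<alpha>\<close> the derivative of
  \<open>u powr (1 + \<alpha>)\<close> blows up at the boundary. Writing
  \<open>\<xi> powr \<alpha>\<close> as \<open>\<xi> powr (1 + \<alpha>) / \<xi>\<close> and using
  the linear growth of \<open>u\<close> bounds it by a multiple of
  \<open>1 / \<rho>\<close>.\<close>

lemma rhs_diff:
 obtains C2 C3 where "C2 >= 0" "C3 >= 0"
  "!!y \<tau>. y : Om ==> y : ball Q r1 ==> \<tau> > 0 ==> y+\<tau>*.nu Q : ball Q r0 ==>
   \<bar>rhs u G (y+\<tau>*.nu Q)-rhs u G y\<bar> <= C2*\<tau>/\<rho> y+C3*norm (G (y+\<tau>*.nu Q)-G y)"
proof -
 obtain C1 where C1: "C1 > 0" "!!x. x : closure Om ==> u x <= C1" using u_bounded by blast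
 obtain K where K: "K >= 0" "!!s t. s : {\<kappa>/2..2*\<kappa>} ==> t : {\<kappa>/2..2*\<kappa>} ==>
   \<bar>s powr (- \<alpha>)-t powr (- \<alpha>)\<bar> <= K*\<bar>s-t\<bar>"
  using powr_lipschitz[of "\<kappa>/2" "2*\<kappa>" "- \<alpha>"] kappa_pos by auto
 define B where "B = (\<kappa>/2) powr (- \<alpha>)+K*(2*\<kappa>)"
 have B: "s powr (- \<alpha>) <= B" if "s : {\<kappa>/2..2*\<kappa>}" for s
 proof -
  have "s powr (- \<alpha>)-(\<kappa>/2) powr (- \<alpha>) <= K*\<bar>s-\<kappa>/2\<bar>" using K(2)[OF that, of "\<kappa>/2"] kappa_pos by auto
  also have "\<dots> <= K*(2*\<kappa>)" using that kappa_pos K by (intro mult_left_mono) auto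
  finally show ?thesis by (simp add: B_def)
 qed
 have B0: "B >= 0" using K kappa_pos by (simp add: B_def)
 define C2 where "C2 = lam*((1+\<alpha>)*C1 powr (1+\<alpha>)*(4*Lam)*B)"
 define C3 where "C3 = lam*(C1 powr (1+\<alpha>)*K)"
 have "C2 >= 0" "C3 >= 0" using lam alpha Lam1 kappa_pos B0 K by (auto simp: C2_def C3_def)
 moreover have "\<bar>rhs u G (y+\<tau>*.nu Q)-rhs u G y\<bar> <= C2*\<tau>/\<rho> y+C3*norm (G (y+\<tau>*.nu Q)-G y)"
  if y: "y : Om" "y : ball Q r1" and \<tau>: "\<tau> > 0" "y+\<tau>*.nu Q : ball Q r0" for y \<tau>
 proof -
  define z where "z = y+\<tau>*.nu Q"
  have cl: "y : closure Om" "y : ball Q r0" using y r1 closure_subset[of Om] by auto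
  have z: "z : Om" "z : closure Om" "z : ball Q r0" using shift_in[OF cl \<tau>] closure_subset[of Om] \<tau> by (auto simp: z_def)
  have uy: "u y > 0" and \<rho>y: "\<rho> y > 0" using upos y cl rho_pos_iff by auto
  obtain s where s: "y + s*.nu Q : Om" "y + s*.nu Q : ball Q r0" "u z-u y = \<tau>*(G (y + s*.nu Q) \<bullet> nu Q)"
   using shift_mvt[OF cl \<tau>] unfolding z_def by metis
  have scl: "y + s*.nu Q : closure Om" using s closure_subset[of Om] by auto
  have "G (y + s*.nu Q) \<bullet> nu Q <= norm (G (y + s*.nu Q))*norm (nu Q)" by (rule norm_cauchy_schwarz)
  hence "G (y + s*.nu Q) \<bullet> nu Q <= 2*\<kappa>" "0 < G (y + s*.nu Q) \<bullet> nu Q"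
   using gb[OF scl s(2)] gnu[OF scl s(2)] nuQ kappa_pos by auto
  hence du: "0 < u z-u y" "u z-u y <= \<tau>*(2*\<kappa>)" using s \<tau> by (auto intro!: mult_left_mono)
  have "\<exists>\<xi>. u y < \<xi> & \<xi> < u z & u z powr (1+\<alpha>)-u y powr (1+\<alpha>) = (u z-u y)*((1+\<alpha>)*\<xi> powr (1+\<alpha>-1))"
   by (rule MVT2) (use du uy in simp, rule has_real_derivative_powr, use uy in simp)
  then obtain \<xi> where \<xi>: "u y < \<xi>" "\<xi> < u z" "u z powr (1+\<alpha>)-u y powr (1+\<alpha>) = (u z-u y)*((1+\<alpha>)*\<xi> powr \<alpha>)" by auto
  have "\<xi> powr \<alpha> = \<xi> powr (1+\<alpha>)*(1/\<xi>)" using \<xi> uy by (simp add: powr_add)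
  also have "\<dots> <= C1 powr (1+\<alpha>)*(2*Lam/\<kappa>/\<rho> y)"
  proof (intro mult_mono powr_mono2)
   have "1/\<xi> <= 1/(\<kappa>/(2*Lam)*\<rho> y)" using growth[OF y] \<xi>(1) uy \<rho>y kappa_pos Lam1 by (intro divide_left_mono mult_pos_pos divide_pos_pos) auto
   thus "1/\<xi> <= 2*Lam/\<kappa>/\<rho> y" by simp
  qed (use \<xi> uy alpha C1(2)[OF z(2)] in auto)
  finally have x1: "\<xi> powr \<alpha> <= C1 powr (1+\<alpha>)*(2*Lam/\<kappa>/\<rho> y)" .
  have d1: "\<bar>u z powr (1+\<alpha>)-u y powr (1+\<alpha>)\<bar> <= (\<tau>*(2*\<kappa>))*((1+\<alpha>)*(C1 powr (1+\<alpha>)*(2*Lam/\<kappa>/\<rho> y)))"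
  proof -
   have "\<bar>u z powr (1+\<alpha>)-u y powr (1+\<alpha>)\<bar> = (u z-u y)*((1+\<alpha>)*\<xi> powr \<alpha>)" using \<xi>(3) du alpha by simp
   also have "\<dots> <= (\<tau>*(2*\<kappa>))*((1+\<alpha>)*(C1 powr (1+\<alpha>)*(2*Lam/\<kappa>/\<rho> y)))"
    using du x1 alpha \<tau> kappa_pos by (intro mult_mono mult_left_mono) auto
   finally show ?thesis .
  qed
  define n1 n2 where "n1 = norm (G y) powr (- \<alpha>)" and "n2 = norm (G z) powr (- \<alpha>)"
  have n: "norm (G y) : {\<kappa>/2..2*\<kappa>}" "norm (G z) : {\<kappa>/2..2*\<kappa>}" using gb[OF cl] gb[OF z(2,3)] by auto
  have "\<bar>n2-n1\<bar> <= K*\<bar>norm (G z)-norm (G y)\<bar>" using K(2)[OF n(2,1)] by (simp add: n1_def n2_def)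
  also have "\<dots> <= K*norm (G z-G y)" using K by (intro mult_left_mono norm_triangle_ineq3) auto
  finally have n21: "\<bar>n2-n1\<bar> <= K*norm (G z-G y)" .
  have "\<bar>rhs u G z-rhs u G y\<bar> = lam*\<bar>(u z powr (1+\<alpha>)-u y powr (1+\<alpha>))*n2+u y powr (1+\<alpha>)*(n2-n1)\<bar>"
  proof -
   have "rhs u G z-rhs u G y = - (lam*((u z powr (1+\<alpha>)-u y powr (1+\<alpha>))*n2+u y powr (1+\<alpha>)*(n2-n1)))"
    by (simp add: rhs_def n1_def n2_def algebra_simps)
   thus ?thesis using lam by (simp add: abs_mult)
  qed
  also have "\<dots> <= lam*(\<bar>u z powr (1+\<alpha>)-u y powr (1+\<alpha>)\<bar>*n2+u y powr (1+\<alpha>)*\<bar>n2-n1\<bar>)"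
   using lam abs_triangle_ineq[of "(u z powr (1+\<alpha>)-u y powr (1+\<alpha>))*n2" "u y powr (1+\<alpha>)*(n2-n1)"]
   by (intro mult_left_mono) (auto simp: abs_mult n2_def)
  also have "\<dots> <= lam*((\<tau>*(2*\<kappa>))*((1+\<alpha>)*(C1 powr (1+\<alpha>)*(2*Lam/\<kappa>/\<rho> y)))*B+C1 powr (1+\<alpha>)*(K*norm (G z-G y)))"
  proof (intro mult_left_mono add_mono mult_mono)
   show "n2 <= B" unfolding n2_def by (rule B[OF n(2)])
   show "u y powr (1+\<alpha>) <= C1 powr (1+\<alpha>)" using C1(2)[OF cl(1)] uy alpha by (intro powr_mono2) auto
  qed (use lam d1 n21 K alpha \<tau> kappa_pos Lam1 \<rho>y in \<open>auto simp: n2_def\<close>)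
  also have "\<dots> = C2*\<tau>/\<rho> y+C3*norm (G z-G y)" using kappa_pos \<rho>y by (simp add: C2_def C3_def field_simps)
  finally show ?thesis by (simp add: z_def)
 qed
 ultimately show ?thesis using that by blast
qed

end

lemma GDERIV_shift: "GDERIV f (x + v) :> D ==> GDERIV (%y. f (y + v)) x :> D"
 unfolding gderiv_def
 by (rule has_derivative_compose[of "%y. y + v" "%h. h" x UNIV f "%h. h \<bullet> D"]) (auto intro!: derivative_eq_intros)

lemma norm_sgn_diff_le:
 fixes p q :: "'a::real_inner"
 assumes "1 <= norm p" "1 <= norm q" shows "norm (sgn p - sgn q) <= 2*norm (p-q)"
proof -
 have 0: "norm p > 0" "norm q > 0" using assms by linarith+
 have "sgn p - sgn q = (1/norm p)*.(p-q)+((norm q-norm p)/norm p) *. sgn q"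
  using 0 by (simp add: sgn_div_norm scaleR_diff_right diff_divide_distrib inverse_eq_divide algebra_simps)
 hence "norm (sgn p - sgn q) <= norm (p-q)/norm p+\<bar>norm q-norm p\<bar>/norm p"
  using norm_triangle_ineq[of "(1/norm p)*.(p-q)" "((norm q-norm p)/norm p) *. sgn q"] 0 by (simp add: norm_sgn split: if_splits)
 also have "\<dots> <= norm (p-q)/1+norm (p-q)/1"
  using assms norm_triangle_ineq3[of q p] by (intro add_mono frac_le) (auto simp: norm_minus_commute)
 finally show ?thesis by simp
qed

context bpoint
begin

text \<open>For unit vectors, 1 minus their product is half the square of their distance, so the
  Lipschitz bound on the normal enters squared. This is the source of the quadratic term in the
  gradient expansion.\<close>

lemma frontier_normal:
 assumes "x : frontier Om" "x : ball Q r0"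
 shows "1-2*L0^2*(norm (x-Q))^2 <= nu x \<bullet> nu Q"
proof -
 have "nu x = sgn (D x)" "nu Q = sgn (D Q)" using frontier_rho[OF assms(2,1)] frontier_rho[OF _ Q] r0 by auto
 hence "norm (nu x-nu Q) <= 2*norm (D x-D Q)" using norm_sgn_diff_le[OF bfacts(6) bfacts(6)] by simp
 also have "\<dots> <= 2*(L0*norm (x-Q))" using assms r0 by (intro mult_left_mono lipD) auto
 finally have "(norm (nu x-nu Q))^2 <= (2*(L0*norm (x-Q)))^2" by (intro power_mono) auto
 thus ?thesis unfolding norm_diff_square[of "nu x"] using norm_nu[OF assms(1)] nuQ by (simp add: power_mult_distrib)
qed

text \<open>A translate of \<open>u\<close> solves the translated equation, so the comparison lemma
  applies to the increment and to its negative.\<close>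

lemma shifted_comparison:
 assumes V: "open V" "x : V" "V <= Om" "V <= ball Q r0" "!!y. y : V ==> y + v : Om & y + v : ball Q r0"
  and sg: "sg = 1 | sg = -1" and sj: "superjet (%y. sg*(u (y + v)-u y)) x p X" and X: "transpose X = X"
 shows "- \<bar>rhs u G (x + v)-rhs u G x\<bar> <= pucci_plus a A X" "norm (G (x + v)-G x) = norm p"
proof -
 define us where "us y = u (y + v)" for y
 define rs where "rs y = rhs u G (y + v)" for y
 have Gne: "G y ~= 0" if "y : Om" "y : ball Q r0" for y
  using gb[of y] that closure_subset[of Om] kappa_pos by auto
 have vs: "vsub M (rhs u G) V u" "vsup M (rhs u G) V u" by (rule vsub_u vsup_u, fact, rule Gne; use V(3,4) in blast)+
 have "vsub M (rhs u G) ((%y. y + v) ` V) u" "vsup M (rhs u G) ((%y. y + v) ` V) u" using V(5) Gne by (auto intro!: vsub_u vsup_u)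
 hence vs': "vsub M rs V us" "vsup M rs V us"
  using superjet_translate[of u "- v" 0] subjet_translate[of u "- v" 0]
  unfolding vsub_def vsup_def us_def rs_def by simp_all blast+
 have rc: "continuous (at y) (rhs u G)" if "y : Om" "y : ball Q r0" for y
  using that upos Gne by (intro rhs_continuous u_continuous_at G_continuous_at) auto
 have c: "continuous (at x) (rhs u G)" "continuous (at x) rs"
  unfolding rs_def by (rule rc; use V(2-5) in auto) (rule isCont_o2[of x "%y. y + v"]; use V(2-5) rc in simp)
 have uc': "continuous_on V u" "continuous_on V us"
  unfolding us_def using V(3,5) closure_subset[of Om]
  by (auto intro!: continuous_on_subset[OF uc] continuous_on_compose2[OF uc] continuous_intros)
 have d: "GDERIV us x :> G (x + v)" "GDERIV u x :> G x"
  unfolding us_def using V(2-5) by (auto intro!: GDERIV_shift GD)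
 have "- \<bar>rhs u G (x + v)-rhs u G x\<bar> <= pucci_plus a A X & norm (G (x + v)-G x) = norm p"
  using sg
 proof
  assume "sg = 1"
  hence sj': "superjet (%y. us y-u y) x p X" using sj by (simp add: us_def)
  from pucci_comparison[OF aA M V(1,2) uc'(2,1) c vs'(1) vs(2) this X] superjet_gradient[OF sj' GDERIV_diff[OF d]]
  show ?thesis by (simp add: rs_def)
 next
  assume "sg = -1"
  hence sj': "superjet (%y. u y-us y) x p X" using sj by (simp add: us_def)
  from pucci_comparison[OF aA M V(1,2) uc' c(2,1) vs(1) vs'(2) this X] superjet_gradient[OF sj' GDERIV_diff[OF d(2,1)]]
  show ?thesis by (simp add: rs_def norm_minus_commute)
 qed
 thus "- \<bar>rhs u G (x + v)-rhs u G x\<bar> <= pucci_plus a A X" "norm (G (x + v)-G x) = norm p" by auto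
qed

text \<open>Barrier \<open>T = L \<bar>x - Q\<bar>^2 + K \<rho> powr \<beta>\<close> for difference
  quotients. A positive maximum of the excess is impossible on the sphere of radius
  \<open>r\<close>, by the size of \<open>L\<close>; on the boundary, by
  \<open>frontier_normal\<close>, \<open>\<epsilon>\<close> covering the oscillation of
  \<open>G\<close> at scale \<open>\<tau>\<close>; and in the interior, because the concavity of
  \<open>\<rho> powr \<beta>\<close>, of order \<open>\<rho> powr (\<beta> - 2)\<close>, beats the
  singular right-hand side of order \<open>1 / \<rho>\<close>. The last point forces
  \<open>\<beta> < 1\<close>.\<close>

lemma difference_quotient_bound:
 assumes \<beta>: "0 < \<beta>" "\<beta> < 1"
 obtains r L K where "0 < r" "r < r1" "0 <= L" "0 <= K"
  "!!sg \<epsilon> \<tau> x. sg = 1 | sg = -1 ==> 0 < \<epsilon> ==> 0 < \<tau> ==> \<tau> < r0/2 ==>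
   (!!y z. y : closure Om ==> z : closure Om ==> dist y z <= \<tau> ==> dist (G y) (G z) <= \<epsilon>) ==>
   x : closure Om ==> x : cball Q r ==>
   sg*(u (x+\<tau>*.nu Q)-u x) <= \<tau>*(sg*\<kappa>+\<epsilon>+L*(norm (x-Q))^2+K*\<rho> x powr \<beta>)"
proof -
 obtain C2 C3 where C: "C2 >= 0" "C3 >= 0"
  "!!y \<tau>. y : Om ==> y : ball Q r1 ==> \<tau> > 0 ==> y+\<tau>*.nu Q : ball Q r0 ==>
   \<bar>rhs u G (y+\<tau>*.nu Q)-rhs u G y\<bar> <= C2*\<tau>/\<rho> y+C3*norm (G (y+\<tau>*.nu Q)-G y)"
  using rhs_diff by blast
 \<comment> \<open>Half of the gain from concavity; the other half absorbs the Hessian of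
   \<open>\<rho>\<close> and the gradient of the barrier, through the choice of
   \<open>r\<close>.\<close>
 define \<theta> where "\<theta> = (1-\<beta>)*a/2"
 have \<theta>: "\<theta> > 0" using \<beta> aA by (simp add: \<theta>_def)
 define C5 where "C5 = A*CARD('n)*L0+C3*Lam"
 have C5: "C5 >= 0" using aA bfacts(1) C Lam1 by (simp add: C5_def)
 define r where "r = min (r1/2) (min 1 (\<theta>/(C5+1))/Lam)"
 have r: "0 < r" "r < r1" using r1 \<theta> C5 Lam1 by (auto simp: r_def min_less_iff_disj)
 have "r <= min 1 (\<theta>/(C5+1))/Lam" unfolding r_def by (rule min.cobounded2)
 hence "r*Lam <= min 1 (\<theta>/(C5+1))" using Lam1 by (simp only: pos_le_divide_eq)
 hence r3: "r*Lam <= 1" "C5*(r*Lam) <= \<theta>"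
 proof -
  assume *: "r*Lam <= min 1 (\<theta>/(C5+1))"
  thus "r*Lam <= 1" by simp
  have "C5*(r*Lam) <= C5*(\<theta>/(C5+1))" using * C5 by (intro mult_left_mono) auto
  also have "\<dots> <= \<theta>" using C5 \<theta> by (simp add: field_simps)
  finally show "C5*(r*Lam) <= \<theta>" .
 qed
 have "r1 <= r0/3" unfolding r1_def using r0 Lam1 by (intro divide_left_mono) auto
 hence rr0: "r < r0/3" using r by simp
 have \<rho>r: "\<rho> y <= r*Lam" if "y : cball Q r" for y
 proof -
  have "\<rho> y <= Lam*norm (y-Q)" using rho_lip[of Q y] that r0 rr0 bfacts(2) by simp
  also have "\<dots> <= Lam*r" using that Lam1 by (intro mult_left_mono) (auto simp: dist_norm norm_minus_commute)
  finally show ?thesis by (simp add: mult.commute)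
 qed
 \<comment> \<open>The first summand handles the sphere \<open>norm (x - Q) = r\<close>, the second
   the boundary of the domain.\<close>
 define L where "L = 3*\<kappa>/r^2+2*\<kappa>*L0^2"
 have L: "L >= 0" "3*\<kappa> <= L*r^2" "2*\<kappa>*L0^2 <= L" using kappa_pos r by (auto simp: L_def algebra_simps)
 define E where "E = 2*L*A*CARD('n)+C2+C3*(2*L*r)"
 have E: "E >= 0" using L aA C r by (simp add: E_def)
 \<comment> \<open>\<open>E\<close> sums the errors not multiplied by \<open>K\<close>; the
   additional 1 leaves the strictly negative total \<open>- \<tau> m / \<beta>\<close> at the
   end.\<close>
 define K where "K = (E+1)/(\<beta>*\<theta>)"
 have K: "K > 0" "K*\<theta> = (E+1)/\<beta>" using E \<beta> \<theta> by (auto simp: K_def)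
 define T where "T y = L*(norm (y-Q))^2+K*\<rho> y powr \<beta>" for y
 let ?S = "closure Om Int cball Q r"
 have main: "sg*(u (x+\<tau>*.nu Q)-u x) <= \<tau>*(sg*\<kappa>+\<epsilon>+T x)"
  if sg: "sg = 1 | sg = -1" and \<epsilon>: "0 < \<epsilon>" and \<tau>: "0 < \<tau>" "\<tau> < r0/2"
   and uni: "!!y z. y : closure Om ==> z : closure Om ==> dist y z <= \<tau> ==> dist (G y) (G z) <= \<epsilon>"
   and x: "x : ?S" for sg \<epsilon> \<tau> x
 proof (rule ccontr)
  assume less: "\<not> ?thesis"
  define v where "v = \<tau>*.nu Q"
  define F where "F y = sg*(u (y + v)-u y)-\<tau>*(sg*\<kappa>+\<epsilon>+T y)" for y
  have bl: "y + v : ball Q r0" "y : ball Q r0" if "y : cball Q r" for y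
  proof -
   have "dist Q (y + v) <= dist Q y+dist y (y + v)" by (rule dist_triangle)
   also have "dist y (y + v) = \<tau>" using \<tau> nuQ by (simp add: v_def dist_norm)
   finally show "y + v : ball Q r0" "y : ball Q r0" using that rr0 \<tau> r0 by auto
  qed
  have shin: "y + v : Om" if "y : ?S" for y using shift_in[of y \<tau>] bl[of y] that \<tau> by (simp add: v_def)
  have "continuous_on ?S F" unfolding F_def T_def
   using shin closure_subset[of Om] rho_nonneg bl \<beta>
   by (intro continuous_intros continuous_on_subset[OF uc] continuous_on_compose2[OF uc] continuous_on_powr' brep_continuous[OF b]) auto
  from continuous_attains_sup[OF _ _ this] x compact_closure
  obtain x1 where x1: "x1 : ?S" "!!y. y : ?S ==> F y <= F x1" by (metis closed_cball compact_Int_closed empty_iff)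
  have pos: "F x1 > 0" using x1(2)[OF x] less by (simp add: F_def v_def)
  have x1c: "x1 : closure Om" "x1 : ball Q r0" "x1 + v : ball Q r0" "\<rho> x1 >= 0" using x1(1) bl[of x1] rho_nonneg[of x1] by auto
  hence T0: "T x1 >= L*(norm (x1-Q))^2" using K by (simp add: T_def)
  obtain s where s: "0 < s" "s < \<tau>" "x1 + s*.nu Q : Om" "x1 + s*.nu Q : ball Q r0" "u (x1 + v)-u x1 = \<tau>*(G (x1 + s*.nu Q) \<bullet> nu Q)"
   using shift_mvt[OF x1c(1,2) \<tau>(1)] x1c(3) unfolding v_def by metis
  have scl: "x1 + s*.nu Q : closure Om" using s closure_subset[of Om] by auto
  have "0 < \<tau>*(sg*(G (x1 + s*.nu Q) \<bullet> nu Q)-(sg*\<kappa>+\<epsilon>+T x1))"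
   using pos unfolding F_def s(5) by (simp add: algebra_simps)
  hence gt: "sg*\<kappa>+\<epsilon>+T x1 < sg*(G (x1 + s*.nu Q) \<bullet> nu Q)" using \<tau> by (simp add: zero_less_mult_iff)
  have "norm (x1-Q) ~= r"
  proof
   assume "norm (x1-Q) = r"
   hence "3*\<kappa> <= T x1" using T0 L by simp
   moreover have "\<bar>G (x1 + s*.nu Q) \<bullet> nu Q\<bar> <= 2*\<kappa>*1"
    using gb[OF scl s(4)] nuQ by (intro order_trans[OF Cauchy_Schwarz_ineq2] mult_mono) auto
   ultimately show False using gt sg \<epsilon> kappa_pos by auto
  qed
  hence x1r: "norm (x1-Q) < r" using x1(1) by (auto simp: dist_norm norm_minus_commute)
  have "x1 : Om"
  proof (rule ccontr)
   assume "x1 ~: Om"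
   hence fr: "x1 : frontier Om" using x1c frontierI by blast
   have "dist (G (x1 + s*.nu Q)) (G x1) <= \<epsilon>" using s nuQ by (intro uni scl x1c(1)) (simp add: dist_norm)
   hence "\<bar>(G (x1 + s*.nu Q)-G x1) \<bullet> nu Q\<bar> <= \<epsilon>*1"
    using nuQ \<epsilon> by (intro order_trans[OF Cauchy_Schwarz_ineq2] mult_mono) (auto simp: dist_norm)
   hence d: "\<bar>G (x1 + s*.nu Q) \<bullet> nu Q-\<kappa>*(nu x1 \<bullet> nu Q)\<bar> <= \<epsilon>" by (simp add: inner_diff_left G_nu)
   have "nu x1 \<bullet> nu Q <= 1" using norm_cauchy_schwarz[of "nu x1" "nu Q"] nuQ norm_nu[OF fr] by simp
   hence 1: "\<kappa>*(nu x1 \<bullet> nu Q) <= \<kappa>*1" using kappa_pos by (intro mult_left_mono) auto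
   have "\<kappa>*(1-2*L0^2*(norm (x1-Q))^2) <= \<kappa>*(nu x1 \<bullet> nu Q)"
    using frontier_normal[OF fr x1c(2)] kappa_pos by (intro mult_left_mono) auto
   moreover have "2*\<kappa>*L0^2*(norm (x1-Q))^2 <= L*(norm (x1-Q))^2" using L by (intro mult_right_mono) auto
   ultimately have 2: "\<kappa>-T x1 <= \<kappa>*(nu x1 \<bullet> nu Q)" using T0 by (simp add: algebra_simps)
   have "0 <= L*(norm (x1-Q))^2" using L by simp
   thus False using gt sg d 1 2 T0 by (auto simp: abs_le_iff)
  qed
  hence \<rho>1: "\<rho> x1 > 0" using rho_pos_iff x1c by blast
  \<comment> \<open>\<open>m \<rho>\<close> and \<open>- (1 - \<beta>) m\<close> are the first and
    second derivatives of the power \<open>\<beta>\<close>. As \<open>\<rho> <= 1\<close> and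
    \<open>\<beta> < 1\<close>, both 1 and \<open>1 / \<rho>\<close> are at most
    \<open>m / \<beta>\<close>, so all errors are measured in \<open>m\<close>.\<close>
  define m where "m = \<beta>*\<rho> x1 powr (\<beta>-2)"
  have \<rho>le: "\<rho> x1 <= r*Lam" "\<rho> x1 <= 1" using \<rho>r[of x1] x1(1) r3 by auto
  have m: "m > 0" "1/\<rho> x1 <= m/\<beta>" "1 <= m/\<beta>"
  proof -
   show "m > 0" using \<beta> \<rho>1 by (simp add: m_def)
   have "\<rho> x1 powr (-1) <= \<rho> x1 powr (\<beta>-2)" using \<rho>1 \<rho>le \<beta> by (intro powr_mono') auto
   thus "1/\<rho> x1 <= m/\<beta>" using \<rho>1 \<beta> by (simp add: m_def powr_minus divide_simps)
   moreover have "1 <= 1/\<rho> x1" using \<rho>1 \<rho>le by simp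
   ultimately show "1 <= m/\<beta>" by linarith
  qed
  define Y where "Y = (2*L)*.mat 1+((K*(m*\<rho> x1))*.H x1+(K*((1-\<beta>)*m))*.(- outer (D x1) (D x1)))"
  define p where "p = \<tau>*.(L*.(2*.(x1-Q))+K*.((m*\<rho> x1)*.D x1))"
  have YS: "transpose Y = Y" by (simp add: Y_def sym_simps bfacts(5))
  have mp: "\<beta>*\<rho> x1 powr (\<beta>-1) = m*\<rho> x1"
   using \<rho>1 powr_add[of "\<rho> x1" "\<beta>-2" 1] by (simp add: m_def)
  have "jet2 T x1 (L*.(2*.(x1-Q))+K*.((m*\<rho> x1)*.D x1))
   (L*.(2*.mat 1)+K*.((m*\<rho> x1)*.H x1+(\<beta>*(\<beta>-1)*\<rho> x1 powr (\<beta>-2)) *. outer (D x1) (D x1)))"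
   unfolding T_def mp[symmetric] by (intro jet2_add jet2_cmult jet2_norm2 jet2_powr bfacts(4) \<rho>1)
  moreover have "L*.(2*.mat 1)+K*.((m*\<rho> x1)*.H x1+(\<beta>*(\<beta>-1)*\<rho> x1 powr (\<beta>-2)) *. outer (D x1) (D x1)) = Y"
   by (simp add: Y_def m_def scaleR_add_right scaleR_minus_left[symmetric] algebra_simps del: scaleR_minus_left)
  ultimately have "jet2 (%y. (sg*\<kappa>+\<epsilon>)+T y) x1 (0+(L*.(2*.(x1-Q))+K*.((m*\<rho> x1)*.D x1))) (0+Y)"
   by (intro jet2_add jet2_const) auto
  from jet2_cmult[OF this, of \<tau>] have J: "jet2 (%y. \<tau>*(sg*\<kappa>+\<epsilon>+T y)) x1 p (\<tau>*.Y)" by (simp add: p_def)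
  have sj: "superjet (%y. sg*(u (y + v)-u y)) x1 p (\<tau>*.Y)"
  proof (rule superjet_local_max[OF J])
   have "\<forall>\<^sub>F y in nhds x1. y : Om Int ball Q r"
    using x1r \<open>x1 : Om\<close> by (intro eventually_nhds_in_open open_Int dom open_ball) (auto simp: dist_norm norm_minus_commute)
   thus "\<forall>\<^sub>F y in nhds x1. sg*(u (y + v)-u y)-\<tau>*(sg*\<kappa>+\<epsilon>+T y) <= sg*(u (x1 + v)-u x1)-\<tau>*(sg*\<kappa>+\<epsilon>+T x1)"
    by eventually_elim (use x1(2) closure_subset[of Om] in \<open>auto simp: F_def subset_eq\<close>)
  qed
  have SV: "y : ?S" if "y : Om Int ball Q r" for y using that closure_subset[of Om] by auto
  have cmp: "- \<bar>rhs u G (x1 + v)-rhs u G x1\<bar> <= pucci_plus a A (\<tau>*.Y)" "norm (G (x1 + v)-G x1) = norm p"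
  proof -
   note sc = shifted_comparison[of "Om Int ball Q r" x1 v sg p "\<tau>*.Y", OF _ _ _ _ _ sg sj]
   show "- \<bar>rhs u G (x1 + v)-rhs u G x1\<bar> <= pucci_plus a A (\<tau>*.Y)" "norm (G (x1 + v)-G x1) = norm p"
    using x1r \<open>x1 : Om\<close> dom(1) YS bl shin[OF SV]
    by (intro sc; auto simp: dist_norm norm_minus_commute sym_simps)+
  qed
  have np: "norm p <= \<tau>*(2*L*r+K*(m*\<rho> x1)*Lam)"
  proof -
   have "norm (L*.(2*.(x1-Q))+K*.((m*\<rho> x1)*.D x1)) <= L*(2*norm (x1-Q))+K*(m*\<rho> x1*norm (D x1))"
    using L K m \<rho>1 by (intro order_trans[OF norm_triangle_ineq]) simp
   also have "\<dots> <= L*(2*r)+K*(m*\<rho> x1*Lam)"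
    using L K m \<rho>1 x1r norm_D[OF x1c(2)] mult_pos_pos[OF bfacts(1) r0(1)] by (intro add_mono mult_left_mono) (auto simp: Lam_def)
   finally show ?thesis using \<tau> by (simp add: p_def mult_ac)
  qed
  have "pucci_plus a A Y <= 2*L*(A*CARD('n))+(K*(m*\<rho> x1)*(A*CARD('n)*L0)+K*((1-\<beta>)*m) * - a)"
  proof -
   have I: "pucci_plus a A (mat 1 :: real^'n^'n) <= A*CARD('n)" using pucci_plus_id[OF aA, of 1] by simp
   have H: "pucci_plus a A (H x1) <= A*CARD('n)*L0"
   proof -
    have "pucci_plus a A (H x1) <= A*CARD('n)*norm (H x1)" using pucci_plus_abs[OF aA bfacts(5)] abs_le_D1 by blast
    also have "\<dots> <= A*CARD('n)*L0" using bfacts(7)[OF x1c(2)] aA by (intro mult_left_mono) auto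
    finally show ?thesis .
   qed
   have O: "pucci_plus a A (- outer (D x1) (D x1)) <= - a"
   proof -
    have "a*1 <= a*(norm (D x1))^2" using bfacts(6)[of x1] aA by (intro mult_left_mono) (auto simp: one_le_power)
    thus ?thesis using pucci_plus_neg_outer[OF aA, of "D x1"] by simp
   qed
   have "pucci_plus a A Y <= pucci_plus a A ((2*L)*.(mat 1 :: real^'n^'n))+(pucci_plus a A ((K*(m*\<rho> x1))*.H x1)
     + pucci_plus a A ((K*((1-\<beta>)*m))*.(- outer (D x1) (D x1))))"
    unfolding Y_def by (intro order_trans[OF pucci_plus_add[OF aA]] add_left_mono pucci_plus_add[OF aA]) (simp_all add: sym_simps bfacts(5))
   also have "\<dots> = 2*L*pucci_plus a A (mat 1 :: real^'n^'n)+(K*(m*\<rho> x1)*pucci_plus a A (H x1)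
     + K*((1-\<beta>)*m)*pucci_plus a A (- outer (D x1) (D x1)))"
    using L K m \<rho>1 \<beta> by (subst pucci_plus_scaleR[OF aA], simp add: sym_simps bfacts(5), simp)+ simp
   also have "\<dots> <= 2*L*(A*CARD('n))+(K*(m*\<rho> x1)*(A*CARD('n)*L0)+K*((1-\<beta>)*m) * - a)"
    using L K m \<rho>1 \<beta> I H O by (intro add_mono mult_left_mono) auto
   finally show ?thesis .
  qed
  hence "\<tau>*pucci_plus a A Y <= \<tau>*(2*L*(A*CARD('n))+(K*(m*\<rho> x1)*(A*CARD('n)*L0)+K*((1-\<beta>)*m) * - a))"
   using \<tau> by (intro mult_left_mono) auto
  moreover have "pucci_plus a A (\<tau>*.Y) = \<tau>*pucci_plus a A Y" using pucci_plus_scaleR[OF aA YS] \<tau> by simp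
  moreover have "\<bar>rhs u G (x1 + v)-rhs u G x1\<bar> <= C2*\<tau>/\<rho> x1+C3*norm p"
   using C(3)[OF \<open>x1 : Om\<close> _ \<tau>(1)] cmp(2) x1r r x1c(3) by (auto simp: v_def dist_norm norm_minus_commute)
  moreover have "C3*norm p <= C3*(\<tau>*(2*L*r+K*(m*\<rho> x1)*Lam))" using np C by (intro mult_left_mono) auto
  ultimately have "0 <= \<tau>*(2*L*(A*CARD('n))+(K*(m*\<rho> x1)*(A*CARD('n)*L0)+K*((1-\<beta>)*m) * - a))
   + C2*\<tau>/\<rho> x1+C3*(\<tau>*(2*L*r+K*(m*\<rho> x1)*Lam))" using cmp(1) by linarith
  also have "\<dots> = \<tau>*((2*L*A*CARD('n)+C3*(2*L*r))*1+C2*(1/\<rho> x1)+K*m*(C5*\<rho> x1-(1-\<beta>)*a))"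
   by (simp add: C5_def algebra_simps)
  also have "\<dots> <= \<tau>*((2*L*A*CARD('n)+C3*(2*L*r))*(m/\<beta>)+C2*(m/\<beta>)+K*m*(- \<theta>))"
  proof -
   have "C5*\<rho> x1 <= C5*(r*Lam)" using \<rho>le C5 by (intro mult_left_mono) auto
   moreover have "(1-\<beta>)*a = 2*\<theta>" by (simp add: \<theta>_def)
   ultimately have "C5*\<rho> x1-(1-\<beta>)*a <= - \<theta>" using r3 by linarith
   hence "K*m*(C5*\<rho> x1-(1-\<beta>)*a) <= K*m*(- \<theta>)" using K m by (intro mult_left_mono) auto
   from mult_left_mono[OF add_mono[OF add_mono[OF mult_left_mono[OF m(3)] mult_left_mono[OF m(2) C(1)]] this]]
   show ?thesis using L aA C r \<tau> by simp
  qed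
  also have "\<dots> = \<tau>*m*(E/\<beta>-K*\<theta>)" by (simp add: E_def algebra_simps add_divide_distrib)
  also have "\<dots> = - (\<tau>*m/\<beta>)" unfolding K using \<beta> by (simp add: field_simps)
  finally show False using \<tau> m \<beta> by (simp add: divide_le_0_iff mult_le_0_iff)
 qed
 show ?thesis
 proof (rule that[OF r L(1) less_imp_le[OF K(1)]])
  fix sg \<epsilon> \<tau> :: real and x
  assume "sg = 1 | sg = -1" "0 < \<epsilon>" "0 < \<tau>" "\<tau> < r0/2" "x : closure Om" "x : cball Q r"
   "!!y z. y : closure Om ==> z : closure Om ==> dist y z <= \<tau> ==> dist (G y) (G z) <= \<epsilon>"
  hence "sg*(u (x+\<tau>*.nu Q)-u x) <= \<tau>*(sg*\<kappa>+\<epsilon>+T x)" by (intro main) auto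
  thus "sg*(u (x+\<tau>*.nu Q)-u x) <= \<tau>*(sg*\<kappa>+\<epsilon>+L*(norm (x-Q))^2+K*\<rho> x powr \<beta>)"
   unfolding T_def add.assoc .
 qed
qed

text \<open>First \<open>\<tau>\<close> and then \<open>\<epsilon>\<close> tends to 0 in the bound
  for difference quotients; the two signs \<open>sg\<close> give the two inequalities.\<close>

lemma gradient_expansion:
 assumes \<beta>: "0 < \<beta>" "\<beta> < 1"
 obtains r L K where "0 < r" "r < r1" "0 <= L" "0 <= K"
  "!!x. x : Om ==> x : cball Q r ==> \<bar>G x \<bullet> nu Q-\<kappa>\<bar> <= L*(norm (x-Q))^2+K*\<rho> x powr \<beta>"
proof (rule difference_quotient_bound[OF \<beta>])
 fix r L K assume r: "0 < r" "r < r1" "0 <= L" "0 <= K" and dq: "!!sg \<epsilon> \<tau> x. sg = 1 | sg = -1 ==> 0 < \<epsilon> ==> 0 < \<tau> ==> \<tau> < r0/2 ==>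
   (!!y z. y : closure Om ==> z : closure Om ==> dist y z <= \<tau> ==> dist (G y) (G z) <= \<epsilon>) ==>
   x : closure Om ==> x : cball Q r ==>
   sg*(u (x+\<tau>*.nu Q)-u x) <= \<tau>*(sg*\<kappa>+\<epsilon>+L*(norm (x-Q))^2+K*\<rho> x powr \<beta>)"
 have sgb: "sg*(G x \<bullet> nu Q) <= sg*\<kappa>+(L*(norm (x-Q))^2+K*\<rho> x powr \<beta>)"
  if sg: "sg = 1 | sg = (-1::real)" and x: "x : Om" "x : cball Q r" for sg x
 proof (rule field_le_epsilon)
  fix \<epsilon> :: real assume \<epsilon>: "\<epsilon> > 0"
  have "uniformly_continuous_on (closure Om) G" by (intro compact_uniformly_continuous Gc compact_closure)
  then obtain d where d: "d > 0" "!!y z. y : closure Om ==> z : closure Om ==> dist y z < d ==> dist (G y) (G z) < \<epsilon>"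
   using \<epsilon> unfolding uniformly_continuous_on_def by (metis dist_commute)
  have "GDERIV u (x+0*.nu Q) :> G x" using GD x by simp
  from GDERIV_line[OF this] have "((%t. (u (x+t*.nu Q)-u x)/t) \<longlongrightarrow> G x \<bullet> nu Q) (at 0)"
   by (simp add: has_field_derivative_iff)
  hence lim: "((%t. sg*((u (x+t*.nu Q)-u x)/t)) \<longlongrightarrow> sg*(G x \<bullet> nu Q)) (at_right 0)"
   by (intro tendsto_mult_left) (simp add: filterlim_at_split)
  have "\<forall>\<^sub>F \<tau> in at_right 0. sg*((u (x+\<tau>*.nu Q)-u x)/\<tau>) <= sg*\<kappa>+(L*(norm (x-Q))^2+K*\<rho> x powr \<beta>)+\<epsilon>"
   unfolding eventually_at_right_field
  proof (intro exI[of _ "min d (r0/2)"] conjI allI impI)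
   show "0 < min d (r0/2)" using d r0 by simp
   fix \<tau> assume \<tau>: "0 < \<tau>" "\<tau> < min d (r0/2)"
   have "sg*(u (x+\<tau>*.nu Q)-u x) <= \<tau>*(sg*\<kappa>+\<epsilon>+L*(norm (x-Q))^2+K*\<rho> x powr \<beta>)"
    using \<tau> d(2) x closure_subset[of Om] by (intro dq[OF sg \<epsilon>]) (auto intro!: less_imp_le)
   thus "sg*((u (x+\<tau>*.nu Q)-u x)/\<tau>) <= sg*\<kappa>+(L*(norm (x-Q))^2+K*\<rho> x powr \<beta>)+\<epsilon>"
    using \<tau> by (simp add: pos_divide_le_eq algebra_simps)
  qed
  thus "sg*(G x \<bullet> nu Q) <= sg*\<kappa>+(L*(norm (x-Q))^2+K*\<rho> x powr \<beta>)+\<epsilon>"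
   by (rule tendsto_upperbound[OF lim]) simp
 qed
 have "\<bar>G x \<bullet> nu Q-\<kappa>\<bar> <= L*(norm (x-Q))^2+K*\<rho> x powr \<beta>"
  if "x : Om" "x : cball Q r" for x using sgb[of 1 x] sgb[of "-1" x] that by (simp add: abs_le_iff)
 thus thesis by (rule that[OF r])
qed

end

subsection \<open>The corner lemma\<close>

context bpoint
begin

text \<open>\<open>\<sigma>\<close> is the height of the boundary over the tangent plane, so the
  point lies at distance \<open>s - \<sigma>\<close> from its foot in the direction
  \<open>nu Q\<close>. The expansion of \<open>\<rho>\<close> at \<open>Q\<close> determines
  \<open>\<sigma>\<close> up to the Hoelder error, and the gradient expansion on the segment from
  the foot determines \<open>u\<close>.\<close>

lemma foot_expansion:
 assumes f: "norm f = 1" "f \<bullet> nu Q = 0" and \<beta>: "0 < \<beta>" "\<beta> < 1"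
 obtains C t0 where "C > 0" "0 < t0" "t0 <= 1"
  "!!t s. 0 < t ==> t <= t0 ==> 0 < s ==> s <= t ==> t^2 <= s ==> Q+t*.f + s*.nu Q : Om ==>
   \<exists>\<sigma>. \<bar>norm (D Q)*\<sigma>+t^2*(f \<bullet> (H Q *v f))/2\<bar> <= C*t powr (2+\<eta>) &
    \<bar>u (Q+t*.f + s*.nu Q)-\<kappa>*(s-\<sigma>)\<bar> <= C*(s*t^2 + s powr (1+\<beta>))"
proof (rule gradient_expansion[OF \<beta>])
 fix r L K assume r: "0 < r" "r < r1" "0 <= L" "0 <= K"
  and ge: "!!x. x : Om ==> x : cball Q r ==> \<bar>G x \<bullet> nu Q-\<kappa>\<bar> <= L*(norm (x-Q))^2+K*\<rho> x powr \<beta>"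
 define C0 where "C0 = 1+4*Lam"
 define B where "B = 1+2*L0"
 have C0: "C0 >= 5" and B: "B >= 1" using Lam1 bfacts(1) by (auto simp: C0_def B_def)
 \<comment> \<open>The second bound absorbs \<open>L0 \<sigma>^2\<close> into
   \<open>\<bar>\<sigma>\<bar>/2\<close>, by the crude estimate
   \<open>\<bar>\<sigma>\<bar> <= C0 t\<close>. The third keeps the segment in the ball of the
   gradient expansion, the fourth the point in the ball where feet exist.\<close>
 define t0 where "t0 = Min {1, 1/(2*L0*C0), r/(2*B), r1/3}"
 have t0: "0 < t0" "t0 <= 1" "t0 <= 1/(2*L0*C0)" "t0 <= r/(2*B)" "t0 <= r1/3"
  using bfacts(1) C0 B r r1 by (auto simp: t0_def)
 define C where "C = B*(L*(2*B)^2+K*(Lam*B) powr \<beta>)+(L0*B powr (2+\<eta>)+2*L0^2+2*L0 ^ 3)+1"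
 have parts: "0 <= B*(L*(2*B)^2)" "0 <= B*(K*(Lam*B) powr \<beta>)" "0 <= L0*B powr (2+\<eta>)+2*L0^2+2*L0 ^ 3"
  using B r(3,4) bfacts(1) by auto
 hence C: "C > 0" "B*(L*(2*B)^2) <= C" "B*(K*(Lam*B) powr \<beta>) <= C" "L0*B powr (2+\<eta>)+2*L0^2+2*L0 ^ 3 <= C"
  by (auto simp: C_def distrib_left)
 show thesis
 proof (rule that[OF C(1) t0(1,2)])
  fix t s assume t: "0 < t" "t <= t0" and s: "0 < s" "s <= t" "t^2 <= s" and x: "Q+t*.f + s*.nu Q : Om"
  define x where "x = Q+t*.f + s*.nu Q"
  have pt: "norm (t*.f+\<sigma>*.nu Q) <= t+\<bar>\<sigma>\<bar>" for \<sigma>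
   using norm_triangle_ineq[of "t*.f" "\<sigma>*.nu Q"] t f nuQ by simp
  have xQ: "norm (x-Q) <= 2*t" using pt[of s] s by (simp add: x_def add.assoc)
  have xr: "x : ball Q r1" "x : ball Q r0" using xQ t t0(5) r1 by (auto simp: dist_norm norm_minus_commute)
  obtain s' where s': "0 < s'" "s' <= 2*\<rho> x" and fr: "x - s'*.nu Q : frontier Om"
   and bl: "!!\<sigma>. 0 <= \<sigma> ==> \<sigma> <= s' ==> x-\<sigma>*.nu Q : ball Q r0"
   by (rule foot[OF x[folded x_def] xr(1)]) blast
  define P \<sigma> where "P = x - s'*.nu Q" and "\<sigma> = s - s'"
  have P: "P-Q = t*.f+\<sigma>*.nu Q" by (simp add: P_def \<sigma>_def x_def algebra_simps)
  have Pb: "P : ball Q r0" "P : closure Om" using bl[of s'] s' fr frontier_facts by (auto simp: P_def)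
  have \<rho>P: "\<rho> P = 0" using frontier_rho[OF Pb(1)] fr by (simp add: P_def)
  have "\<rho> x <= Lam*norm (x-Q)" using rho_lip[of Q x] xr r0 bfacts(2) by simp
  also have "\<dots> <= Lam*(2*t)" using xQ Lam1 by (intro mult_left_mono) auto
  finally have "s' <= 4*Lam*t" using s' by simp
  hence \<sigma>0: "\<bar>\<sigma>\<bar> <= C0*t" using s s' t by (auto simp: \<sigma>_def C0_def algebra_simps abs_le_iff)
  have ff: "f \<bullet> f = 1" "nu Q \<bullet> nu Q = 1" using f nuQ by (auto simp: dot_square_norm)
  have n2: "(norm (P-Q))^2 = t^2+\<sigma>^2"
   unfolding P power2_norm_eq_inner using f ff by (simp add: inner_add_left inner_add_right inner_commute power2_eq_square)
  have DP: "D Q \<bullet> (P-Q) = norm (D Q)*\<sigma>"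
   unfolding P by (subst DQ) (use f ff in \<open>simp add: inner_add_right inner_commute\<close>)
  have D1: "\<bar>\<sigma>\<bar> <= norm (D Q)*\<bar>\<sigma>\<bar>" using bfacts(6)[of Q] mult_right_mono[of 1 "norm (D Q)" "\<bar>\<sigma>\<bar>"] by simp
  have \<sigma>2: "\<bar>\<sigma>\<bar> <= 2*L0*t^2"
  proof -
   have "norm (D Q)*\<bar>\<sigma>\<bar> <= L0*(t^2+\<sigma>^2)"
    using quad[of Q P] Pb r0 \<rho>P bfacts(2) n2 DP by (simp add: abs_mult)
   moreover have "L0*\<sigma>^2 <= \<bar>\<sigma>\<bar>/2"
   proof -
    have "L0*\<sigma>^2 = L0*\<bar>\<sigma>\<bar>*\<bar>\<sigma>\<bar>" by (simp add: power2_eq_square)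
    also have "\<dots> <= L0*(C0*t0)*\<bar>\<sigma>\<bar>"
     using \<sigma>0 t C0 bfacts(1) by (intro mult_right_mono mult_left_mono order_trans[OF \<sigma>0]) auto
    also have "\<dots> <= 1/2*\<bar>\<sigma>\<bar>" using t0(3) bfacts(1) C0 by (intro mult_right_mono) (auto simp: field_simps)
    finally show ?thesis by simp
   qed
   ultimately show ?thesis using D1 by (simp add: algebra_simps)
  qed
  have tt: "t^2 <= t" "t <= 1" using t t0 by (auto simp: power2_eq_square mult_left_le_one_le)
  have "\<bar>\<sigma>\<bar> <= 2*L0 * s" "\<bar>\<sigma>\<bar> <= 2*L0*t"
   by (rule order_trans[OF \<sigma>2 mult_left_mono], use s(3) tt(1) bfacts(1) in simp_all)+
  hence s'B: "s' <= B * s" and PQ: "norm (P-Q) <= B*t" using pt[of \<sigma>] unfolding P by (auto simp: \<sigma>_def B_def algebra_simps abs_le_iff)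
  have h1: "\<bar>norm (D Q)*\<sigma>+t^2*(f \<bullet> (H Q *v f))/2\<bar> <= C*t powr (2+\<eta>)"
  proof -
   have nH: "norm (H Q) <= L0" using bfacts(7)[of Q] r0 by simp
   have e1: "\<bar>f \<bullet> (H Q *v nu Q)\<bar> <= L0" "\<bar>nu Q \<bullet> (H Q *v nu Q)\<bar> <= L0"
    using abs_form_le[of f "H Q" "nu Q"] abs_form_le[of "nu Q" "H Q" "nu Q"] f nuQ nH by auto
   have sym: "nu Q \<bullet> (H Q *v f) = f \<bullet> (H Q *v nu Q)" using sym_dot[OF bfacts(5)] by (metis inner_commute)
   have form: "(P-Q) \<bullet> (H Q *v (P-Q))/2 = t^2*(f \<bullet> (H Q *v f))/2+(t*\<sigma>*(f \<bullet> (H Q *v nu Q))+\<sigma>^2*(nu Q \<bullet> (H Q *v nu Q))/2)"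
    unfolding P using sym by (simp add: matrix_vector_right_distrib matrix_vector_mult_scaleR inner_add_left inner_add_right power2_eq_square algebra_simps)
   have "\<bar>t*\<sigma>*(f \<bullet> (H Q *v nu Q))\<bar> <= t*(2*L0*t^2)*L0"
    unfolding abs_mult using \<sigma>2 e1 t bfacts(1) by (intro mult_mono) auto
   moreover have "\<bar>\<sigma>^2*(nu Q \<bullet> (H Q *v nu Q))\<bar> <= (2*L0*t^2)^2*L0"
    unfolding abs_mult using power_mono[OF \<sigma>2, of 2] e1 bfacts(1) by (intro mult_mono) auto
   moreover have "(2*L0*t^2)^2*L0 <= 4*L0 ^ 3*t ^ 3"
    using power_decreasing[of 3 4 t] t tt bfacts(1) by (simp add: power_mult_distrib power2_eq_square power3_eq_cube power4_eq_xxxx mult_ac)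
   ultimately have rest: "\<bar>t*\<sigma>*(f \<bullet> (H Q *v nu Q))+\<sigma>^2*(nu Q \<bullet> (H Q *v nu Q))/2\<bar> <= (2*L0^2+2*L0 ^ 3)*t ^ 3"
    by (simp add: power2_eq_square power3_eq_cube algebra_simps abs_le_iff)
   have "norm (P-Q) powr (2+\<eta>) <= (B*t) powr (2+\<eta>)" using PQ eta by (intro powr_mono2) auto
   also have "\<dots> = B powr (2+\<eta>)*t powr (2+\<eta>)" using B t by (simp add: powr_mult)
   finally have "L0*norm (P-Q) powr (2+\<eta>) <= L0*(B powr (2+\<eta>)*t powr (2+\<eta>))" using bfacts(1) by (intro mult_left_mono) auto
   moreover have "t ^ 3 <= t powr (2+\<eta>)"
    using powr_mono'[of "2+\<eta>" 3 t] eta t tt by simp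
   hence "(2*L0^2+2*L0 ^ 3)*t ^ 3 <= (2*L0^2+2*L0 ^ 3)*t powr (2+\<eta>)" using bfacts(1) by (intro mult_left_mono) auto
   moreover have "(L0*B powr (2+\<eta>)+2*L0^2+2*L0 ^ 3)*t powr (2+\<eta>) <= C*t powr (2+\<eta>)"
    using C(4) by (intro mult_right_mono) auto
   ultimately show ?thesis using hoelder[of P] rest unfolding \<rho>P DP form by (simp add: algebra_simps abs_le_iff)
  qed
  have eqx: "P + s'*.nu Q = x" by (simp add: P_def)
  obtain \<tau> where \<tau>: "0 < \<tau>" "\<tau> < s'" "P+\<tau>*.nu Q : Om" "P+\<tau>*.nu Q : ball Q r0" "u x-u P = s'*(G (P+\<tau>*.nu Q) \<bullet> nu Q)"
   using shift_mvt[OF Pb(2,1) s'(1)] xr(2) unfolding eqx by metis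
  define z where "z = P+\<tau>*.nu Q"
  have zQ: "norm (z-Q) <= 2*B*t"
  proof -
   have "norm (z-Q) <= norm (P-Q)+norm (\<tau>*.nu Q)" using norm_triangle_ineq[of "P-Q" "\<tau>*.nu Q"] by (simp add: z_def algebra_simps)
   also have "\<dots> <= B*t+B * s" using PQ \<tau> s'B nuQ by simp
   also have "\<dots> <= 2*B*t" using s B by simp
   finally show ?thesis .
  qed
  also have "\<dots> <= 2*B*t0" using t B by (intro mult_left_mono) auto
  also have "\<dots> <= r" using t0(4) B by (simp add: pos_le_divide_eq mult.commute)
  finally have zr: "z : cball Q r" by (simp add: dist_norm norm_minus_commute)
  have "\<rho> z <= Lam*\<tau>" using rho_lip[OF Pb(1) \<tau>(4)] \<rho>P nuQ \<tau> by (simp add: z_def)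
  also have "\<dots> <= Lam*(B * s)" using \<tau> s'B Lam1 by (intro mult_left_mono) auto
  finally have "\<rho> z powr \<beta> <= (Lam*B * s) powr \<beta>" using \<beta> rho_pos_iff[OF \<tau>(4)] \<tau>(3) by (intro powr_mono2) (auto simp: z_def)
  hence z1: "\<rho> z powr \<beta> <= (Lam*B) powr \<beta> * s powr \<beta>" using Lam1 B s by (simp add: powr_mult)
  have z2: "(norm (z-Q))^2 <= (2*B)^2*t^2" using power_mono[OF zQ, of 2] by (simp add: power_mult_distrib)
  have ux: "u x = s'*(G z \<bullet> nu Q)" using \<tau>(5) u0 fr by (simp add: z_def P_def)
  have "\<bar>G z \<bullet> nu Q-\<kappa>\<bar> <= L*((2*B)^2*t^2)+K*((Lam*B) powr \<beta> * s powr \<beta>)"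
   using ge[OF \<tau>(3)[folded z_def] zr] mult_left_mono[OF z2 r(3)] mult_left_mono[OF z1 r(4)] by linarith
  hence "s'*\<bar>G z \<bullet> nu Q-\<kappa>\<bar> <= (B * s)*(L*((2*B)^2*t^2)+K*((Lam*B) powr \<beta> * s powr \<beta>))"
   using s'B s' s B by (intro mult_mono) auto
  also have "\<dots> = (B*(L*(2*B)^2))*(s*t^2)+(B*(K*(Lam*B) powr \<beta>))*(s * s powr \<beta>)" by (simp add: algebra_simps)
  also have "s * s powr \<beta> = s powr (1+\<beta>)" using s by (simp add: powr_add)
  also have "(B*(L*(2*B)^2))*(s*t^2)+(B*(K*(Lam*B) powr \<beta>)) * s powr (1+\<beta>) <= C*(s*t^2)+C * s powr (1+\<beta>)"
   using C s by (intro add_mono mult_right_mono) auto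
  finally have "\<bar>u x-\<kappa>*(s-\<sigma>)\<bar> <= C*(s*t^2 + s powr (1+\<beta>))"
   using s' unfolding ux by (simp add: \<sigma>_def abs_mult[symmetric] distrib_left right_diff_distrib mult.commute abs_if split: if_splits)
  thus "\<exists>\<sigma>. \<bar>norm (D Q)*\<sigma>+t^2*(f \<bullet> (H Q *v f))/2\<bar> <= C*t powr (2+\<eta>) &
    \<bar>u (Q+t*.f + s*.nu Q)-\<kappa>*(s-\<sigma>)\<bar> <= C*(s*t^2 + s powr (1+\<beta>))"
   using h1 unfolding x_def by blast
 qed
qed

text \<open>The quadratic form that determines the height of the boundary is even, so it is the same
  in the directions \<open>e\<close> and \<open>- e\<close>. The heights of the two feet then differ
  by the Hoelder error only.\<close>

lemma corner_upper:
 assumes e: "norm e = 1" "e \<bullet> nu Q = 0" and \<beta>: "0 < \<beta>" "\<beta> < 1"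
 obtains C t0 where "C > 0" "0 < t0" "t0 <= 1"
  "!!t s. 0 < t ==> t <= t0 ==> 0 < s ==> s <= t ==> t^2 <= s ==> Q+t*.e + s*.nu Q : Om ==> Q-t*.e + s*.nu Q : Om ==>
   u (Q-t*.e + s*.nu Q)-u (Q+t*.e + s*.nu Q) <= C*(t powr (2+\<eta>) + s*t^2 + s powr (1+\<beta>))"
proof (rule foot_expansion[OF e \<beta>])
 fix C1 t1 assume 1: "C1 > 0" "0 < t1" "t1 <= 1"
  "!!t s. 0 < t ==> t <= t1 ==> 0 < s ==> s <= t ==> t^2 <= s ==> Q+t*.e + s*.nu Q : Om ==>
   \<exists>\<sigma>. \<bar>norm (D Q)*\<sigma>+t^2*(e \<bullet> (H Q *v e))/2\<bar> <= C1*t powr (2+\<eta>) &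
    \<bar>u (Q+t*.e + s*.nu Q)-\<kappa>*(s-\<sigma>)\<bar> <= C1*(s*t^2 + s powr (1+\<beta>))"
 have e': "norm (- e) = 1" "- e \<bullet> nu Q = 0" using e by auto
 show thesis
 proof (rule foot_expansion[OF e' \<beta>])
  fix C2 t2 assume 2: "C2 > 0" "0 < t2" "t2 <= 1"
   "!!t s. 0 < t ==> t <= t2 ==> 0 < s ==> s <= t ==> t^2 <= s ==> Q+t *. - e + s*.nu Q : Om ==>
    \<exists>\<sigma>. \<bar>norm (D Q)*\<sigma>+t^2*(- e \<bullet> (H Q *v-e))/2\<bar> <= C2*t powr (2+\<eta>) &
     \<bar>u (Q+t *. - e + s*.nu Q)-\<kappa>*(s-\<sigma>)\<bar> <= C2*(s*t^2 + s powr (1+\<beta>))"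
  define C where "C = (1+\<kappa>)*(C1+C2)"
  show thesis
  proof (rule that[of C "min t1 t2"])
   show "C > 0" "0 < min t1 t2" "min t1 t2 <= 1" using 1(1-3) 2(1-3) kappa_pos by (auto simp: C_def)
   fix t s assume t: "0 < t" "t <= min t1 t2" "0 < s" "s <= t" "t^2 <= s"
    and x: "Q+t*.e + s*.nu Q : Om" "Q-t*.e + s*.nu Q : Om"
   define T S where "T = t powr (2+\<eta>)" and "S = s*t^2 + s powr (1+\<beta>)"
   have TS: "T >= 0" "S >= 0" using t by (auto simp: T_def S_def)
   obtain \<sigma> where \<sigma>: "\<bar>norm (D Q)*\<sigma>+t^2*(e \<bullet> (H Q *v e))/2\<bar> <= C1*T" "\<bar>u (Q+t*.e + s*.nu Q)-\<kappa>*(s-\<sigma>)\<bar> <= C1*S"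
    using 1(4)[OF t(1) _ t(3-5) x(1)] t(2) unfolding T_def S_def by auto
   have neg: "- e \<bullet> (H Q *v-e) = e \<bullet> (H Q *v e)" using matrix_vector_mult_scaleR[of "H Q" "-1" e] by simp
   obtain \<sigma>' where \<sigma>': "\<bar>norm (D Q)*\<sigma>'+t^2*(e \<bullet> (H Q *v e))/2\<bar> <= C2*T" "\<bar>u (Q-t*.e + s*.nu Q)-\<kappa>*(s-\<sigma>')\<bar> <= C2*S"
    using 2(4)[OF t(1) _ t(3-5)] t(2) x(2) unfolding T_def S_def neg by auto
   have "norm (D Q)*(\<sigma>-\<sigma>') <= (C1+C2)*T" using \<sigma>(1) \<sigma>'(1) unfolding abs_le_iff by (simp add: algebra_simps)
   moreover have "\<sigma>-\<sigma>' <= norm (D Q)*(\<sigma>-\<sigma>') | \<sigma>-\<sigma>' <= 0"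
    using bfacts(6)[of Q] mult_right_mono[of 1 "norm (D Q)" "\<sigma>-\<sigma>'"] by (cases "\<sigma>-\<sigma>' <= 0") auto
   moreover have "0 <= (C1+C2)*T" using TS 1 2 by simp
   ultimately have "\<sigma>-\<sigma>' <= (C1+C2)*T" by linarith
   hence "\<kappa>*(\<sigma>-\<sigma>') <= \<kappa>*((C1+C2)*T)" using kappa_pos by (intro mult_left_mono) auto
   hence "u (Q-t*.e + s*.nu Q)-u (Q+t*.e + s*.nu Q) <= \<kappa>*((C1+C2)*T)+(C1+C2)*S"
    using \<sigma>(2) \<sigma>'(2) unfolding abs_le_iff by (simp add: algebra_simps)
   also have "\<dots> <= C*(T+S)" using TS 1 2 kappa_pos by (simp add: C_def algebra_simps)
   finally show "u (Q-t*.e + s*.nu Q)-u (Q+t*.e + s*.nu Q) <= C*(t powr (2+\<eta>) + s*t^2 + s powr (1+\<beta>))"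
    by (simp add: T_def S_def add.assoc)
  qed
 qed
qed

end

context overdet
begin

text \<open>If contact does not fill a neighbourhood of \<open>Q\<close> beyond the plane, the
  dichotomy makes the difference positive there. The barrier is used in the intersection of an
  interior ball at \<open>Q\<close> with a ball that touches the plane at \<open>Q\<close> from the
  side of the cap.\<close>

lemma corner_lower:
 assumes e: "norm e = 1" and cap: "cap_ok e \<mu>" and Q: "Q : frontier Om" "Q \<bullet> e = \<mu>" "e \<bullet> nu Q = 0"
  and q: "CARD('n)*(A-a) < (q-1)*a"
  and ns: "\<not> (\<exists>r>0. \<forall>y\<in>frontier Om Int ball Q r. y \<bullet> e > \<mu> --> y : Sset e \<mu>)"
 obtains c R r where "c > 0" "R > 0" "r > 0" "cball (Q+R*.nu Q) R - {Q} <= Om"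
  "!!y. y : cball Q r ==> 0 <= capfun R Q (nu Q) y ==> 0 <= capfun R Q e y ==>
   c*(capfun R Q (nu Q) y * capfun R Q e y) powr q <= u (reflect e \<mu> y)-u y"
proof -
 define P where "P = {y. y \<bullet> e > \<mu>}"
 have P: "open P" "convex P" unfolding P_def
  by (auto intro!: open_Collect_less continuous_intros simp: inner_commute[of _ e] convex_halfspace_gt)
 have P2: "y + s*.nu Q : P" if "y : P" for y s using that Q(3) by (simp add: P_def inner_add_left inner_commute[of "nu Q" e])
 have rQ: "reflect e \<mu> Q = Q" by (rule reflect_same[OF e Q(2)])
 obtain r2 C where r2: "r2 > 0" "C >= 0" and hop: "hopfable a A C (Om Int ball Q r2 Int P) (%x. u (reflect e \<mu> x)-u x)"
  and alt: "(\<forall>y\<in>frontier Om Int ball Q r2 Int P. y : Sset e \<mu>) | (\<forall>y\<in>Om Int ball Q r2 Int P. u y < u (reflect e \<mu> y))"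
  by (rule local_dichotomy[OF e cap Q(1), of 1 P]) (use P P2 rQ Q(1) in \<open>auto simp: P_def\<close>)
 have pos: "u y < u (reflect e \<mu> y)" if "y : Om Int ball Q r2 Int P" for y
  using alt ns r2(1) that by (auto simp: P_def)
 obtain R0 where R0: "R0 > 0" "!!R. 0 < R ==> R <= R0 ==> cball (Q+R*.nu Q) R - {Q} <= Om" using interior_ball[OF Q(1)] by metis
 define R where "R = min R0 (r2/3)"
 have R: "R > 0" "R <= R0" "R <= r2/3" using R0 r2 by (auto simp: R_def)
 note nn = norm_nu[OF Q(1)]
 have in1: "y : Om Int ball Q r2 Int P" if y: "0 <= capfun R Q (nu Q) y" "0 <= capfun R Q e y" "y ~= Q" for y
 proof -
  have "y : cball (Q+R*.nu Q) R" using y(1) capfun_ball[OF R(1) nn] by simp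
  hence "y : Om" "dist Q y <= 2*R"
   using R0(2)[OF R(1,2)] y(3) dist_triangle[of Q y "Q+R*.nu Q"] R nn by (auto simp: dist_norm norm_minus_commute)
  moreover have "0 < (norm (y-Q))^2/(2*R)" using y(3) R by simp
  hence "0 < e \<bullet> (y-Q)" using y(2) unfolding capfun_def by linarith
  hence "y : P" using Q(2) by (simp add: P_def inner_diff_right inner_commute)
  ultimately show ?thesis using R by auto
 qed
 have cl: "y : closure Om & reflect e \<mu> y : closure Om" if y: "0 <= capfun R Q (nu Q) y" "0 <= capfun R Q e y" for y
 proof (cases "y = Q")
  case False
  thus ?thesis using in1[OF y] cap closure_subset[of Om] by (auto simp: cap_ok_def P_def)
 qed (use rQ frontier_facts(2)[OF Q(1)] in simp)
 have "\<exists>c>0. \<exists>r>0. \<forall>y\<in>cball Q r. 0 <= capfun R Q (nu Q) y --> 0 <= capfun R Q e y -->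
  c*(capfun R Q (nu Q) y * capfun R Q e y) powr q <= u (reflect e \<mu> y)-u y"
 proof (rule corner_barrier[OF aA r2(2) R(1) nn e _ q])
  show "nu Q \<bullet> e = 0" using Q(3) by (simp add: inner_commute)
  show "continuous_on {y. 0 <= capfun R Q (nu Q) y & 0 <= capfun R Q e y} (%y. u (reflect e \<mu> y)-u y)"
   using cl by (intro continuous_intros continuous_on_subset[OF uc] continuous_on_compose2[OF uc] reflect_continuous[OF e]) auto
  show "0 < u (reflect e \<mu> y)-u y" if "0 <= capfun R Q (nu Q) y" "0 <= capfun R Q e y" "y ~= Q" for y
   using pos[OF in1[OF that]] by simp
  have "y ~= Q" if "0 < capfun R Q e y" for y using that by (auto simp: capfun_def)
  thus "hopfable a A C {y. 0 < capfun R Q (nu Q) y & 0 < capfun R Q e y} (%y. u (reflect e \<mu> y)-u y)"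
   using in1 by (intro hopfable_subset[OF hop]) (auto simp: less_imp_le)
 qed (simp add: rQ)
 thus ?thesis using that R R0(2)[OF R(1,2)] by blast
qed

text \<open>At \<open>Q \<plusminus> t e + s \<nu>\<close> with \<open>s = t powr (1 + \<eta> / 2)\<close> the barrier is of order \<open>t powr p\<close>, where
 \<open>p = (2 + \<eta> / 2) (1 + \<eta> / 8)\<close>, and the upper bound is of order \<open>t powr (p + 3 \<eta> / 32)\<close>.\<close>

lemma corner_lemma:
 assumes e: "norm e = 1" and cap: "cap_ok e \<mu>" and hQ: "Q : frontier Om" "Q \<bullet> e = \<mu>" "e \<bullet> nu Q = 0"
  and small: "CARD('n)*(A-a) < \<eta>/8*a"
 shows "\<exists>r>0. \<forall>y\<in>frontier Om Int ball Q r. y \<bullet> e > \<mu> --> y : Sset e \<mu>"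
proof (rule ccontr)
 assume ns: "\<not> ?thesis"
 define q \<beta> p where "q = 1+\<eta>/8" and "\<beta> = 1-\<eta>/16" and "p = (2+\<eta>/2)*q"
 have q: "CARD('n)*(A-a) < (q-1)*a" "q > 0" and \<beta>: "0 < \<beta>" "\<beta> < 1" using small eta by (auto simp: q_def \<beta>_def)
 obtain c R r where c: "c > 0" "R > 0" "r > 0" "cball (Q+R*.nu Q) R - {Q} <= Om"
  and low: "!!y. y : cball Q r ==> 0 <= capfun R Q (nu Q) y ==> 0 <= capfun R Q e y ==>
   c*(capfun R Q (nu Q) y * capfun R Q e y) powr q <= u (reflect e \<mu> y)-u y"
  using corner_lower[OF e cap hQ q(1) ns] by metis
 obtain \<rho> D H rb L0 r0 where "bpoint \<alpha> a A lam \<kappa> \<eta> M Om u G Q \<rho> D H rb L0 r0" using bpoint_exists[OF hQ(1)] by blast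
 then interpret bpoint \<alpha> a A lam \<kappa> \<eta> M Om u G Q \<rho> D H rb L0 r0 .
 obtain C t0 where C: "C > 0" "0 < t0" "t0 <= 1"
  and up: "!!t s. 0 < t ==> t <= t0 ==> 0 < s ==> s <= t ==> t^2 <= s ==> Q+t*.e + s*.nu Q : Om ==> Q-t*.e + s*.nu Q : Om ==>
   u (Q-t*.e + s*.nu Q)-u (Q+t*.e + s*.nu Q) <= C*(t powr (2+\<eta>) + s*t^2 + s powr (1+\<beta>))"
  using corner_upper[OF e hQ(3) \<beta>] by metis
 \<comment> \<open>The gain in the exponent: each of the three error terms is at most
   \<open>t powr (p + \<gamma>)\<close>.\<close>
 define \<gamma> where "\<gamma> = 3*\<eta>/32"
 have \<gamma>: "\<gamma> > 0" using eta by (simp add: \<gamma>_def)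
 define c' where "c' = c*(1/4) powr q"
 have c': "c' > 0" using c by (simp add: c'_def)
 \<comment> \<open>The fourth bound gives \<open>t^2 <= s R/2\<close>, which puts both points into
   the interior ball. The last one makes \<open>3 C t powr \<gamma>\<close> smaller than
   \<open>c'\<close>, the final contradiction.\<close>
 define t where "t = Min {t0, r/2, R/2, (R/2) powr (2/(2-\<eta>)), (c'/(4*C)) powr (1/\<gamma>)}"
 have t: "0 < t" "t <= t0" "t <= r/2" "t <= R/2" "t <= (R/2) powr (2/(2-\<eta>))" "t <= (c'/(4*C)) powr (1/\<gamma>)"
  using C c c' by (auto simp: t_def)
 have t1: "t <= 1" using t C by simp
 define s where "s = t powr (1+\<eta>/2)"
 have tp: "t powr x <= t powr y" if "y <= x" for x y using that t t1 by (intro powr_mono') auto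
 have s: "0 < s" "s <= t" "t^2 <= s"
  using t tp[of 1 "1+\<eta>/2"] tp[of "1+\<eta>/2" 2] eta by (auto simp: s_def)
 have ts: "t^2 <= s*(R/2)"
 proof -
  have "t powr (1-\<eta>/2) <= ((R/2) powr (2/(2-\<eta>))) powr (1-\<eta>/2)" using t eta by (intro powr_mono2) auto
  also have "\<dots> = (R/2) powr 1" unfolding powr_powr using eta by (intro arg_cong2[where f = "(powr)"]) (auto simp: field_simps)
  finally have "s*t powr (1-\<eta>/2) <= s*(R/2)" using c s by (intro mult_left_mono) auto
  thus ?thesis using t by (simp add: s_def powr_add[symmetric])
 qed
 have ss: "s^2 <= t^2" using s by (intro power_mono) auto
 have nn: "nu Q \<bullet> nu Q = 1" "e \<bullet> e = 1" "nu Q \<bullet> e = 0" using norm_nu[OF hQ(1)] e hQ(3) by (auto simp: dot_square_norm inner_commute)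
 have norm2: "(norm (\<sigma>*.e + s*.nu Q))^2 = t^2 + s^2" if "\<sigma>^2 = t^2" for \<sigma>
  unfolding power2_norm_eq_inner using nn hQ(3) that by (simp add: inner_add_left inner_add_right power2_eq_square)
 define y where "y \<sigma> = Q+\<sigma>*.e + s*.nu Q" for \<sigma>
 have yQ: "y \<sigma>-Q = \<sigma>*.e + s*.nu Q" for \<sigma> by (simp add: y_def)
 have capn: "s/2 <= capfun R Q (nu Q) (y \<sigma>)" if "\<sigma>^2 = t^2" for \<sigma>
 proof -
  have "(t^2 + s^2)/(2*R) <= s/2" using ts ss c by (simp add: field_simps)
  thus ?thesis unfolding capfun_def yQ norm2[OF that] using nn by (simp add: inner_add_right)
 qed
 have inOm: "y \<sigma> : Om" if "\<sigma>^2 = t^2" for \<sigma>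
 proof -
  have "0 <= capfun R Q (nu Q) (y \<sigma>)" using capn[OF that] s by linarith
  hence "y \<sigma> : cball (Q+R*.nu Q) R" using capfun_ball[OF c(2) norm_nu[OF hQ(1)]] by simp
  moreover have "(norm (y \<sigma>-Q))^2 > 0" unfolding yQ norm2[OF that] using t by (simp add: add_pos_nonneg)
  hence "y \<sigma> ~= Q" by auto
  ultimately show ?thesis using c(4) by blast
 qed
 have cape: "t/2 <= capfun R Q e (y t)"
 proof -
  have "(t^2 + s^2)/(2*R) <= t^2/R" using ss c by (simp add: field_simps)
  also have "\<dots> <= t/2" using t c by (simp add: field_simps power2_eq_square)
  finally show ?thesis unfolding capfun_def yQ norm2[OF refl] using nn hQ(3) by (simp add: inner_add_right)
 qed
 have "y t : cball Q r"
 proof -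
  have "norm (y t-Q) <= t + s" unfolding yQ using norm_triangle_ineq[of "t*.e" "s*.nu Q"] t s e norm_nu[OF hQ(1)] by simp
  thus ?thesis using s t by (simp add: dist_norm norm_minus_commute)
 qed
 moreover have "0 <= capfun R Q (nu Q) (y t)" "0 <= capfun R Q e (y t)" using capn[of t] cape s t by linarith+
 ultimately have "c*(capfun R Q (nu Q) (y t) * capfun R Q e (y t)) powr q <= u (reflect e \<mu> (y t))-u (y t)" by (rule low)
 moreover have "(s/2*(t/2)) powr q <= (capfun R Q (nu Q) (y t) * capfun R Q e (y t)) powr q"
  using capn[of t] cape s t q by (intro powr_mono2 mult_mono) auto
 hence "c*(s/2*(t/2)) powr q <= c*(capfun R Q (nu Q) (y t) * capfun R Q e (y t)) powr q" using c by (intro mult_left_mono) auto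
 moreover have "s/2*(t/2) = 1/4*t powr (2+\<eta>/2)" using t by (simp add: s_def powr_add power2_eq_square)
 hence "c*(s/2*(t/2)) powr q = c'*t powr p" by (simp only: c'_def p_def powr_mult powr_powr mult.assoc)
 moreover have "reflect e \<mu> (y t) = y (- t)"
 proof -
  have "y t \<bullet> e = \<mu>+t" using hQ(2) nn by (simp add: y_def inner_add_left)
  hence "reflect e \<mu> (y t) = y t+(- t + - t)*.e" by (simp add: reflect_def)
  thus ?thesis by (simp only: y_def scaleR_add_left) simp
 qed
 moreover have "u (y (- t))-u (y t) <= C*(t powr (2+\<eta>) + s*t^2 + s powr (1+\<beta>))"
  using up[of t s] t s inOm[of t] inOm[of "- t"] by (simp add: y_def)
 moreover have "C*(t powr (2+\<eta>) + s*t^2 + s powr (1+\<beta>)) <= C*(3*t powr (p+\<gamma>))"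
 proof -
  \<comment> \<open>The tightest comparison is with \<open>(1 + \<eta>/2) (1 + \<beta>)\<close>. By
    \<open>\<theta> <= \<eta>\<close> the value \<open>2 + 29 \<eta>/32\<close> separates the two
    exponents.\<close>
  define \<theta> where "\<theta> = \<eta>*\<eta>"
  have \<theta>: "\<theta> <= \<eta>" "p+\<gamma> = 2+27*\<eta>/32+\<theta>/16" "(1+\<eta>/2)*(1+\<beta>) = 2+15*\<eta>/16-\<theta>/32"
   using eta by (auto simp: \<theta>_def mult_left_le_one_le p_def q_def \<gamma>_def \<beta>_def field_simps)
  have "p+\<gamma> <= 2+\<eta>" "p+\<gamma> <= 3+\<eta>/2" "p+\<gamma> <= (1+\<eta>/2)*(1+\<beta>)"
   using \<theta> eta by linarith+
  hence "t powr (2+\<eta>) <= t powr (p+\<gamma>)" "t powr (3+\<eta>/2) <= t powr (p+\<gamma>)" "t powr ((1+\<eta>/2)*(1+\<beta>)) <= t powr (p+\<gamma>)"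
   by (auto intro!: tp)
  moreover have "s*t^2 = t powr (3+\<eta>/2)" using t powr_add[of t "1+\<eta>/2" 2] by (simp add: s_def add.commute)
  moreover have "s powr (1+\<beta>) = t powr ((1+\<eta>/2)*(1+\<beta>))" by (simp add: s_def powr_powr)
  ultimately show ?thesis using C by (intro mult_left_mono) auto
 qed
 ultimately have "c'*t powr p <= 3*C*t powr \<gamma>*t powr p" by (simp add: powr_add mult_ac)
 hence "c' <= 3*C*t powr \<gamma>" using t by simp
 also have "t powr \<gamma> <= ((c'/(4*C)) powr (1/\<gamma>)) powr \<gamma>" using t \<gamma> by (intro powr_mono2) auto
 also have "\<dots> = c'/(4*C)" using c' C \<gamma> by (simp add: powr_powr)
 finally have "c' <= 3*C*(c'/(4*C))" using C by simp
 thus False using c' C by simp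
qed

end

subsection \<open>Moving planes\<close>

context overdet
begin

lemma dir_in: "x : frontier Om ==> h \<bullet> nu x > 0 ==> \<exists>d>0. \<forall>t. 0 < t --> t < d --> x+t*.h : Om"
 and dir_out: "x : frontier Om ==> h \<bullet> nu x < 0 ==> \<exists>d>0. \<forall>t. 0 < t --> t < d --> x+t*.h ~: closure Om"
 using directions[of x h] unfolding eventually_at_right_field by auto

lemma first_exit:
 assumes x: "x : Om" and \<tau>: "0 <= \<tau>" "x+\<tau>*.d ~: Om"
 obtains s where "0 < s" "s <= \<tau>" "x + s*.d : frontier Om" "!!t. 0 <= t ==> t < s ==> x+t*.d : Om"
proof -
 let ?X = "{0..\<tau>} Int (%t. x+t*.d) -` (- Om)"
 have "compact ?X" using dom(1) by (intro compact_Int_closed closed_vimage continuous_intros) auto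
 moreover have "?X ~= {}" using \<tau> by force
 ultimately obtain s where s: "s : ?X" "!!t. t : ?X ==> s <= t" using compact_attains_inf by metis
 have inn: "x+t*.d : Om" if "0 <= t" "t < s" for t using s(2)[of t] s(1) that by force
 have "s ~= 0" using s(1) x by auto
 hence s0: "s > 0" using s(1) by auto
 have "((%t. x+t*.d) \<longlongrightarrow> x + s*.d) (at_left s)" by (intro tendsto_intros)
 moreover have "\<forall>\<^sub>F t in at_left s. x+t*.d : closure Om"
  unfolding eventually_at_left_field using inn s0 closure_subset[of Om] by (intro exI[of _ 0]) auto
 ultimately have "x + s*.d : closure Om" by (intro Lim_in_closed_set[OF closed_closure]) auto
 thus ?thesis using that[of s] s(1) s0 inn frontierI by auto
qed

text \<open>\<open>e + nu x\<close> points into the domain and \<open>e - nu x\<close> out of it, so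
  the boundary is met between two such points, both of which have a larger
  \<open>e\<close>-coordinate than \<open>x\<close>.\<close>

lemma frontier_beyond:
 assumes e: "norm e = 1" and x: "x : frontier Om" "e \<bullet> nu x = 0" and r: "r > 0"
 shows "\<exists>y\<in>frontier Om Int ball x r. y \<bullet> e > x \<bullet> e"
proof -
 note nn = norm_nu[OF x(1)]
 have "(e+nu x) \<bullet> nu x > 0" "(e-nu x) \<bullet> nu x < 0" using x(2) nn by (auto simp: inner_add_left inner_diff_left dot_square_norm)
 from dir_in[OF x(1) this(1)] dir_out[OF x(1) this(2)] obtain d1 d2 where d: "d1 > 0" "d2 > 0"
  "!!t. 0 < t ==> t < d1 ==> x+t*.(e+nu x) : Om" "!!t. 0 < t ==> t < d2 ==> x+t*.(e-nu x) ~: closure Om" by metis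
 define t where "t = Min {d1/2, d2/2, r/4}"
 have t: "0 < t" "t < d1" "t < d2" "t <= r/4" using d r by (auto simp: t_def min_less_iff_disj)
 have eq: "x+t*.(e+nu x)+(t+t)*.(- nu x) = x+t*.(e-nu x)"
  by (simp only: scaleR_add_left scaleR_add_right scaleR_diff_right scaleR_minus_right) simp
 have "x+t*.(e+nu x)+(t+t)*.(- nu x) ~: Om" unfolding eq using d(4)[OF t(1,3)] closure_subset[of Om] by auto
 then obtain s where s: "0 < s" "s <= 2*t" "x+t*.(e+nu x) + s*.(- nu x) : frontier Om"
  using first_exit[OF d(3)[OF t(1,2)], of "t+t" "- nu x"] t by auto
 define y where "y = x+t*.(e+nu x) + s*.(- nu x)"
 have y: "y-x = t*.e+(t - s)*.nu x" by (simp add: y_def algebra_simps)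
 hence "norm (y-x) <= t+\<bar>t - s\<bar>" using norm_triangle_ineq[of "t*.e" "(t - s)*.nu x"] nn e t by simp
 hence "y : ball x r" using s t by (simp add: dist_norm norm_minus_commute)
 moreover have "(y-x) \<bullet> e = t" unfolding y using x(2) e by (simp add: inner_add_left dot_square_norm inner_commute[of "nu x"])
 ultimately show ?thesis using s(3) t(1) unfolding y_def[symmetric] by (auto simp: inner_diff_left)
qed

text \<open>If \<open>e\<close> pointed into the domain at \<open>x\<close>, reflection in the plane
  through \<open>x\<close> would move points \<open>x + t e\<close> of the domain to points
  \<open>x - t e\<close> outside its closure.\<close>

lemma nu_nonpos:
 assumes e: "norm e = 1" and x: "x : frontier Om" and cap: "cap_ok e (x \<bullet> e)"
 shows "e \<bullet> nu x <= 0"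
proof (rule ccontr)
 assume "\<not> ?thesis"
 hence "e \<bullet> nu x > 0" "- e \<bullet> nu x < 0" by auto
 from dir_in[OF x this(1)] dir_out[OF x this(2)] obtain d1 d2 where d: "d1 > 0" "d2 > 0"
  "!!t. 0 < t ==> t < d1 ==> x+t*.e : Om" "!!t. 0 < t ==> t < d2 ==> x+t*.(- e) ~: closure Om" by metis
 define t where "t = min d1 d2/2"
 have t: "0 < t" "t < d1" "t < d2" using d by (auto simp: t_def)
 have "(x+t*.e) \<bullet> e = x \<bullet> e+t" using e by (simp add: inner_add_left dot_square_norm)
 moreover from this have "reflect e (x \<bullet> e) (x+t*.e) = x+t*.(- e)"
  by (simp add: reflect_def algebra_simps scaleR_2[symmetric] flip: scaleR_add_left)
 ultimately show False using cap d(3)[OF t(1,2)] d(4)[OF t(1,3)] t(1) closure_subset[of Om] unfolding cap_ok_def by fastforce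
qed

lemma reflect_closure:
 assumes e: "norm e = 1" and cap: "cap_ok e \<mu>" and x: "x : closure Om" "x \<bullet> e > \<mu>"
 shows "reflect e \<mu> x : closure Om"
proof -
 let ?U = "{y. y \<bullet> e > \<mu>}"
 have "open ?U" by (intro open_Collect_less continuous_intros)
 hence "x : closure (?U Int Om)" using x open_Int_closure_subset[of ?U Om] by auto
 hence "reflect e \<mu> x : closure (reflect e \<mu> ` (?U Int Om))"
  using image_closure_subset[OF reflect_continuous[OF e] closed_closure closure_subset] by blast
 also have "\<dots> <= closure Om" using cap by (intro closure_mono) (auto simp: cap_ok_def)
 finally show ?thesis .
qed

text \<open>An interior ball at \<open>x\<close> that lies beyond the plane is reflected to a ball
  in \<open>Om\<close> touching the boundary at the image of \<open>x\<close>, so its centre lies on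
  the normal there.\<close>

lemma Sset_normal:
 assumes e: "norm e = 1" and cap: "cap_ok e \<mu>" and x: "x : Sset e \<mu>"
 shows "nu (reflect e \<mu> x) = refl_mat e *v nu x"
proof -
 have fx: "x : frontier Om" "x \<bullet> e > \<mu>" "reflect e \<mu> x : frontier Om" using x by (auto simp: Sset_def)
 note nn = norm_nu[OF fx(1)]
 obtain R0 where R0: "R0 > 0" "!!R. 0 < R ==> R <= R0 ==> cball (x+R*.nu x) R - {x} <= Om" using interior_ball[OF fx(1)] by metis
 define R where "R = min R0 ((x \<bullet> e-\<mu>)/3)"
 have R: "R > 0" "R <= R0" "R <= (x \<bullet> e-\<mu>)/3" using R0 fx min.cobounded2[of R0] by (auto simp only: R_def min.cobounded1 min_less_iff_conj) auto
 define p where "p = x+R*.nu x"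
 have pr: "reflect e \<mu> p-reflect e \<mu> x = R*.(refl_mat e *v nu x)" by (simp add: p_def reflect_diff[OF e] matrix_vector_mult_scaleR)
 have "ball (reflect e \<mu> p) R <= Om"
 proof
  fix y assume y: "y : ball (reflect e \<mu> p) R"
  define z where "z = reflect e \<mu> y"
  have z: "dist p z < R" "reflect e \<mu> z = y" using y dist_reflect[OF e, of \<mu> "reflect e \<mu> p" y] by (auto simp: z_def reflect_reflect[OF e])
  have "dist p x = R" using R nn by (simp add: p_def dist_norm)
  hence "z : Om" using R0(2)[OF R(1,2)] z(1) by (auto simp: p_def)
  moreover have "dist x z < 2*R" using dist_triangle[of x z p] z \<open>dist p x = R\<close> by (simp add: dist_commute)
  hence "\<bar>(x-z) \<bullet> e\<bar> < 2*R" using Cauchy_Schwarz_ineq2[of "x-z" e] e by (simp add: dist_norm)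
  hence "z \<bullet> e > \<mu>" using R fx(2) by (auto simp: inner_diff_left abs_less_iff)
  ultimately show "y : Om" using cap z(2) by (auto simp: cap_ok_def)
 qed
 from touching_ball[OF this fx(3) _ R(1)] show ?thesis using pr R nn by (simp add: norm_refl_mat[OF e])
qed

text \<open>The infimum of the positions beyond which all caps are admissible. It is itself
  admissible: in the limit the reflected cap lies in the closure of \<open>Om\<close> and, being
  open, in \<open>Om\<close>. Planes behind the domain are not admissible, which bounds the
  positions from below.\<close>

lemma minimal_plane:
 assumes e: "norm e = 1"
 obtains m where "!!\<mu>. \<mu> >= m ==> cap_ok e \<mu>"
  "!!\<epsilon>. \<epsilon> > 0 ==> \<exists>\<mu> x. m-\<epsilon> < \<mu> & \<mu> < m & x : Om & x \<bullet> e > \<mu> & reflect e \<mu> x ~: Om"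
proof -
 define Z where "Z = {\<mu>. \<forall>\<mu>'\<ge>\<mu>. cap_ok e \<mu>'}"
 obtain B where B: "!!x. x : Om ==> norm x <= B" using dom(3) unfolding bounded_iff by blast
 have xe: "\<bar>x \<bullet> e\<bar> <= B" if "x : Om" for x using Cauchy_Schwarz_ineq2[of x e] B[OF that] e by simp
 have ZB: "B : Z" using xe by (force simp: Z_def cap_ok_def)
 obtain x0 where x0: "x0 : Om" using dom(4) by blast
 have low: "- B <= \<mu>" if "\<mu> : Z" for \<mu>
 proof (rule ccontr)
  assume "\<not> - B <= \<mu>"
  hence "x0 \<bullet> e > \<mu>" "\<mu> < - B" using xe[OF x0] by auto
  hence "reflect e \<mu> x0 : Om" using \<open>\<mu> : Z\<close> x0 by (auto simp: Z_def cap_ok_def)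
  thus False using xe[of "reflect e \<mu> x0"] \<open>x0 \<bullet> e > \<mu>\<close> \<open>\<mu> < - B\<close> by (simp add: reflect_inner[OF e])
 qed
 define m where "m = Inf Z"
 have bb: "bdd_below Z" using low by (auto simp: bdd_below_def)
 have gt: "cap_ok e \<mu>" if "\<mu> > m" for \<mu>
 proof -
  obtain z where "z : Z" "z < \<mu>" using \<open>\<mu> > m\<close> cInf_lessD[of Z \<mu>] ZB unfolding m_def by blast
  thus ?thesis by (simp add: Z_def)
 qed
 have capm: "cap_ok e m"
 proof -
  let ?V = "{x : Om. x \<bullet> e > m}"
  have V: "open (reflect e m ` ?V)"
  proof -
   have eq: "reflect e m ` ?V = reflect e m -` ?V" using reflect_reflect[OF e] by (auto simp: image_iff) metis
   have "open ?V" using dom(1) by (simp add: Collect_conj_eq open_Int open_Collect_less continuous_intros)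
   thus ?thesis unfolding eq by (rule open_vimage[OF _ reflect_continuous[OF e]])
  qed
  have "reflect e m x : closure Om" if x: "x : ?V" for x
  proof (rule Lim_in_closed_set[OF closed_closure])
   show "((%\<mu>. reflect e \<mu> x) \<longlongrightarrow> reflect e m x) (at_right m)" unfolding reflect_def by (intro tendsto_intros)
   show "\<forall>\<^sub>F \<mu> in at_right m. reflect e \<mu> x : closure Om"
    unfolding eventually_at_right_field using x gt closure_subset[of Om] by (intro exI[of _ "x \<bullet> e"]) (auto simp: cap_ok_def)
  qed simp
  hence "reflect e m ` ?V <= interior (closure Om)" using V by (intro interior_maximal) auto
  thus ?thesis unfolding interior_closure cap_ok_def by auto
 qed
 have ge: "cap_ok e \<mu>" if "\<mu> >= m" for \<mu> using gt[of \<mu>] capm that by (cases "\<mu> = m") auto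
 have "\<exists>\<mu> x. m-\<epsilon> < \<mu> & \<mu> < m & x : Om & x \<bullet> e > \<mu> & reflect e \<mu> x ~: Om" if "\<epsilon> > 0" for \<epsilon>
 proof -
  have "m-\<epsilon>/2 ~: Z" using cInf_lower[OF _ bb, of "m-\<epsilon>/2"] that by (auto simp: m_def)
  then obtain \<mu> where \<mu>: "\<mu> >= m-\<epsilon>/2" "\<not> cap_ok e \<mu>" by (auto simp: Z_def)
  hence "\<mu> < m" using ge[of \<mu>] by fastforce
  thus ?thesis using \<mu> that by (intro exI[of _ \<mu>]) (auto simp: cap_ok_def)
 qed
 thus ?thesis using that ge by blast
qed

text \<open>Let \<open>T\<close> be a limit of points whose reflections in planes slightly below
  \<open>m\<close> are not in \<open>Om\<close>. Off the plane it is a contact point. On the plane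
  \<open>e\<close> must be tangential at \<open>T\<close>, since otherwise the monotonicity of the
  defining function along \<open>- e\<close> would keep the reflections inside. Then the corner
  lemma and \<open>frontier_beyond\<close> provide contact points.\<close>

lemma contact_exists:
 assumes e: "norm e = 1" and cap: "!!\<mu>. \<mu> >= m ==> cap_ok e \<mu>"
  and fail: "!!\<epsilon>. \<epsilon> > 0 ==> \<exists>\<mu> x. m-\<epsilon> < \<mu> & \<mu> < m & x : Om & x \<bullet> e > \<mu> & reflect e \<mu> x ~: Om"
  and small: "CARD('n)*(A-a) < \<eta>/8*a"
 shows "Sset e m ~= {}"
proof -
 have "\<forall>k. \<exists>\<mu> x. m-inverse (real (Suc k)) < \<mu> & \<mu> < m & x : Om & x \<bullet> e > \<mu> & reflect e \<mu> x ~: Om" using fail by simp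
 then obtain \<mu> x where \<mu>: "!!k. m-inverse (real (Suc k)) < \<mu> k" "!!k. \<mu> k < m"
  and x: "!!k. x k : Om" "!!k. x k \<bullet> e > \<mu> k" "!!k. reflect e (\<mu> k) (x k) ~: Om" by metis
 have "\<forall>k. x k : closure Om" using x(1) closure_subset[of Om] by auto
 then obtain T f where T: "T : closure Om" "strict_mono (f :: nat => nat)" "(x \<circ> f) \<longlonglongrightarrow> T"
  using compact_closure unfolding compact_def by metis
 have "\<mu> \<longlonglongrightarrow> m"
 proof (rule tendsto_sandwich[of "%k. m-inverse (real (Suc k))" _ _ "%_. m"])
  show "(%k. m-inverse (real (Suc k))) \<longlonglongrightarrow> m" using LIMSEQ_inverse_real_of_nat tendsto_diff[OF tendsto_const] by fastforce
 qed (use \<mu> in \<open>auto intro!: always_eventually less_imp_le\<close>)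
 hence lims: "(%k. \<mu> (f k)) \<longlonglongrightarrow> m" "(%k. x (f k)) \<longlonglongrightarrow> T" using LIMSEQ_subseq_LIMSEQ[OF _ T(2)] T(3) by (auto simp: o_def)
 have lr: "(%k. reflect e (\<mu> (f k)) (x (f k))) \<longlonglongrightarrow> reflect e m T" unfolding reflect_def by (intro tendsto_intros lims)
 have "reflect e m T : - Om" by (rule closed_sequentially[OF _ _ lr]) (use dom(1) x(3) in auto)
 hence rT: "reflect e m T ~: Om" by simp
 have Tm: "T \<bullet> e >= m" using x(2) by (intro LIMSEQ_le[OF lims(1) tendsto_inner[OF lims(2) tendsto_const]]) (auto intro: less_imp_le)
 show ?thesis
 proof (cases "T \<bullet> e = m")
  case False
  hence Tm: "T \<bullet> e > m" using Tm by simp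
  hence "T : frontier Om" using T(1) rT cap[of m] by (intro frontierI) (auto simp: cap_ok_def)
  hence "T : Sset e m" using Tm frontierI[OF reflect_closure[OF e cap T(1) Tm] rT] by (simp add: Sset_def)
  thus ?thesis by blast
 next
  case True
  hence TF: "T : frontier Om" using T(1) rT by (auto intro!: frontierI simp: reflect_same[OF e])
  have "e \<bullet> nu T <= 0" using nu_nonpos[OF e TF] cap True by simp
  moreover have "\<not> e \<bullet> nu T < 0"
  proof
   assume neg: "e \<bullet> nu T < 0"
   have "norm (- e) = 1" "- e \<bullet> nu T > 0" using e neg by auto
   then obtain \<rho> D H r L r' where b: "brep \<eta> Om T \<rho> D H r L" and r': "0 < r'" "r' <= r"
    and mono: "!!y s. y : ball T r' ==> s >= 0 ==> y + s*.(- e) : ball T r' ==> \<rho> y + s*(- e \<bullet> nu T)/2 <= \<rho> (y + s*.(- e))"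
    using monotone_direction[OF TF] by metis
   have "Om Int ball T r = {y : ball T r. 0 < \<rho> y}" using b unfolding brep_def by blast
   hence om: "y : Om \<longleftrightarrow> 0 < \<rho> y" if "y : ball T r'" for y using subset_ball[OF r'(2), of T] that by blast
   have "\<forall>\<^sub>F k in sequentially. x (f k) : ball T r'"
    using lims(2) r' by (intro topological_tendstoD) auto
   moreover have "\<forall>\<^sub>F k in sequentially. reflect e (\<mu> (f k)) (x (f k)) : ball T r'"
    using lr r' True by (intro topological_tendstoD) (auto simp: reflect_same[OF e])
   ultimately have "\<forall>\<^sub>F k :: nat in sequentially. False"
   proof eventually_elim
    case (elim k)
    define y t where "y = x (f k)" and "t = 2*(y \<bullet> e-\<mu> (f k))"
    have t: "t > 0" using x(2)[of "f k"] by (simp add: t_def y_def)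
    have h: "reflect e (\<mu> (f k)) y = y+t*.(- e)" by (simp add: reflect_def t_def flip: scaleR_minus_left)
    have y: "y : ball T r'" "y+t*.(- e) : ball T r'" by (rule elim(1)[folded y_def], rule elim(2)[folded y_def, unfolded h])
    hence "\<rho> y > 0" using om[OF y(1)] x(1)[of "f k"] by (simp add: y_def)
    moreover have "0 <= t*(- e \<bullet> nu T)/2" using t neg by (simp add: mult_nonneg_nonpos)
    ultimately have "\<rho> (y+t*.(- e)) > 0" using mono[OF y(1) less_imp_le[OF t] y(2)] by linarith
    hence "y+t*.(- e) : Om" using om[OF y(2)] by simp
    thus False using x(3)[of "f k", folded y_def, unfolded h] by contradiction
   qed
   thus False by simp
  qed
  ultimately have n0: "e \<bullet> nu T = 0" by simp
  obtain r where "r > 0" "\<forall>y\<in>frontier Om Int ball T r. y \<bullet> e > m --> y : Sset e m"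
   using corner_lemma[OF e cap TF True n0 small] by auto
  thus ?thesis using frontier_beyond[OF e TF n0, of r] True by auto
 qed
qed

text \<open>Otherwise the corner lemma at the plane through \<open>x\<close> produces contact
  points; let \<open>y\<close> be one that is farthest in the direction \<open>e\<close>. Slightly
  lower planes are admissible as well, so \<open>- e\<close> does not leave the closure at the image
  of \<open>y\<close>. Together with \<open>nu_nonpos\<close> at \<open>y\<close> and the symmetry
  of the normals, \<open>e\<close> is tangential at \<open>y\<close>, and contact spreads beyond
  \<open>y\<close>.\<close>

lemma normal_negative:
 assumes e: "norm e = 1" and cap: "!!\<mu>. \<mu> >= m ==> cap_ok e \<mu>" and small: "CARD('n)*(A-a) < \<eta>/8*a"
  and x: "x : frontier Om" "x \<bullet> e > m"
 shows "e \<bullet> nu x < 0"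
proof (rule ccontr)
 assume "\<not> ?thesis"
 hence n0: "e \<bullet> nu x = 0" using nu_nonpos[OF e x(1)] cap x(2) by fastforce
 define \<mu> where "\<mu> = x \<bullet> e"
 have \<mu>: "\<mu> > m" "cap_ok e \<mu>" using x cap by (auto simp: \<mu>_def)
 obtain r where r: "r > 0" "\<forall>y\<in>frontier Om Int ball x r. y \<bullet> e > \<mu> --> y : Sset e \<mu>"
  using corner_lemma[OF e \<mu>(2) x(1) _ n0 small] by (auto simp: \<mu>_def)
 then obtain y0 where y0: "y0 : Sset e \<mu>" using frontier_beyond[OF e x(1) n0 r(1)] by (auto simp: \<mu>_def)
 define K where "K = {y : frontier Om. y \<bullet> e >= y0 \<bullet> e & reflect e \<mu> y : frontier Om}"
 have "K = frontier Om Int ({y. y0 \<bullet> e <= y \<bullet> e} Int reflect e \<mu> -` frontier Om)" by (auto simp: K_def)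
 hence "compact K"
  by (auto intro!: compact_Int_closed compact_frontier closed_Int closed_Collect_le closed_vimage reflect_continuous[OF e] continuous_intros)
 moreover have "y0 : K" using y0 by (auto simp: K_def Sset_def)
 moreover have "continuous_on K (%y. y \<bullet> e)" by (intro continuous_intros)
 ultimately obtain y where y: "y : K" "!!z. z : K ==> z \<bullet> e <= y \<bullet> e"
  using continuous_attains_sup[of K "%y. y \<bullet> e"] by blast
 have yS: "y : Sset e \<mu>" using y(1) y0 by (auto simp: K_def Sset_def)
 hence fy: "y : frontier Om" "y \<bullet> e > \<mu>" "reflect e \<mu> y : frontier Om" by (auto simp: Sset_def)
 have "- e \<bullet> nu (reflect e \<mu> y) >= 0"
 proof (rule ccontr)
  assume "\<not> ?thesis"
  then obtain d where d: "d > 0" "!!t. 0 < t ==> t < d ==> reflect e \<mu> y+t*.(- e) ~: closure Om"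
   using dir_out[OF fy(3), of "- e"] by auto
  define t where "t = min (d/2) (\<mu>-m)"
  have t: "0 < t" "t < d" using d \<mu> by (auto simp: t_def)
  have "t <= \<mu>-m" unfolding t_def by (rule min.cobounded2)
  hence t3: "\<mu>-t/2 >= m" using t(1) by linarith
  have "reflect e (\<mu>-t/2) y : closure Om" using fy t by (intro reflect_closure[OF e cap[OF t3]] frontier_facts(2)) auto
  moreover have "reflect e (\<mu>-t/2) y = reflect e \<mu> y+t*.(- e)" by (simp add: reflect_def algebra_simps)
  ultimately show False using d(2)[OF t(1,2)] by simp
 qed
 moreover have "e \<bullet> nu (reflect e \<mu> y) = - (e \<bullet> nu y)"
  unfolding Sset_normal[OF e \<mu>(2) yS] using e by (simp add: refl_mat_mv inner_diff_right dot_square_norm)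
 moreover have "e \<bullet> nu y <= 0" using nu_nonpos[OF e fy(1)] cap fy(2) \<mu> by simp
 ultimately have "e \<bullet> nu y = 0" by simp
 moreover obtain r where r: "r > 0" "frontier Om Int ball y r <= Sset e \<mu>" using Sset_open[OF e \<mu>(2) yS] by blast
 ultimately obtain z where "z : Sset e \<mu>" "z \<bullet> e > y \<bullet> e" using frontier_beyond[OF e fy(1) _ r(1)] by blast
 thus False using y(2)[of z] y(1) by (auto simp: K_def Sset_def)
qed

text \<open>The open segments between a contact point and its reflection lie in \<open>Om\<close>; their union is open
 and closed in \<open>Om\<close>, hence all of it.\<close>

lemma symmetric_convex:
 assumes e: "norm e = 1" and small: "CARD('n)*(A-a) < \<eta>/8*a"
 shows "\<exists>m. \<forall>x\<in>Om. \<forall>s\<in>{0..1}. x+(s*(2*(m-x \<bullet> e)))*.e : Om"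
proof (rule minimal_plane[OF e])
 fix m assume cap: "!!\<mu>. \<mu> >= m ==> cap_ok e \<mu>"
  and fail: "!!\<epsilon>. \<epsilon> > 0 ==> \<exists>\<mu> x. m-\<epsilon> < \<mu> & \<mu> < m & x : Om & x \<bullet> e > \<mu> & reflect e \<mu> x ~: Om"
 have capm: "cap_ok e m" using cap by simp
 have neg: "e \<bullet> nu x < 0" if "x : frontier Om" "x \<bullet> e > m" for x by (rule normal_negative[OF e cap small that])
 have ee: "e \<bullet> e = 1" using e by (simp add: dot_square_norm)
 have inn: "(x-t*.e) \<bullet> e = x \<bullet> e-t" "(x+t*.e) \<bullet> e = x \<bullet> e+t" for x t by (simp_all add: inner_diff_left inner_add_left ee)
 have down: "x-\<sigma>*.e : Om" if x: "x : Om" and \<sigma>: "0 <= \<sigma>" "\<sigma> < x \<bullet> e-m" for x \<sigma>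
 proof (rule ccontr)
  assume "\<not> ?thesis"
  then obtain s where s: "0 < s" "s <= \<sigma>" "x + s*.(- e) : frontier Om" "!!t. 0 <= t ==> t < s ==> x+t*.(- e) : Om"
   using first_exit[OF x \<sigma>(1), of "- e"] by auto
  obtain d where d: "d > 0" "!!t. 0 < t ==> t < d ==> x + s*.(- e)+t*.e ~: closure Om"
   using dir_out[OF s(3) neg[OF s(3)]] s(2) \<sigma>(2) inn by auto
  define t where "t = min (d/2) s"
  have "0 < t" "t < d" "t <= s" using d s by (auto simp: t_def)
  moreover have "x + s*.(- e)+t*.e = x+(s-t)*.(- e)" by (simp add: algebra_simps)
  moreover have "x+(s-t)*.(- e) : Om" using \<open>0 < t\<close> \<open>t <= s\<close> by (intro s(4)) auto
  ultimately show False using d(2)[of t] closure_subset[of Om] by (metis subsetD)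
 qed
 have downF: "y-\<sigma>*.e : Om" if y: "y : frontier Om" and \<sigma>: "0 < \<sigma>" "\<sigma> < y \<bullet> e-m" for y \<sigma>
 proof -
  obtain d where d: "d > 0" "!!t. 0 < t ==> t < d ==> y+t*.(- e) : Om" using dir_in[OF y, of "- e"] neg[OF y] \<sigma> by auto
  define t where "t = min (d/2) \<sigma>"
  have t: "0 < t" "t < d" "t <= \<sigma>" using d \<sigma> by (auto simp: t_def)
  have "(y-t*.e)-(\<sigma>-t)*.e : Om" by (rule down) (use d(2)[OF t(1,2)] t \<sigma> inn in auto)
  thus ?thesis by (simp add: algebra_simps)
 qed
 have refl: "y-(2*(y \<bullet> e-m)-\<sigma>)*.e = reflect e m (y-\<sigma>*.e)" for y \<sigma>
 proof -
  have "reflect e m (y-\<sigma>*.e) = y+(- \<sigma>+2*(m-(y \<bullet> e-\<sigma>)))*.e" by (simp only: reflect_def inn scaleR_add_left) simp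
  also have "- \<sigma>+2*(m-(y \<bullet> e-\<sigma>)) = - (2*(y \<bullet> e-m)-\<sigma>)" by simp
  finally show ?thesis by (simp only: scaleR_minus_left diff_conv_add_uminus)
 qed
 have seg: "y-\<sigma>*.e : Om" if y: "y : frontier Om" and \<sigma>: "0 < \<sigma>" "\<sigma> < 2*(y \<bullet> e-m)" for y \<sigma>
 proof -
  have up: "y-\<sigma>*.e : Om & y-(2*(y \<bullet> e-m)-\<sigma>)*.e : Om" if "0 < \<sigma>" "\<sigma> < y \<bullet> e-m" for \<sigma>
   using downF[OF y that] that capm inn unfolding refl cap_ok_def by auto
  consider "\<sigma> < y \<bullet> e-m" | "\<sigma> > y \<bullet> e-m" | "\<sigma> = y \<bullet> e-m" by linarith
  thus ?thesis
  proof cases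
   case 2
   thus ?thesis using up[of "2*(y \<bullet> e-m)-\<sigma>"] \<sigma> by simp
  next
   case 3
   define z where "z = y-\<sigma>*.e"
   have ze: "z \<bullet> e = m" by (simp add: z_def inn 3)
   have zt: "z+t*.e : Om" "z+t*.(- e) : Om" if "0 < t" "t < \<sigma>" for t
   proof -
    have "z+t*.e = y-(\<sigma>-t)*.e" "z+t*.(- e) = y-(2*(y \<bullet> e-m)-(\<sigma>-t))*.e"
     unfolding 3[symmetric] z_def by (simp_all add: algebra_simps)
    thus "z+t*.e : Om" "z+t*.(- e) : Om" using up[of "\<sigma>-t"] that 3 by auto
   qed
   \<comment> \<open>A midpoint \<open>z\<close> not in \<open>Om\<close> would be a boundary point
     with \<open>z + t e\<close> and \<open>z - t e\<close> in \<open>Om\<close>, so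
     \<open>e\<close> is tangential at \<open>z\<close>. Moving the foot of \<open>z + t e\<close>
     along \<open>- e\<close> back to the plane gives a point of the closure, but it is also
     \<open>z - s nu z\<close>, where the defining function is negative.\<close>
   show ?thesis
   proof (rule ccontr)
    assume "\<not> ?thesis"
    hence zn: "z ~: Om" by (simp add: z_def)
    have "((%t. z+t*.e) \<longlongrightarrow> z+0*.e) (at_right 0)" by (intro tendsto_intros)
    moreover have "\<forall>\<^sub>F t in at_right 0. z+t*.e : closure Om"
     unfolding eventually_at_right_field using zt(1) \<sigma>(1) closure_subset[of Om] by (intro exI[of _ \<sigma>]) auto
    ultimately have "z : closure Om" using Lim_in_closed_set[OF closed_closure, of "%t. z+t*.e" Om "at_right 0" z] by simp
    hence zF: "z : frontier Om" using zn by (rule frontierI)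
    obtain \<rho> D H rb L0 r0 where "bpoint \<alpha> a A lam \<kappa> \<eta> M Om u G z \<rho> D H rb L0 r0" using bpoint_exists[OF zF] by blast
    then interpret bpoint \<alpha> a A lam \<kappa> \<eta> M Om u G z \<rho> D H rb L0 r0 .
    define r2 where "r2 = r1/(1+2*Lam)"
    have r1': "r2 > 0" "r2 <= r1" "(1+2*Lam)*r2 = r1" using r1 Lam1 by (auto simp: r2_def field_simps)
    define t where "t = min (\<sigma>/2) (r2/2)"
    have t: "0 < t" "t < \<sigma>" "t < r2" using \<sigma> r1' by (auto simp: t_def min_less_iff_disj)
    have tb: "z+t*.e : ball z r1" "z+t*.e : ball z r0" using t r1 r1' e by (auto simp: dist_norm)
    obtain s where s: "0 < s" "s <= 2*\<rho> (z+t*.e)" "z+t*.e - s*.nu z : frontier Om"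
     using foot[OF zt(1)[OF t(1,2)] tb(1)] by metis
    have ort: "e \<bullet> nu z = 0"
    proof (rule ccontr)
     assume "e \<bullet> nu z ~= 0"
     hence "e \<bullet> nu z < 0 | - e \<bullet> nu z < 0" by auto
     then obtain d where d: "d > 0" "(\<forall>t. 0 < t --> t < d --> z+t*.e ~: closure Om) | (\<forall>t. 0 < t --> t < d --> z+t*.(- e) ~: closure Om)"
      using dir_out[OF zF] by metis
     thus False using zt[of "min d \<sigma>/2"] \<sigma>(1) closure_subset[of Om] by (auto simp: min_less_iff_disj)
    qed
    have "\<rho> (z+t*.e) <= Lam*t" using rho_lip[of z "z+t*.e"] tb r0 bfacts(2) e t by simp
    hence "s <= (1+2*Lam)*t" using s t by (simp add: algebra_simps)
    also have "\<dots> < (1+2*Lam)*r2" using t(3) Lam1 by (intro mult_strict_left_mono) auto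
    finally have sb: "z - s*.nu z : ball z r0" using s r1 r1'(3) nuQ by (simp add: dist_norm)
    have "\<rho> (z - s*.nu z) + s/2 <= \<rho> (z - s*.nu z + s*.nu z)" using s r0 by (intro mono[OF sb]) auto
    hence "z - s*.nu z ~: closure Om" using rho_nonneg[OF sb] s bfacts(2) by auto
    moreover have "z - s*.nu z : closure Om"
    proof (rule Lim_in_closed_set[OF closed_closure])
     let ?P = "z+t*.e - s*.nu z"
     have Pe: "?P \<bullet> e = m+t" using ort ze by (simp add: inner_diff_left inner_add_left ee inner_commute[of "nu z"])
     have "((%\<sigma>. ?P-\<sigma>*.e) \<longlongrightarrow> ?P-t*.e) (at_left t)" by (intro tendsto_intros)
     thus "((%\<sigma>. ?P-\<sigma>*.e) \<longlongrightarrow> z - s*.nu z) (at_left t)" by simp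
     show "\<forall>\<^sub>F \<sigma> in at_left t. ?P-\<sigma>*.e : closure Om"
      unfolding eventually_at_left_field using downF[OF s(3)] Pe t(1) closure_subset[of Om] by (intro exI[of _ 0]) auto
    qed simp
    ultimately show False by blast
   qed
  qed (use up \<sigma> in blast)
 qed
 define W where "W = {x. \<exists>y\<in>Sset e m. \<exists>\<sigma>. x = y-\<sigma>*.e & 0 < \<sigma> & \<sigma> < 2*(y \<bullet> e-m)}"
 have SD: "y : frontier Om" "y \<bullet> e > m" if "y : Sset e m" for y using that by (auto simp: Sset_def)
 have WOm: "W <= Om" using seg SD by (auto simp: W_def)
 \<comment> \<open>A point near \<open>x\<close> is moved along \<open>e\<close> until it leaves the
   domain. This happens close to \<open>y\<close>, hence again in the contact set, which is
   relatively open in the boundary.\<close>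
 have "open W"
  unfolding open_contains_ball
 proof
  fix x assume "x : W"
  then obtain y \<sigma> where y: "y : Sset e m" and x: "x = y-\<sigma>*.e" and \<sigma>: "0 < \<sigma>" "\<sigma> < 2*(y \<bullet> e-m)" by (auto simp: W_def)
  obtain r where r: "r > 0" "frontier Om Int ball y r <= Sset e m" using Sset_open[OF e capm y] by blast
  have "e \<bullet> nu y < 0" "- e \<bullet> nu y > 0" using neg[OF SD[OF y]] by auto
  from dir_out[OF SD(1)[OF y] this(1)] dir_in[OF SD(1)[OF y] this(2)] obtain d1 d2 where d: "d1 > 0" "d2 > 0"
   "!!t. 0 < t ==> t < d1 ==> y+t*.e ~: closure Om" "!!t. 0 < t ==> t < d2 ==> y+t*.(- e) : Om" by metis
  define \<delta> where "\<delta> = 2*(y \<bullet> e-m)-\<sigma>"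
  have \<delta>: "\<delta> > 0" using \<sigma> by (simp add: \<delta>_def)
  define t where "t = Min {d1/2, d2/2, r/2, \<sigma>/2, \<delta>/5}"
  have t: "0 < t" "t < d1" "t < d2" "t <= r/2" "t < \<sigma>" "5*t <= \<delta>"
   using d r \<sigma> \<delta> by (auto simp: t_def min_less_iff_disj min_le_iff_disj)
  have "open (- closure Om)" by auto
  then obtain k1 where k1: "k1 > 0" "ball (y+t*.e) k1 <= - closure Om" using d(3)[OF t(1,2)] unfolding open_contains_ball by blast
  obtain k2 where k2: "k2 > 0" "ball (y+t*.(- e)) k2 <= Om" using d(4)[OF t(1,3)] dom(1) unfolding open_contains_ball by blast
  define k where "k = Min {k1, k2, t}"
  have k: "k > 0" "k <= k1" "k <= k2" "k <= t" using k1 k2 t by (auto simp: k_def)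
  have "ball x k <= W"
  proof
   fix x' assume "x' : ball x k"
   hence x': "norm (x'-x) < k" by (simp add: dist_norm norm_minus_commute)
   define v where "v = x'-x"
   have v: "x'+\<tau>*.e = y+(\<tau>-\<sigma>)*.e + v" for \<tau> by (simp add: v_def x algebra_simps)
   have in1: "x'+(\<sigma>-t)*.e : Om" using k2(2) k x' unfolding v by (auto simp: dist_norm v_def[symmetric] subset_eq)
   have "\<sigma>+t = (\<sigma>-t)+2*t" by simp
   hence eq: "x'+(\<sigma>-t)*.e+(2*t)*.e = x'+(\<sigma>+t)*.e" by (simp only: scaleR_add_left add.assoc)
   have "x'+(\<sigma>+t)*.e : - closure Om" using k1(2) k x' unfolding v by (auto simp: dist_norm v_def[symmetric] subset_eq)
   hence "x'+(\<sigma>-t)*.e+(2*t)*.e ~: Om" unfolding eq using closure_subset[of Om] by blast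
   then obtain s where s: "0 < s" "s <= 2*t" "x'+(\<sigma>-t)*.e + s*.e : frontier Om"
    using first_exit[OF in1, of "2*t" e] t(1) by (metis less_imp_le mult_pos_pos zero_less_numeral)
   define \<sigma>' y' where "\<sigma>' = \<sigma>-t + s" and "y' = x'+\<sigma>'*.e"
   have \<sigma>': "\<bar>\<sigma>'-\<sigma>\<bar> <= t" "0 < \<sigma>'" using s t by (auto simp: \<sigma>'_def)
   have y'F: "y' : frontier Om" using s(3) by (simp add: y'_def \<sigma>'_def scaleR_add_left add.assoc)
   have yy: "y'-y = (\<sigma>'-\<sigma>)*.e + v" unfolding y'_def v by simp
   have "norm (y'-y) < t+t" unfolding yy using norm_triangle_ineq[of "(\<sigma>'-\<sigma>)*.e" v] e \<sigma>' x' k by (simp add: v_def)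
   hence "y' : Sset e m" using r(2) y'F t(4) by (auto simp: dist_norm norm_minus_commute)
   moreover have "\<bar>(y'-y) \<bullet> e\<bar> < 2*t" using Cauchy_Schwarz_ineq2[of "y'-y" e] e \<open>norm (y' - y) < t + t\<close> by simp
   hence "\<sigma>' < 2*(y' \<bullet> e-m)" using \<sigma>' t unfolding inner_diff_left \<delta>_def by (simp add: abs_less_iff abs_le_iff)
   ultimately show "x' : W" using \<sigma>'(2) unfolding W_def by (auto simp: y'_def intro!: bexI[of _ y'])
  qed
  thus "\<exists>k>0. ball x k <= W" using k by blast
 qed
 \<comment> \<open>A limit can leave \<open>W\<close> only by reaching an end of its segment, and
   both ends are boundary points, not points of \<open>Om\<close>.\<close>
 moreover have "closedin (top_of_set Om) W"
  unfolding closedin_limpt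
 proof (intro conjI WOm allI impI)
  fix l assume "l islimpt W & l : Om"
  then obtain x where "\<forall>k. x k : W" "l : Om" "x \<longlonglongrightarrow> l" unfolding islimpt_sequential by blast
  hence xW: "\<forall>k. \<exists>y \<sigma>. y : Sset e m & x k = y-\<sigma>*.e & 0 < \<sigma> & \<sigma> < 2*(y \<bullet> e-m)" and l: "l : Om" "x \<longlonglongrightarrow> l"
   unfolding W_def by blast+
  then obtain y \<sigma> where y: "!!k. y k : Sset e m" "!!k. x k = y k-\<sigma> k*.e" "!!k. 0 < \<sigma> k" "!!k. \<sigma> k < 2*(y k \<bullet> e-m)" by metis
  obtain Y f where Y: "Y : frontier Om" "strict_mono (f :: nat => nat)" "(y \<circ> f) \<longlonglongrightarrow> Y"
   using compact_frontier SD(1)[OF y(1)] unfolding compact_def by metis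
  have ly: "(%k. y (f k)) \<longlonglongrightarrow> Y" using Y(3) by (simp add: o_def)
  have lx: "(%k. x (f k)) \<longlonglongrightarrow> l" using LIMSEQ_subseq_LIMSEQ[OF l(2) Y(2)] by (simp add: o_def)
  define s where "s = (Y-l) \<bullet> e"
  have "(%k. (y (f k)-x (f k)) \<bullet> e) \<longlonglongrightarrow> s" unfolding s_def by (intro tendsto_intros ly lx)
  hence ls: "(%k. \<sigma> (f k)) \<longlonglongrightarrow> s" by (simp add: y(2) ee)
  have "(%k. y (f k)-\<sigma> (f k)*.e) \<longlonglongrightarrow> Y - s*.e" by (intro tendsto_intros ly ls)
  hence lY: "l = Y - s*.e" using lx LIMSEQ_unique by (simp add: y(2))
  have s0: "0 <= s" by (rule LIMSEQ_le_const[OF ls]) (use y(3) in \<open>auto intro: less_imp_le\<close>)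
  have "(%k. 2*(y (f k) \<bullet> e-m)) \<longlonglongrightarrow> 2*(Y \<bullet> e-m)" by (intro tendsto_intros ly)
  hence s1: "s <= 2*(Y \<bullet> e-m)" by (rule LIMSEQ_le[OF ls]) (use y(4) less_imp_le in blast)
  have lr: "(%k. reflect e m (y (f k))) \<longlonglongrightarrow> reflect e m Y" unfolding reflect_def by (intro tendsto_intros ly)
  have rY: "reflect e m Y : frontier Om" by (rule closed_sequentially[OF frontier_closed _ lr]) (use y(1) in \<open>auto simp: Sset_def\<close>)
  have lF: "l ~: frontier Om" using l(1) frontier_facts(1) by blast
  have "Y-(2*(Y \<bullet> e-m))*.e = reflect e m Y" using refl[of Y 0] by (simp only: diff_zero scaleR_zero_left)
  hence "s ~= 0" "s ~= 2*(Y \<bullet> e-m)" using lY Y(1) rY lF by auto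
  hence "0 < s" "s < 2*(Y \<bullet> e-m)" using s0 s1 by auto
  moreover from this have "Y : Sset e m" using Y(1) rY by (simp add: Sset_def)
  ultimately show "l : W" unfolding W_def lY by blast
 qed
 moreover have "W ~= {}"
 proof -
  obtain y where y: "y : Sset e m" using contact_exists[OF e cap fail small] by blast
  hence "y-(y \<bullet> e-m)*.e : W" using SD(2)[OF y] unfolding W_def by (intro CollectI bexI[OF _ y] exI[of _ "y \<bullet> e-m"]) auto
  thus ?thesis by blast
 qed
 ultimately have W: "W = Om" using dom(2) WOm dom(1) by (metis connected_clopen openin_open_eq)
 have "x+(s*(2*(m-x \<bullet> e)))*.e : Om" if x: "x : Om" and s: "s : {0..1}" for x s
 proof -
  have "x : W" using x W by simp
  then obtain y \<sigma> where y: "y : Sset e m" and x: "x = y-\<sigma>*.e" and \<sigma>: "0 < \<sigma>" "\<sigma> < 2*(y \<bullet> e-m)" unfolding W_def by blast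
  define \<tau> where "\<tau> = (1 - s)*\<sigma> + s*(2*(y \<bullet> e-m)-\<sigma>)"
  have "0 < \<tau> & \<tau> < 2*(y \<bullet> e-m)"
  proof (cases "s = 0")
   case False
   have "0 <= (1 - s)*\<sigma>" "0 < s*(2*(y \<bullet> e-m)-\<sigma>)" "(1 - s)*\<sigma> <= (1 - s)*(2*(y \<bullet> e-m))" "s*(2*(y \<bullet> e-m)-\<sigma>) < s*(2*(y \<bullet> e-m))"
    using s False \<sigma> by (auto intro!: mult_left_mono)
   thus ?thesis unfolding \<tau>_def by (simp add: algebra_simps)
  qed (use \<sigma> in \<open>simp add: \<tau>_def\<close>)
  hence "y-\<tau>*.e : Om" using seg[OF SD(1)[OF y]] by simp
  moreover have "x+(s*(2*(m-x \<bullet> e)))*.e = y-\<tau>*.e" unfolding x inn \<tau>_def by (simp add: algebra_simps)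
  ultimately show ?thesis by simp
 qed
 thus ?thesis by blast
qed

end

subsection \<open>Sets symmetric in all directions\<close>

text \<open>The reflections in coordinate directions compose to the point reflection in
  \<open>c\<close>. A plane of symmetry missing \<open>c\<close> would generate arbitrarily long
  displacements, against boundedness, so all planes pass through \<open>c\<close>. Any two points at
  equal distance from \<open>c\<close> are mirror images of each other, and the segment between them
  lies in \<open>Om\<close>; such segments fill the ball.\<close>

lemma symmetric_imp_ball:
 fixes Om :: "'a::euclidean_space set"
 assumes Om: "open Om" "bounded Om" "Om ~= {}"
  and sym: "!!e. norm e = 1 ==> \<exists>m. \<forall>x\<in>Om. \<forall>s\<in>{0..1}. x+(s*(2*(m-x \<bullet> e)))*.e : Om"
 shows "\<exists>z r. r > 0 & Om = ball z r"
proof -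
 obtain m where m: "!!e x s. norm e = 1 ==> x : Om ==> s : {0..1} ==> x+(s*(2*(m e-x \<bullet> e)))*.e : Om"
  using sym by metis
 define c where "c = (\<Sum>b\<in>Basis. m b*.b)"
 have flip: "x+(\<Sum>b\<in>B. (2*(m b-x \<bullet> b))*.b) : Om" if "x : Om" "finite B" "B <= Basis" for x B
  using that(2,3)
 proof (induction B rule: finite_induct)
  case (insert b B)
  define y where "y = x+(\<Sum>b\<in>B. (2*(m b-x \<bullet> b))*.b)"
  have "(\<Sum>b'\<in>B. (2*(m b'-x \<bullet> b'))*(b' \<bullet> b)) = 0"
   
   using insert.hyps(2) insert.prems by (intro sum.neutral ballI) (simp, metis inner_not_same_Basis subsetD)
  hence "y \<bullet> b = x \<bullet> b" by (simp add: y_def inner_add_left inner_sum_left)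
  thus ?case using m[of b y 1] insert by (simp add: y_def add_ac)
 qed (use that in simp)
 have c: "c + c-x : Om" if "x : Om" for x
 proof -
  have "(\<Sum>b\<in>Basis. (m b-x \<bullet> b)*.b) = c-x"
   by (simp add: c_def scaleR_diff_left sum_subtractf euclidean_representation)
  hence "(\<Sum>b\<in>Basis. (2*(m b-x \<bullet> b))*.b) = (c-x)+(c-x)"
   by (simp only: mult_2 scaleR_add_left sum.distrib)
  hence "x+((c-x)+(c-x)) : Om" using flip[OF that finite_Basis order_refl] by (simp only:)
  thus ?thesis by (simp add: algebra_simps)
 qed
 have mc: "m e = c \<bullet> e" if e: "norm e = 1" for e
 proof (rule ccontr)
  assume ne: "m e ~= c \<bullet> e"
  obtain x0 where x0: "x0 : Om" using Om(3) by blast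
  define \<delta> where "\<delta> = 2*(c \<bullet> e-m e)"
  have step: "\<exists>y\<in>Om. y \<bullet> e = x \<bullet> e+\<delta>" if "x : Om" for x
   using c[OF m[OF e that, of 1]] e by (intro bexI[of _ "c + c-(x+(1*(2*(m e-x \<bullet> e)))*.e)"])
    (auto simp: inner_add_left inner_diff_left dot_square_norm \<delta>_def)
  have "\<exists>y\<in>Om. y \<bullet> e = x0 \<bullet> e+real k*\<delta>" for k
  proof (induction k)
   case (Suc k)
   then obtain y where "y : Om" "y \<bullet> e = x0 \<bullet> e+real k*\<delta>" by blast
   moreover from this(1) obtain y' where "y' : Om" "y' \<bullet> e = y \<bullet> e+\<delta>" using step by blast
   ultimately show ?case by (intro bexI[of _ y']) (auto simp: algebra_simps)
  qed (use x0 in auto)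
  then obtain y where y: "!!k. y k : Om" "!!k. y k \<bullet> e = x0 \<bullet> e+real k*\<delta>" by metis
  obtain B where B: "!!x. x : Om ==> norm x <= B" using Om(2) unfolding bounded_iff by blast
  obtain k :: nat where k: "real k > 2*B/\<bar>\<delta>\<bar>" using reals_Archimedean2 by blast
  have "\<bar>(y k-x0) \<bullet> e\<bar> <= norm (y k-x0)" using Cauchy_Schwarz_ineq2[of "y k-x0" e] e by simp
  hence "real k*\<bar>\<delta>\<bar> <= norm (y k-x0)" by (simp add: inner_diff_left y(2) abs_mult)
  also have "\<dots> <= 2*B" using norm_triangle_ineq4[of "y k" x0] B[OF y(1)[of k]] B[OF x0] by linarith
  finally show False using k ne by (simp add: divide_less_eq \<delta>_def)
 qed
 have seg: "x + s*.(y-x) : Om" if x: "x : Om" and y: "norm (y - c) = norm (x - c)" and s: "s : {0..1}" for x y s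
 proof (cases "x = y")
  case False
  define e where "e = (1/norm (y-x))*.(y-x)"
  have e: "norm e = 1" "y-x = norm (y-x)*.e" using False by (auto simp: e_def)
  have "(norm (y-x))^2 = - 2*((x - c) \<bullet> (y-x))"
   using norm_diff_square[of "y-x" "c-x"] y by (simp add: norm_minus_commute inner_commute inner_diff_right inner_diff_left)
  also have "(x - c) \<bullet> (y-x) = norm (y-x)*((x - c) \<bullet> e)" by (subst e(2)) simp
  finally have "norm (y-x)*norm (y-x) = norm (y-x)*(- 2*((x - c) \<bullet> e))" by (simp add: power2_eq_square)
  hence "norm (y-x) = 2*(m e-x \<bullet> e)" using False unfolding mc[OF e(1)] mult_cancel_left by (simp add: inner_diff_left)
  thus ?thesis using m[OF e(1) x s] by (subst e(2)) simp
 qed (use x in simp)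
 have inside: "z : Om" if x: "x : Om" and z: "norm (z - c) <= norm (x - c)" for x z
 proof -
  \<comment> \<open>The line through \<open>z\<close> in an arbitrary direction \<open>d\<close>
    meets the sphere about \<open>c\<close> through \<open>x\<close> in \<open>p1\<close> and
    \<open>p2\<close>, and \<open>z\<close> lies between them.\<close>
  obtain d :: 'a where d: "norm d = 1" by (metis SOME_Basis norm_Basis)
  define q where "q = z - c"
  define t where "t = sqrt ((q \<bullet> d)^2+(norm (x - c))^2-(norm q)^2)"
  have "(norm q)^2 <= (norm (x - c))^2" using z by (intro power_mono) (auto simp: q_def)
  hence pos: "(q \<bullet> d)^2 <= (q \<bullet> d)^2+(norm (x - c))^2-(norm q)^2" by linarith
  hence "0 <= (q \<bullet> d)^2+(norm (x - c))^2-(norm q)^2" using zero_le_power2[of "q \<bullet> d"] by linarith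
  hence t: "t^2 = (q \<bullet> d)^2+(norm (x - c))^2-(norm q)^2" "\<bar>q \<bullet> d\<bar> <= t"
   using pos unfolding t_def by (auto simp only: real_sqrt_pow2 power2_abs intro!: real_le_rsqrt)
  have nrm: "norm (c+q+\<tau>*.d - c) = norm (x - c)" if "(\<tau>+q \<bullet> d)^2 = t^2" for \<tau>
  proof -
   have "(norm (q+\<tau>*.d))^2 = (norm q)^2+(\<tau>+q \<bullet> d)^2-(q \<bullet> d)^2"
    using norm_diff_square[of q "- (\<tau>*.d)"] d by (simp add: power2_sum mult.commute)
   hence "(norm (q+\<tau>*.d))^2 = (norm (x - c))^2" using t(1) that by simp
   thus ?thesis by (simp add: power2_eq_iff_nonneg algebra_simps)
  qed
  define p1 p2 where "p1 = c+q+(- t-q \<bullet> d)*.d" and "p2 = c+q+(t-q \<bullet> d)*.d"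
  have p: "norm (p1 - c) = norm (x - c)" "norm (p2 - c) = norm (x - c)" unfolding p1_def p2_def by (rule nrm, simp)+
  have p1Om: "p1 : Om" using seg[OF x p(1), of 1] by simp
  show ?thesis
  proof (cases "t = 0")
   case True
   hence "p1 = z" using t(2) by (simp add: p1_def q_def)
   thus ?thesis using p1Om by simp
  next
   case False
   hence t0: "t > 0" using t(2) by linarith
   define s where "s = (t+q \<bullet> d)/(2*t)"
   have "s : {0..1}" using t(2) t0 by (auto simp: s_def field_simps abs_le_iff)
   hence "p1 + s*.(p2-p1) : Om" using p by (intro seg p1Om) auto
   moreover have d2: "p2-p1 = (2*t)*.d" unfolding p1_def p2_def add_diff_cancel_left scaleR_left_diff_distrib[symmetric] by simp
   have st: "s*(2*t) = t+q \<bullet> d" using t0 by (simp add: s_def)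
   have "p1 + s*.(p2-p1) = c+q+((- t-q \<bullet> d) + s*(2*t))*.d"
    unfolding d2 by (simp only: p1_def scaleR_add_left scaleR_scaleR add.assoc)
   ultimately show ?thesis unfolding st by (simp add: q_def)
  qed
 qed
 define r where "r = Sup ((%x. norm (x - c)) ` Om)"
 have bdd: "bdd_above ((%x. norm (x - c)) ` Om)"
  using bounded_translation[OF Om(2), of "- c"] by (auto simp: bdd_above_def bounded_iff)
 have le: "norm (x - c) <= r" if "x : Om" for x unfolding r_def using bdd that by (intro cSup_upper) auto
 have "Om = ball c r"
 proof
  show "Om <= ball c r"
  proof
   fix x assume x: "x : Om"
   obtain k where k: "k > 0" "ball x k <= Om" using Om(1) x unfolding open_contains_ball by blast
   obtain d :: 'a where d: "norm d = 1" "(x - c) = norm (x - c)*.d"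
   proof (cases "x = c")
    case True
    thus ?thesis using that[of "SOME i. i : Basis"] SOME_Basis by simp
   qed (use that[of "sgn (x - c)"] in \<open>auto simp: norm_sgn sgn_div_norm\<close>)
   have "x+(k/2)*.d : Om" using k d by (auto simp: dist_norm)
   hence "norm ((x - c)+(k/2)*.d) <= r" using le by (metis add_diff_eq add.commute diff_add_eq)
   hence "norm ((norm (x - c) + k/2)*.d) <= r" by (subst scaleR_add_left, subst d(2)[symmetric])
   thus "x : ball c r" using k d(1) by (simp add: dist_norm norm_minus_commute)
  qed
  show "ball c r <= Om"
  proof
   fix z assume "z : ball c r"
   hence "norm (z - c) < r" by (simp add: dist_norm norm_minus_commute)
   then obtain x where "x : Om" "norm (z - c) < norm (x - c)" unfolding r_def using less_cSup_iff[OF _ bdd] Om(3) by auto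
   thus "z : Om" using inside by simp
  qed
 qed
 moreover from this have "r > 0" using Om(3) by (metis ball_empty not_le)
 ultimately show ?thesis by blast
qed

subsection \<open>From viscosity solutions to jets\<close>

lemma quadratic_test:
 fixes Y :: "real^'n^'n" and p x :: "real^'n"
 assumes Y: "transpose Y = Y"
 defines "\<phi> \<equiv> %y. p \<bullet> (y-x)+(y-x) \<bullet> (Y *v (y-x))/2"
 shows "C2_on S \<phi>" "gradient \<phi> x = p" "hessian \<phi> x = Y"
proof -
 have D: "GDERIV \<phi> y :> p+Y *v (y-x)" for y
  unfolding \<phi>_def gderiv_def
  by (rule derivative_eq_intros linear_imp_has_derivative[THEN has_derivative_compose[rotated]] refl | simp)+
   (simp add: inner_add_right sym_dot[OF Y] inner_commute fun_eq_iff)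
 hence g: "gradient \<phi> = (%y. p+Y *v (y-x))" by (auto intro!: gradient_eq)
 have dg: "((%y. p+Y *v (y-x)) has_derivative (*v) Y) (at y)" for y
  by (rule derivative_eq_intros linear_imp_has_derivative[THEN has_derivative_compose[rotated]] refl | simp)+
 have h: "hessian \<phi> y = Y" for y
  unfolding hessian_def g jacobian_def using frechet_derivative_at[OF dg[of y]] by (metis matrix_of_matrix_vector_mul)
 thus "hessian \<phi> x = Y" .
 show "gradient \<phi> x = p" by (simp add: g)
 have "hessian \<phi> = (%_. Y)" using h by auto
 thus "C2_on S \<phi>" unfolding C2_on_def g using D dg by (auto simp: gderiv_def differentiable_def)
qed

lemma pucci_shift:
 fixes X :: "real^'n^'n" and a A \<epsilon> :: real
 assumes aA: "0 < a" "a <= A" and M: "M : {pucci_plus a A, pucci_minus a A}" and X: "transpose X = X" and \<epsilon>: "\<epsilon> > 0"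
 shows "M (X+\<epsilon>*.mat 1) <= M X+\<epsilon>*(A*CARD('n))"
proof -
 have I: "pucci_plus a A (\<epsilon>*.(mat 1 :: real^'n^'n)) <= \<epsilon>*(A*CARD('n))"
  using \<epsilon> by (intro pucci_plus_id[OF aA]) auto
 have "pucci_plus a A (X+\<epsilon>*.mat 1) <= pucci_plus a A X+pucci_plus a A (\<epsilon>*.(mat 1 :: real^'n^'n))"
  using X by (intro pucci_plus_add[OF aA]) (auto simp: sym_simps)
 moreover have "pucci_plus a A (- (X+\<epsilon>*.mat 1)+\<epsilon>*.mat 1) <= pucci_plus a A (- (X+\<epsilon>*.mat 1))+pucci_plus a A (\<epsilon>*.(mat 1 :: real^'n^'n))"
  using X by (intro pucci_plus_add[OF aA]) (auto simp: sym_simps)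
 moreover have "- (X+\<epsilon>*.mat 1)+\<epsilon>*.mat 1 = - X" by simp
 ultimately show ?thesis using M I unfolding pucci_minus_eq by auto
qed

lemma locally_constant_jet:
 assumes "locally_constant_at Om v x k" "subjet v x p X" shows "p = 0"
proof -
 obtain r where r: "r > 0" "!!y. y : ball x r ==> v y = k" using assms(1) unfolding locally_constant_at_def by blast
 have "GDERIV v x :> 0" unfolding gderiv_def
  by (rule has_derivative_transform_within_open[of "%_. k" _ _ _ "ball x r"]) (use r in auto)
 from subjet_gradient[OF assms(2) this] show ?thesis by simp
qed

lemma pucci_limit:
 fixes X :: "real^'n^'n"
 assumes aA: "0 < a" "a <= A" and M: "M : {pucci_plus a A, pucci_minus a A}" and X: "transpose X = X" and c: "c > 0"
  and le: "!!\<epsilon>. \<epsilon> > 0 ==> c*M (X-(2*\<epsilon>)*.mat 1) <= k"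
 shows "c*M X <= k"
proof (rule field_le_epsilon)
 fix \<delta> :: real assume \<delta>: "\<delta> > 0"
 define d where "d = c*(2*(A*CARD('n)))"
 have "A > 0" using aA by linarith
 hence d: "d > 0" unfolding d_def using c by (intro mult_pos_pos) auto
 define \<epsilon> where "\<epsilon> = \<delta>/d"
 have \<epsilon>: "\<epsilon> > 0" using \<delta> d by (simp add: \<epsilon>_def)
 have "M X <= M (X-(2*\<epsilon>)*.mat 1)+2*\<epsilon>*(A*CARD('n))"
  using pucci_shift[OF aA M, of "X-(2*\<epsilon>)*.mat 1" "2*\<epsilon>"] X \<epsilon> by (simp add: sym_simps)
 hence "c*M X <= c*(M (X-(2*\<epsilon>)*.mat 1)+2*\<epsilon>*(A*CARD('n)))" using c by (intro mult_left_mono) auto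
 moreover have "c*(2*\<epsilon>*(A*CARD('n))) = d*\<epsilon>" by (simp add: d_def)
 moreover have "d*\<epsilon> = \<delta>" using d by (simp add: \<epsilon>_def)
 ultimately show "c*M X <= k+\<delta>" using le[OF \<epsilon>] by (simp add: distrib_left)
qed

text \<open>The quadratic polynomial with matrix \<open>X - 2 \<epsilon>\<close> times the identity
  touches \<open>v\<close> from below, and \<open>\<epsilon>\<close> tends to 0. A nonzero
  \<open>p\<close> rules out that \<open>v\<close> is locally constant, so the clause with test
  functions applies.\<close>

lemma supersolution_jet:
 fixes Om :: "(real^'n) set"
 assumes aA: "0 < a" "a <= A" and M: "M : {pucci_plus a A, pucci_minus a A}"
  and v: "viscosity_supersolution (op_F \<alpha> M) f Om v" and x: "x : Om" and X: "transpose X = X" and p: "p ~= 0" and sj: "subjet v x p X"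
 shows "norm p powr \<alpha>*M X <= - f (v x)"
proof (rule pucci_limit[OF aA M X])
 show "norm p powr \<alpha> > 0" using p by simp
 fix \<epsilon> :: real assume \<epsilon>: "\<epsilon> > 0"
 define Y \<phi> where "Y = X-(2*\<epsilon>)*.mat 1" and "\<phi> = (%y. p \<bullet> (y-x)+(y-x) \<bullet> (Y *v (y-x))/2)"
 have Y: "transpose Y = Y" using X by (simp add: Y_def sym_simps)
 have form: "k \<bullet> (Y *v k) = k \<bullet> (X *v k)-2*\<epsilon>*(norm k)^2" for k
  by (simp add: Y_def mv_diff mv_scaleR inner_diff_right power2_norm_eq_inner)
 have "local_min_at (%y. v y-\<phi> y) x"
  using sj[unfolded subjet_def, rule_format, OF \<epsilon>] unfolding local_min_at_def \<phi>_def
  by eventually_elim (simp add: form diff_divide_distrib)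
 moreover have "\<not> (\<exists>k. locally_constant_at Om v x k)" using locally_constant_jet[OF _ sj] p by blast
 hence "\<forall>\<phi>. C2_on Om \<phi> & local_min_at (%y. v y-\<phi> y) x & gradient \<phi> x ~= 0 -->
  op_F \<alpha> M (gradient \<phi> x) (hessian \<phi> x)+f (v x) <= 0" using v x unfolding viscosity_supersolution_def by blast
 note q = quadratic_test[OF Y, where p = p and x = x, folded \<phi>_def]
 from \<open>\<forall>\<phi>. _ --> _\<close>[THEN spec, of \<phi>] have "local_min_at (%y. v y-\<phi> y) x --> op_F \<alpha> M p Y+f (v x) <= 0"
  unfolding q(2,3) using q(1)[of Om] p by blast
 ultimately show "norm p powr \<alpha>*M (X-(2*\<epsilon>)*.mat 1) <= - f (v x)" by (simp add: op_F_def Y_def)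
qed

lemma subsolution_jet:
 fixes Om :: "(real^'n) set"
 assumes aA: "0 < a" "a <= A" and M: "M : {pucci_plus a A, pucci_minus a A}"
  and v: "viscosity_subsolution (op_F \<alpha> M) f Om v" and x: "x : Om" and X: "transpose X = X" and p: "p ~= 0" and sj: "superjet v x p X"
 shows "- f (v x) <= norm p powr \<alpha>*M X"
proof -
 define M' where "M' X = - M (- X)" for X
 have M': "M' : {pucci_plus a A, pucci_minus a A}" using M by (auto simp: M'_def[abs_def] pucci_minus_eq[abs_def])
 have X': "transpose (- X) = - X" using X by (simp add: sym_simps)
 have sj': "subjet (%y. - v y) x (- p) (- X)" using sj by (simp add: superjet_def)
 have "norm p powr \<alpha>*M' (- X) <= f (v x)"
 proof (rule pucci_limit[OF aA M' X'])
  show "norm p powr \<alpha> > 0" using p by simp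
  fix \<epsilon> :: real assume \<epsilon>: "\<epsilon> > 0"
  define Y \<phi> where "Y = X+(2*\<epsilon>)*.mat 1" and "\<phi> = (%y. p \<bullet> (y-x)+(y-x) \<bullet> (Y *v (y-x))/2)"
  have Y: "transpose Y = Y" using X by (simp add: Y_def sym_simps)
  have form: "k \<bullet> (Y *v k) = k \<bullet> (X *v k)+2*\<epsilon>*(norm k)^2" for k
   by (simp add: Y_def mv_add mv_scaleR inner_add_right power2_norm_eq_inner)
  have "local_max_at (%y. v y-\<phi> y) x"
   using sj'[unfolded subjet_def, rule_format, OF \<epsilon>] unfolding local_max_at_def \<phi>_def
   by eventually_elim (simp add: form mv_uminus add_divide_distrib)
  moreover have "\<not> (\<exists>k. locally_constant_at Om v x k)"
  proof
   assume "\<exists>k. locally_constant_at Om v x k"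
   then obtain k where "locally_constant_at Om (%y. - v y) x (- k)" unfolding locally_constant_at_def by auto
   from locally_constant_jet[OF this sj'] show False using p by simp
  qed
  hence "\<forall>\<phi>. C2_on Om \<phi> & local_max_at (%y. v y-\<phi> y) x & gradient \<phi> x ~= 0 -->
   op_F \<alpha> M (gradient \<phi> x) (hessian \<phi> x)+f (v x) >= 0" using v x unfolding viscosity_subsolution_def by blast
  note q = quadratic_test[OF Y, where p = p and x = x, folded \<phi>_def]
  from \<open>\<forall>\<phi>. _ --> _\<close>[THEN spec, of \<phi>] have "local_max_at (%y. v y-\<phi> y) x --> 0 <= op_F \<alpha> M p Y+f (v x)"
   unfolding q(2,3) using q(1)[of Om] p by blast
  ultimately show "norm p powr \<alpha>*M' (- X-(2*\<epsilon>)*.mat 1) <= f (v x)" by (simp add: op_F_def Y_def M'_def add.commute)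
 qed
 thus ?thesis by (simp add: M'_def)
qed

section \<open>From the eigenvalue problem to a positive solution\<close>

text \<open>The constants 1 and -1 are admissible for the value 0, by the alternative for locally
  constant points.\<close>

lemma principal_eigenvalue_nonneg:
 fixes Om :: "(real^'n) set"
 assumes "open Om"
 shows "0 <= principal_eigenvalue_plus \<alpha> M Om" "0 <= principal_eigenvalue_minus \<alpha> M Om"
proof -
 have lc: "locally_constant_at Om (%_. c) x c" if "x : Om" for x c
  using that assms unfolding open_contains_ball locally_constant_at_def by blast
 have e0: "eigen_term \<alpha> 0 k = 0" for k by (simp add: eigen_term_def)
 have "viscosity_supersolution (op_F \<alpha> M) (eigen_term \<alpha> 0) Om (%_. 1)" "viscosity_subsolution (op_F \<alpha> M) (eigen_term \<alpha> 0) Om (%_. -1)"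
  unfolding viscosity_supersolution_def viscosity_subsolution_def e0 using lc by (auto simp: image_constant_conv)
 thus "0 <= principal_eigenvalue_plus \<alpha> M Om" "0 <= principal_eigenvalue_minus \<alpha> M Om"
  unfolding principal_eigenvalue_plus_def principal_eigenvalue_minus_def zero_ereal_def
  by (intro Sup_upper imageI CollectI exI[of _ "%_. 1"] exI[of _ "%_. -1"]; simp)+
qed

text \<open>The normal does not depend on the local description of the boundary: if two descriptions
  gave different normals, the difference \<open>h\<close> of their unit gradients would point into
  \<open>Om\<close> for one and out of it for the other.\<close>

lemma graph_normal:
 assumes Om: "open Om" and x: "x : frontier Om" and b: "brep \<eta> Om x \<rho> D H r L" and n: "unit_outer_normal Om x n"
 shows "sgn (D x) = - n"
proof (rule ccontr)
 assume ne: "sgn (D x) ~= - n"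
 obtain e \<gamma> where lg: "local_graph Om x e \<gamma>" and C2: "C2_on UNIV \<gamma>" and n: "n = sgn (gradient \<gamma> x-e)" using n unfolding unit_outer_normal_def by blast
 have d: "\<gamma> differentiable (at y)" for y using C2 by (simp add: C2_on_def)
 hence gc: "continuous_on UNIV \<gamma>" by (meson continuous_at_imp_continuous_on differentiable_imp_continuous_within)
 define E where "E = e-gradient \<gamma> x"
 have nE: "- n = sgn E" by (simp add: n E_def sgn_minus[symmetric])
 have E1: "norm E >= 1" unfolding E_def by (rule local_graph_gradient(2)[OF lg d])
 hence E0: "norm E > 0" by linarith
 hence E: "norm (sgn E) = 1" "E = norm E *. sgn E" "norm E > 0" by (auto simp: norm_sgn sgn_div_norm)
 define h where "h = sgn (D x) - sgn E"
 have "h ~= 0" using ne nE by (simp add: h_def)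
 hence "0 < (norm h)^2" by simp
 also have "(norm h)^2 = 2-2*(sgn (D x) \<bullet> sgn E)" unfolding h_def norm_diff_square using E(1) brep_D(2)[OF b] by simp
 finally have h: "h \<bullet> sgn (D x) > 0" "h \<bullet> sgn E < 0"
  using E(1) brep_D(2)[OF b] by (auto simp: h_def inner_diff_left dot_square_norm inner_commute[of "sgn E"])
 hence "h \<bullet> D x > 0" by (subst brep_D(3)[OF b]) (use brep_D(1)[OF b] in simp)
 from brep_directions(1)[OF b this] have ev: "\<forall>\<^sub>F t in at_right 0. x+t*.h : Om" .
 obtain r' where r': "r' > 0" "Om Int ball x r' = {y : ball x r'. \<gamma> y < y \<bullet> e}" using lg unfolding local_graph_def by blast
 have "GDERIV (%y. y \<bullet> e-\<gamma> y) (x+0*.h) :> E" using local_graph_gradient(1)[OF lg d, of x] by (simp add: E_def)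
 from GDERIV_line[OF this] have der: "((%t. (x+t*.h) \<bullet> e-\<gamma> (x+t*.h)) has_real_derivative E \<bullet> h) (at 0)" .
 have "E \<bullet> h < 0" using h(2) E(3) by (subst E(2)) (simp add: inner_commute mult_pos_neg)
 from DERIV_neg_dec_right[OF der this] local_graph_value[OF lg x Om gc]
 obtain d where "d > 0" "\<forall>t>0. t < d --> (x+t*.h) \<bullet> e-\<gamma> (x+t*.h) < 0" by auto
 hence ev2: "\<forall>\<^sub>F t in at_right 0. (x+t*.h) \<bullet> e < \<gamma> (x+t*.h)" unfolding eventually_at_right_field by auto
 have "((%t. x+t*.h) \<longlongrightarrow> x+0*.h) (at_right 0)" by (intro tendsto_intros)
 hence "\<forall>\<^sub>F t in at_right 0. x+t*.h : ball x r'" using r' by (intro topological_tendstoD) auto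
 with ev ev2 have "\<forall>\<^sub>F t :: real in at_right 0. False"
  by eventually_elim (use r'(2) in \<open>blast dest: order.asym\<close>)
 thus False by (simp add: trivial_limit_at_right_real)
qed

lemma nonneg_solution_ball:
 fixes Om :: "(real^'n) set" and M :: "real^'n^'n => real" and \<alpha> a A lam \<eta> \<kappa> :: real
 assumes alpha: "\<alpha> > -1" and aA: "0 < a" "a <= A" and eta: "0 < \<eta>" "\<eta> < 1" and small: "CARD('n)*(A-a) < \<eta>/8*a"
  and M: "M : {pucci_plus a A, pucci_minus a A}" and Om: "bounded Om" "C2_Holder_domain \<eta> Om" and lam: "lam >= 0"
  and nn: "!!x. x : Om ==> u x >= 0" and ex: "\<exists>x\<in>Om. u x ~= 0" and C1: "C1_closure Om u" and u0: "!!x. x : frontier Om ==> u x = 0"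
  and sup: "!!x p X. x : Om ==> transpose X = X ==> p ~= 0 ==> subjet u x p X ==> norm p powr \<alpha>*M X <= - eigen_term \<alpha> lam (u x)"
  and sub: "!!x p X. x : Om ==> transpose X = X ==> p ~= 0 ==> superjet u x p X ==> - eigen_term \<alpha> lam (u x) <= norm p powr \<alpha>*M X"
  and lc: "!!x k. x : Om ==> locally_constant_at Om u x k ==> eigen_term \<alpha> lam k = 0"
  and bd: "!!x. x : frontier Om ==> \<exists>n. unit_outer_normal Om x n & ((%t. u (x-t*.n)/t) \<longlongrightarrow> \<kappa>) (at_right 0)"
 shows "\<exists>z r. r > 0 & Om = ball z r"
proof -
 have dom: "open Om" "connected Om" and lgx: "!!x. x : frontier Om ==> \<exists>e \<gamma>. local_graph Om x e \<gamma> & C2_Holder \<eta> \<gamma>"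
  using Om(2) by (auto simp: C2_Holder_domain_def)
 obtain G where uc: "continuous_on (closure Om) u" and G: "continuous_on (closure Om) G" "!!x. x : Om ==> GDERIV u x :> G x"
  using C1 unfolding C1_closure_def by blast
 have ucOm: "continuous_on Om u" using uc closure_subset by (rule continuous_on_subset)
 have et: "eigen_term \<alpha> lam (u x) = lam*u x powr (1+\<alpha>)" if "x : Om" for x
  using nn[OF that] by (cases "u x = 0") (auto simp: eigen_term_def powr_add)
 have sup': "M X <= - (lam*u x powr (1+\<alpha>)*norm p powr (- \<alpha>))" if "x : Om" "transpose X = X" "p ~= 0" "subjet u x p X" for x p X
  using sup[OF that] et[OF that(1)] that(3) by (simp add: powr_minus field_simps)
 have sub': "- (lam*u x powr (1+\<alpha>)*norm p powr (- \<alpha>)) <= M X" if "x : Om" "transpose X = X" "p ~= 0" "superjet u x p X" for x p X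
  using sub[OF that] et[OF that(1)] that(3) by (simp add: powr_minus field_simps)
 have Mle: "pucci_minus a A X <= M X" "M X <= pucci_plus a A X" if "transpose X = X" for X using M pucci_minus_le_plus[OF aA that] by auto
 have hop: "hopfable a A 0 Om u" unfolding hopfable_def
 proof (intro ballI allI impI)
  fix x p X assume *: "x : Om" "transpose X = X" "p ~= 0" "subjet u x p X"
  have "0 <= lam*u x powr (1+\<alpha>)*norm p powr (- \<alpha>)" using lam by simp
  thus "pucci_minus a A X <= 0*norm p" using sup'[OF *] Mle(1)[OF *(2)] by linarith
 qed
 have upos: "u x > 0" if x: "x : Om" for x
 proof (rule ccontr)
  assume "\<not> u x > 0"
  hence "u x = 0" using nn[OF x] by simp
  hence "u y = 0" if "y : Om" for y
   using strong_maximum_principle[OF aA order_refl dom ucOm nn hop _ x _ that] G(2) by blast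
  thus False using ex by blast
 qed
 have ne: "Om ~= {}" "frontier Om ~= {}" using ex dom Om(1) frontier_eq_empty[of Om] not_bounded_UNIV by auto
 \<comment> \<open>For \<open>lam = 0\<close> the strong maximum principle also applies at an
   interior maximum and makes \<open>u\<close> constant, against its boundary values.\<close>
 have lam0: "lam ~= 0"
 proof
  assume l0: "lam = 0"
  have cc: "compact (closure Om)" using Om(1) by (simp add: compact_closure)
  obtain z where z: "z : closure Om" "!!y. y : closure Om ==> u y <= u z"
   using continuous_attains_sup[OF cc _ uc] ne(1) by (metis closure_eq_empty)
  obtain y0 where y0: "y0 : Om" using ne by blast
  have uz: "u z > 0" using z(2)[of y0] upos[OF y0] y0 closure_subset[of Om] by force
  have zOm: "z : Om" using z(1) uz u0[of z] dom(1) by (auto simp: frontier_def interior_open)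
  have hopw: "hopfable a A 0 Om (%x. u z-u x)" unfolding hopfable_def
  proof (intro ballI allI impI)
   fix x p X assume *: "x : Om" "transpose X = X" "p ~= 0" "subjet (%x. u z-u x) x p X"
   have "subjet (%y. - u y) x p X" by (rule subjet_mono[OF *(4)]) simp
   hence "superjet u x (- p) (- X)" by (simp add: superjet_def)
   from sub'[OF *(1) _ _ this] have "0 <= M (- X)" using * l0 by (simp add: sym_simps)
   thus "pucci_minus a A X <= 0*norm p" using Mle(2)[of "- X"] *(2) by (simp add: pucci_minus_eq sym_simps)
  qed
  have wd: "\<exists>D. GDERIV (%x. u z-u x) x :> D" if "x : Om" for x using GDERIV_diff[OF GDERIV_const G(2)[OF that]] by blast
  have "u z-u y = 0" if "y : Om" for y
   by (rule strong_maximum_principle[OF aA order_refl dom _ _ hopw wd zOm _ that])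
    (use z(2) closure_subset[of Om] ucOm in \<open>auto intro!: continuous_intros\<close>)
  hence "Om <= {y : closure Om. u y = u z}" using closure_subset[of Om] by auto
  moreover have "closed {y : closure Om. u y = u z}" using continuous_closed_preimage_constant[OF uc closed_closure] .
  ultimately have "closure Om <= {y : closure Om. u y = u z}" by (rule closure_minimal)
  thus False using ne(2) u0 uz by (fastforce simp: frontier_def)
 qed
 hence lam1: "lam > 0" using lam by simp
 have "overdet \<alpha> a A lam \<kappa> \<eta> M Om u G"
 proof (rule overdet.intro)
  show "\<exists>y\<in>ball x r. u y ~= u x" if "x : Om" "r > 0" "ball x r <= Om" for x r
  proof (rule ccontr)
   assume "\<not> ?thesis"
   hence "locally_constant_at Om u x (u x)" using that(2,3) unfolding locally_constant_at_def by blast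
   from lc[OF that(1) this] have "lam*u x powr (1+\<alpha>) = 0" unfolding et[OF that(1)] .
   thus False using upos[OF that(1)] lam0 by simp
  qed
  show "\<exists>\<rho> D H r L. brep \<eta> Om x \<rho> D H r L & ((%t. u (x+t *. sgn (D x))/t) \<longlongrightarrow> \<kappa>) (at_right 0)" if x: "x : frontier Om" for x
  proof -
   obtain e \<gamma> where "local_graph Om x e \<gamma>" "C2_Holder \<eta> \<gamma>" using lgx[OF x] by blast
   then obtain \<rho> D H r L where b: "brep \<eta> Om x \<rho> D H r L" using brep_exists[OF _ x dom(1) _ eta(1)] by metis
   obtain n where n: "unit_outer_normal Om x n" "((%t. u (x-t*.n)/t) \<longlongrightarrow> \<kappa>) (at_right 0)" using bd[OF x] by blast
   have "sgn (D x) = - n" by (rule graph_normal[OF dom(1) x b n(1)])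
   thus ?thesis using b n(2) by (intro exI[of _ \<rho>] exI[of _ D] exI[of _ H] exI[of _ r] exI[of _ L]) simp
  qed
 qed (fact alpha aA eta M dom Om(1) ne uc G u0 upos sup' sub' lam1)+
 then interpret overdet \<alpha> a A lam \<kappa> \<eta> M Om u G .
 show ?thesis using symmetric_imp_ball[OF dom(1) Om(1) ne(1)] symmetric_convex[OF _ small] by blast
qed

theorem corollary2p4:
  fixes \<alpha> A \<eta> :: real
  assumes "\<alpha> > -1" and "A > 0" and "0 < \<eta>" and "\<eta> < 1"
  shows "\<exists>\<delta>>0. \<forall>a. 0 < a \<and> a \<le> A \<and> \<bar>a - A\<bar> < \<delta> \<longrightarrow>
    (\<forall>M \<in> {pucci_plus a A, pucci_minus a A}. \<forall>\<Omega> :: (real^'n) set.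
       bounded \<Omega> \<and> C2_Holder_domain \<eta> \<Omega> \<and>
       (\<exists>c \<psi>. eigenfunction \<alpha> M \<Omega> \<psi> \<and> constant_sign \<Omega> \<psi> \<and>
          (\<forall>x\<in>frontier \<Omega>. \<exists>n. unit_outer_normal \<Omega> x n \<and> has_outer_derivative \<psi> x n c))
       \<longrightarrow> (\<exists>z r. r > 0 \<and> \<Omega> = ball z r))"
proof -
 define N :: real where "N = CARD('n)"
 have N: "N > 0" by (simp add: N_def)
 \<comment> \<open>The value of \<open>A - a\<close> at which \<open>N (A - a) = \<eta>/8 a\<close>;
   below it the hypothesis of the corner lemma holds.\<close>
 define \<delta> where "\<delta> = \<eta>/8*A/(N+\<eta>/8)"
 have "\<delta> > 0" using assms N by (simp add: \<delta>_def add_pos_pos)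
 moreover have "\<exists>z r. r > 0 & Om = ball z r"
  if a: "0 < a" "a <= A" "\<bar>a-A\<bar> < \<delta>" and M: "M : {pucci_plus a A, pucci_minus a A}" and Om: "bounded Om" "C2_Holder_domain \<eta> Om"
   and ef: "eigenfunction \<alpha> M Om \<psi>" and cs: "constant_sign Om \<psi>"
   and bd: "!!x. x : frontier Om ==> \<exists>n. unit_outer_normal Om x n & has_outer_derivative \<psi> x n c"
  for a M and Om :: "(real^'n) set" and c \<psi>
 proof -
  have N8: "N+\<eta>/8 > 0" using N assms by simp
  have "A-a < \<eta>/8*A/(N+\<eta>/8)" using a(2,3) by (simp add: \<delta>_def)
  hence "(A-a)*(N+\<eta>/8) < \<eta>/8*A" by (simp only: pos_less_divide_eq[OF N8])
  hence "N*(A-a)+\<eta>/8*A-\<eta>/8*a < \<eta>/8*A" by (simp only: distrib_left right_diff_distrib left_diff_distrib mult.commute)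
  hence small: "CARD('n)*(A-a) < \<eta>/8*a" by (simp add: N_def)
  have op: "open Om" using Om(2) by (simp add: C2_Holder_domain_def)
  obtain lam where ex: "\<exists>x\<in>Om. \<psi> x ~= 0" and C1: "C1_closure Om \<psi>" and \<psi>0: "!!x. x : frontier Om ==> \<psi> x = 0"
   and le: "ereal lam = principal_eigenvalue_plus \<alpha> M Om | ereal lam = principal_eigenvalue_minus \<alpha> M Om"
   and vs: "viscosity_supersolution (op_F \<alpha> M) (eigen_term \<alpha> lam) Om \<psi>" "viscosity_subsolution (op_F \<alpha> M) (eigen_term \<alpha> lam) Om \<psi>"
   using ef unfolding eigenfunction_def viscosity_solution_def by blast
  have lam: "lam >= 0" using le principal_eigenvalue_nonneg[OF op, of \<alpha> M] by (metis ereal_less_eq(5))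
  have lc: "eigen_term \<alpha> lam k = 0" if x: "x : Om" and k: "locally_constant_at Om \<psi> x k" for x k
  proof -
   have "k' = k" if "locally_constant_at Om \<psi> x k'" for k'
    using k that unfolding locally_constant_at_def by (metis centre_in_ball)
   hence "eigen_term \<alpha> lam k <= 0" "0 <= eigen_term \<alpha> lam k"
    using vs x k unfolding viscosity_supersolution_def viscosity_subsolution_def by metis+
   thus ?thesis by simp
  qed
  have bd': "\<exists>n. unit_outer_normal Om x n & ((%t. - \<psi> (x-t*.n)/t) \<longlongrightarrow> c) (at_right 0)" if "x : frontier Om" for x
   using bd[OF that] \<psi>0[OF that] by (auto simp: has_outer_derivative_def)
  note jets = supersolution_jet[OF a(1,2) M vs(1)] subsolution_jet[OF a(1,2) M vs(2)]
  show ?thesis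
  proof (cases "\<forall>x\<in>Om. \<psi> x >= 0")
   case True
   have "\<exists>n. unit_outer_normal Om x n & ((%t. \<psi> (x-t*.n)/t) \<longlongrightarrow> - c) (at_right 0)" if x: "x : frontier Om" for x
   proof -
    obtain n where n: "unit_outer_normal Om x n" "((%t. - \<psi> (x-t*.n)/t) \<longlongrightarrow> c) (at_right 0)" using bd'[OF x] by blast
    show ?thesis using n(1) tendsto_minus[OF n(2)] by auto
   qed
   thus ?thesis
    using True by (intro nonneg_solution_ball[OF assms(1) a(1,2) assms(3,4) small M Om lam _ ex C1 \<psi>0 jets lc]) auto
  next
   case False
   hence neg: "!!x. x : Om ==> \<psi> x <= 0" using cs by (auto simp: constant_sign_def)
   \<comment> \<open>For \<open>\<psi> <= 0\<close> the function \<open>- \<psi>\<close> solves the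
     equation with \<open>M'\<close>, which is the other Pucci operator.\<close>
   define M' where "M' X = - M (- X)" for X
   have M': "M' : {pucci_plus a A, pucci_minus a A}" using M by (auto simp: M'_def[abs_def] pucci_minus_eq[abs_def])
   have od: "eigen_term \<alpha> lam (- s) = - eigen_term \<alpha> lam s" for s by (simp add: eigen_term_def)
   show ?thesis
   proof (rule nonneg_solution_ball[OF assms(1) a(1,2) assms(3,4) small M' Om lam _ _ _ _ _ _ _ bd'])
    show "C1_closure Om (%x. - \<psi> x)"
     using C1 unfolding C1_closure_def gderiv_def
     by (auto intro!: continuous_intros exI[of _ "%x. - G x" for G] has_derivative_minus[THEN has_derivative_eq_rhs])
    show "norm p powr \<alpha>*M' X <= - eigen_term \<alpha> lam (- \<psi> x)"
     if "x : Om" "transpose X = X" "p ~= 0" "subjet (%x. - \<psi> x) x p X" for x p X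
     using jets(2)[of x "- X" "- p"] that by (simp add: M'_def od superjet_def sym_simps)
    show "- eigen_term \<alpha> lam (- \<psi> x) <= norm p powr \<alpha>*M' X"
     if "x : Om" "transpose X = X" "p ~= 0" "superjet (%x. - \<psi> x) x p X" for x p X
     using jets(1)[of x "- X" "- p"] that by (simp add: M'_def od superjet_def sym_simps)
    show "eigen_term \<alpha> lam k = 0" if "x : Om" "locally_constant_at Om (%x. - \<psi> x) x k" for x k
    proof -
     have "locally_constant_at Om \<psi> x (- k)" using that(2) unfolding locally_constant_at_def by force
     from lc[OF that(1) this] show ?thesis by (simp add: od)
    qed
   qed (use neg ex \<psi>0 in auto)
  qed
 qed
 ultimately show ?thesis by (intro exI[of _ \<delta>]) blast
qed

end
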